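(* Let $m,n\ge2$ be fixed while $d\to\infty$, and suppose assumptions (A1), (A2), (A3), (A4) stated in the context hold and $\varsigma_d^2\asymp d$. Assume that $X=\mu_X+V_X$ and $Y=\mu_Y+V_Y$, where $\mathbb{E}(V_X)=\mathbb{E}(V_Y)=0$ and $V_X,V_Y$ are mutually independent random vectors in $\mathbb{R}^d$. Assume that the components of $V_X=(V_{X,1},V_{X,2},\dots)$ are strictly stationary and satisfy $\sum_{k=1}^\infty\rho_X(2^k)<\infty$, where $\rho_X(\cdot)$ is the $\rho$-mixing coefficient, and that the components of $V_Y=(V_{Y,1},V_{Y,2},\dots)$ are similarly strictly stationary with $\sum_{k=1}^\infty\rho_Y(2^k)<\infty$ for another mixing coefficient $\rho_Y(\cdot)$. Let $X_1,\dots,X_m$ be i.i.d. copies of $X$ and, independently, $Y_1,\dots,Y_n$ i.i.d. copies of $Y$. Write $\Sigma=\Sigma_X=\Sigma_Y$, $\overline\sigma_d^2=d^{-1}\mathrm{tr}(\Sigma)$, $\overline\sigma^2=\lim_{d\to\infty}\overline\sigma_d^2$ and $$\psi_{m,n}=\mathrm{tr}(\Sigma^2)\left\{\frac2{m(m-1)}+\frac2{n(n-1)}+\frac4{mn}\right\}.$$ Let $z_\alpha$ be the upper $\alpha$ quantile of the standard normal distribution, with distribution function $\Phi$, and define $\phi'_{\mathrm{CvM}}=\mathbf 1(2\pi\sqrt3\,d\,\overline\sigma^2U_{\mathrm{CvM}}>z_\alpha\psi_{m,n}^{1/2})$, $\phi'_{\mathrm{Energy}}=\mathbf 1(\sqrt{2d}\,\overline\sigma\,U_{\mathrm{Energy}}>z_\alpha\psi_{m,n}^{1/2})$,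 $\phi'_{\mathrm{MMD}}=\mathbf 1(\varsigma_d^2e^{-d\overline\sigma_d^2/\varsigma_d^2}U_{\mathrm{MMD}}>z_\alpha\psi_{m,n}^{1/2})$, $\phi'_{\mathrm{CQ}}=\mathbf 1(U_{\mathrm{CQ}}>z_\alpha\psi_{m,n}^{1/2})$, $\phi'_{\mathrm{WMW}}=\mathbf 1(d\,\overline\sigma^2U_{\mathrm{WMW}}>z_\alpha\psi_{m,n}^{1/2})$. Then, as $d\to\infty$ with $m,n$ fixed, $$\lim_{d\to\infty}\mathbb{E}[\phi'_{\mathrm{CvM}}]=\lim_{d\to\infty}\mathbb{E}[\phi'_{\mathrm{Energy}}]=\lim_{d\to\infty}\mathbb{E}[\phi'_{\mathrm{MMD}}]=\lim_{d\to\infty}\mathbb{E}[\phi'_{\mathrm{CQ}}]=\lim_{d\to\infty}\mathbb{E}[\phi'_{\mathrm{WMW}}],$$ which converges to $$\Phi\big(-z_\alpha+\psi_{m,n}^{-1/2}\|\mu_X-\mu_Y\|^2\big).$$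
   Context: For each $d$, $P_X,P_Y$ denote the distributions of $X,Y$ on $\mathbb{R}^d$, with means $\mu_X,\mu_Y$ and positive definite covariance matrices $\Sigma_X,\Sigma_Y$; $V_X$ and $V_Y$ in dimension $d$ consist of the first $d$ terms of infinite sequences. Standing assumption: $\beta^\top X,\beta^\top Y$ have continuous distribution functions for almost all $\beta$ in the unit sphere. The $\rho$-mixing coefficient of a sequence $(V_j)_{j\ge1}$ is $\rho(k)=\sup_{l\ge1}\sup|\mathrm{corr}(f,g)|$, the inner supremum over square-integrable $f$ measurable with respect to $\sigma(V_1,\dots,V_l)$ and $g$ measurable with respect to $\sigma(V_j:j\ge l+k)$. $a_d\asymp b_d$ means $C<|a_d/b_d|<C'$ for some constants $C,C'>0$ and all large $d$. In (A1) and (A3), $Z_1^\ast,Z_2^\ast,Z_3^\ast,Z_4^\ast$ are independent and each follows either $P_X$ or $P_Y$. (A1) $\mathrm{Var}(\|Z_1^\ast-Z_2^\ast\|^2)=O(d)$ and $\mathrm{Var}\{(Z_1^\ast-Z_3^\ast)^\top(Z_2^\ast-Z_3^\ast)\}=O(d)$. (A2) $d^{-1}\mathrm{tr}(\Sigma_X)\to\overline\sigma_X^2$, $d^{-1}\mathrm{tr}(\Sigma_Y)\to\overline\sigma_Y^2$, $d^{-1}\|\mu_X-\mu_Y\|^2\to\overline\delta_{XY}^2$, where $0<\overline\sigma_X^2,\overline\sigma_Y^2<\infty$, $0\le\overline\delta_{XY}^2<\infty$. (A3) $\mathrm{Var}\{(Z_1^\ast-Z_2^\ast)^\top(Z_3^\ast-Z_4^\ast)\}=O(d)$.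 (A4) $\Sigma_X=\Sigma_Y$ and $\|\mu_X-\mu_Y\|^2=O(\sqrt d)$. Statistics (sums over $i_1\ne i_2$ in $\{1,\dots,m\}$ and $j_1\ne j_2$ in $\{1,\dots,n\}$; $\mathsf{Ang}(u,v)=\arccos\{u^\top v/(\|u\|\|v\|)\}$; $c_{m,n}=\{m(m-1)n(n-1)\}^{-1}$): $U_{\mathrm{CvM}}=c_{m,n}\sum\sum\{\frac13-\frac1{2\pi}\mathsf{Ang}(X_{i_1}-Y_{j_1},X_{i_2}-Y_{j_1})-\frac1{2\pi}\mathsf{Ang}(Y_{j_1}-X_{i_1},Y_{j_2}-X_{i_1})\}$; $U_{\mathrm{CQ}}=c_{m,n}\sum\sum(X_{i_1}-Y_{j_1})^\top(X_{i_2}-Y_{j_2})$; $U_{\mathrm{WMW}}=c_{m,n}\sum\sum\frac{(X_{i_1}-Y_{j_1})^\top(X_{i_2}-Y_{j_2})}{\|X_{i_1}-Y_{j_1}\|\,\|X_{i_2}-Y_{j_2}\|}$; $U_{\mathrm{Energy}}=\frac2{mn}\sum_{i,j}\|X_i-Y_j\|-\frac1{m(m-1)}\sum\|X_{i_1}-X_{i_2}\|-\frac1{n(n-1)}\sum\|Y_{j_1}-Y_{j_2}\|$; $U_{\mathrm{MMD}}=\frac1{m(m-1)}\sum k(X_{i_1},X_{i_2})+\frac1{n(n-1)}\sum k(Y_{j_1},Y_{j_2})-\frac2{mn}\sum_{i,j}k(X_i,Y_j)$ with $k(x,y)=\exp(-\|x-y\|^2/(2\varsigma_d^2))$.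
   Formalization: The MMD test is normalised by ς_d² exp(+dσ̄_d²/ς_d²) rather than exp(−…), and the WMW test by 2dσ̄² rather than dσ̄²; with the printed constants these two tests do not have the stated limiting power (e.g. i.i.d. N(0,1) components, equal means, ς_d²=d). *)

theory Defs
  imports "HOL-Probability.Probability" "HOL-Library.Landau_Symbols"
begin

section \<open>Vectors of dimension d\<close>

text \<open>Since the dimension tends to infinity, vectors of dimension d are functions on the index
  set \<open>{1..d}\<close>, with the product Borel sigma-algebra.\<close>

abbreviation Rd :: "nat \<Rightarrow> (nat \<Rightarrow> real) measure" where
  "Rd d \<equiv> \<Pi>\<^sub>M k\<in>{1..d}. borel"

definition vdot :: "nat \<Rightarrow> (nat \<Rightarrow> real) \<Rightarrow> (nat \<Rightarrow> real) \<Rightarrow> real" where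
  "vdot d u v = (\<Sum>k\<in>{1..d}. u k * v k)"

definition vnorm :: "nat \<Rightarrow> (nat \<Rightarrow> real) \<Rightarrow> real" where
  "vnorm d u = L2_set u {1..d}"

definition vdiff :: "(nat \<Rightarrow> real) \<Rightarrow> (nat \<Rightarrow> real) \<Rightarrow> nat \<Rightarrow> real" where
  "vdiff u v = (\<lambda>k. u k - v k)"

definition Ang :: "nat \<Rightarrow> (nat \<Rightarrow> real) \<Rightarrow> (nat \<Rightarrow> real) \<Rightarrow> real" where
  "Ang d u v = arccos (vdot d u v / (vnorm d u * vnorm d v))"

definition mtrace :: "nat \<Rightarrow> (nat \<Rightarrow> nat \<Rightarrow> real) \<Rightarrow> real" where
  "mtrace d A = (\<Sum>i\<in>{1..d}. A i i)"

definition mmult :: "nat \<Rightarrow> (nat \<Rightarrow> nat \<Rightarrow> real) \<Rightarrow> (nat \<Rightarrow> nat \<Rightarrow> real) \<Rightarrow> nat \<Rightarrow> nat \<Rightarrow> real" where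
  "mmult d A B = (\<lambda>i j. \<Sum>k\<in>{1..d}. A i k * B k j)"

definition pos_def :: "nat \<Rightarrow> (nat \<Rightarrow> nat \<Rightarrow> real) \<Rightarrow> bool" where
  "pos_def d A \<longleftrightarrow>
     (\<forall>i\<in>{1..d}. \<forall>j\<in>{1..d}. A i j = A j i) \<and>
     (\<forall>v. (\<exists>i\<in>{1..d}. v i \<noteq> 0) \<longrightarrow> 0 < (\<Sum>i\<in>{1..d}. \<Sum>j\<in>{1..d}. v i * A i j * v j))"

text \<open>The uniform distribution on the unit sphere is the law of the direction of a point drawn
  uniformly from the unit ball; the centre of the ball is a null set for \<open>d \<ge> 1\<close>.\<close>

definition unif_sphere :: "nat \<Rightarrow> (nat \<Rightarrow> real) measure" where
  "unif_sphere d =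
     distr (uniform_measure (\<Pi>\<^sub>M k\<in>{1..d}. lborel)
              {x \<in> space (\<Pi>\<^sub>M k\<in>{1..d}. lborel). vnorm d x \<le> 1})
           (Rd d) (\<lambda>x. \<lambda>k\<in>{1..d}. x k / vnorm d x)"

section \<open>Moments and mixing\<close>

definition square_integrable :: "'a measure \<Rightarrow> ('a \<Rightarrow> real) \<Rightarrow> bool" where
  "square_integrable M f \<longleftrightarrow> f \<in> borel_measurable M \<and> integrable M (\<lambda>x. (f x)\<^sup>2)"

definition cov :: "'a measure \<Rightarrow> ('a \<Rightarrow> real) \<Rightarrow> ('a \<Rightarrow> real) \<Rightarrow> real" where
  "cov M f g = (\<integral>x. (f x - (\<integral>y. f y \<partial>M)) * (g x - (\<integral>y. g y \<partial>M)) \<partial>M)"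

text \<open>If one of the variances vanishes, the correlation is 0 by division by zero.\<close>

definition corr :: "'a measure \<Rightarrow> ('a \<Rightarrow> real) \<Rightarrow> ('a \<Rightarrow> real) \<Rightarrow> real" where
  "corr M f g = cov M f g / sqrt (cov M f f * cov M g g)"

definition cov_matrix :: "(nat \<Rightarrow> real) measure \<Rightarrow> nat \<Rightarrow> nat \<Rightarrow> real" where
  "cov_matrix P = (\<lambda>i j. cov P (\<lambda>x. x i) (\<lambda>x. x j))"

text \<open>\<open>Var (f d) = O(d)\<close>. A Bochner integral that does not exist is 0, so finiteness of the
  variance for all large d has to be stated separately.\<close>

definition var_O_d :: "(nat \<Rightarrow> 'a measure) \<Rightarrow> (nat \<Rightarrow> 'a \<Rightarrow> real) \<Rightarrow> bool" where
  "var_O_d M f \<longleftrightarrow>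
     (\<forall>\<^sub>F d in sequentially. square_integrable (M d) (f d)) \<and>
     (\<lambda>d. cov (M d) (f d) (f d)) \<in> O(\<lambda>d. real d)"

text \<open>Sequences \<open>V\<close> are indexed from 1; \<open>V 0\<close> is never used.\<close>

definition sigma_gen :: "'b measure \<Rightarrow> (nat \<Rightarrow> 'b \<Rightarrow> real) \<Rightarrow> nat set \<Rightarrow> 'b measure" where
  "sigma_gen N V I = sigma (space N) (\<Union>i\<in>I. {V i -` A \<inter> space N | A. A \<in> sets borel})"

text \<open>On a probability space the set below is nonempty and bounded by 1.\<close>

definition rho_mix :: "'b measure \<Rightarrow> (nat \<Rightarrow> 'b \<Rightarrow> real) \<Rightarrow> nat \<Rightarrow> real" where
  "rho_mix N V k =
     Sup {\<bar>corr N f g\<bar> | f g l. 1 \<le> l \<and>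
            f \<in> borel_measurable (sigma_gen N V {1..l}) \<and> square_integrable N f \<and>
            g \<in> borel_measurable (sigma_gen N V {l + k..}) \<and> square_integrable N g}"

definition strictly_stationary :: "'b measure \<Rightarrow> (nat \<Rightarrow> 'b \<Rightarrow> real) \<Rightarrow> bool" where
  "strictly_stationary N V \<longleftrightarrow>
     (\<forall>r h. distr N (Rd r) (\<lambda>\<omega>. \<lambda>i\<in>{1..r}. V (i + h) \<omega>) =
            distr N (Rd r) (\<lambda>\<omega>. \<lambda>i\<in>{1..r}. V i \<omega>))"

definition centred_L2_seq :: "'b measure \<Rightarrow> (nat \<Rightarrow> 'b \<Rightarrow> real) \<Rightarrow> bool" where
  "centred_L2_seq N V \<longleftrightarrow> (\<forall>k\<ge>1. square_integrable N (V k) \<and> (\<integral>\<omega>. V k \<omega> \<partial>N) = 0)"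

text \<open>The law of \<open>\<mu> + V\<close> in dimension d.\<close>

definition shift_law ::
  "'b measure \<Rightarrow> (nat \<Rightarrow> nat \<Rightarrow> real) \<Rightarrow> (nat \<Rightarrow> 'b \<Rightarrow> real) \<Rightarrow> nat \<Rightarrow> (nat \<Rightarrow> real) measure" where
  "shift_law N \<mu> V d = distr N (Rd d) (\<lambda>\<omega>. \<lambda>k\<in>{1..d}. \<mu> d k + V k \<omega>)"

definition cont_projections :: "nat \<Rightarrow> (nat \<Rightarrow> real) measure \<Rightarrow> bool" where
  "cont_projections d P \<longleftrightarrow>
     (AE \<beta> in unif_sphere d. continuous_on UNIV (cdf (distr P borel (vdot d \<beta>))))"

section \<open>The assumptions A1 to A4\<close>

text \<open>\<open>Q i\<close> is the law of \<open>Z\<^sub>i\<^sup>*\<close>; each one is chosen freely from the laws of X and Y.\<close>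

definition A1 :: "(nat \<Rightarrow> (nat \<Rightarrow> real) measure) \<Rightarrow> (nat \<Rightarrow> (nat \<Rightarrow> real) measure) \<Rightarrow> bool" where
  "A1 PX PY \<longleftrightarrow>
     (\<forall>Q :: nat \<Rightarrow> nat \<Rightarrow> (nat \<Rightarrow> real) measure. (\<forall>i. Q i \<in> {PX, PY}) \<longrightarrow>
        var_O_d (\<lambda>d. \<Pi>\<^sub>M i\<in>{1..4}. Q i d) (\<lambda>d z. (vnorm d (vdiff (z 1) (z 2)))\<^sup>2) \<and>
        var_O_d (\<lambda>d. \<Pi>\<^sub>M i\<in>{1..4}. Q i d)
          (\<lambda>d z. vdot d (vdiff (z 1) (z 3)) (vdiff (z 2) (z 3))))"

definition A2 ::
  "(nat \<Rightarrow> (nat \<Rightarrow> real) measure) \<Rightarrow> (nat \<Rightarrow> (nat \<Rightarrow> real) measure) \<Rightarrow>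
   (nat \<Rightarrow> nat \<Rightarrow> real) \<Rightarrow> (nat \<Rightarrow> nat \<Rightarrow> real) \<Rightarrow> bool" where
  "A2 PX PY \<mu>X \<mu>Y \<longleftrightarrow>
     (\<exists>sX2 sY2 delta2 :: real. 0 < sX2 \<and> 0 < sY2 \<and> 0 \<le> delta2 \<and>
        (\<lambda>d. mtrace d (cov_matrix (PX d)) / real d) \<longlonglongrightarrow> sX2 \<and>
        (\<lambda>d. mtrace d (cov_matrix (PY d)) / real d) \<longlonglongrightarrow> sY2 \<and>
        (\<lambda>d. (vnorm d (vdiff (\<mu>X d) (\<mu>Y d)))\<^sup>2 / real d) \<longlonglongrightarrow> delta2)"

definition A3 :: "(nat \<Rightarrow> (nat \<Rightarrow> real) measure) \<Rightarrow> (nat \<Rightarrow> (nat \<Rightarrow> real) measure) \<Rightarrow> bool" where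
  "A3 PX PY \<longleftrightarrow>
     (\<forall>Q :: nat \<Rightarrow> nat \<Rightarrow> (nat \<Rightarrow> real) measure. (\<forall>i. Q i \<in> {PX, PY}) \<longrightarrow>
        var_O_d (\<lambda>d. \<Pi>\<^sub>M i\<in>{1..4}. Q i d)
          (\<lambda>d z. vdot d (vdiff (z 1) (z 2)) (vdiff (z 3) (z 4))))"

definition A4 ::
  "(nat \<Rightarrow> (nat \<Rightarrow> real) measure) \<Rightarrow> (nat \<Rightarrow> (nat \<Rightarrow> real) measure) \<Rightarrow>
   (nat \<Rightarrow> nat \<Rightarrow> real) \<Rightarrow> (nat \<Rightarrow> nat \<Rightarrow> real) \<Rightarrow> bool" where
  "A4 PX PY \<mu>X \<mu>Y \<longleftrightarrow>
     (\<forall>d. \<forall>i\<in>{1..d}. \<forall>j\<in>{1..d}. cov_matrix (PX d) i j = cov_matrix (PY d) i j) \<and>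
     (\<lambda>d. (vnorm d (vdiff (\<mu>X d) (\<mu>Y d)))\<^sup>2) \<in> O(\<lambda>d. sqrt (real d))"

section \<open>The test statistics\<close>

definition neq_pairs :: "nat \<Rightarrow> (nat \<times> nat) set" where
  "neq_pairs n = {(i, i'). i \<in> {1..n} \<and> i' \<in> {1..n} \<and> i \<noteq> i'}"

definition c_mn :: "nat \<Rightarrow> nat \<Rightarrow> real" where
  "c_mn m n = 1 / (real m * (real m - 1) * real n * (real n - 1))"

definition U_CvM ::
  "nat \<Rightarrow> nat \<Rightarrow> nat \<Rightarrow> (nat \<Rightarrow> nat \<Rightarrow> real) \<Rightarrow> (nat \<Rightarrow> nat \<Rightarrow> real) \<Rightarrow> real" where
  "U_CvM d m n x y = c_mn m n *
     (\<Sum>(i1, i2)\<in>neq_pairs m. \<Sum>(j1, j2)\<in>neq_pairs n.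
        1 / 3 - 1 / (2 * pi) * Ang d (vdiff (x i1) (y j1)) (vdiff (x i2) (y j1))
              - 1 / (2 * pi) * Ang d (vdiff (y j1) (x i1)) (vdiff (y j2) (x i1)))"

definition U_CQ ::
  "nat \<Rightarrow> nat \<Rightarrow> nat \<Rightarrow> (nat \<Rightarrow> nat \<Rightarrow> real) \<Rightarrow> (nat \<Rightarrow> nat \<Rightarrow> real) \<Rightarrow> real" where
  "U_CQ d m n x y = c_mn m n *
     (\<Sum>(i1, i2)\<in>neq_pairs m. \<Sum>(j1, j2)\<in>neq_pairs n.
        vdot d (vdiff (x i1) (y j1)) (vdiff (x i2) (y j2)))"

definition U_WMW ::
  "nat \<Rightarrow> nat \<Rightarrow> nat \<Rightarrow> (nat \<Rightarrow> nat \<Rightarrow> real) \<Rightarrow> (nat \<Rightarrow> nat \<Rightarrow> real) \<Rightarrow> real" where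
  "U_WMW d m n x y = c_mn m n *
     (\<Sum>(i1, i2)\<in>neq_pairs m. \<Sum>(j1, j2)\<in>neq_pairs n.
        vdot d (vdiff (x i1) (y j1)) (vdiff (x i2) (y j2)) /
        (vnorm d (vdiff (x i1) (y j1)) * vnorm d (vdiff (x i2) (y j2))))"

definition U_Energy ::
  "nat \<Rightarrow> nat \<Rightarrow> nat \<Rightarrow> (nat \<Rightarrow> nat \<Rightarrow> real) \<Rightarrow> (nat \<Rightarrow> nat \<Rightarrow> real) \<Rightarrow> real" where
  "U_Energy d m n x y =
     2 / (real m * real n) * (\<Sum>i\<in>{1..m}. \<Sum>j\<in>{1..n}. vnorm d (vdiff (x i) (y j)))
     - 1 / (real m * (real m - 1)) * (\<Sum>(i1, i2)\<in>neq_pairs m. vnorm d (vdiff (x i1) (x i2)))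
     - 1 / (real n * (real n - 1)) * (\<Sum>(j1, j2)\<in>neq_pairs n. vnorm d (vdiff (y j1) (y j2)))"

definition gauss_kernel :: "nat \<Rightarrow> real \<Rightarrow> (nat \<Rightarrow> real) \<Rightarrow> (nat \<Rightarrow> real) \<Rightarrow> real" where
  "gauss_kernel d s u v = exp (- (vnorm d (vdiff u v))\<^sup>2 / (2 * s\<^sup>2))"

definition U_MMD ::
  "nat \<Rightarrow> nat \<Rightarrow> nat \<Rightarrow> real \<Rightarrow> (nat \<Rightarrow> nat \<Rightarrow> real) \<Rightarrow> (nat \<Rightarrow> nat \<Rightarrow> real) \<Rightarrow> real" where
  "U_MMD d m n s x y =
     1 / (real m * (real m - 1)) * (\<Sum>(i1, i2)\<in>neq_pairs m. gauss_kernel d s (x i1) (x i2))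
     + 1 / (real n * (real n - 1)) * (\<Sum>(j1, j2)\<in>neq_pairs n. gauss_kernel d s (y j1) (y j2))
     - 2 / (real m * real n) * (\<Sum>i\<in>{1..m}. \<Sum>j\<in>{1..n}. gauss_kernel d s (x i) (y j))"

section \<open>The tests\<close>

datatype two_sample_test = CvM | Energy | MMD | CQ | WMW

text \<open>Here \<open>sd2\<close> is the average variance \<open>tr \<Sigma> / d\<close>, \<open>s2\<close> is its limit and \<open>bw\<close> is the kernel
  bandwidth. Since squared distances between independent observations concentrate around
  \<open>2 * d * sd2\<close>, the MMD statistic is asymptotically \<open>exp (- d * sd2 / bw\<^sup>2) / bw\<^sup>2\<close> times the CQ
  statistic, and the WMW statistic is \<open>1 / (2 * d * s2)\<close> times the CQ statistic. The normalisations
  of MMD and WMW below are the inverses of these factors. They differ from the source, which prints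
  \<open>bw\<^sup>2 * exp (- d * sd2 / bw\<^sup>2)\<close> and \<open>d * s2\<close>: with those factors the two tests do not have
  the limiting power of the other three.\<close>

fun scaled_stat ::
  "two_sample_test \<Rightarrow> nat \<Rightarrow> nat \<Rightarrow> nat \<Rightarrow> real \<Rightarrow> real \<Rightarrow> real \<Rightarrow>
   (nat \<Rightarrow> nat \<Rightarrow> real) \<Rightarrow> (nat \<Rightarrow> nat \<Rightarrow> real) \<Rightarrow> real" where
  "scaled_stat CvM d m n sd2 s2 bw x y = 2 * pi * sqrt 3 * real d * s2 * U_CvM d m n x y"
| "scaled_stat Energy d m n sd2 s2 bw x y = sqrt (2 * real d) * sqrt s2 * U_Energy d m n x y"
| "scaled_stat MMD d m n sd2 s2 bw x y = bw\<^sup>2 * exp (real d * sd2 / bw\<^sup>2) * U_MMD d m n bw x y"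
| "scaled_stat CQ d m n sd2 s2 bw x y = U_CQ d m n x y"
| "scaled_stat WMW d m n sd2 s2 bw x y = 2 * real d * s2 * U_WMW d m n x y"

definition psi :: "nat \<Rightarrow> nat \<Rightarrow> nat \<Rightarrow> (nat \<Rightarrow> nat \<Rightarrow> real) \<Rightarrow> real" where
  "psi d m n \<Sigma> = mtrace d (mmult d \<Sigma> \<Sigma>) *
     (2 / (real m * (real m - 1)) + 2 / (real n * (real n - 1)) + 4 / (real m * real n))"

definition Phi :: "real \<Rightarrow> real" where
  "Phi = cdf std_normal_distribution"

definition upper_quantile :: "real \<Rightarrow> real" where
  "upper_quantile \<alpha> = (THE z. Phi z = 1 - \<alpha>)"

definition phi_test ::
  "two_sample_test \<Rightarrow> nat \<Rightarrow> nat \<Rightarrow> nat \<Rightarrow> real \<Rightarrow> (nat \<Rightarrow> nat \<Rightarrow> real) \<Rightarrow> real \<Rightarrow> real \<Rightarrow>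
   (nat \<Rightarrow> nat \<Rightarrow> real) \<Rightarrow> (nat \<Rightarrow> nat \<Rightarrow> real) \<Rightarrow> real" where
  "phi_test T d m n \<alpha> \<Sigma> s2 bw x y =
     of_bool (scaled_stat T d m n (mtrace d \<Sigma> / real d) s2 bw x y
              > upper_quantile \<alpha> * sqrt (psi d m n \<Sigma>))"

end

theory Submission
  imports Defs
begin

text \<open>All five statistics are averages of smooth functions of the squared interpoint distances,
  which by A1 concentrate around \<open>2 \<sigma>\<^sup>2 d\<close> with fluctuations of order \<open>sqrt d\<close>. Expanding to first
  order, each scaled statistic equals the CQ statistic up to \<open>o\<^sub>P (sqrt d)\<close>. The CQ statistic is
  \<open>\<parallel>\<mu>X - \<mu>Y\<parallel>\<^sup>2\<close>, plus a linear term that is negligible because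
  \<open>\<parallel>\<mu>X - \<mu>Y\<parallel>\<^sup>2 = O(sqrt d)\<close> and the autocovariances are square summable, plus \<open>W\<^sub>1 + \<dots> + W\<^sub>d\<close>,
  where \<open>W\<^sub>k\<close> is a quadratic form in the \<open>k\<close>-th coordinates of the \<open>m + n\<close> independent noise
  sequences. The mixing coefficient of a product of independent families is at most the largest of
  theirs, so \<open>W\<close> is again \<open>\<rho>\<close>-mixing, and its partial sums have variance exactly \<open>\<psi>\<close>. The central limit theorem
  for \<open>W\<close> needs no moments beyond the second: truncate \<open>W\<close>, bound fourth moments of the truncated
  sums by \<open>C p\<^sup>2\<close>, and cut \<open>{1..d}\<close> into a fixed number of almost independent blocks.\<close>

section \<open>Square integrable functions\<close>

text \<open>The accuracy needed is \<open>sqrt d\<close> because \<open>psi\<close> is of exact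
  order \<open>d\<close>: by stationarity \<open>tr (\<Sigma>\<^sup>2)\<close> is convex in
  \<open>d\<close>; mixing makes it at most linear, and it is at least \<open>d\<close> times the
  squared marginal variance, which positive definiteness makes positive. Only squared distances have
  controlled fluctuations, so every remainder is treated through second moments and
  differentiability at a single point. The constants in the normalisations are derivatives there:
  three points at equal distances form an equilateral triangle, so \<open>Ang\<close> is near
  \<open>pi / 3\<close>, and the derivative of \<open>arccos\<close> at \<open>1 / 2\<close>
  produces \<open>sqrt 3\<close>. The shift
  \<open>\<parallel>\<mu>X - \<mu>Y\<parallel>\<^sup>2 / sqrt psi\<close> is bounded but need not
  converge, so the normal approximation has to be uniform over a bounded range of thresholds, and
  the conclusion speaks of differences. In the central limit theorem the order of choices decides:
  the truncation first, then the number of blocks, which absorbs the fourth moment constant of the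
  truncated sums however large it is, then the gap, and the dimension last.\<close>

lemma square_integrable_mult:
  assumes "square_integrable M f" "square_integrable M g"
  shows "integrable M (\<lambda>x. f x * g x)"
proof (rule Bochner_Integration.integrable_bound[of M "\<lambda>x. (f x)\<^sup>2 + (g x)\<^sup>2"])
  show "integrable M (\<lambda>x. (f x)\<^sup>2 + (g x)\<^sup>2)"
    using assms by (auto simp: square_integrable_def)
  show "(\<lambda>x. f x * g x) \<in> borel_measurable M"
    using assms by (auto simp: square_integrable_def)
  have "\<bar>a * b\<bar> \<le> a\<^sup>2 + b\<^sup>2" for a b :: real
    using sum_squares_bound[of a b] sum_squares_bound[of "-a" b] zero_le_power2[of a] zero_le_power2[of b]
    by (auto simp: abs_if)
  then show "AE x in M. norm (f x * g x) \<le> norm ((f x)\<^sup>2 + (g x)\<^sup>2)"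
    by (intro AE_I2) (auto simp: abs_mult)
qed

lemma square_integrable_measurable:
  "square_integrable M f \<Longrightarrow> f \<in> borel_measurable M"
  by (simp add: square_integrable_def)

lemma square_integrable_cmult:
  "square_integrable M f \<Longrightarrow> square_integrable M (\<lambda>x. c * f x)"
  by (auto simp: square_integrable_def power_mult_distrib)

lemma square_integrable_add:
  assumes "square_integrable M f" "square_integrable M g"
  shows "square_integrable M (\<lambda>x. f x + g x)"
  using assms square_integrable_mult[OF assms]
  by (auto simp: square_integrable_def power2_sum mult.assoc)

lemma square_integrable_diff:
  assumes "square_integrable M f" "square_integrable M g"
  shows "square_integrable M (\<lambda>x. f x - g x)"
  using square_integrable_add[OF assms(1) square_integrable_cmult[OF assms(2), of "-1"]] by simp

lemma square_integrable_sum: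
  assumes "\<And>i. i \<in> I \<Longrightarrow> square_integrable M (f i)"
  shows "square_integrable M (\<lambda>x. \<Sum>i\<in>I. f i x)"
  using assms
  by (induction I rule: infinite_finite_induct)
     (auto intro: square_integrable_add simp: square_integrable_def[of M "\<lambda>_. 0"])

context prob_space
begin

lemma square_integrable_bounded:
  assumes "f \<in> borel_measurable M" "\<And>x. x \<in> space M \<Longrightarrow> \<bar>f x\<bar> \<le> K"
  shows "square_integrable M f"
  unfolding square_integrable_def
proof
  show "integrable M (\<lambda>x. (f x)\<^sup>2)"
    using assms by (intro integrable_const_bound[where B = "K\<^sup>2"] AE_I2)
      (auto simp: abs_le_square_iff[symmetric] intro: order_trans[OF _ abs_ge_self])
qed fact

lemma square_integrable_const: "square_integrable M (\<lambda>_. c)"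
  by (simp add: square_integrable_def)

lemma square_integrable_integrable:
  "square_integrable M f \<Longrightarrow> integrable M f"
  using square_integrable_mult[OF _ square_integrable_const[of 1]] by simp

lemma expectation_square_le:
  assumes "square_integrable M f"
  shows "(expectation f)\<^sup>2 \<le> expectation (\<lambda>x. (f x)\<^sup>2)"
proof -
  have "0 \<le> variance f" by simp
  also have "variance f = expectation (\<lambda>x. (f x)\<^sup>2) - (expectation f)\<^sup>2"
    using assms square_integrable_integrable[OF assms]
    by (intro variance_eq) (auto simp: square_integrable_def)
  finally show ?thesis by simp
qed

lemma expectation_abs_le:
  assumes "square_integrable M f"
  shows "expectation (\<lambda>x. \<bar>f x\<bar>) \<le> sqrt (expectation (\<lambda>x. (f x)\<^sup>2))"
proof -
  have "square_integrable M (\<lambda>x. \<bar>f x\<bar>)" using assms by (auto simp: square_integrable_def)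
  from expectation_square_le[OF this] show ?thesis
    by (intro real_le_rsqrt) simp
qed

text \<open>Cauchy-Schwarz against the constant 1 costs a factor \<open>card I\<close> but asks
  nothing of the dependence between the summands. It is enough where the number of terms is fixed or
  small.\<close>

lemma expectation_sum_square_le:
  assumes "finite I" "\<And>i. i \<in> I \<Longrightarrow> square_integrable M (f i)"
    and "\<And>i. i \<in> I \<Longrightarrow> expectation (\<lambda>x. (f i x)\<^sup>2) \<le> w"
  shows "expectation (\<lambda>x. (\<Sum>i\<in>I. f i x)\<^sup>2) \<le> (real (card I))\<^sup>2 * w"
proof -
  have "expectation (\<lambda>x. (\<Sum>i\<in>I. f i x)\<^sup>2) \<le> expectation (\<lambda>x. real (card I) * (\<Sum>i\<in>I. (f i x)\<^sup>2))"
  proof (intro integral_mono)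
    show "integrable M (\<lambda>x. (\<Sum>i\<in>I. f i x)\<^sup>2)"
      using square_integrable_sum[of I M f] assms by (auto simp: square_integrable_def)
    show "integrable M (\<lambda>x. real (card I) * (\<Sum>i\<in>I. (f i x)\<^sup>2))"
      using assms by (auto simp: square_integrable_def)
    fix x
    show "(\<Sum>i\<in>I. f i x)\<^sup>2 \<le> real (card I) * (\<Sum>i\<in>I. (f i x)\<^sup>2)"
      using Cauchy_Schwarz_ineq_sum[of "\<lambda>_. 1" "\<lambda>i. f i x" I] by simp
  qed
  also have "\<dots> = real (card I) * (\<Sum>i\<in>I. expectation (\<lambda>x. (f i x)\<^sup>2))"
    using assms by (simp add: square_integrable_def Bochner_Integration.integral_sum)
  also have "\<dots> \<le> real (card I) * (real (card I) * w)"
    using assms by (intro mult_left_mono sum_bounded_above) auto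
  finally show ?thesis by (simp add: power2_eq_square)
qed

end

section \<open>Mixing sequences\<close>

text \<open>Every term of \<open>f\<close> is repeated \<open>c\<close> times, so partial sums grow
  at most by the factor \<open>c\<close>. It is used with \<open>c = 4\<close>, for quantities that
  change only at every fourth dyadic scale.\<close>

lemma summable_div:
  fixes f :: "nat \<Rightarrow> real"
  assumes "summable f" "\<And>k. 0 \<le> f k" "c > 0"
  shows "summable (\<lambda>k. f (k div c))"
proof (rule summableI_nonneg_bounded[where x = "real c * suminf f"])
  fix n
  have "(\<Sum>k<n. f (k div c)) \<le> (\<Sum>k<n * c. f (k div c))"
    using assms by (intro sum_mono2) auto
  also have "\<dots> = (\<Sum>m<n. \<Sum>k = m * c..<m * c + c. f (k div c))"
    by (rule sum.nat_group[symmetric])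
  also have "\<dots> = (\<Sum>m<n. \<Sum>k = m * c..<m * c + c. f m)"
  proof (intro sum.cong refl arg_cong[of _ _ f])
    fix m k assume "k \<in> {m * c..<m * c + c}"
    then show "k div c = m"
      by (metis atLeastLessThan_iff assms(3) div_nat_eqI mult.commute mult_Suc_right add.commute)
  qed
  also have "\<dots> = real c * (\<Sum>m<n. f m)"
    by (simp add: sum_distrib_left)
  also have "\<dots> \<le> real c * suminf f"
    using assms by (intro mult_left_mono sum_le_suminf) auto
  finally show "(\<Sum>k<n. f (k div c)) \<le> real c * suminf f" .
qed (use assms in auto)

text \<open>A discrete Gronwall inequality: the growth factors multiply to at most
  \<open>exp (suminf a)\<close>, and no additive term is amplified by more than that.\<close>

lemma affine_recursion_bounded:
  fixes u a b :: "nat \<Rightarrow> real"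
  assumes rec: "\<And>k. u (Suc k) = (1 + a k) * u k + b k" and u0: "0 \<le> u 0"
    and a: "summable a" "\<And>k. 0 \<le> a k" and b: "summable b" "\<And>k. 0 \<le> b k"
  shows "\<exists>C\<ge>0. \<forall>k. 0 \<le> u k \<and> u k \<le> C"
proof (intro exI[of _ "exp (suminf a) * (u 0 + suminf b)"] conjI allI)
  have *: "0 \<le> u k \<and> u k \<le> exp (\<Sum>j<k. a j) * (u 0 + (\<Sum>j<k. b j))" for k
  proof (induction k)
    case (Suc k)
    have "0 \<le> u 0 + (\<Sum>j<k. b j)" using u0 b by (intro add_nonneg_nonneg sum_nonneg) auto
    then have "u (Suc k) \<le> exp (a k) * (exp (\<Sum>j<k. a j) * (u 0 + (\<Sum>j<k. b j))) + b k"
      unfolding rec using Suc.IH a(2)[of k] exp_ge_add_one_self[of "a k"] by (intro add_mono mult_mono) auto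
    also have "b k \<le> exp (a k) * exp (\<Sum>j<k. a j) * b k"
      using b(2)[of k] a(2) by (simp add: mult_le_cancel_right1 sum_nonneg flip: exp_add)
    finally have "u (Suc k) \<le> exp (\<Sum>j<Suc k. a j) * (u 0 + (\<Sum>j<Suc k. b j))"
      by (simp add: exp_add algebra_simps)
    moreover have "0 \<le> u (Suc k)" unfolding rec using Suc a(2)[of k] b(2)[of k] by simp
    ultimately show ?case by simp
  qed (use u0 in simp)
  show "0 \<le> exp (suminf a) * (u 0 + suminf b)" using u0 b by (simp add: suminf_nonneg)
  fix k
  show "0 \<le> u k" using * by simp
  have "exp (\<Sum>j<k. a j) * (u 0 + (\<Sum>j<k. b j)) \<le> exp (suminf a) * (u 0 + suminf b)"
    using a b u0 by (intro mult_mono) (auto intro!: sum_le_suminf sum_nonneg add_nonneg_nonneg)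
  then show "u k \<le> exp (suminf a) * (u 0 + suminf b)" using *[of k] by linarith
qed

text \<open>The arithmetic mean of the second moments in place of the geometric one costs nothing, since
  \<open>f\<close> and \<open>g\<close> can be rescaled separately, and it makes the condition additive in \<open>f\<close> and \<open>g\<close>.\<close>

locale rho_mixing = prob_space M for M :: "'a measure" +
  fixes A B :: "nat \<Rightarrow> 'a measure" and r :: "nat \<Rightarrow> real"
  assumes past: "\<And>l f. f \<in> borel_measurable (A l) \<Longrightarrow> (f :: 'a \<Rightarrow> real) \<in> borel_measurable M"
    and future: "\<And>l f. f \<in> borel_measurable (B l) \<Longrightarrow> (f :: 'a \<Rightarrow> real) \<in> borel_measurable M"
    and mixing: "\<And>l q f g. 1 \<le> l \<Longrightarrow> f \<in> borel_measurable (A l) \<Longrightarrow> square_integrable M f \<Longrightarrow>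
        g \<in> borel_measurable (B (l + q)) \<Longrightarrow> square_integrable M g \<Longrightarrow>
        \<bar>expectation (\<lambda>x. f x * g x) - expectation f * expectation g\<bar>
          \<le> r q * (expectation (\<lambda>x. (f x)\<^sup>2) + expectation (\<lambda>x. (g x)\<^sup>2)) / 2"
    and r_nonneg: "\<And>q. 0 \<le> r q"
    and r_summable: "summable (\<lambda>k. r (2 ^ Suc k))"
begin

definition adapted :: "(nat \<Rightarrow> 'a \<Rightarrow> real) \<Rightarrow> bool" where
  "adapted W \<longleftrightarrow> (\<forall>k l. 1 \<le> k \<and> k \<le> l \<longrightarrow> W k \<in> borel_measurable (A l)) \<and>
                 (\<forall>k l. 1 \<le> k \<and> l \<le> k \<longrightarrow> W k \<in> borel_measurable (B l))"

text \<open>The bound \<open>w\<close> is a parameter so that variance bounds linear in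
  \<open>w\<close> apply alike to a sequence, to its truncation and to the small residual of the
  truncation.\<close>

definition centred_L2 :: "(nat \<Rightarrow> 'a \<Rightarrow> real) \<Rightarrow> real \<Rightarrow> bool" where
  "centred_L2 W w \<longleftrightarrow> adapted W \<and>
     (\<forall>k\<ge>1. square_integrable M (W k) \<and> expectation (W k) = 0 \<and> expectation (\<lambda>x. (W k x)\<^sup>2) \<le> w)"

text \<open>Open on the left, so that consecutive blocks join without overlap: the block belongs to
  the past at time \<open>h + p\<close> and to the future from \<open>Suc h\<close> on.\<close>

definition blk :: "(nat \<Rightarrow> 'a \<Rightarrow> real) \<Rightarrow> nat \<Rightarrow> nat \<Rightarrow> 'a \<Rightarrow> real" where
  "blk W h p = (\<lambda>x. \<Sum>k\<in>{h<..h + p}. W k x)"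

lemma blk_0 [simp]: "blk W h 0 = (\<lambda>_. 0)"
  by (simp add: blk_def)

lemma blk_add: "blk W h (p + q) x = blk W h p x + blk W (h + p) q x"
proof -
  have "{h<..h + (p + q)} = {h<..h + p} \<union> {h + p<..h + p + q}" by auto
  then show ?thesis unfolding blk_def by (simp add: sum.union_disjoint)
qed

lemma blk_past: "adapted W \<Longrightarrow> h + p \<le> l \<Longrightarrow> blk W h p \<in> borel_measurable (A l)"
  unfolding blk_def adapted_def by (intro borel_measurable_sum) auto

lemma blk_future: "adapted W \<Longrightarrow> l \<le> Suc h \<Longrightarrow> blk W h p \<in> borel_measurable (B l)"
  unfolding blk_def adapted_def by (intro borel_measurable_sum) auto

lemma centred_L2_adapted: "centred_L2 W w \<Longrightarrow> adapted W"
  by (simp add: centred_L2_def)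

lemma blk_square_integrable: "centred_L2 W w \<Longrightarrow> square_integrable M (blk W h p)"
  unfolding blk_def centred_L2_def by (intro square_integrable_sum) auto

lemma blk_expectation:
  assumes "centred_L2 W w" shows "expectation (blk W h p) = 0"
proof -
  have "expectation (blk W h p) = (\<Sum>k\<in>{h<..h + p}. expectation (W k))"
    unfolding blk_def using assms
    by (intro Bochner_Integration.integral_sum square_integrable_integrable) (auto simp: centred_L2_def)
  then show ?thesis using assms by (auto simp: centred_L2_def intro!: sum.neutral)
qed

lemma centred_L2_nonneg: "centred_L2 W w \<Longrightarrow> 0 \<le> w"
  unfolding centred_L2_def
  by (rule order_trans[of _ "expectation (\<lambda>x. (W 1 x)\<^sup>2)"]) auto

lemma blk_expectation_square_crude:
  assumes "centred_L2 W w" shows "expectation (\<lambda>x. (blk W h p x)\<^sup>2) \<le> (real p)\<^sup>2 * w"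
  using expectation_sum_square_le[of "{h<..h + p}" W w] assms unfolding blk_def centred_L2_def
  by auto

text \<open>The second half is moved \<open>q\<close> places to the right, so that mixing applies
  across a gap. The three corrections are the gap itself, the odd term left over by
  \<open>p div 2\<close>, and the overshoot beyond \<open>h + p\<close>; none is longer than
  \<open>max q 1\<close>.\<close>

lemma blk_halving:
  "blk W h p x = blk W h (p div 2) x + blk W (h + p div 2 + q) (p div 2) x +
     (blk W (h + p div 2) q x + blk W (h + 2 * (p div 2) + q) (p mod 2) x - blk W (h + p) q x)"
proof -
  have "blk W h p x + blk W (h + p) q x = blk W h (p + q) x" by (simp add: blk_add)
  also have "p + q = p div 2 + (q + (p div 2 + p mod 2))" by presburger
  finally have "blk W h p x + blk W (h + p) q x = blk W h (p div 2) x + (blk W (h + p div 2) q x +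
      (blk W (h + p div 2 + q) (p div 2) x + blk W (h + p div 2 + q + p div 2) (p mod 2) x))"
    by (simp only: blk_add)
  moreover have "h + p div 2 + q + p div 2 = h + 2 * (p div 2) + q" by simp
  ultimately show ?thesis by simp
qed

text \<open>By mixing the cross term is at most \<open>r q * s\<close>, so the two separated halves
  together have variance at most \<open>(1 + r q) * (2 * s)\<close>. Young's inequality with weight
  \<open>e\<close> splits off the three correction blocks, for which the crude bound is enough. In
  \<open>9 = 3 * 3\<close> one 3 comes from squaring a sum of three terms and one from adding three
  bounds.\<close>

lemma variance_step:
  assumes W: "centred_L2 W w" and p: "p \<ge> 2" and q: "q \<ge> 1" and e: "e > 0"
    and s: "\<And>h'. expectation (\<lambda>x. (blk W h' (p div 2) x)\<^sup>2) \<le> s"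
  shows "expectation (\<lambda>x. (blk W h p x)\<^sup>2) \<le> (1 + e) * (1 + r q) * (2 * s) + (1 + 1 / e) * (9 * (real q)\<^sup>2 * w)"
proof -
  let ?h = "p div 2"
  define R where "R x = blk W (h + ?h) q x + blk W (h + 2 * ?h + q) (p mod 2) x - blk W (h + p) q x" for x
  have S: "blk W h p x = blk W h ?h x + blk W (h + ?h + q) ?h x + R x" for x
    unfolding R_def by (rule blk_halving)
  let ?X = "blk W h ?h" and ?Y = "blk W (h + ?h + q) ?h"
  note sq = blk_square_integrable[OF W]
  have w: "0 \<le> w" using centred_L2_nonneg[OF W] .
  have sqR: "square_integrable M R"
    unfolding R_def by (intro square_integrable_add square_integrable_diff sq)
  have XY: "expectation (\<lambda>x. ?X x * ?Y x) \<le> r q * s"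
  proof -
    have "expectation (\<lambda>x. ?X x * ?Y x) \<le>
       r q * (expectation (\<lambda>x. (?X x)\<^sup>2) + expectation (\<lambda>x. (?Y x)\<^sup>2)) / 2"
    proof -
      have "1 \<le> h + ?h" using p by linarith
      from mixing[OF this blk_past[OF centred_L2_adapted[OF W] order_refl] sq
          blk_future[OF centred_L2_adapted[OF W]] sq, of q "h + ?h + q" ?h]
      show ?thesis unfolding blk_expectation[OF W] by linarith
    qed
    also have "\<dots> \<le> r q * (s + s) / 2"
      using r_nonneg s by (intro divide_right_mono mult_left_mono add_mono) auto
    finally show ?thesis by simp
  qed
  have iX: "integrable M (\<lambda>x. (?X x)\<^sup>2)" and iY: "integrable M (\<lambda>x. (?Y x)\<^sup>2)"
    and iR: "integrable M (\<lambda>x. (R x)\<^sup>2)"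
    using sq sqR by (auto simp: square_integrable_def)
  have iXY: "integrable M (\<lambda>x. ?X x * ?Y x)" by (intro square_integrable_mult sq)
  have 1: "expectation (\<lambda>x. (?X x + ?Y x)\<^sup>2) \<le> (1 + r q) * (2 * s)"
  proof -
    have "expectation (\<lambda>x. (?X x + ?Y x)\<^sup>2) = expectation (\<lambda>x. (?X x)\<^sup>2) + expectation (\<lambda>x. (?Y x)\<^sup>2)
        + 2 * expectation (\<lambda>x. ?X x * ?Y x)"
      using iX iY iXY by (simp add: power2_sum mult.assoc)
    then show ?thesis using XY s[of h] s[of "h + ?h + q"] by (simp add: algebra_simps)
  qed
  have 2: "expectation (\<lambda>x. (R x)\<^sup>2) \<le> 9 * (real q)\<^sup>2 * w"
  proof -
    have "expectation (\<lambda>x. (R x)\<^sup>2) \<le> expectation (\<lambda>x. 3 * ((blk W (h + ?h) q x)\<^sup>2 +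
         (blk W (h + 2 * ?h + q) (p mod 2) x)\<^sup>2 + (blk W (h + p) q x)\<^sup>2))"
    proof (intro integral_mono)
      show "integrable M (\<lambda>x. 3 * ((blk W (h + ?h) q x)\<^sup>2 +
         (blk W (h + 2 * ?h + q) (p mod 2) x)\<^sup>2 + (blk W (h + p) q x)\<^sup>2))"
        using sq by (auto simp: square_integrable_def)
      fix x
      have "(a + b - c)\<^sup>2 \<le> 3 * (a\<^sup>2 + b\<^sup>2 + c\<^sup>2)" for a b c :: real
        using zero_le_power2[of "a - b"] zero_le_power2[of "a + c"] zero_le_power2[of "b + c"]
        by (simp add: power2_eq_square algebra_simps)
      then show "(R x)\<^sup>2 \<le> 3 * ((blk W (h + ?h) q x)\<^sup>2 +
         (blk W (h + 2 * ?h + q) (p mod 2) x)\<^sup>2 + (blk W (h + p) q x)\<^sup>2)"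
        unfolding R_def .
    qed (rule iR)
    also have "\<dots> = 3 * (expectation (\<lambda>x. (blk W (h + ?h) q x)\<^sup>2) +
        expectation (\<lambda>x. (blk W (h + 2 * ?h + q) (p mod 2) x)\<^sup>2) + expectation (\<lambda>x. (blk W (h + p) q x)\<^sup>2))"
      using sq by (simp add: square_integrable_def)
    also have "\<dots> \<le> 3 * ((real q)\<^sup>2 * w + (real q)\<^sup>2 * w + (real q)\<^sup>2 * w)"
    proof (intro mult_left_mono add_mono blk_expectation_square_crude[OF W])
      have "expectation (\<lambda>x. (blk W (h + 2 * ?h + q) (p mod 2) x)\<^sup>2) \<le> (real (p mod 2))\<^sup>2 * w"
        by (rule blk_expectation_square_crude[OF W])
      also have "\<dots> \<le> (real q)\<^sup>2 * w"
      proof -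
        have "p mod 2 \<le> q" using q by linarith
        then show ?thesis using w by (intro mult_right_mono power_mono) auto
      qed
      finally show "expectation (\<lambda>x. (blk W (h + 2 * ?h + q) (p mod 2) x)\<^sup>2) \<le> (real q)\<^sup>2 * w" .
    qed auto
    finally show ?thesis by (simp add: mult_ac)
  qed
  have "expectation (\<lambda>x. (blk W h p x)\<^sup>2) \<le> expectation (\<lambda>x. (1 + e) * (?X x + ?Y x)\<^sup>2 + (1 + 1 / e) * (R x)\<^sup>2)"
  proof (intro integral_mono)
    show "integrable M (\<lambda>x. (blk W h p x)\<^sup>2)" using sq by (simp add: square_integrable_def)
    show "integrable M (\<lambda>x. (1 + e) * (?X x + ?Y x)\<^sup>2 + (1 + 1 / e) * (R x)\<^sup>2)"
      using sqR square_integrable_add[OF sq sq] by (simp add: square_integrable_def)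
    fix x
    have "(a + b)\<^sup>2 \<le> (1 + e) * a\<^sup>2 + (1 + 1 / e) * b\<^sup>2" for a b :: real
    proof -
      have "0 \<le> (sqrt e * a - b / sqrt e)\<^sup>2" by simp
      also have "\<dots> = e * a\<^sup>2 - 2 * a * b + b\<^sup>2 / e"
        using e by (simp add: power2_diff power_mult_distrib power_divide)
      finally show ?thesis by (simp add: power2_sum algebra_simps)
    qed
    then show "(blk W h p x)\<^sup>2 \<le> (1 + e) * (?X x + ?Y x)\<^sup>2 + (1 + 1 / e) * (R x)\<^sup>2"
      unfolding S .
  qed
  also have "\<dots> = (1 + e) * expectation (\<lambda>x. (?X x + ?Y x)\<^sup>2) + (1 + 1 / e) * expectation (\<lambda>x. (R x)\<^sup>2)"
    using sqR square_integrable_add[OF sq sq] by (simp add: square_integrable_def)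
  also have "\<dots> \<le> (1 + e) * ((1 + r q) * (2 * s)) + (1 + 1 / e) * (9 * (real q)\<^sup>2 * w)"
    using e 1 2 by (intro add_mono mult_left_mono) auto
  finally show ?thesis by (simp add: mult.assoc)
qed

text \<open>Halving a block of length about \<open>2^k\<close> with a gap \<open>q = 2^(k div 4 + 1)\<close> between the halves: the
  gap is long enough for \<open>\<Sum>\<^sub>k r (q k)\<close> to converge by the dyadic condition, and short enough for
  the removed terms, of variance at most \<open>O(q\<^sup>2)\<close>, to be summable relative to \<open>2^k\<close>.\<close>

lemma variance_bound:
  "\<exists>C\<ge>0. \<forall>W w h p. centred_L2 W w \<longrightarrow> expectation (\<lambda>x. (blk W h p x)\<^sup>2) \<le> C * w * real p"
proof -
  \<comment> \<open>\<open>e\<close> is the weight in Young's inequality at scale \<open>k\<close>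
    and \<open>q\<close> the gap. \<open>a\<close> is the excess over exact doubling in one step,
    and \<open>b\<close> the additive error relative to \<open>2 ^ Suc k * w\<close>. With these,
    \<open>u k * 2 ^ k * w\<close> bounds the variance of every block shorter than
    \<open>2 ^ Suc k\<close>.\<close>
  define e :: "nat \<Rightarrow> real" where "e k = (1 / 2) ^ (k div 4)" for k
  define q :: "nat \<Rightarrow> nat" where "q k = 2 ^ Suc (k div 4)" for k
  define a where "a k = (1 + e k) * (1 + r (q k)) - 1" for k
  define b where "b k = (1 + 1 / e k) * (9 * (real (q k))\<^sup>2) / 2 ^ Suc k" for k
  define u where "u = rec_nat 1 (\<lambda>k v. (1 + a k) * v + b k)"
  have e01: "0 < e k" "e k \<le> 1" for k by (auto simp: e_def power_le_one)
  have a0: "0 \<le> a k" for k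
    using e01[of k] r_nonneg[of "q k"] by (simp add: a_def algebra_simps)
  have b0: "0 \<le> b k" for k using e01[of k] by (simp add: b_def)
  have e_sum: "summable e"
    unfolding e_def by (rule summable_div) (auto intro: summable_geometric)
  have rq_sum: "summable (\<lambda>k. r (q k))"
    unfolding q_def by (rule summable_div[where f = "\<lambda>j. r (2 ^ Suc j)"]) (use r_summable r_nonneg in auto)
  have a_sum: "summable a"
  proof (rule summable_comparison_test')
    show "summable (\<lambda>k. e k + 2 * r (q k))" using e_sum rq_sum by (intro summable_add summable_mult)
    fix k
    have "e k * r (q k) \<le> 1 * r (q k)" using e01 r_nonneg by (intro mult_right_mono) auto
    then show "norm (a k) \<le> e k + 2 * r (q k)" using a0[of k] by (simp add: a_def algebra_simps)
  qed
  have b_sum: "summable b"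
  proof (rule summable_comparison_test')
    show "summable (\<lambda>k. 36 * e k)" using e_sum by (intro summable_mult)
    fix k :: nat
    \<comment> \<open>The error is of order \<open>(2 ^ j) ^ 3\<close>, one factor from
      \<open>1 / e k\<close> and two from the squared gap, against a block length of at least
      \<open>16 ^ j\<close>. What remains is of order \<open>e k\<close>.\<close>
    define j where "j = k div 4"
    have "(16::real) ^ j \<le> 2 ^ k"
    proof -
      have "(16::real) ^ j = 2 ^ (4 * j)" by (simp add: power_mult)
      also have "\<dots> \<le> 2 ^ k" unfolding j_def by (intro power_increasing) auto
      finally show ?thesis .
    qed
    then have "(1 + 2 ^ j) * (9 * (2 * 2 ^ j)\<^sup>2) * (2::real)^j \<le> (2 ^ j + 2 ^ j) * (9 * (2 * 2 ^ j)\<^sup>2) * 2 ^ j"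
      by (intro mult_right_mono add_mono) auto
    also have "\<dots> = 72 * (2^j)^4" by (simp add: power2_eq_square power4_eq_xxxx)
    also have "(2^j)^4 = (16::real)^j" by (simp flip: power_mult add: mult.commute[of j 4]) (simp add: power_mult)
    also have "72 * (16::real)^j \<le> 72 * 2^k" using \<open>16 ^ j \<le> 2 ^ k\<close> by simp
    finally have "(1 + 2 ^ j) * (9 * (2 * 2 ^ j)\<^sup>2) * (2::real)^j \<le> 36 * 2 ^ Suc k" by simp
    then have "b k \<le> 36 * e k"
      unfolding b_def e_def q_def j_def[symmetric] by (simp add: field_simps power_divide)
    then show "norm (b k) \<le> 36 * e k" using b0[of k] by simp
  qed
  have u0: "u 0 = 1" and urec: "\<And>k. u (Suc k) = (1 + a k) * u k + b k" by (simp_all add: u_def)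
  obtain C where C: "C \<ge> 0" "\<And>k. 0 \<le> u k" "\<And>k. u k \<le> C"
    using affine_recursion_bounded[OF urec _ a_sum a0 b_sum b0] u0 by auto
  have main: "expectation (\<lambda>x. (blk W h p x)\<^sup>2) \<le> u k * 2 ^ k * w"
    if W: "centred_L2 W w" and "p < 2 ^ Suc k" for W w h p k
    using that(2)
  proof (induction k arbitrary: h p)
    case 0
    have "expectation (\<lambda>x. (blk W h p x)\<^sup>2) \<le> (real p)\<^sup>2 * w" by (rule blk_expectation_square_crude[OF W])
    also have "\<dots> \<le> 1 * w" using 0 centred_L2_nonneg[OF W]
      by (intro mult_right_mono) (auto simp: less_2_cases_iff)
    finally show ?case by (simp add: u0)
  next
    case (Suc k)
    show ?case
    proof (cases "p \<ge> 2")
      case True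
      have "p div 2 < 2 ^ Suc k" using Suc.prems by auto
      then have "expectation (\<lambda>x. (blk W h p x)\<^sup>2) \<le> (1 + e k) * (1 + r (q k)) * (2 * (u k * 2 ^ k * w)) +
          (1 + 1 / e k) * (9 * (real (q k))\<^sup>2 * w)"
        using True e01[of k] by (intro variance_step W Suc.IH) (auto simp: q_def)
      also have "\<dots> = ((1 + a k) * u k + b k) * 2 ^ Suc k * w"
        by (simp add: a_def b_def field_simps)
      finally show ?thesis by (simp only: urec)
    next
      case False
      then have "p < 2 ^ Suc k"
        using one_le_power[of "2::nat" k] by (simp only: power_Suc) linarith
      have "expectation (\<lambda>x. (blk W h p x)\<^sup>2) \<le> u k * 2 ^ k * w" by (rule Suc.IH) fact
      also have "\<dots> \<le> u (Suc k) * 2 ^ Suc k * w"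
      proof (intro mult_right_mono mult_mono)
        have "u k \<le> (1 + a k) * u k" using a0 C(2) by (simp add: algebra_simps)
        then show "u k \<le> u (Suc k)" using b0[of k] by (simp add: urec)
      qed (use C centred_L2_nonneg[OF W] in auto)
      finally show ?thesis .
    qed
  qed
  show ?thesis
  proof (intro exI[of _ C] conjI allI impI)
    fix W w h p assume W: "centred_L2 W w"
    show "expectation (\<lambda>x. (blk W h p x)\<^sup>2) \<le> C * w * real p"
    proof (cases "p = 0")
      case False
      then obtain k where k: "2 ^ k \<le> p" "p < 2 ^ Suc k"
        using ex_power_ivl1[of 2 p] by auto
      have "expectation (\<lambda>x. (blk W h p x)\<^sup>2) \<le> u k * 2 ^ k * w" by (rule main[OF W k(2)])
      also have "\<dots> \<le> C * real p * w"
        using C k(1) centred_L2_nonneg[OF W] by (intro mult_right_mono mult_mono) (auto simp flip: of_nat_le_iff)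
      finally show ?thesis by (simp add: mult_ac)
    qed simp
  qed (rule C(1))
qed

end

section \<open>Fourth moments of sums of bounded terms\<close>

lemma abs_diff_le_imp:
  fixes u v c :: real shows "\<bar>u - v\<bar> \<le> c \<Longrightarrow> u \<le> v + c"
  by linarith

lemma power4_le:
  fixes a K :: real assumes "\<bar>a\<bar> \<le> K" shows "a ^ 4 \<le> K ^ 4"
  using power_mono[OF assms abs_ge_zero, of 4] by simp

context rho_mixing
begin

text \<open>What matters is that \<open>7 / 2\<close> is below 4, the factor by which
  \<open>p\<^sup>2\<close> grows when \<open>p\<close> doubles. The two halves contribute
  \<open>3 / 2 * (a + a)\<close>, and the mixed term adds only \<open>46 / 200 * a\<close> because
  the gap makes \<open>r q\<close> small. The correction terms are bounded pointwise through
  \<open>K\<close>.\<close>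

lemma fourth_moment_step:
  assumes W: "centred_L2 W w" and K: "\<And>k x. 1 \<le> k \<Longrightarrow> x \<in> space M \<Longrightarrow> \<bar>W k x\<bar> \<le> K"
    and q: "r q \<le> 1 / 200" and p: "p \<ge> 2"
    and V: "\<And>h'. expectation (\<lambda>x. (blk W h' (p div 2) x)\<^sup>2) \<le> v"
    and F: "\<And>h'. expectation (\<lambda>x. (blk W h' (p div 2) x) ^ 4) \<le> a"
  shows "expectation (\<lambda>x. (blk W h p x) ^ 4) \<le> 7 / 2 * a + 50 * v\<^sup>2 + 4913 * ((2 * real q + 1) * K) ^ 4"
proof -
  let ?h = "p div 2"
  let ?X = "blk W h ?h" and ?Y = "blk W (h + ?h + q) ?h"
  define R where "R x = blk W (h + ?h) q x + blk W (h + 2 * ?h + q) (p mod 2) x - blk W (h + p) q x" for x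
  have bnd: "\<bar>blk W h' p' x\<bar> \<le> real p' * K" if "x \<in> space M" for h' p' x
  proof -
    have "\<bar>blk W h' p' x\<bar> \<le> (\<Sum>k\<in>{h'<..h' + p'}. \<bar>W k x\<bar>)" unfolding blk_def by (rule sum_abs)
    also have "\<dots> \<le> (\<Sum>k\<in>{h'<..h' + p'}. K)" using K that by (intro sum_mono) auto
    finally show ?thesis by simp
  qed
  have meas[measurable]: "blk W h' p' \<in> borel_measurable M" for h' p'
    using blk_square_integrable[OF W] by (simp add: square_integrable_def)
  have int: "integrable M f" if "f \<in> borel_measurable M" "\<And>x. x \<in> space M \<Longrightarrow> \<bar>f x\<bar> \<le> c"
    for f :: "'a \<Rightarrow> real" and c
    using that by (intro integrable_const_bound[where B = c]) auto
  have int_pow: "integrable M (\<lambda>x. (blk W h' p' x) ^ i * (blk W h'' p'' x) ^ j)" for h' p' h'' p'' i j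
    using bnd by (intro int[of _ "(real p' * K) ^ i * (real p'' * K) ^ j"])
      (auto simp: abs_mult power_abs intro!: mult_mono power_mono zero_le_power
        intro: order_trans[OF abs_ge_zero])
  have sqX: "square_integrable M (\<lambda>x. (blk W h' p' x)\<^sup>2)" for h' p'
    unfolding square_integrable_def using int_pow[of h' p' 4 h' p' 0] by (simp flip: power_mult)
  \<comment> \<open>Boundedness makes the squares of the block sums square integrable, so mixing may
    be applied to the squares themselves.\<close>
  have "\<bar>expectation (\<lambda>x. (?X x)\<^sup>2 * (?Y x)\<^sup>2) - expectation (\<lambda>x. (?X x)\<^sup>2) * expectation (\<lambda>x. (?Y x)\<^sup>2)\<bar>
     \<le> r q * (expectation (\<lambda>x. ((?X x)\<^sup>2)\<^sup>2) + expectation (\<lambda>x. ((?Y x)\<^sup>2)\<^sup>2)) / 2"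
  proof (rule mixing[where l = "h + ?h"])
    show "1 \<le> h + ?h" using p by linarith
    show "(\<lambda>x. (?X x)\<^sup>2) \<in> borel_measurable (A (h + ?h))"
      by (intro borel_measurable_power blk_past[OF centred_L2_adapted[OF W]]) simp
    show "(\<lambda>x. (?Y x)\<^sup>2) \<in> borel_measurable (B (h + ?h + q))"
      by (intro borel_measurable_power blk_future[OF centred_L2_adapted[OF W]]) simp
  qed (rule sqX)+
  also have "\<dots> \<le> (1 / 200) * (a + a) / 2"
    using q r_nonneg[of q] F[of h] F[of "h + ?h + q"]
    by (intro divide_right_mono mult_mono add_mono add_nonneg_nonneg) (simp_all flip: power_mult)
  also have "\<dots> = a / 200" by simp
  finally have "expectation (\<lambda>x. (?X x)\<^sup>2 * (?Y x)\<^sup>2) \<le>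
      expectation (\<lambda>x. (?X x)\<^sup>2) * expectation (\<lambda>x. (?Y x)\<^sup>2) + a / 200"
    by (rule abs_diff_le_imp)
  also have "\<dots> \<le> v * v + a / 200"
    using V order_trans[OF _ V] by (intro add_mono mult_mono) auto
  finally have XY: "expectation (\<lambda>x. (?X x)\<^sup>2 * (?Y x)\<^sup>2) \<le> v\<^sup>2 + a / 200" by (simp add: power2_eq_square)
  have R_bnd: "\<bar>R x\<bar> \<le> (2 * real q + 1) * K" if x: "x \<in> space M" for x
  proof -
    have "0 \<le> K" using order_trans[OF abs_ge_zero K[of 1 x]] x by simp
    then have "real (p mod 2) * K \<le> 1 * K" by (intro mult_right_mono) auto
    moreover have "(2 * real q + 1) * K = real q * K + 1 * K + real q * K" by (simp add: algebra_simps)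
    ultimately show ?thesis
      using bnd[OF x, of "h + ?h" q] bnd[OF x, of "h + 2 * ?h + q" "p mod 2"] bnd[OF x, of "h + p" q]
      unfolding R_def by linarith
  qed
  have [measurable]: "R \<in> borel_measurable M" unfolding R_def by measurable
  have iR: "integrable M (\<lambda>x. (R x) ^ 4)"
    using R_bnd by (intro int[of _ "((2 * real q + 1) * K) ^ 4"])
     (auto intro!: power4_le)
  have ER: "expectation (\<lambda>x. (R x) ^ 4) \<le> ((2 * real q + 1) * K) ^ 4"
    using R_bnd by (intro integral_le_const iR AE_I2 power4_le)
  \<comment> \<open>\<open>e\<close> is split off by the weighted inequality \<open>sq\<close>. Used
    twice it gives \<open>(17 / 16) ^ 3 = 4913 / 4096\<close>, about 1.2, on the main part and
    \<open>17 ^ 3 = 4913\<close> on \<open>e\<close>. The odd products in \<open>(c + d) ^ 4\<close>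
    are absorbed at weight \<open>1 / 4\<close> into the fourth powers, and 1.2 times
    \<open>5 / 4\<close> and 38 stays below \<open>3 / 2\<close> and 46.\<close>
  have pw: "(c + d + e) ^ 4 \<le> 3 / 2 * (c ^ 4 + d ^ 4) + 46 * (c\<^sup>2 * d\<^sup>2) + 4913 * e ^ 4"
    for c d e :: real
  proof -
    have sq: "(c + d)\<^sup>2 \<le> 17 / 16 * c\<^sup>2 + 17 * d\<^sup>2" for c d :: real
      using zero_le_power2[of "c / 4 - 4 * d"] by (simp add: power2_eq_square algebra_simps)
    have four: "(c + d) ^ 4 \<le> 4913 / 4096 * c ^ 4 + 4913 * d ^ 4" for c d :: real
    proof -
      have "(c + d) ^ 4 = ((c + d)\<^sup>2)\<^sup>2" by simp
      also have "\<dots> \<le> (17 / 16 * c\<^sup>2 + 17 * d\<^sup>2)\<^sup>2" by (intro power_mono sq) auto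
      also have "\<dots> \<le> 17 / 16 * (17 / 16 * c\<^sup>2)\<^sup>2 + 17 * (17 * d\<^sup>2)\<^sup>2" by (rule sq)
      finally show ?thesis by (simp add: power_mult_distrib power_divide)
    qed
    have "(c + d) ^ 4 \<le> 5 / 4 * (c ^ 4 + d ^ 4) + 38 * (c\<^sup>2 * d\<^sup>2)"
    proof -
      have "0 \<le> (c\<^sup>2 / 2 - 4 * (c * d))\<^sup>2 + (d\<^sup>2 / 2 - 4 * (c * d))\<^sup>2" by simp
      then show ?thesis by (simp add: power2_eq_square power4_eq_xxxx algebra_simps)
    qed
    then have "4913 / 4096 * (c + d) ^ 4 \<le> 4913 / 4096 * (5 / 4 * (c ^ 4 + d ^ 4) + 38 * (c\<^sup>2 * d\<^sup>2))"
      by (rule mult_left_mono) simp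
    moreover have "0 \<le> c ^ 4" "0 \<le> d ^ 4" "0 \<le> c\<^sup>2 * d\<^sup>2" by auto
    ultimately show ?thesis using four[of "c + d" e] by argo
  qed
  have "expectation (\<lambda>x. (blk W h p x) ^ 4) \<le>
     expectation (\<lambda>x. 3 / 2 * ((?X x) ^ 4 + (?Y x) ^ 4) + 46 * ((?X x)\<^sup>2 * (?Y x)\<^sup>2) + 4913 * (R x) ^ 4)"
  proof (intro integral_mono)
    show "integrable M (\<lambda>x. (blk W h p x) ^ 4)" using int_pow[of h p 4 h p 0] by simp
    show "integrable M (\<lambda>x. 3 / 2 * ((?X x) ^ 4 + (?Y x) ^ 4) + 46 * ((?X x)\<^sup>2 * (?Y x)\<^sup>2) + 4913 * (R x) ^ 4)"
      using int_pow[of _ _ 4 _ _ 0] int_pow[of _ _ 2 _ _ 2] iR by simp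
    fix x
    have "blk W h p x = ?X x + ?Y x + R x" unfolding R_def by (rule blk_halving)
    then show "(blk W h p x) ^ 4 \<le> 3 / 2 * ((?X x) ^ 4 + (?Y x) ^ 4) + 46 * ((?X x)\<^sup>2 * (?Y x)\<^sup>2) + 4913 * (R x) ^ 4"
      using pw[of "?X x" "?Y x" "R x"] by simp
  qed
  also have "\<dots> = 3 / 2 * (expectation (\<lambda>x. (?X x) ^ 4) + expectation (\<lambda>x. (?Y x) ^ 4)) +
      46 * expectation (\<lambda>x. (?X x)\<^sup>2 * (?Y x)\<^sup>2) + 4913 * expectation (\<lambda>x. (R x) ^ 4)"
    using int_pow[of _ _ 4 _ _ 0] int_pow[of _ _ 2 _ _ 2] iR by simp
  also have "\<dots> \<le> 3 / 2 * (a + a) + 46 * (v\<^sup>2 + a / 200) + 4913 * ((2 * real q + 1) * K) ^ 4"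
    by (intro add_mono mult_left_mono F XY ER) auto
  also have "\<dots> \<le> 7 / 2 * a + 50 * v\<^sup>2 + 4913 * ((2 * real q + 1) * K) ^ 4"
  proof -
    have "0 \<le> a" by (rule order_trans[OF _ F[of h]]) auto
    then show ?thesis using zero_le_power2[of v] by argo
  qed
  finally show ?thesis .
qed

lemma r_tendsto: "(\<lambda>k. r (2 ^ Suc k)) \<longlonglongrightarrow> 0"
  by (rule summable_LIMSEQ_zero[OF r_summable])

text \<open>Since each doubling loses only \<open>7 / 2\<close> where \<open>p\<^sup>2\<close> gains
  4, errors do not accumulate over the scales, and one fixed gap with
  \<open>r q \<le> 1 / 200\<close> serves all lengths.\<close>

lemma fourth_moment_bound:
  assumes W: "centred_L2 W w" and K: "\<And>k x. 1 \<le> k \<Longrightarrow> x \<in> space M \<Longrightarrow> \<bar>W k x\<bar> \<le> K"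
  shows "\<exists>D\<ge>0. \<forall>h p. expectation (\<lambda>x. (blk W h p x) ^ 4) \<le> D * (real p)\<^sup>2"
proof -
  obtain C where C: "C \<ge> 0" "\<And>W w h p. centred_L2 W w \<Longrightarrow> expectation (\<lambda>x. (blk W h p x)\<^sup>2) \<le> C * w * real p"
    using variance_bound by blast
  have "\<forall>\<^sub>F k in sequentially. r (2 ^ Suc k) < 1 / 200"
    by (rule order_tendstoD(2)[OF r_tendsto]) simp
  then obtain k where "r (2 ^ Suc k) < 1 / 200" by (auto simp: eventually_sequentially)
  then obtain q where q: "r q \<le> 1 / 200" by (metis less_imp_le)
  define D0 where "D0 = 50 * (C * w)\<^sup>2 + 4913 * ((2 * real q + 1) * K) ^ 4"
  \<comment> \<open>\<open>8 * D0\<close> is what \<open>(7 / 8) * D + D0 \<le> D\<close> asks for;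
    \<open>K ^ 4\<close> covers blocks of length 1.\<close>
  define D where "D = 8 * D0 + K ^ 4"
  have D0: "0 \<le> D0" by (simp add: D0_def)
  have D: "8 * D0 \<le> D" "K ^ 4 \<le> D" "0 \<le> D" using D0 by (auto simp: D_def)
  have "expectation (\<lambda>x. (blk W h p x) ^ 4) \<le> D * (real p)\<^sup>2" for h p
  proof (induction p arbitrary: h rule: less_induct)
    case (less p)
    consider "p = 0" | "p = 1" | "p \<ge> 2" by linarith
    then show ?case
    proof cases
      case 2
      have "\<bar>expectation (\<lambda>x. (W (Suc h) x) ^ 4)\<bar> \<le> K ^ 4"
      proof -
        have "integrable M (\<lambda>x. (W (Suc h) x) ^ 4)"
        proof (rule integrable_const_bound[where B = "K ^ 4"])
          show "AE x in M. norm (W (Suc h) x ^ 4) \<le> K ^ 4"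
            using K[of "Suc h"] by (intro AE_I2) (simp add: power4_le)
          show "(\<lambda>x. W (Suc h) x ^ 4) \<in> borel_measurable M"
            using W unfolding centred_L2_def square_integrable_def by (intro borel_measurable_power) auto
        qed
        moreover have "(W (Suc h) x) ^ 4 \<le> K ^ 4" if "x \<in> space M" for x
          using K[OF _ that, of "Suc h"] by (intro power4_le) simp
        ultimately show ?thesis by (subst abs_of_nonneg) (auto intro!: integral_le_const)
      qed
      moreover have "{h<..Suc h} = {Suc h}" by auto
      ultimately show ?thesis using 2 D by (simp add: blk_def)
    next
      case 3
      let ?p = "p div 2"
      have p: "?p < p" "real ?p \<le> real p / 2" using 3 by auto
      have "expectation (\<lambda>x. (blk W h p x) ^ 4) \<le> 7 / 2 * (D * (real ?p)\<^sup>2) + 50 * (C * w * real ?p)\<^sup>2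
          + 4913 * ((2 * real q + 1) * K) ^ 4"
        by (rule fourth_moment_step[OF W K q 3 C(2)[OF W] less.IH[OF p(1)]])
      also have "\<dots> \<le> 7 / 2 * (D * (real p / 2)\<^sup>2) + (50 * (C * w)\<^sup>2 * (real p)\<^sup>2
          + 4913 * ((2 * real q + 1) * K) ^ 4 * (real p)\<^sup>2)"
      proof -
        have "7 / 2 * (D * (real ?p)\<^sup>2) \<le> 7 / 2 * (D * (real p / 2)\<^sup>2)"
          using p D by (intro mult_left_mono power_mono) auto
        moreover have "50 * (C * w * real ?p)\<^sup>2 \<le> 50 * (C * w)\<^sup>2 * (real p)\<^sup>2"
          using p unfolding power_mult_distrib[of "C * w"] by (auto intro!: mult_left_mono power_mono)
        moreover have "4913 * ((2 * real q + 1) * K) ^ 4 * 1 \<le> 4913 * ((2 * real q + 1) * K) ^ 4 * (real p)\<^sup>2"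
          using 3 by (intro mult_left_mono) auto
        ultimately show ?thesis by linarith
      qed
      also have "\<dots> = (7 / 8 * D + D0) * (real p)\<^sup>2"
        by (simp add: D0_def power_divide algebra_simps)
      also have "\<dots> \<le> D * (real p)\<^sup>2" using D by (intro mult_right_mono) auto
      finally show ?thesis .
    qed simp
  qed
  then show ?thesis using D by blast
qed

end

section \<open>Characteristic functions of sums of separated blocks\<close>

text \<open>A Lindeberg type bound, with \<open>a\<close> the truncated part and \<open>b\<close>
  the rest. If \<open>b\<close> dominates, the remainder is bounded quadratically and costs a second
  moment of \<open>b\<close>. If \<open>a\<close> dominates, it is bounded cubically, and the
  geometric mean inequality trades the third power for the second and the fourth. No moment of
  \<open>b\<close> above the second enters.\<close>

lemma iexp_quadratic_bound:
  assumes "0 < lam" and x: "x = a + b"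
  shows "cmod (iexp x - (1 + \<i> * x - x\<^sup>2 / 2)) \<le> 4 * b\<^sup>2 + 4 * (lam * a\<^sup>2 + a ^ 4 / lam)"
proof -
  have eq: "(\<Sum>k\<le>2. (\<i> * complex_of_real x) ^ k / fact k) = 1 + \<i> * x - x\<^sup>2 / 2"
    by (simp add: numeral_2_eq_2 power_mult_distrib power2_eq_square)
  show ?thesis
  proof (cases "\<bar>a\<bar> \<le> \<bar>b\<bar>")
    case True
    have "cmod (iexp x - (\<Sum>k\<le>2. (\<i> * x) ^ k / fact k)) \<le> x\<^sup>2"
      using iexp_approx2[of x 2] by (simp add: fact_numeral)
    also have "x\<^sup>2 \<le> (2 * \<bar>b\<bar>)\<^sup>2"
      using True unfolding x by (intro power2_le_iff_abs_le[THEN iffD2]) auto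
    also have "\<dots> \<le> 4 * b\<^sup>2 + 4 * (lam * a\<^sup>2 + a ^ 4 / lam)"
      using assms by (simp add: power_mult_distrib)
    finally show ?thesis unfolding eq by simp
  next
    case False
    have "cmod (iexp x - (\<Sum>k\<le>2. (\<i> * x) ^ k / fact k)) \<le> \<bar>x\<bar> ^ 3 / 6"
      using iexp_approx1[of x 2] by (simp add: fact_numeral numeral_3_eq_3)
    also have "\<dots> \<le> (2 * \<bar>a\<bar>) ^ 3 / 6"
      using False unfolding x by (intro divide_right_mono power_mono) auto
    also have "\<dots> \<le> 4 * (2 * \<bar>a\<bar> ^ 3)" by (simp add: power_mult_distrib)
    also have "2 * \<bar>a\<bar> ^ 3 \<le> lam * a\<^sup>2 + a ^ 4 / lam"
    proof -
      have "0 \<le> (sqrt lam * \<bar>a\<bar> - a\<^sup>2 / sqrt lam)\<^sup>2" by simp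
      also have "\<dots> = lam * a\<^sup>2 + a ^ 4 / lam - 2 * \<bar>a\<bar> ^ 3"
        using assms by (simp add: power2_diff power_mult_distrib power_divide power3_eq_cube)
          (simp add: power2_eq_square abs_if)
      finally show ?thesis by simp
    qed
    also have "4 * (lam * a\<^sup>2 + a ^ 4 / lam) \<le> 4 * b\<^sup>2 + 4 * (lam * a\<^sup>2 + a ^ 4 / lam)" by simp
    finally show ?thesis unfolding eq by simp
  qed
qed

lemma iexp_diff_le: "cmod (iexp a - iexp b) \<le> \<bar>a - b\<bar>"
proof -
  have "iexp a - iexp b = iexp b * (iexp (a - b) - 1)"
    by (simp add: right_diff_distrib flip: exp_add distrib_left)
  then have "cmod (iexp a - iexp b) = cmod (iexp (a - b) - 1)" by (simp add: norm_mult)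
  also have "\<dots> \<le> \<bar>a - b\<bar>" using iexp_approx1[of "a - b" 0] by simp
  finally show ?thesis .
qed

text \<open>Quadratic precision is the point: with \<open>x\<close> of order \<open>1 / k\<close> in
  each of \<open>k\<close> factors, the total error is still of order \<open>1 / k\<close>.\<close>

lemma exp_minus_quadratic:
  fixes x :: real assumes "0 \<le> x" shows "\<bar>1 - x - exp (- x)\<bar> \<le> x\<^sup>2 / 2"
proof -
  have "exp (- x) \<le> 1 - x + x\<^sup>2 / 2"
  proof -
    let ?f = "\<lambda>x::real. 1 - x + x\<^sup>2 / 2 - exp (- x)"
    have "?f 0 \<le> ?f x"
    proof (rule DERIV_nonneg_imp_nondecreasing[OF assms])
      fix y :: real assume "0 \<le> y"
      have "(?f has_real_derivative (- 1 + y + exp (- y))) (at y)"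
        by (auto intro!: derivative_eq_intros)
      moreover have "0 \<le> - 1 + y + exp (- y)" using exp_ge_add_one_self[of "- y"] by simp
      ultimately show "\<exists>z. (?f has_real_derivative z) (at y) \<and> 0 \<le> z" by blast
    qed
    then show ?thesis by simp
  qed
  moreover have "1 - x \<le> exp (- x)" using exp_ge_add_one_self[of "- x"] by simp
  ultimately show ?thesis by (simp add: abs_le_iff)
qed

context rho_mixing
begin

lemma integrable_iexp:
  "f \<in> borel_measurable M \<Longrightarrow> integrable M (\<lambda>x. iexp (f x))"
  by (intro integrable_const_bound[where B = 1]) auto

text \<open>Here \<open>f\<close> is a block sum and \<open>g\<close> the block sum of its
  truncation. Centring of \<open>f\<close> removes the linear term, and the fourth moment is asked
  only of \<open>g\<close>.\<close>

lemma expectation_iexp_near_quadratic: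
  assumes "square_integrable M f" "expectation f = 0" "square_integrable M g" "0 < lam"
    and "\<And>x. x \<in> space M \<Longrightarrow> \<bar>g x\<bar> \<le> K"
  shows "cmod (expectation (\<lambda>x. iexp (s * f x)) - (1 - s\<^sup>2 * expectation (\<lambda>x. (f x)\<^sup>2) / 2))
    \<le> 4 * s\<^sup>2 * expectation (\<lambda>x. (f x - g x)\<^sup>2)
      + 4 * (lam * s\<^sup>2 * expectation (\<lambda>x. (g x)\<^sup>2) + s ^ 4 * expectation (\<lambda>x. (g x) ^ 4) / lam)"
proof -
  have [measurable]: "f \<in> borel_measurable M" "g \<in> borel_measurable M"
    using assms by (auto simp: square_integrable_def)
  have f: "integrable M f" "integrable M (\<lambda>x. (f x)\<^sup>2)" "integrable M (\<lambda>x. (g x)\<^sup>2)"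
    "integrable M (\<lambda>x. (f x - g x)\<^sup>2)"
    using square_integrable_integrable[OF assms(1)] assms(1,3) square_integrable_diff[OF assms(1,3)]
    by (simp_all add: square_integrable_def)
  have g4: "integrable M (\<lambda>x. (g x) ^ 4)"
    using assms(5) by (intro integrable_const_bound[where B = "K ^ 4"] AE_I2) (auto intro: power4_le)
  let ?q = "\<lambda>x. iexp (s * f x) - (1 + \<i> * (s * f x) - (s * f x)\<^sup>2 / 2)"
  have i: "integrable M (\<lambda>x. complex_of_real (s * f x))" "integrable M (\<lambda>x. complex_of_real ((s * f x)\<^sup>2))"
    unfolding power_mult_distrib using f by (intro integrable_of_real; simp)+
  have "expectation ?q = expectation (\<lambda>x. iexp (s * f x)) - (1 - s\<^sup>2 * expectation (\<lambda>x. (f x)\<^sup>2) / 2)"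
  proof -
    have "expectation ?q = expectation (\<lambda>x. iexp (s * f x)) -
        (1 + \<i> * expectation (\<lambda>x. complex_of_real (s * f x)) - expectation (\<lambda>x. complex_of_real ((s * f x)\<^sup>2)) / 2)"
      using i integrable_iexp[of "\<lambda>x. s * f x"] by (simp add: prob_space)
    also have "expectation (\<lambda>x. complex_of_real (s * f x)) = 0"
      using assms(2) by (simp del: of_real_mult)
    also have "expectation (\<lambda>x. complex_of_real ((s * f x)\<^sup>2)) = s\<^sup>2 * expectation (\<lambda>x. (f x)\<^sup>2)"
      by (simp only: integral_complex_of_real power_mult_distrib integral_mult_right_zero of_real_mult)
    finally show ?thesis by simp
  qed
  then have "cmod (expectation (\<lambda>x. iexp (s * f x)) - (1 - s\<^sup>2 * expectation (\<lambda>x. (f x)\<^sup>2) / 2)) = cmod (expectation ?q)"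
    by simp
  also have "\<dots> \<le> expectation (\<lambda>x. cmod (?q x))" by (rule integral_norm_bound)
  also have "\<dots> \<le> expectation (\<lambda>x. 4 * (s\<^sup>2 * (f x - g x)\<^sup>2) + 4 * (lam * (s\<^sup>2 * (g x)\<^sup>2) + s ^ 4 * (g x) ^ 4 / lam))"
  proof (intro integral_mono integrable_norm)
    show "integrable M ?q" using i integrable_iexp[of "\<lambda>x. s * f x"] by simp
    show "integrable M (\<lambda>x. 4 * (s\<^sup>2 * (f x - g x)\<^sup>2) + 4 * (lam * (s\<^sup>2 * (g x)\<^sup>2) + s ^ 4 * (g x) ^ 4 / lam))"
      using f g4 by simp
    fix x
    show "cmod (?q x) \<le> 4 * (s\<^sup>2 * (f x - g x)\<^sup>2) + 4 * (lam * (s\<^sup>2 * (g x)\<^sup>2) + s ^ 4 * (g x) ^ 4 / lam)"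
      using iexp_quadratic_bound[OF assms(4), of "s * f x" "s * g x" "s * (f x - g x)"]
      by (simp add: power_mult_distrib) (simp add: algebra_simps)
  qed
  also have "\<dots> = 4 * s\<^sup>2 * expectation (\<lambda>x. (f x - g x)\<^sup>2)
      + 4 * (lam * s\<^sup>2 * expectation (\<lambda>x. (g x)\<^sup>2) + s ^ 4 * expectation (\<lambda>x. (g x) ^ 4) / lam)"
    using f g4 by simp
  finally show ?thesis .
qed

lemma expectation_iexp:
  assumes [measurable]: "f \<in> borel_measurable M"
  shows "expectation (\<lambda>x. iexp (f x)) = complex_of_real (expectation (\<lambda>x. cos (f x))) + \<i> * complex_of_real (expectation (\<lambda>x. sin (f x)))"
proof -
  have "integrable M (\<lambda>x. cos (f x))" "integrable M (\<lambda>x. sin (f x))"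
    by (intro integrable_const_bound[where B = 1]; simp)+
  moreover have "iexp (f x) = complex_of_real (cos (f x)) + \<i> * complex_of_real (sin (f x))" for x
    by (simp add: cis_conv_exp[symmetric] complex_eq_iff)
  ultimately show ?thesis by simp
qed

text \<open>Mixing speaks of real functions, so the exponential is split into cosine and sine. Four
  covariances arise, each at most \<open>r q\<close> because cosine and sine have second moments at
  most 1.\<close>

lemma iexp_mixing:
  assumes l: "1 \<le> l" and f: "f \<in> borel_measurable (A l)" and g: "g \<in> borel_measurable (B (l + q))"
  shows "cmod (expectation (\<lambda>x. iexp (f x + g x)) - expectation (\<lambda>x. iexp (f x)) * expectation (\<lambda>x. iexp (g x)))
    \<le> 4 * r q"
proof -
  have [measurable]: "f \<in> borel_measurable M" "g \<in> borel_measurable M" using past[OF f] future[OF g] by simp_all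
  have sq: "square_integrable M (\<lambda>x. cos (h x))" "square_integrable M (\<lambda>x. sin (h x))"
    if [measurable]: "h \<in> borel_measurable M" for h :: "'a \<Rightarrow> real"
    by (intro square_integrable_bounded[where K = 1]; simp)+
  have le1: "expectation (\<lambda>x. (h x)\<^sup>2) \<le> 1" if "\<And>x. \<bar>h x\<bar> \<le> 1" "square_integrable M h" for h
  proof (intro integral_le_const AE_I2)
    show "integrable M (\<lambda>x. (h x)\<^sup>2)" using that by (simp add: square_integrable_def)
    show "(h x)\<^sup>2 \<le> 1" for x using that(1)[of x] by (simp add: abs_square_le_1)
  qed
  have mix: "\<bar>expectation (\<lambda>x. u (f x) * v (g x)) - expectation (\<lambda>x. u (f x)) * expectation (\<lambda>x. v (g x))\<bar> \<le> r q"
    if "u \<in> {cos, sin}" "v \<in> {cos, sin}" for u v :: "real \<Rightarrow> real"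
  proof -
    have u: "u \<in> borel_measurable borel" "v \<in> borel_measurable borel"
      "\<And>x. \<bar>u x\<bar> \<le> 1" "\<And>x. \<bar>v x\<bar> \<le> 1" using that by auto
    have s: "square_integrable M (\<lambda>x. u (f x))" "square_integrable M (\<lambda>x. v (g x))"
      using that sq by auto
    have "\<bar>expectation (\<lambda>x. u (f x) * v (g x)) - expectation (\<lambda>x. u (f x)) * expectation (\<lambda>x. v (g x))\<bar>
       \<le> r q * (expectation (\<lambda>x. (u (f x))\<^sup>2) + expectation (\<lambda>x. (v (g x))\<^sup>2)) / 2"
      using f g u by (intro mixing[OF l] s) (auto intro: measurable_compose)
    also have "\<dots> \<le> r q * (1 + 1) / 2"
      using r_nonneg s u by (intro divide_right_mono mult_left_mono add_mono le1) auto
    finally show ?thesis by simp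
  qed
  have i: "integrable M (\<lambda>x. u (f x) * v (g x))" if "u \<in> {cos, sin}" "v \<in> {cos, sin}" for u v :: "real \<Rightarrow> real"
    using that sq by (intro square_integrable_mult) auto
  have "expectation (\<lambda>x. cos (f x + g x)) = expectation (\<lambda>x. cos (f x) * cos (g x)) - expectation (\<lambda>x. sin (f x) * sin (g x))"
    using i[of cos cos] i[of sin sin] by (simp add: cos_add)
  moreover have "expectation (\<lambda>x. sin (f x + g x)) = expectation (\<lambda>x. sin (f x) * cos (g x)) + expectation (\<lambda>x. cos (f x) * sin (g x))"
    using i[of sin cos] i[of cos sin] by (simp add: sin_add)
  ultimately have "expectation (\<lambda>x. iexp (f x + g x)) - expectation (\<lambda>x. iexp (f x)) * expectation (\<lambda>x. iexp (g x))
    = Complex ((expectation (\<lambda>x. cos (f x) * cos (g x)) - expectation (\<lambda>x. cos (f x)) * expectation (\<lambda>x. cos (g x)))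
             - (expectation (\<lambda>x. sin (f x) * sin (g x)) - expectation (\<lambda>x. sin (f x)) * expectation (\<lambda>x. sin (g x))))
       ((expectation (\<lambda>x. sin (f x) * cos (g x)) - expectation (\<lambda>x. sin (f x)) * expectation (\<lambda>x. cos (g x)))
             + (expectation (\<lambda>x. cos (f x) * sin (g x)) - expectation (\<lambda>x. cos (f x)) * expectation (\<lambda>x. sin (g x))))"
    (is "_ = Complex (?a - ?b) (?c + ?d)")
    by (simp add: expectation_iexp complex_eq_iff algebra_simps del: of_real_add)
  then have "cmod (expectation (\<lambda>x. iexp (f x + g x)) - expectation (\<lambda>x. iexp (f x)) * expectation (\<lambda>x. iexp (g x)))
    \<le> \<bar>?a - ?b\<bar> + \<bar>?c + ?d\<bar>" using cmod_le[of "Complex (?a - ?b) (?c + ?d)"] by simp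
  also have "\<dots> \<le> \<bar>?a\<bar> + \<bar>?b\<bar> + (\<bar>?c\<bar> + \<bar>?d\<bar>)" by linarith
  also have "\<dots> \<le> r q + r q + (r q + r q)" by (intro add_mono mix) auto
  finally show ?thesis by simp
qed

text \<open>The blocks start \<open>p\<close> apart and have length \<open>p'\<close>, which leaves
  a gap of at least \<open>q\<close>. Adding one block costs one use of mixing, and multiplying by a
  further characteristic function does not enlarge the error made so far.\<close>

lemma char_blocks:
  assumes W: "adapted W" and p': "1 \<le> p'" and p: "p' + q \<le> p"
  shows "cmod (expectation (\<lambda>x. iexp (s * (\<Sum>j<k. blk W (j * p) p' x))) -
     (\<Prod>j<k. expectation (\<lambda>x. iexp (s * blk W (j * p) p' x)))) \<le> 4 * r q * real k"
proof (induction k)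
  case (Suc k)
  have bm[measurable]: "blk W h m \<in> borel_measurable M" for h m
    by (rule past[OF blk_past[OF W order_refl]])
  let ?E = "\<lambda>k. expectation (\<lambda>x. iexp (s * (\<Sum>j<k. blk W (j * p) p' x)))"
  let ?e = "\<lambda>j. expectation (\<lambda>x. iexp (s * blk W (j * p) p' x))"
  have e1: "cmod (?e j) \<le> 1" for j
  proof -
    have "cmod (?e j) \<le> expectation (\<lambda>x. cmod (iexp (s * blk W (j * p) p' x)))" by (rule integral_norm_bound)
    then show ?thesis by (simp add: prob_space)
  qed
  have "cmod (?E (Suc k) - ?E k * ?e k) \<le> 4 * r q"
  \<comment> \<open>Before the first block there is no past to which mixing, stated for
    \<open>1 \<le> l\<close>, could refer; the two sides then agree.\<close>
  proof (cases "k = 0")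
    case True
    then show ?thesis using r_nonneg[of q] by (simp add: prob_space)
  next
    case False
    define l where "l = (k - 1) * p + p'"
    have l: "1 \<le> l" using p' by (simp add: l_def)
    have lq: "l + q \<le> k * p" using False p by (cases k) (auto simp: l_def)
    have "(\<lambda>x. \<Sum>j<k. blk W (j * p) p' x) \<in> borel_measurable (A l)"
    proof (intro borel_measurable_sum blk_past[OF W])
      fix j assume "j \<in> {..<k}"
      then have "j * p \<le> (k - 1) * p" by (intro mult_right_mono) auto
      then show "j * p + p' \<le> l" by (simp add: l_def)
    qed
    moreover have "blk W (k * p) p' \<in> borel_measurable (B (l + q))"
      using lq by (intro blk_future[OF W]) simp
    ultimately show ?thesis
      using iexp_mixing[OF l, of "\<lambda>x. s * (\<Sum>j<k. blk W (j * p) p' x)" "\<lambda>x. s * blk W (k * p) p' x" q]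
      by (simp add: distrib_left)
  qed
  moreover have "cmod (?E k * ?e k - (\<Prod>j<k. ?e j) * ?e k) \<le> 4 * r q * real k * 1"
    unfolding left_diff_distrib[symmetric] norm_mult using Suc e1[of k] r_nonneg[of q]
    by (intro mult_mono) auto
  ultimately have "cmod ((?E (Suc k) - ?E k * ?e k) + (?E k * ?e k - (\<Prod>j<k. ?e j) * ?e k)) \<le> 4 * r q + 4 * r q * real k * 1"
    by (rule norm_triangle_mono)
  then show ?case by (simp add: algebra_simps)
qed (simp add: prob_space)

text \<open>The discarded terms are the \<open>k\<close> gaps and the last incomplete stretch of
  length \<open>m\<close>. The crude moment bound suffices: \<open>k\<close>, \<open>q\<close> and
  \<open>m\<close> stay bounded while \<open>s\<close> will be of order
  \<open>1 / sqrt n\<close>.\<close>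

lemma char_drop_gaps:
  assumes W: "centred_L2 W w" and p: "p = p' + q" and n: "n = k * p + m"
  shows "cmod (expectation (\<lambda>x. iexp (s * blk W 0 n x)) - expectation (\<lambda>x. iexp (s * (\<Sum>j<k. blk W (j * p) p' x))))
     \<le> \<bar>s\<bar> * ((real k * real q + real m) * sqrt w)"
proof -
  have sq: "square_integrable M (blk W h m)" for h m by (rule blk_square_integrable[OF W])
  have [measurable]: "blk W h m \<in> borel_measurable M" for h m
    by (rule square_integrable_measurable[OF sq])
  define R where "R x = (\<Sum>j<k. blk W (j * p + p') q x) + blk W (k * p) m x" for x
  have split: "blk W 0 (k * p) x = (\<Sum>j<k. blk W (j * p) p' x) + (\<Sum>j<k. blk W (j * p + p') q x)" for x k
  proof (induction k)
    case (Suc k)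
    have "blk W 0 (Suc k * p) x = blk W 0 (k * p) x + blk W (k * p) (p' + q) x"
      using blk_add[of W 0 "k * p" p x] p by (simp add: add.commute)
    then show ?case using Suc by (simp add: blk_add)
  qed simp
  have S: "blk W 0 n x = (\<Sum>j<k. blk W (j * p) p' x) + R x" for x
    unfolding n blk_add R_def using split[of k x] by simp
  have abs1: "expectation (\<lambda>x. \<bar>blk W h q x\<bar>) \<le> real q * sqrt w" for h q
  proof -
    have "expectation (\<lambda>x. \<bar>blk W h q x\<bar>) \<le> sqrt (expectation (\<lambda>x. (blk W h q x)\<^sup>2))"
      by (rule expectation_abs_le[OF sq])
    also have "\<dots> \<le> sqrt ((real q)\<^sup>2 * w)"
      by (intro real_sqrt_le_mono blk_expectation_square_crude[OF W])
    finally show ?thesis by (simp add: real_sqrt_mult)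
  qed
  have i: "integrable M (\<lambda>x. \<bar>blk W h q x\<bar>)" for h q
    using square_integrable_integrable[OF sq] by simp
  have "expectation (\<lambda>x. \<bar>R x\<bar>) \<le> expectation (\<lambda>x. (\<Sum>j<k. \<bar>blk W (j * p + p') q x\<bar>) + \<bar>blk W (k * p) m x\<bar>)"
    using i square_integrable_integrable[OF sq] unfolding R_def
    by (intro integral_mono) (auto intro: order_trans[OF abs_triangle_ineq] add_mono sum_abs)
  also have "\<dots> \<le> (\<Sum>j<k. real q * sqrt w) + real m * sqrt w"
    using i by (simp del: sum_constant) (intro add_mono sum_mono abs1)
  also have "\<dots> = (real k * real q + real m) * sqrt w" by (simp add: algebra_simps)
  finally have R: "expectation (\<lambda>x. \<bar>R x\<bar>) \<le> (real k * real q + real m) * sqrt w" .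
  have iR: "integrable M R"
    unfolding R_def using square_integrable_integrable[OF sq] by simp
  let ?T = "\<lambda>x. \<Sum>j<k. blk W (j * p) p' x"
  have "expectation (\<lambda>x. iexp (s * blk W 0 n x)) - expectation (\<lambda>x. iexp (s * ?T x))
     = expectation (\<lambda>x. iexp (s * blk W 0 n x) - iexp (s * ?T x))"
    by (intro Bochner_Integration.integral_diff[symmetric] integrable_iexp) measurable
  also have "cmod \<dots> \<le> expectation (\<lambda>x. cmod (iexp (s * blk W 0 n x) - iexp (s * ?T x)))"
    by (rule integral_norm_bound)
  also have "\<dots> \<le> expectation (\<lambda>x. \<bar>s\<bar> * \<bar>R x\<bar>)"
  proof (intro integral_mono integrable_norm Bochner_Integration.integrable_diff integrable_iexp)
    show "integrable M (\<lambda>x. \<bar>s\<bar> * \<bar>R x\<bar>)" using iR by simp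
    show "cmod (iexp (s * blk W 0 n x) - iexp (s * ?T x)) \<le> \<bar>s\<bar> * \<bar>R x\<bar>" for x
      using iexp_diff_le[of "s * blk W 0 n x" "s * ?T x"] by (simp add: S distrib_left abs_mult)
  qed measurable
  also have "\<dots> \<le> \<bar>s\<bar> * ((real k * real q + real m) * sqrt w)"
    using R by (simp add: mult_left_mono)
  finally show ?thesis .
qed

end

text \<open>For fixed \<open>k\<close> and \<open>q\<close>, the \<open>k\<close> shortened blocks
  of length \<open>n div k - q\<close> cover all but a bounded number of the indices up to
  \<open>n\<close>, so their variances add up to the variance of the whole, asymptotically.\<close>

lemma tendsto_div_ratio:
  fixes v :: "nat \<Rightarrow> real"
  assumes v: "(\<lambda>p. v p / real p) \<longlonglongrightarrow> c" and k: "k \<ge> 1"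
  shows "(\<lambda>n. real k * v (n div k - q) / real n) \<longlonglongrightarrow> c"
proof -
  have lim: "filterlim (\<lambda>n. n div k - q) at_top sequentially"
    unfolding filterlim_at_top
  proof
    fix Z
    show "\<forall>\<^sub>F n in sequentially. Z \<le> n div k - q"
      unfolding eventually_sequentially
    proof (intro exI[of _ "(Z + q) * k"] allI impI)
      fix n assume "(Z + q) * k \<le> n"
      then have "(Z + q) * k div k \<le> n div k" by (rule div_le_mono)
      then show "Z \<le> n div k - q" using k by simp
    qed
  qed
  have "(\<lambda>n. real k * real (n div k - q) / real n) \<longlonglongrightarrow> 1"
  proof (rule LIM_zero_cancel, rule Lim_null_comparison)
    show "\<forall>\<^sub>F n in sequentially. norm (real k * real (n div k - q) / real n - 1) \<le> (real k + real k * real q) / real n"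
      unfolding eventually_sequentially
    proof (intro exI[of _ "k * (q + 1)"] allI impI)
      fix n assume n: "k * (q + 1) \<le> n"
      have "q \<le> n div k"
        using div_le_mono[OF n, of k] k by simp
      moreover have "real n = real k * real (n div k) + real (n mod k)"
        by (simp flip: of_nat_mult of_nat_add)
      ultimately have *: "real k * real (n div k - q) = real n - real (n mod k) - real k * real q"
        by (simp add: of_nat_diff right_diff_distrib)
      have "n mod k \<le> k" using k by (simp add: less_imp_le)
      then have m: "real (n mod k) \<le> real k" by simp
      have "0 < n" using n k by (cases n) auto
      then have "real k * real (n div k - q) / real n - 1 = - (real (n mod k) + real k * real q) / real n"
        unfolding * by (simp add: field_simps)
      then have "norm (real k * real (n div k - q) / real n - 1) = \<bar>real (n mod k) + real k * real q\<bar> / real n"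
        by (simp only: real_norm_def abs_divide abs_minus_cancel abs_of_nat)
      also have "\<dots> \<le> (real k + real k * real q) / real n"
        using m by (intro divide_right_mono) auto
      finally show "norm (real k * real (n div k - q) / real n - 1) \<le> (real k + real k * real q) / real n" .
    qed
    show "(\<lambda>n. (real k + real k * real q) / real n) \<longlonglongrightarrow> 0" by (rule lim_const_over_n)
  qed
  then have "(\<lambda>n. v (n div k - q) / real (n div k - q) * (real k * real (n div k - q) / real n)) \<longlonglongrightarrow> c * 1"
    by (intro tendsto_mult filterlim_compose[OF v lim])
  moreover have "\<forall>\<^sub>F n in sequentially. v (n div k - q) / real (n div k - q) * (real k * real (n div k - q) / real n)
      = real k * v (n div k - q) / real n"
    using eventually_ge_at_top[of 1] filterlim_at_top[THEN iffD1, OF lim, rule_format, of 1]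
    by eventually_elim (auto simp: field_simps)
  ultimately show ?thesis unfolding mult_1_right by (rule Lim_transform_eventually)
qed

context rho_mixing
begin

text \<open>The error terms, in order: discarded gaps, dependence between blocks, truncation, Taylor
  remainder (in two parts, balanced by \<open>lam\<close>), mismatch of the block variance, and the
  exchange of \<open>1 - x\<close> for \<open>exp (- x)\<close>. Each block contributes
  \<open>1 / k\<close> times the bracket, because \<open>s\<^sup>2 * p'\<close> is at most
  \<open>t\<^sup>2 / k\<close>. Only the gaps and the variance mismatch depend on
  \<open>n\<close>.\<close>

lemma char_sum_bound:
  assumes W: "centred_L2 W w" and U: "centred_L2 U w" and D: "centred_L2 (\<lambda>k x. W k x - U k x) \<epsilon>"
    and K: "\<And>k x. 1 \<le> k \<Longrightarrow> x \<in> space M \<Longrightarrow> \<bar>U k x\<bar> \<le> K"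
    and C: "\<And>W w h p. centred_L2 W w \<Longrightarrow> expectation (\<lambda>x. (blk W h p x)\<^sup>2) \<le> C * w * real p"
    and F: "\<And>h p. expectation (\<lambda>x. (blk U h p x) ^ 4) \<le> D * (real p)\<^sup>2"
    and v: "\<And>h p. expectation (\<lambda>x. (blk W h p x)\<^sup>2) = v p"
    and CD: "0 \<le> C" "0 \<le> D" "0 \<le> \<sigma>"
    and lam: "0 < lam" and k: "1 \<le> k" and n: "k * (q + 1) \<le> n"
  shows "cmod (expectation (\<lambda>x. iexp (t / sqrt n * blk W 0 n x)) - complex_of_real (exp (- \<sigma> * t\<^sup>2 / 2))) \<le>
     \<bar>t\<bar> * ((real k * real q + real k) * sqrt w) / sqrt n + 4 * r q * real k +
     (4 * t\<^sup>2 * (C * \<epsilon>) + 4 * (lam * t\<^sup>2 * (C * w)) + 4 * t ^ 4 * D / lam / real k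
      + t\<^sup>2 / 2 * \<bar>real k * v (n div k - q) / real n - \<sigma>\<bar> + \<sigma>\<^sup>2 * t ^ 4 / 8 / real k)"
proof -
  define p p' s where "p = n div k" and "p' = p - q" and "s = t / sqrt n"
  have "q + 1 \<le> p" unfolding p_def using div_le_mono[OF n, of k] k by simp
  then have p: "p = p' + q" "1 \<le> p'" by (auto simp: p'_def)
  have n0: "0 < real n" using n k by (cases n) auto
  have s2: "s\<^sup>2 = t\<^sup>2 / n"
    by (simp add: s_def power_divide)
  have kp: "real k * real p' \<le> real n"
  proof -
    have "k * p' \<le> k * (n div k)" by (simp add: p'_def p_def)
    also have "\<dots> \<le> n" by simp
    finally show ?thesis by (simp flip: of_nat_mult)
  qed
  have s2p: "s\<^sup>2 * real p' \<le> t\<^sup>2 / real k"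
  proof -
    have "t\<^sup>2 * (real k * real p') \<le> t\<^sup>2 * real n" by (intro mult_left_mono kp) simp
    then show ?thesis using n0 k by (simp add: s2 field_simps)
  qed
  have s4p: "s ^ 4 * (real p')\<^sup>2 \<le> t ^ 4 / (real k)\<^sup>2"
  proof -
    have "(s\<^sup>2 * real p')\<^sup>2 \<le> (t\<^sup>2 / real k)\<^sup>2" using s2p by (intro power_mono) auto
    then show ?thesis by (simp add: power_mult_distrib power_divide)
  qed
  let ?e = "\<lambda>j. expectation (\<lambda>x. iexp (s * blk W (j * p) p' x))"
  let ?g = "complex_of_real (exp (- (\<sigma> * t\<^sup>2 / (2 * real k))))"
  have w0: "0 \<le> w" by (rule centred_L2_nonneg[OF W])
  have block: "cmod (?e j - ?g) \<le> (4 * t\<^sup>2 * (C * \<epsilon>) + 4 * (lam * t\<^sup>2 * (C * w)) + 4 * t ^ 4 * D / lam / real k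
      + t\<^sup>2 / 2 * \<bar>real k * v p' / real n - \<sigma>\<bar> + \<sigma>\<^sup>2 * t ^ 4 / 8 / real k) / real k" for j
  proof -
    have bU: "\<bar>blk U h m x\<bar> \<le> real m * K" if "x \<in> space M" for h m x
    proof -
      have "\<bar>blk U h m x\<bar> \<le> (\<Sum>k\<in>{h<..h + m}. \<bar>U k x\<bar>)" unfolding blk_def by (rule sum_abs)
      also have "\<dots> \<le> (\<Sum>k\<in>{h<..h + m}. K)" using K that by (intro sum_mono) auto
      finally show ?thesis by simp
    qed
    have dif: "blk (\<lambda>k x. W k x - U k x) h m x = blk W h m x - blk U h m x" for h m x
      by (simp add: blk_def sum_subtractf)
    have "cmod (?e j - (1 - s\<^sup>2 * expectation (\<lambda>x. (blk W (j * p) p' x)\<^sup>2) / 2)) \<le>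
       4 * s\<^sup>2 * expectation (\<lambda>x. (blk W (j * p) p' x - blk U (j * p) p' x)\<^sup>2)
      + 4 * (lam * s\<^sup>2 * expectation (\<lambda>x. (blk U (j * p) p' x)\<^sup>2) + s ^ 4 * expectation (\<lambda>x. (blk U (j * p) p' x) ^ 4) / lam)"
      by (rule expectation_iexp_near_quadratic[OF blk_square_integrable[OF W] blk_expectation[OF W]
            blk_square_integrable[OF U] lam bU])
    also have "\<dots> \<le> 4 * s\<^sup>2 * (C * \<epsilon> * real p') + 4 * (lam * s\<^sup>2 * (C * w * real p') + s ^ 4 * (D * (real p')\<^sup>2) / lam)"
      using lam C[OF D, of "j * p" p', unfolded dif]
      by (intro add_mono mult_left_mono divide_right_mono C[OF U] F) auto
    also have "\<dots> = 4 * (C * \<epsilon>) * (s\<^sup>2 * real p') + 4 * lam * (C * w) * (s\<^sup>2 * real p') + 4 * D / lam * (s ^ 4 * (real p')\<^sup>2)"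
      by (simp add: algebra_simps)
    also have "\<dots> \<le> 4 * (C * \<epsilon>) * (t\<^sup>2 / real k) + 4 * lam * (C * w) * (t\<^sup>2 / real k) + 4 * D / lam * (t ^ 4 / (real k)\<^sup>2)"
      using CD lam w0 centred_L2_nonneg[OF D] by (intro add_mono mult_left_mono s2p s4p) auto
    also have "\<dots> = (4 * t\<^sup>2 * (C * \<epsilon>) + 4 * (lam * t\<^sup>2 * (C * w)) + 4 * t ^ 4 * D / lam / real k) / real k"
      using k by (simp add: field_simps power2_eq_square)
    finally have 1: "cmod (?e j - (1 - s\<^sup>2 * v p' / 2)) \<le>
       (4 * t\<^sup>2 * (C * \<epsilon>) + 4 * (lam * t\<^sup>2 * (C * w)) + 4 * t ^ 4 * D / lam / real k) / real k"
      unfolding v .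
    have "(1 - s\<^sup>2 * v p' / 2) - (1 - \<sigma> * t\<^sup>2 / (2 * real k)) = - (t\<^sup>2 / 2 * (real k * v p' / real n - \<sigma>) / real k)"
      using n0 k by (simp add: s2 field_simps)
    then have 2: "\<bar>(1 - s\<^sup>2 * v p' / 2) - (1 - \<sigma> * t\<^sup>2 / (2 * real k))\<bar> = t\<^sup>2 / 2 * \<bar>real k * v p' / real n - \<sigma>\<bar> / real k"
      by (simp add: abs_mult)
    have 3: "\<bar>(1 - \<sigma> * t\<^sup>2 / (2 * real k)) - exp (- (\<sigma> * t\<^sup>2 / (2 * real k)))\<bar> \<le> \<sigma>\<^sup>2 * t ^ 4 / 8 / real k / real k"
    proof -
      have "\<bar>(1 - \<sigma> * t\<^sup>2 / (2 * real k)) - exp (- (\<sigma> * t\<^sup>2 / (2 * real k)))\<bar> \<le> (\<sigma> * t\<^sup>2 / (2 * real k))\<^sup>2 / 2"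
        using CD by (intro exp_minus_quadratic) auto
      then show ?thesis by (simp add: power_mult_distrib power_divide power2_eq_square power4_eq_xxxx mult_ac)
    qed
    have "cmod (complex_of_real (1 - s\<^sup>2 * v p' / 2) - ?g) \<le> \<bar>(1 - s\<^sup>2 * v p' / 2) - (1 - \<sigma> * t\<^sup>2 / (2 * real k))\<bar> +
       \<bar>(1 - \<sigma> * t\<^sup>2 / (2 * real k)) - exp (- (\<sigma> * t\<^sup>2 / (2 * real k)))\<bar>"
      unfolding of_real_diff[symmetric] norm_of_real by linarith
    then have 4: "cmod ((1 - s\<^sup>2 * v p' / 2) - ?g) \<le> t\<^sup>2 / 2 * \<bar>real k * v p' / real n - \<sigma>\<bar> / real k + \<sigma>\<^sup>2 * t ^ 4 / 8 / real k / real k"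
      using 2 3 by simp
    have "cmod (?e j - ?g) \<le> cmod (?e j - (1 - s\<^sup>2 * v p' / 2)) + cmod ((1 - s\<^sup>2 * v p' / 2) - ?g)"
      using norm_triangle_ineq[of "?e j - (1 - s\<^sup>2 * v p' / 2)" "(1 - s\<^sup>2 * v p' / 2) - ?g"] by simp
    also have "\<dots> \<le> (4 * t\<^sup>2 * (C * \<epsilon>) + 4 * (lam * t\<^sup>2 * (C * w)) + 4 * t ^ 4 * D / lam / real k) / real k
        + (t\<^sup>2 / 2 * \<bar>real k * v p' / real n - \<sigma>\<bar> / real k + \<sigma>\<^sup>2 * t ^ 4 / 8 / real k / real k)"
      by (rule add_mono[OF 1 4])
    finally show ?thesis by (simp add: add_divide_distrib)
  qed
  have "cmod (expectation (\<lambda>x. iexp (s * blk W 0 n x)) - expectation (\<lambda>x. iexp (s * (\<Sum>j<k. blk W (j * p) p' x))))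
     \<le> \<bar>s\<bar> * ((real k * real q + real (n mod k)) * sqrt w)"
    by (rule char_drop_gaps[OF W p(1)]) (simp add: p_def)
  also have "\<dots> \<le> \<bar>s\<bar> * ((real k * real q + real k) * sqrt w)"
    using k w0 by (intro mult_left_mono mult_right_mono add_mono) (auto intro: less_imp_le)
  also have "\<dots> = \<bar>t\<bar> * ((real k * real q + real k) * sqrt w) / sqrt n" by (simp add: s_def)
  finally have a: "cmod (expectation (\<lambda>x. iexp (s * blk W 0 n x)) - expectation (\<lambda>x. iexp (s * (\<Sum>j<k. blk W (j * p) p' x))))
     \<le> \<bar>t\<bar> * ((real k * real q + real k) * sqrt w) / sqrt n" .
  have b: "cmod (expectation (\<lambda>x. iexp (s * (\<Sum>j<k. blk W (j * p) p' x))) - (\<Prod>j<k. ?e j)) \<le> 4 * r q * real k"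
    by (rule char_blocks[OF centred_L2_adapted[OF W] p(2)]) (simp add: p(1))
  \<comment> \<open>All factors lie in the unit disc, so the products differ by at most the sum of
    the \<open>k\<close> single differences.\<close>
  have "cmod ((\<Prod>j<k. ?e j) - (\<Prod>j<k. ?g)) \<le> (\<Sum>j<k. cmod (?e j - ?g))"
  proof (rule norm_prod_diff)
    fix j
    have "cmod (?e j) \<le> expectation (\<lambda>x. cmod (iexp (s * blk W (j * p) p' x)))" by (rule integral_norm_bound)
    then show "cmod (?e j) \<le> 1" by (simp add: prob_space)
    show "cmod ?g \<le> 1" using CD unfolding norm_of_real by simp
  qed
  also have "\<dots> \<le> real k * ((4 * t\<^sup>2 * (C * \<epsilon>) + 4 * (lam * t\<^sup>2 * (C * w)) + 4 * t ^ 4 * D / lam / real k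
      + t\<^sup>2 / 2 * \<bar>real k * v p' / real n - \<sigma>\<bar> + \<sigma>\<^sup>2 * t ^ 4 / 8 / real k) / real k)"
    using sum_bounded_above[of "{..<k}" "\<lambda>j. cmod (?e j - ?g)", OF block] by simp
  also have "\<dots> = 4 * t\<^sup>2 * (C * \<epsilon>) + 4 * (lam * t\<^sup>2 * (C * w)) + 4 * t ^ 4 * D / lam / real k
      + t\<^sup>2 / 2 * \<bar>real k * v p' / real n - \<sigma>\<bar> + \<sigma>\<^sup>2 * t ^ 4 / 8 / real k"
    using k by simp
  also have "(\<Prod>j<k. ?g) = complex_of_real (exp (- \<sigma> * t\<^sup>2 / 2))"
  proof -
    have "exp (- (\<sigma> * t\<^sup>2 / (2 * real k))) ^ k = exp (- \<sigma> * t\<^sup>2 / 2)"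
      using k by (simp flip: exp_of_nat_mult)
    then show ?thesis unfolding prod_constant by (metis card_lessThan of_real_power)
  qed
  finally have c: "cmod ((\<Prod>j<k. ?e j) - complex_of_real (exp (- \<sigma> * t\<^sup>2 / 2))) \<le> 4 * t\<^sup>2 * (C * \<epsilon>) + 4 * (lam * t\<^sup>2 * (C * w)) + 4 * t ^ 4 * D / lam / real k
      + t\<^sup>2 / 2 * \<bar>real k * v p' / real n - \<sigma>\<bar> + \<sigma>\<^sup>2 * t ^ 4 / 8 / real k" .
  from norm_triangle_mono[OF norm_triangle_mono[OF a b] c] show ?thesis
    by (simp only: diff_add_cancel add_diff_eq s_def p'_def p_def)
qed

text \<open>\<open>lam\<close> is chosen first and serves both as Taylor weight and as truncation
  accuracy. It fixes \<open>U\<close>, hence \<open>D\<close>; then \<open>k\<close> beats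
  \<open>D / lam\<close>, then \<open>q\<close> beats \<open>k\<close>, and \<open>n\<close> comes
  last. The hypothesis on \<open>v\<close>, that block variances depend on the length only, is the
  one trace of stationarity.\<close>

theorem central_limit:
  assumes W: "centred_L2 W w"
    and trunc: "\<And>\<epsilon>. 0 < \<epsilon> \<Longrightarrow> \<exists>U K. centred_L2 U w \<and> centred_L2 (\<lambda>k x. W k x - U k x) \<epsilon> \<and>
        (\<forall>k\<ge>1. \<forall>x\<in>space M. \<bar>U k x\<bar> \<le> K)"
    and v: "\<And>h p. expectation (\<lambda>x. (blk W h p x)\<^sup>2) = v p"
    and \<sigma>: "(\<lambda>p. v p / real p) \<longlonglongrightarrow> \<sigma>" "0 \<le> \<sigma>"
  shows "(\<lambda>n. expectation (\<lambda>x. iexp (t / sqrt n * blk W 0 n x))) \<longlonglongrightarrow> complex_of_real (exp (- \<sigma> * t\<^sup>2 / 2))"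
proof (rule tendstoI)
  fix e :: real assume e: "0 < e"
  obtain C where C: "C \<ge> 0" "\<And>W w h p. centred_L2 W w \<Longrightarrow> expectation (\<lambda>x. (blk W h p x)\<^sup>2) \<le> C * w * real p"
    using variance_bound by blast
  have w0: "0 \<le> w" by (rule centred_L2_nonneg[OF W])
  \<comment> \<open>The truncation error and the first Taylor term together equal
    \<open>lam * (c - 1)\<close>; the added 1 keeps \<open>c\<close> positive when
    \<open>t = 0\<close>.\<close>
  define c where "c = 4 * t\<^sup>2 * C * (1 + w) + 1"
  define lam where "lam = e / (6 * c)"
  have pos: "0 < c" unfolding c_def using C(1) w0 by (intro add_nonneg_pos mult_nonneg_nonneg) auto
  have lam: "0 < lam" unfolding lam_def using e pos by simp
  have small1: "4 * t\<^sup>2 * (C * lam) + 4 * (lam * t\<^sup>2 * (C * w)) < e / 6"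
  proof -
    have "4 * t\<^sup>2 * (C * lam) + 4 * (lam * t\<^sup>2 * (C * w)) = lam * (c - 1)" by (simp add: c_def algebra_simps)
    also have "\<dots> < lam * c" using lam by simp
    also have "\<dots> = e / 6" using pos by (simp add: lam_def)
    finally show ?thesis .
  qed
  obtain U K where U: "centred_L2 U w" "centred_L2 (\<lambda>k x. W k x - U k x) lam"
    and K: "\<And>k x. 1 \<le> k \<Longrightarrow> x \<in> space M \<Longrightarrow> \<bar>U k x\<bar> \<le> K"
    using trunc[OF lam] by blast
  obtain D where D: "D \<ge> 0" "\<And>h p. expectation (\<lambda>x. (blk U h p x) ^ 4) \<le> D * (real p)\<^sup>2"
    using fourth_moment_bound[OF U(1) K] by blast
  have "(\<lambda>k. 4 * t ^ 4 * D / lam / real k + \<sigma>\<^sup>2 * t ^ 4 / 8 / real k) \<longlonglongrightarrow> 0 + 0"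
    by (intro tendsto_add lim_const_over_n)
  then have "\<forall>\<^sub>F k in sequentially. 4 * t ^ 4 * D / lam / real k + \<sigma>\<^sup>2 * t ^ 4 / 8 / real k < e / 6 \<and> 1 \<le> k"
    using e by (intro eventually_conj order_tendstoD(2)[where y = "0 + 0"] eventually_ge_at_top) auto
  then obtain k where k: "4 * t ^ 4 * D / lam / real k + \<sigma>\<^sup>2 * t ^ 4 / 8 / real k < e / 6" "1 \<le> k"
    by (auto simp: eventually_sequentially)
  have "(\<lambda>j. 4 * r (2 ^ Suc j) * real k) \<longlonglongrightarrow> 4 * 0 * real k"
    by (intro tendsto_intros r_tendsto)
  then have "\<forall>\<^sub>F j in sequentially. 4 * r (2 ^ Suc j) * real k < e / 6"
    using e by (intro order_tendstoD(2)[where y = "4 * 0 * real k"]) auto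
  then obtain q where q: "4 * r q * real k < e / 6"
    by (auto simp: eventually_sequentially)
  have "(\<lambda>n. \<bar>t\<bar> * ((real k * real q + real k) * sqrt w) / sqrt (real n)) \<longlonglongrightarrow> 0"
    by (rule real_tendsto_divide_at_top[OF tendsto_const filterlim_compose[OF sqrt_at_top filterlim_real_sequentially]])
  then have n1: "\<forall>\<^sub>F n in sequentially. \<bar>t\<bar> * ((real k * real q + real k) * sqrt w) / sqrt (real n) < e / 6"
    using e by (intro order_tendstoD(2)[where y = 0]) auto
  have "(\<lambda>n. t\<^sup>2 / 2 * \<bar>real k * v (n div k - q) / real n - \<sigma>\<bar>) \<longlonglongrightarrow> t\<^sup>2 / 2 * \<bar>\<sigma> - \<sigma>\<bar>"
    by (intro tendsto_intros tendsto_div_ratio \<sigma> k)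
  then have n2: "\<forall>\<^sub>F n in sequentially. t\<^sup>2 / 2 * \<bar>real k * v (n div k - q) / real n - \<sigma>\<bar> < e / 6"
    using e by (intro order_tendstoD(2)[where y = "t\<^sup>2 / 2 * \<bar>\<sigma> - \<sigma>\<bar>"]) auto
  show "\<forall>\<^sub>F n in sequentially. dist (expectation (\<lambda>x. iexp (t / sqrt n * blk W 0 n x))) (complex_of_real (exp (- \<sigma> * t\<^sup>2 / 2))) < e"
    using n1 n2 eventually_ge_at_top[of "k * (q + 1)"]
  proof eventually_elim
    case (elim n)
    have "cmod (expectation (\<lambda>x. iexp (t / sqrt n * blk W 0 n x)) - complex_of_real (exp (- \<sigma> * t\<^sup>2 / 2))) \<le>
     \<bar>t\<bar> * ((real k * real q + real k) * sqrt w) / sqrt n + 4 * r q * real k +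
     (4 * t\<^sup>2 * (C * lam) + 4 * (lam * t\<^sup>2 * (C * w)) + 4 * t ^ 4 * D / lam / real k
      + t\<^sup>2 / 2 * \<bar>real k * v (n div k - q) / real n - \<sigma>\<bar> + \<sigma>\<^sup>2 * t ^ 4 / 8 / real k)"
      by (rule char_sum_bound[where U = U and K = K])
        (use W U K C D v \<sigma>(2) lam k(2) elim(3) in auto)
    then have "cmod (expectation (\<lambda>x. iexp (t / sqrt n * blk W 0 n x)) - complex_of_real (exp (- \<sigma> * t\<^sup>2 / 2))) < e"
      using elim(1,2) q k(1) small1 e by linarith
    then show ?case by (simp add: dist_norm)
  qed
qed

end

section \<open>Mixing of independent families\<close>

text \<open>Variances rather than second moments stand on the right, because the law of total
  variance then reproduces the same inequality, with the same \<open>r\<close>, on a product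
  space.\<close>

definition cov_mixing :: "'a measure \<Rightarrow> 'a measure \<Rightarrow> 'a measure \<Rightarrow> real \<Rightarrow> bool" where
  "cov_mixing P A B r \<longleftrightarrow>
     (\<forall>f g. f \<in> borel_measurable A \<longrightarrow> square_integrable P f \<longrightarrow>
            g \<in> borel_measurable B \<longrightarrow> square_integrable P g \<longrightarrow>
            \<bar>cov P f g\<bar> \<le> r * (cov P f f + cov P g g) / 2)"

lemma subalgebra_iff_id:
  "subalgebra M F \<longleftrightarrow> space F = space M \<and> (\<lambda>x. x) \<in> measurable M F"
proof
  assume "subalgebra M F"
  then show "space F = space M \<and> (\<lambda>x. x) \<in> measurable M F"
    using measurable_from_subalg[of M F "\<lambda>x. x" F] by (simp add: subalgebra_def)
next
  assume *: "space F = space M \<and> (\<lambda>x. x) \<in> measurable M F"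
  have "A \<in> sets M" if "A \<in> sets F" for A
    using measurable_sets[OF conjunct2[OF *] that] sets.sets_into_space[OF that] *
    by (simp add: Int_absorb2)
  then show "subalgebra M F" using * by (auto simp: subalgebra_def)
qed

context prob_space
begin

lemma cov_eq:
  assumes "square_integrable M f" "square_integrable M g"
  shows "cov M f g = expectation (\<lambda>x. f x * g x) - expectation f * expectation g"
proof -
  have i: "integrable M f" "integrable M g" "integrable M (\<lambda>x. f x * g x)"
    using assms square_integrable_integrable square_integrable_mult by auto
  have "cov M f g = expectation (\<lambda>x. f x * g x - expectation g * f x - expectation f * g x + expectation f * expectation g)"
    unfolding cov_def by (intro Bochner_Integration.integral_cong refl) (simp add: algebra_simps)
  then show ?thesis using i by (simp add: prob_space)
qed

lemma cov_self_nonneg: "0 \<le> cov M f f"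
  unfolding cov_def by simp

lemma cov_Cauchy_Schwarz:
  assumes f: "square_integrable M f" and g: "square_integrable M g"
  shows "(cov M f g)\<^sup>2 \<le> cov M f f * cov M g g"
proof -
  let ?u = "cov M f f" and ?w = "cov M g g" and ?c = "cov M f g"
  have q: "0 \<le> s\<^sup>2 * ?u + 2 * s * ?c + ?w" for s
  proof -
    have sf: "square_integrable M (\<lambda>x. s * f x + g x)"
      by (intro square_integrable_add square_integrable_cmult f g)
    have i: "integrable M f" "integrable M g" "integrable M (\<lambda>x. f x * g x)"
      "integrable M (\<lambda>x. f x * f x)" "integrable M (\<lambda>x. g x * g x)"
      using f g square_integrable_integrable square_integrable_mult by auto
    have "expectation (\<lambda>x. (s * f x + g x) * (s * f x + g x)) =
       expectation (\<lambda>x. s\<^sup>2 * (f x * f x) + 2 * s * (f x * g x) + g x * g x)"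
      by (intro Bochner_Integration.integral_cong refl) (simp add: algebra_simps power2_eq_square)
    also have "\<dots> = s\<^sup>2 * expectation (\<lambda>x. f x * f x) + 2 * s * expectation (\<lambda>x. f x * g x) + expectation (\<lambda>x. g x * g x)"
      using i by simp
    finally have e2: "expectation (\<lambda>x. (s * f x + g x) * (s * f x + g x)) = \<dots>" .
    have e1: "expectation (\<lambda>x. s * f x + g x) = s * expectation f + expectation g" using i by simp
    have "cov M (\<lambda>x. s * f x + g x) (\<lambda>x. s * f x + g x) = s\<^sup>2 * ?u + 2 * s * ?c + ?w"
      unfolding cov_eq[OF sf sf] cov_eq[OF f f] cov_eq[OF f g] cov_eq[OF g g] e1 e2
      by (simp add: algebra_simps power2_eq_square)
    then show ?thesis using cov_self_nonneg[of "\<lambda>x. s * f x + g x"] by simp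
  qed
  show ?thesis
  proof (cases "?u = 0")
    case True
    have "?c = 0"
    proof (rule ccontr)
      assume "?c \<noteq> 0"
      \<comment> \<open>At this \<open>s\<close> the quadratic form, affine in \<open>s\<close>
        since \<open>?u = 0\<close>, takes the value \<open>- 1\<close>.\<close>
      then show False using q[of "- (?w + 1) / (2 * ?c)"] True by (simp add: field_simps)
    qed
    then show ?thesis using True by simp
  next
    case False
    then have u: "0 < ?u" using cov_self_nonneg[of f] by simp
    have "0 \<le> ?u * ((- ?c / ?u)\<^sup>2 * ?u + 2 * (- ?c / ?u) * ?c + ?w)" using q[of "- ?c / ?u"] u by simp
    also have "\<dots> = ?u * ?w - ?c\<^sup>2" using u by (simp add: field_simps power2_eq_square)
    finally show ?thesis by simp
  qed
qed

end

lemma sigma_gen_subalgebra: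
  assumes "\<And>k. k \<in> I \<Longrightarrow> V k \<in> borel_measurable N"
  shows "subalgebra N (sigma_gen N V I)"
proof -
  have "(\<Union>i\<in>I. {V i -` A \<inter> space N |A. A \<in> sets borel}) \<subseteq> sets N"
    using assms by (auto intro: measurable_sets)
  moreover from this have "(\<Union>i\<in>I. {V i -` A \<inter> space N |A. A \<in> sets borel}) \<subseteq> Pow (space N)"
    using sets.sets_into_space by blast
  ultimately show ?thesis
    by (simp add: subalgebra_def sigma_gen_def sets.sigma_sets_subset)
qed

lemma sigma_gen_measurable:
  assumes "k \<in> I"
  shows "V k \<in> borel_measurable (sigma_gen N V I)"
proof (rule measurableI)
  fix A :: "real set" assume "A \<in> sets borel"
  then show "V k -` A \<inter> space (sigma_gen N V I) \<in> sets (sigma_gen N V I)"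
    using assms by (auto simp: sigma_gen_def sets_measure_of_conv space_measure_of_conv)
qed simp

text \<open>Cauchy-Schwarz bounds correlations by 1, so the supremum is a genuine upper bound. If a
  variance vanishes, \<open>corr\<close> is 0 by convention and says nothing; Cauchy-Schwarz then
  gives covariance 0 directly. The arithmetic mean replaces the geometric one at the end.\<close>

lemma cov_mixing_rho_mix:
  assumes "prob_space N" and V: "\<And>k. 1 \<le> k \<Longrightarrow> V k \<in> borel_measurable N" and l: "1 \<le> l"
  shows "cov_mixing N (sigma_gen N V {1..l}) (sigma_gen N V {l + k..}) (rho_mix N V k)"
    and "0 \<le> rho_mix N V k"
proof -
  interpret prob_space N by fact
  let ?S = "{\<bar>corr N f g\<bar> | f g l. 1 \<le> l \<and>
            f \<in> borel_measurable (sigma_gen N V {1..l}) \<and> square_integrable N f \<and>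
            g \<in> borel_measurable (sigma_gen N V {l + k..}) \<and> square_integrable N g}"
  have corr1: "\<bar>corr N f g\<bar> \<le> 1" if "square_integrable N f" "square_integrable N g" for f g
  proof -
    have "\<bar>cov N f g\<bar> \<le> sqrt (cov N f f * cov N g g)"
      using cov_Cauchy_Schwarz[OF that] real_le_rsqrt[of "\<bar>cov N f g\<bar>"] by simp
    then show ?thesis by (simp add: corr_def divide_le_eq) (metis abs_ge_self order_trans)
  qed
  have bdd: "bdd_above ?S" by (rule bdd_aboveI[of _ 1]) (auto intro: corr1)
  have upper: "\<bar>corr N f g\<bar> \<le> rho_mix N V k" if "1 \<le> l" "f \<in> borel_measurable (sigma_gen N V {1..l})" "square_integrable N f"
     "g \<in> borel_measurable (sigma_gen N V {l + k..})" "square_integrable N g" for f g l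
    unfolding rho_mix_def by (rule cSup_upper[OF _ bdd]) (use that in blast)
  show rho0: "0 \<le> rho_mix N V k"
    by (rule order_trans[OF _ upper[of l "\<lambda>_. 0" "\<lambda>_. 0"]]) (use l square_integrable_const in auto)
  show "cov_mixing N (sigma_gen N V {1..l}) (sigma_gen N V {l + k..}) (rho_mix N V k)"
    unfolding cov_mixing_def
  proof (intro allI impI)
    fix f g assume fg: "f \<in> borel_measurable (sigma_gen N V {1..l})" "square_integrable N f"
     "g \<in> borel_measurable (sigma_gen N V {l + k..})" "square_integrable N g"
    let ?u = "cov N f f" and ?w = "cov N g g"
    have uw: "0 \<le> ?u" "0 \<le> ?w" by (rule cov_self_nonneg)+
    have "\<bar>cov N f g\<bar> \<le> rho_mix N V k * sqrt (?u * ?w)"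
    proof (cases "?u * ?w = 0")
      case True
      have "(cov N f g)\<^sup>2 \<le> 0" using cov_Cauchy_Schwarz[OF fg(2,4)] unfolding True .
      then have "cov N f g = 0" by simp
      then show ?thesis using rho0 uw by simp
    next
      case False
      then have "0 < sqrt (?u * ?w)" using uw by (simp add: less_le)
      moreover have "\<bar>cov N f g\<bar> / sqrt (?u * ?w) \<le> rho_mix N V k"
        using upper[OF l fg] uw unfolding corr_def by (simp add: abs_divide)
      ultimately show ?thesis by (simp add: divide_le_eq)
    qed
    also have "\<dots> \<le> rho_mix N V k * ((?u + ?w) / 2)"
      by (intro mult_left_mono arith_geo_mean_sqrt rho0 uw)
    finally show "\<bar>cov N f g\<bar> \<le> rho_mix N V k * (?u + ?w) / 2" by simp
  qed
qed

text \<open>Law of total covariance: the conditional covariance given the first coordinate is controlled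
  by the mixing of the second factor, the covariance of the conditional means by that of the first.\<close>

lemma cov_mixing_pair:
  assumes P1: "prob_space P1" and P2: "prob_space P2"
    and F1: "subalgebra P1 F1" and G1: "subalgebra P1 G1"
    and F2: "subalgebra P2 F2" and G2: "subalgebra P2 G2"
    and mix1: "cov_mixing P1 F1 G1 r" and mix2: "cov_mixing P2 F2 G2 r"
  shows "cov_mixing (P1 \<Otimes>\<^sub>M P2) (F1 \<Otimes>\<^sub>M F2) (G1 \<Otimes>\<^sub>M G2) r"
  unfolding cov_mixing_def
proof (intro allI impI)
  interpret P1: prob_space P1 by fact
  interpret P2: prob_space P2 by fact
  interpret P: pair_prob_space P1 P2 by standard
  let ?P = "P1 \<Otimes>\<^sub>M P2"
  let ?E = "\<lambda>h. \<integral>z. h z \<partial>?P"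
  let ?I = "\<lambda>h x. \<integral>y. h (x, y) \<partial>P2"
  fix f g :: "'a \<times> 'b \<Rightarrow> real"
  assume f: "f \<in> borel_measurable (F1 \<Otimes>\<^sub>M F2)" "square_integrable ?P f"
    and g: "g \<in> borel_measurable (G1 \<Otimes>\<^sub>M G2)" "square_integrable ?P g"
  have section_measurable: "(\<lambda>y. h (x, y)) \<in> borel_measurable C2"
    if "h \<in> borel_measurable (C1 \<Otimes>\<^sub>M C2)" "subalgebra P1 C1" "x \<in> space P1"
    for h :: "'a \<times> 'b \<Rightarrow> real" and C1 :: "'a measure" and C2 :: "'b measure" and x
    using that by (intro measurable_Pair2[OF that(1)]) (simp add: subalgebra_def)
  \<comment> \<open>The conditional mean has to be measurable for the small algebra
    \<open>C1\<close>. Since \<open>h\<close> is measurable only for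
    \<open>C1 \<Otimes>\<^sub>M C2\<close>, the parametrised integral is taken over
    \<open>P2\<close> restricted to \<open>C2\<close>, where it has the same value.\<close>
  have mean_measurable: "?I h \<in> borel_measurable C1"
    if h: "h \<in> borel_measurable (C1 \<Otimes>\<^sub>M C2)" and C1: "subalgebra P1 C1" and C2: "subalgebra P2 C2"
    for h :: "'a \<times> 'b \<Rightarrow> real" and C1 C2
  proof -
    interpret R: prob_space "restr_to_subalg P2 C2" by (rule prob_space_restr_to_subalg[OF C2 P2])
    have [measurable_cong]: "sets (restr_to_subalg P2 C2) = sets C2" by (rule sets_restr_to_subalg[OF C2])
    have [measurable]: "h \<in> borel_measurable (C1 \<Otimes>\<^sub>M restr_to_subalg P2 C2)"
      using h by (simp cong: measurable_cong_sets sets_pair_measure_cong)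
    have "(\<lambda>x. \<integral>y. h (x, y) \<partial>restr_to_subalg P2 C2) \<in> borel_measurable C1" by measurable
    then show ?thesis
    proof (rule measurable_cong[THEN iffD1, rotated])
      fix x assume "x \<in> space C1"
      then have "(\<lambda>y. h (x, y)) \<in> borel_measurable C2" by (rule measurable_Pair2[OF h])
      then show "(\<integral>y. h (x, y) \<partial>restr_to_subalg P2 C2) = ?I h x" by (rule integral_subalgebra2[OF C2])
    qed
  qed
  have sq_int: "integrable ?P (\<lambda>z. (f z)\<^sup>2)" "integrable ?P (\<lambda>z. (g z)\<^sup>2)" "integrable ?P (\<lambda>z. f z * g z)"
    "integrable ?P f" "integrable ?P g"
    using f(2) g(2) square_integrable_mult[OF f(2) g(2)]
      P.square_integrable_integrable[OF f(2)] P.square_integrable_integrable[OF g(2)]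
    by (simp_all add: square_integrable_def)
  \<comment> \<open>By Fubini the sections are square integrable only for almost every
    \<open>x\<close>, so the conditional inequality is an almost everywhere statement.\<close>
  have AE_sq: "AE x in P1. square_integrable P2 (\<lambda>y. f (x, y)) \<and> square_integrable P2 (\<lambda>y. g (x, y))"
    using P.AE_integrable_fst'[OF sq_int(1)] P.AE_integrable_fst'[OF sq_int(2)] AE_space
  proof eventually_elim
    case (elim x)
    have "(\<lambda>y. f (x, y)) \<in> borel_measurable P2" "(\<lambda>y. g (x, y)) \<in> borel_measurable P2"
      using square_integrable_measurable[OF f(2)] square_integrable_measurable[OF g(2)] elim(3)
      by (auto intro: measurable_Pair2)
    then show ?case using elim by (simp add: square_integrable_def)
  qed
  have If: "?I f \<in> borel_measurable F1" and Ig: "?I g \<in> borel_measurable G1"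
    by (rule mean_measurable[OF f(1) F1 F2], rule mean_measurable[OF g(1) G1 G2])
  have IfM: "?I f \<in> borel_measurable P1" and IgM: "?I g \<in> borel_measurable P1"
    using measurable_from_subalg[OF F1 If] measurable_from_subalg[OF G1 Ig] by auto
  have sqI: "square_integrable P1 (?I h)"
    if "?I h \<in> borel_measurable P1" "integrable ?P (\<lambda>z. (h z)\<^sup>2)" "AE x in P1. square_integrable P2 (\<lambda>y. h (x, y))" for h
    unfolding square_integrable_def
  proof
    show "integrable P1 (\<lambda>x. (?I h x)\<^sup>2)"
    proof (rule Bochner_Integration.integrable_bound[OF P.integrable_fst'[OF that(2)]])
      show "AE x in P1. norm ((?I h x)\<^sup>2) \<le> norm (\<integral>y. (h (x, y))\<^sup>2 \<partial>P2)"
        using that(3) by eventually_elim (use P2.expectation_square_le in force)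
    qed (use that in measurable)
  qed fact
  have sqf: "square_integrable P1 (?I f)" and sqg: "square_integrable P1 (?I g)"
    using AE_sq by (auto intro!: sqI IfM IgM sq_int)
  have cond: "AE x in P1. \<bar>?I (\<lambda>z. f z * g z) x - ?I f x * ?I g x\<bar> \<le>
      r * ((?I (\<lambda>z. (f z)\<^sup>2) x - (?I f x)\<^sup>2) + (?I (\<lambda>z. (g z)\<^sup>2) x - (?I g x)\<^sup>2)) / 2"
    using AE_sq AE_space
  proof eventually_elim
    case (elim x)
    have "\<bar>cov P2 (\<lambda>y. f (x, y)) (\<lambda>y. g (x, y))\<bar> \<le>
       r * (cov P2 (\<lambda>y. f (x, y)) (\<lambda>y. f (x, y)) + cov P2 (\<lambda>y. g (x, y)) (\<lambda>y. g (x, y))) / 2"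
      using mix2 section_measurable[OF f(1) F1 elim(2)] section_measurable[OF g(1) G1 elim(2)] elim(1)
      unfolding cov_mixing_def by blast
    then show ?case using elim(1) by (simp add: P2.cov_eq power2_eq_square)
  qed
  have int1: "integrable P1 (?I (\<lambda>z. f z * g z))" "integrable P1 (?I (\<lambda>z. (f z)\<^sup>2))" "integrable P1 (?I (\<lambda>z. (g z)\<^sup>2))"
    using P.integrable_fst'[OF sq_int(1)] P.integrable_fst'[OF sq_int(2)] P.integrable_fst'[OF sq_int(3)] by auto
  have int2: "integrable P1 (\<lambda>x. ?I f x * ?I g x)" "integrable P1 (\<lambda>x. (?I f x)\<^sup>2)" "integrable P1 (\<lambda>x. (?I g x)\<^sup>2)"
    using square_integrable_mult[OF sqf sqg] sqf sqg by (auto simp: square_integrable_def)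
  have E: "?E (\<lambda>z. f z * g z) = P1.expectation (?I (\<lambda>z. f z * g z))"
    "?E (\<lambda>z. (f z)\<^sup>2) = P1.expectation (?I (\<lambda>z. (f z)\<^sup>2))"
    "?E (\<lambda>z. (g z)\<^sup>2) = P1.expectation (?I (\<lambda>z. (g z)\<^sup>2))"
    "?E f = P1.expectation (?I f)" "?E g = P1.expectation (?I g)"
    using P.integral_fst'[OF sq_int(1)] P.integral_fst'[OF sq_int(2)] P.integral_fst'[OF sq_int(3)]
      P.integral_fst'[OF sq_int(4)] P.integral_fst'[OF sq_int(5)] by simp_all
  have "\<bar>?E (\<lambda>z. f z * g z) - P1.expectation (\<lambda>x. ?I f x * ?I g x)\<bar>
     = \<bar>P1.expectation (\<lambda>x. ?I (\<lambda>z. f z * g z) x - ?I f x * ?I g x)\<bar>"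
    using int1 int2 E by simp
  also have "\<dots> \<le> P1.expectation (\<lambda>x. \<bar>?I (\<lambda>z. f z * g z) x - ?I f x * ?I g x\<bar>)"
    by (rule integral_abs_bound)
  also have "\<dots> \<le> P1.expectation (\<lambda>x. r * ((?I (\<lambda>z. (f z)\<^sup>2) x - (?I f x)\<^sup>2) + (?I (\<lambda>z. (g z)\<^sup>2) x - (?I g x)\<^sup>2)) / 2)"
    using cond int1 int2 by (intro integral_mono_AE) auto
  also have "\<dots> = r * ((?E (\<lambda>z. (f z)\<^sup>2) - P1.expectation (\<lambda>x. (?I f x)\<^sup>2)) + (?E (\<lambda>z. (g z)\<^sup>2) - P1.expectation (\<lambda>x. (?I g x)\<^sup>2))) / 2"
    using int1 int2 E by simp
  finally have 1: "\<bar>?E (\<lambda>z. f z * g z) - P1.expectation (\<lambda>x. ?I f x * ?I g x)\<bar> \<le> \<dots>" .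
  have 2: "\<bar>cov P1 (?I f) (?I g)\<bar> \<le> r * (cov P1 (?I f) (?I f) + cov P1 (?I g) (?I g)) / 2"
    using mix1 If Ig sqf sqg unfolding cov_mixing_def by blast
  have "\<bar>cov ?P f g\<bar> \<le> \<bar>?E (\<lambda>z. f z * g z) - P1.expectation (\<lambda>x. ?I f x * ?I g x)\<bar> + \<bar>cov P1 (?I f) (?I g)\<bar>"
    unfolding P.cov_eq[OF f(2) g(2)] P1.cov_eq[OF sqf sqg] E(4,5) by linarith
  also have "\<dots> \<le> r * ((?E (\<lambda>z. (f z)\<^sup>2) - P1.expectation (\<lambda>x. (?I f x)\<^sup>2)) + (?E (\<lambda>z. (g z)\<^sup>2) - P1.expectation (\<lambda>x. (?I g x)\<^sup>2))) / 2
     + r * (cov P1 (?I f) (?I f) + cov P1 (?I g) (?I g)) / 2"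
    by (rule add_mono[OF 1 2])
  \<comment> \<open>The mean conditional variance and the variance of the conditional mean add up to
    the full variance; the second moments of the conditional means cancel.\<close>
  also have "\<dots> = r * (cov ?P f f + cov ?P g g) / 2"
  proof -
    have "r * ((a - c) + (b - d)) / 2 + r * ((c - u) + (d - v)) / 2 = r * ((a - u) + (b - v)) / 2" for a b c d u v
      by (simp add: field_simps)
    then show ?thesis
      unfolding P.cov_eq[OF f(2) f(2)] P.cov_eq[OF g(2) g(2)] P1.cov_eq[OF sqf sqf] P1.cov_eq[OF sqg sqg] E(4,5)
        power2_eq_square .
  qed
  finally show "\<bar>cov ?P f g\<bar> \<le> r * (cov ?P f f + cov ?P g g) / 2" .
qed

lemma subalgebra_PiM:
  assumes "\<And>i. i \<in> I \<Longrightarrow> subalgebra (P i) (A i)"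
  shows "subalgebra (PiM I P) (PiM I A)"
proof -
  have "(\<lambda>x. \<lambda>i\<in>I. x i) \<in> measurable (PiM I P) (PiM I A)"
  proof (rule measurable_restrict)
    fix i assume i: "i \<in> I"
    show "(\<lambda>x. x i) \<in> measurable (PiM I P) (A i)"
      using measurable_compose[OF measurable_component_singleton[OF i]] assms[OF i]
      by (auto simp: subalgebra_iff_id)
  qed
  moreover have "(\<lambda>x. \<lambda>i\<in>I. x i) \<in> measurable (PiM I P) (PiM I A) \<longleftrightarrow> (\<lambda>x. x) \<in> measurable (PiM I P) (PiM I A)"
    by (intro measurable_cong) (auto simp: space_PiM PiE_def extensional_restrict)
  moreover have "space (PiM I A) = space (PiM I P)"
    using assms unfolding space_PiM by (intro PiE_cong) (simp add: subalgebra_def)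
  ultimately show ?thesis by (simp add: subalgebra_iff_id)
qed

lemma cov_distr:
  assumes T: "T \<in> measurable M N" and f: "f \<in> borel_measurable N" and g: "g \<in> borel_measurable N"
  shows "cov (distr M N T) f g = cov M (\<lambda>x. f (T x)) (\<lambda>x. g (T x))"
  unfolding cov_def using f g by (simp add: integral_distr[OF T])

lemma square_integrable_distr:
  assumes T: "T \<in> measurable M N" and f: "f \<in> borel_measurable N"
  shows "square_integrable (distr M N T) f \<longleftrightarrow> square_integrable M (\<lambda>x. f (T x))"
  using f measurable_compose[OF T f] unfolding square_integrable_def
  by (simp add: integrable_distr_eq[OF T])

text \<open>Induction with the two-factor case, which returns the same \<open>r\<close>, so the
  coefficient does not grow with the number of factors. The empty product is a single point, on
  which every covariance is 0.\<close>

lemma cov_mixing_PiM: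
  assumes "finite I" and r: "0 \<le> r"
    and "\<And>i. i \<in> I \<Longrightarrow> prob_space (P i)"
    and "\<And>i. i \<in> I \<Longrightarrow> subalgebra (P i) (A i)" "\<And>i. i \<in> I \<Longrightarrow> subalgebra (P i) (B i)"
    and "\<And>i. i \<in> I \<Longrightarrow> cov_mixing (P i) (A i) (B i) r"
  shows "cov_mixing (PiM I P) (PiM I A) (PiM I B) r"
  using assms(1,3-)
proof (induction I)
  case empty
  interpret E: prob_space "PiM {} P" by (rule prob_space_PiM) simp
  have const: "(\<integral>x. h x \<partial>PiM {} P) = h (\<lambda>_. undefined)" for h :: "_ \<Rightarrow> real"
  proof -
    have "(\<integral>x. h x \<partial>PiM {} P) = (\<integral>x. h (\<lambda>_. undefined) \<partial>PiM {} P)"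
      by (intro Bochner_Integration.integral_cong refl) (simp add: space_PiM)
    then show ?thesis by (simp add: E.prob_space)
  qed
  have "cov (PiM {} P) f g = 0" for f g
    unfolding cov_def const by simp
  then show ?case by (simp add: cov_mixing_def)
next
  case (insert i I)
  let ?T = "\<lambda>(x, X). X(i := x)"
  have T: "?T \<in> measurable (Q i \<Otimes>\<^sub>M PiM I Q) (PiM (insert i I) Q)" for Q :: "_ \<Rightarrow> 'b measure"
    using measurable_comp[OF measurable_pair_swap' measurable_add_dim[of i I Q]] by (simp add: comp_def case_prod_beta)
  have distr: "distr (P i \<Otimes>\<^sub>M PiM I P) (PiM (insert i I) P) ?T = PiM (insert i I) P"
    using insert.prems by (intro distr_pair_PiM_eq_PiM) auto
  have pi: "prob_space (P i)" using insert.prems(1) by simp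
  have pI: "prob_space (PiM I P)" using insert.prems(1) by (intro prob_space_PiM) simp
  have IH: "cov_mixing (PiM I P) (PiM I A) (PiM I B) r"
    by (rule insert.IH) (simp_all add: insert.prems)
  have sub: "subalgebra (PiM I P) (PiM I A)" "subalgebra (PiM I P) (PiM I B)"
    by (rule subalgebra_PiM, simp add: insert.prems)+
  have mix: "cov_mixing (P i \<Otimes>\<^sub>M PiM I P) (A i \<Otimes>\<^sub>M PiM I A) (B i \<Otimes>\<^sub>M PiM I B) r"
    by (rule cov_mixing_pair[OF pi pI _ _ sub _ IH]) (simp_all add: insert.prems)
  show ?case
    unfolding cov_mixing_def
  proof (intro allI impI)
    fix f g assume f: "f \<in> borel_measurable (PiM (insert i I) A)" "square_integrable (PiM (insert i I) P) f"
      and g: "g \<in> borel_measurable (PiM (insert i I) B)" "square_integrable (PiM (insert i I) P) g"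
    have m: "f \<in> borel_measurable (PiM (insert i I) P)" "g \<in> borel_measurable (PiM (insert i I) P)"
      using f g by (simp_all add: square_integrable_def)
    have cv: "cov (PiM (insert i I) P) f' g' = cov (P i \<Otimes>\<^sub>M PiM I P) (\<lambda>z. f' (?T z)) (\<lambda>z. g' (?T z))"
      if "f' \<in> borel_measurable (PiM (insert i I) P)" "g' \<in> borel_measurable (PiM (insert i I) P)" for f' g'
      using cov_distr[OF T that] unfolding distr .
    have sqT: "square_integrable (PiM (insert i I) P) f' \<longleftrightarrow> square_integrable (P i \<Otimes>\<^sub>M PiM I P) (\<lambda>z. f' (?T z))"
      if "f' \<in> borel_measurable (PiM (insert i I) P)" for f'
      using square_integrable_distr[OF T that] unfolding distr .
    have "\<bar>cov (P i \<Otimes>\<^sub>M PiM I P) (\<lambda>z. f (?T z)) (\<lambda>z. g (?T z))\<bar> \<le>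
       r * (cov (P i \<Otimes>\<^sub>M PiM I P) (\<lambda>z. f (?T z)) (\<lambda>z. f (?T z)) + cov (P i \<Otimes>\<^sub>M PiM I P) (\<lambda>z. g (?T z)) (\<lambda>z. g (?T z))) / 2"
      by (rule mix[unfolded cov_mixing_def, rule_format, OF measurable_compose[OF T f(1)] _ measurable_compose[OF T g(1)]])
        (use sqT[OF m(1)] sqT[OF m(2)] f(2) g(2) in simp_all)
    then show "\<bar>cov (PiM (insert i I) P) f g\<bar> \<le> r * (cov (PiM (insert i I) P) f f + cov (PiM (insert i I) P) g g) / 2"
      using m by (simp add: cv)
  qed
qed

section \<open>Convergence in probability\<close>

definition oP :: "'a measure \<Rightarrow> (nat \<Rightarrow> 'a \<Rightarrow> real) \<Rightarrow> bool" where
  "oP M R \<longleftrightarrow> (\<forall>d. R d \<in> borel_measurable M) \<and>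
     (\<forall>\<epsilon>>0. (\<lambda>d. measure M {x \<in> space M. \<epsilon> < \<bar>R d x\<bar>}) \<longlonglongrightarrow> 0)"

context prob_space
begin

lemma Markov_square:
  assumes "square_integrable M f" "0 < a"
  shows "prob {x \<in> space M. a < \<bar>f x\<bar>} \<le> expectation (\<lambda>x. (f x)\<^sup>2) / a\<^sup>2"
proof -
  have [measurable]: "f \<in> borel_measurable M" by (rule square_integrable_measurable[OF assms(1)])
  have "prob {x \<in> space M. a < \<bar>f x\<bar>} = expectation (indicator {x \<in> space M. a < \<bar>f x\<bar>})"
    by (simp add: Int_absorb2)
  also have "\<dots> \<le> expectation (\<lambda>x. (f x)\<^sup>2 / a\<^sup>2)"
  proof (intro integral_mono integrable_real_indicator)
    show "integrable M (\<lambda>x. (f x)\<^sup>2 / a\<^sup>2)" using assms by (simp add: square_integrable_def)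
    fix x
    have "1 \<le> (f x)\<^sup>2 / a\<^sup>2" if "a < \<bar>f x\<bar>"
      using power_mono[of a "\<bar>f x\<bar>" 2] that assms(2) by (simp add: le_divide_eq)
    then show "indicator {x \<in> space M. a < \<bar>f x\<bar>} x \<le> (f x)\<^sup>2 / a\<^sup>2"
      by (auto simp: indicator_def)
  qed (auto simp: less_top[symmetric])
  finally show ?thesis using assms by (simp add: square_integrable_def)
qed

lemma oP_measurable: "oP M R \<Longrightarrow> R d \<in> borel_measurable M"
  by (simp add: oP_def)

lemma oP_subset:
  assumes "\<And>d. S d \<in> borel_measurable M"
    and "\<And>\<epsilon>. 0 < \<epsilon> \<Longrightarrow> \<exists>p. (p \<longlonglongrightarrow> 0) \<and>
      (\<forall>\<^sub>F d in sequentially. prob {x \<in> space M. \<epsilon> < \<bar>S d x\<bar>} \<le> p d)"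
  shows "oP M S"
  unfolding oP_def
proof (intro conjI allI impI)
  fix \<epsilon> :: real assume "0 < \<epsilon>"
  then obtain p where p: "p \<longlonglongrightarrow> 0" "\<forall>\<^sub>F d in sequentially. prob {x \<in> space M. \<epsilon> < \<bar>S d x\<bar>} \<le> p d"
    using assms(2) by blast
  show "(\<lambda>d. prob {x \<in> space M. \<epsilon> < \<bar>S d x\<bar>}) \<longlonglongrightarrow> 0"
    by (rule tendsto_sandwich[OF _ p(2) tendsto_const p(1)]) simp
qed (rule assms(1))

lemma oP_L2:
  assumes "\<And>d. R d \<in> borel_measurable M"
    and "\<forall>\<^sub>F d in sequentially. square_integrable M (R d) \<and> expectation (\<lambda>x. (R d x)\<^sup>2) \<le> b d"
    and "b \<longlonglongrightarrow> 0"
  shows "oP M R"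
proof (rule oP_subset[OF assms(1)])
  fix \<epsilon> :: real assume e: "0 < \<epsilon>"
  have "\<forall>\<^sub>F d in sequentially. prob {x \<in> space M. \<epsilon> < \<bar>R d x\<bar>} \<le> b d / \<epsilon>\<^sup>2"
    using assms(2)
  proof eventually_elim
    case (elim d)
    then have "prob {x \<in> space M. \<epsilon> < \<bar>R d x\<bar>} \<le> expectation (\<lambda>x. (R d x)\<^sup>2) / \<epsilon>\<^sup>2"
      using e by (intro Markov_square) auto
    also have "\<dots> \<le> b d / \<epsilon>\<^sup>2" using elim by (intro divide_right_mono) auto
    finally show ?case .
  qed
  moreover have "(\<lambda>d. b d / \<epsilon>\<^sup>2) \<longlonglongrightarrow> 0" using tendsto_divide_zero[OF assms(3)] .
  ultimately show "\<exists>p. (p \<longlonglongrightarrow> 0) \<and> (\<forall>\<^sub>F d in sequentially. prob {x \<in> space M. \<epsilon> < \<bar>R d x\<bar>} \<le> p d)"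
    by blast
qed

lemma oP_add:
  assumes R: "oP M R" and S: "oP M S"
  shows "oP M (\<lambda>d x. R d x + S d x)"
proof (rule oP_subset)
  have [measurable]: "R d \<in> borel_measurable M" "S d \<in> borel_measurable M" for d
    using R S by (auto intro: oP_measurable)
  show "(\<lambda>x. R d x + S d x) \<in> borel_measurable M" for d by measurable
  fix \<epsilon> :: real assume e: "0 < \<epsilon>"
  have "prob {x \<in> space M. \<epsilon> < \<bar>R d x + S d x\<bar>} \<le>
      prob {x \<in> space M. \<epsilon> / 2 < \<bar>R d x\<bar>} + prob {x \<in> space M. \<epsilon> / 2 < \<bar>S d x\<bar>}" for d
  proof -
    have "prob {x \<in> space M. \<epsilon> < \<bar>R d x + S d x\<bar>} \<le>
      prob ({x \<in> space M. \<epsilon> / 2 < \<bar>R d x\<bar>} \<union> {x \<in> space M. \<epsilon> / 2 < \<bar>S d x\<bar>})"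
      by (intro finite_measure_mono) auto
    also have "\<dots> \<le> prob {x \<in> space M. \<epsilon> / 2 < \<bar>R d x\<bar>} + prob {x \<in> space M. \<epsilon> / 2 < \<bar>S d x\<bar>}"
      by (intro measure_Un_le) auto
    finally show ?thesis .
  qed
  moreover have "(\<lambda>d. prob {x \<in> space M. \<epsilon> / 2 < \<bar>R d x\<bar>} + prob {x \<in> space M. \<epsilon> / 2 < \<bar>S d x\<bar>}) \<longlonglongrightarrow> 0 + 0"
    using R[unfolded oP_def, THEN conjunct2, rule_format, OF half_gt_zero[OF e]]
      S[unfolded oP_def, THEN conjunct2, rule_format, OF half_gt_zero[OF e]]
    by (intro tendsto_add)
  ultimately show "\<exists>p. (p \<longlonglongrightarrow> 0) \<and> (\<forall>\<^sub>F d in sequentially. prob {x \<in> space M. \<epsilon> < \<bar>R d x + S d x\<bar>} \<le> p d)"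
    by (intro exI[of _ "\<lambda>d. prob {x \<in> space M. \<epsilon> / 2 < \<bar>R d x\<bar>} + prob {x \<in> space M. \<epsilon> / 2 < \<bar>S d x\<bar>}"])
      (auto intro: always_eventually)
qed

lemma oP_mult_bounded:
  assumes R: "oP M R" and c: "\<forall>\<^sub>F d in sequentially. \<bar>c d\<bar> \<le> (K::real)"
  shows "oP M (\<lambda>d x. c d * R d x)"
proof (rule oP_subset)
  have [measurable]: "R d \<in> borel_measurable M" for d
    using R by (auto intro: oP_measurable)
  show "(\<lambda>x. c d * R d x) \<in> borel_measurable M" for d by measurable
  fix \<epsilon> :: real assume e: "0 < \<epsilon>"
  define L where "L = \<bar>K\<bar> + 1"
  have L: "0 < L" by (simp add: L_def)
  have "\<forall>\<^sub>F d in sequentially. prob {x \<in> space M. \<epsilon> < \<bar>c d * R d x\<bar>} \<le> prob {x \<in> space M. \<epsilon> / L < \<bar>R d x\<bar>}"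
    using c
  proof eventually_elim
    case (elim d)
    show ?case
    proof (intro finite_measure_mono subsetI)
      fix x assume x: "x \<in> {x \<in> space M. \<epsilon> < \<bar>c d * R d x\<bar>}"
      have "\<bar>c d * R d x\<bar> \<le> L * \<bar>R d x\<bar>"
        unfolding abs_mult using elim by (intro mult_right_mono) (auto simp: L_def)
      then show "x \<in> {x \<in> space M. \<epsilon> / L < \<bar>R d x\<bar>}" using x L by (simp add: divide_less_eq mult.commute)
    qed measurable
  qed
  moreover have "(\<lambda>d. prob {x \<in> space M. \<epsilon> / L < \<bar>R d x\<bar>}) \<longlonglongrightarrow> 0"
    using R e L unfolding oP_def by simp
  ultimately show "\<exists>p. (p \<longlonglongrightarrow> 0) \<and> (\<forall>\<^sub>F d in sequentially. prob {x \<in> space M. \<epsilon> < \<bar>c d * R d x\<bar>} \<le> p d)"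
    by blast
qed

lemma oP_cmult: "oP M R \<Longrightarrow> oP M (\<lambda>d x. c * R d x)"
  by (rule oP_mult_bounded[where K = "\<bar>c\<bar>"]) simp_all

lemma oP_zero: "oP M (\<lambda>d x. 0)"
  by (simp add: oP_def)

lemma oP_sum:
  assumes "\<And>i. i \<in> I \<Longrightarrow> oP M (R i)"
  shows "oP M (\<lambda>d x. \<Sum>i\<in>I. R i d x)"
  using assms by (induction I rule: infinite_finite_induct) (auto intro: oP_zero oP_add)

text \<open>Equality for large \<open>d\<close> is what the algebra below delivers, since the
  rescalings divide by \<open>d\<close>.\<close>

lemma oP_cong:
  assumes "oP M R" "\<And>d. S d \<in> borel_measurable M"
    and "\<forall>\<^sub>F d in sequentially. \<forall>x\<in>space M. S d x = R d x"
  shows "oP M S"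
proof (rule oP_subset[OF assms(2)])
  fix \<epsilon> :: real assume "0 < \<epsilon>"
  moreover have "\<forall>\<^sub>F d in sequentially. prob {x \<in> space M. \<epsilon> < \<bar>S d x\<bar>} \<le> prob {x \<in> space M. \<epsilon> < \<bar>R d x\<bar>}"
    using assms(3)
  proof eventually_elim
    case (elim d)
    then have "{x \<in> space M. \<epsilon> < \<bar>S d x\<bar>} = {x \<in> space M. \<epsilon> < \<bar>R d x\<bar>}" by auto
    then show ?case by simp
  qed
  ultimately show "\<exists>p. (p \<longlonglongrightarrow> 0) \<and> (\<forall>\<^sub>F d in sequentially. prob {x \<in> space M. \<epsilon> < \<bar>S d x\<bar>} \<le> p d)"
    using assms(1) unfolding oP_def by blast
qed

text \<open>Where \<open>X d\<close> is within \<delta> of \<open>x0\<close>, the remainder is at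
  most \<open>e\<close> times the distance, and the factor \<open>sqrt d\<close> is cancelled by the
  mean square rate \<open>1 / d\<close>. The probability of being further away is itself of order
  \<open>1 / d\<close>. Differentiability at the one point \<open>x0\<close> is therefore
  enough.\<close>

lemma delta_method:
  fixes X :: "nat \<Rightarrow> 'a \<Rightarrow> 'e::real_normed_vector" and f :: "'e \<Rightarrow> real"
  assumes f: "(f has_derivative f') (at x0)"
    and X: "\<forall>\<^sub>F d in sequentially. square_integrable M (\<lambda>\<omega>. norm (X d \<omega> - x0)) \<and>
        expectation (\<lambda>\<omega>. (norm (X d \<omega> - x0))\<^sup>2) \<le> C / real d"
    and meas: "\<And>d. (\<lambda>\<omega>. sqrt (real d) * (f (X d \<omega>) - f x0 - f' (X d \<omega> - x0))) \<in> borel_measurable M"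
  shows "oP M (\<lambda>d \<omega>. sqrt (real d) * (f (X d \<omega>) - f x0 - f' (X d \<omega> - x0)))"
  unfolding oP_def
proof (intro conjI allI impI meas)
  let ?R = "\<lambda>d \<omega>. sqrt (real d) * (f (X d \<omega>) - f x0 - f' (X d \<omega> - x0))"
  let ?N = "\<lambda>d \<omega>. norm (X d \<omega> - x0)"
  fix \<epsilon> :: real assume eps: "0 < \<epsilon>"
  show "(\<lambda>d. prob {\<omega> \<in> space M. \<epsilon> < \<bar>?R d \<omega>\<bar>}) \<longlonglongrightarrow> 0"
  proof (rule tendstoI)
    fix \<eta> :: real assume eta: "0 < \<eta>"
    \<comment> \<open>Chosen so that Markov's inequality gives
      \<open>\<bar>C\<bar> * e\<^sup>2 / \<epsilon>\<^sup>2\<close>, a bound free of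
      \<open>d\<close>, below \<open>\<eta> / 2\<close>. The 1 added to \<open>\<bar>C\<bar>\<close>
      avoids division by zero.\<close>
    define e where "e = \<epsilon> * sqrt (\<eta> / (2 * (\<bar>C\<bar> + 1)))"
    have e: "0 < e" using eps eta by (simp add: e_def)
    have small: "\<bar>C\<bar> * e\<^sup>2 / \<epsilon>\<^sup>2 < \<eta> / 2"
    proof -
      have "\<bar>C\<bar> * e\<^sup>2 / \<epsilon>\<^sup>2 = \<bar>C\<bar> * (\<eta> / (2 * (\<bar>C\<bar> + 1)))"
        using eps eta by (simp add: e_def power_mult_distrib)
      also have "\<dots> < (\<bar>C\<bar> + 1) * (\<eta> / (2 * (\<bar>C\<bar> + 1)))"
        using eta by (intro mult_strict_right_mono) auto
      also have "\<dots> = \<eta> / 2"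
      proof -
        have "k * (\<eta> / (2 * k)) = \<eta> / 2" if "0 < k" for k :: real using that by simp
        from this[of "\<bar>C\<bar> + 1"] show ?thesis by argo
      qed
      finally show ?thesis .
    qed
    obtain \<delta> where \<delta>: "0 < \<delta>" "\<And>y. norm (y - x0) < \<delta> \<Longrightarrow> norm (f y - f x0 - f' (y - x0)) \<le> e * norm (y - x0)"
      using f e unfolding has_derivative_at_alt by blast
    have "(\<lambda>d. \<bar>C\<bar> / (\<delta> / 2)\<^sup>2 / real d) \<longlonglongrightarrow> 0" by (rule lim_const_over_n)
    then have "\<forall>\<^sub>F d in sequentially. \<bar>C\<bar> / (\<delta> / 2)\<^sup>2 / real d < \<eta> / 2"
      using eta by (intro order_tendstoD(2)) auto
    with X eventually_gt_at_top[of 0]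
    show "\<forall>\<^sub>F d in sequentially. dist (prob {\<omega> \<in> space M. \<epsilon> < \<bar>?R d \<omega>\<bar>}) 0 < \<eta>"
    proof eventually_elim
      case (elim d)
      have [measurable]: "?N d \<in> borel_measurable M" using elim(1) by (simp add: square_integrable_def)
      have d: "0 < sqrt (real d)" using elim(2) by simp
      \<comment> \<open>Half of \<delta> appears because Markov's inequality is stated for a strict
        excess, while the complement of \<open>?N d \<omega> < \<delta>\<close> allows
        equality.\<close>
      have "{\<omega> \<in> space M. \<epsilon> < \<bar>?R d \<omega>\<bar>} \<subseteq>
         {\<omega> \<in> space M. \<delta> / 2 < \<bar>?N d \<omega>\<bar>} \<union> {\<omega> \<in> space M. \<epsilon> / (e * sqrt (real d)) < \<bar>?N d \<omega>\<bar>}"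
      proof
        fix \<omega> assume w: "\<omega> \<in> {\<omega> \<in> space M. \<epsilon> < \<bar>?R d \<omega>\<bar>}"
        show "\<omega> \<in> {\<omega> \<in> space M. \<delta> / 2 < \<bar>?N d \<omega>\<bar>} \<union> {\<omega> \<in> space M. \<epsilon> / (e * sqrt (real d)) < \<bar>?N d \<omega>\<bar>}"
        proof (cases "?N d \<omega> < \<delta>")
          case True
          have "\<epsilon> < sqrt (real d) * \<bar>f (X d \<omega>) - f x0 - f' (X d \<omega> - x0)\<bar>"
            using w by (simp add: abs_mult)
          also have "\<dots> \<le> sqrt (real d) * (e * ?N d \<omega>)"
            using \<delta>(2)[OF True] by (intro mult_left_mono) auto
          finally have "\<epsilon> / (e * sqrt (real d)) < ?N d \<omega>"
            using e d by (simp add: divide_less_eq mult_ac)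
          then show ?thesis using w by simp
        qed (use w \<delta>(1) in auto)
      qed
      then have "prob {\<omega> \<in> space M. \<epsilon> < \<bar>?R d \<omega>\<bar>} \<le>
         prob ({\<omega> \<in> space M. \<delta> / 2 < \<bar>?N d \<omega>\<bar>} \<union> {\<omega> \<in> space M. \<epsilon> / (e * sqrt (real d)) < \<bar>?N d \<omega>\<bar>})"
        by (intro finite_measure_mono) auto
      also have "\<dots> \<le> prob {\<omega> \<in> space M. \<delta> / 2 < \<bar>?N d \<omega>\<bar>} + prob {\<omega> \<in> space M. \<epsilon> / (e * sqrt (real d)) < \<bar>?N d \<omega>\<bar>}"
        by (intro measure_Un_le) auto
      also have "\<dots> \<le> expectation (\<lambda>\<omega>. (?N d \<omega>)\<^sup>2) / (\<delta> / 2)\<^sup>2 + expectation (\<lambda>\<omega>. (?N d \<omega>)\<^sup>2) / (\<epsilon> / (e * sqrt (real d)))\<^sup>2"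
        using elim(1) \<delta>(1) eps e d by (intro add_mono Markov_square) auto
      also have "\<dots> \<le> (\<bar>C\<bar> / real d) / (\<delta> / 2)\<^sup>2 + (\<bar>C\<bar> / real d) / (\<epsilon> / (e * sqrt (real d)))\<^sup>2"
      proof -
        have "expectation (\<lambda>\<omega>. (?N d \<omega>)\<^sup>2) \<le> \<bar>C\<bar> / real d"
          using elim(1) divide_right_mono[OF abs_ge_self[of C], of "real d"] by simp
        then show ?thesis by (intro add_mono divide_right_mono) auto
      qed
      also have "(\<bar>C\<bar> / real d) / (\<epsilon> / (e * sqrt (real d)))\<^sup>2 = \<bar>C\<bar> * e\<^sup>2 / \<epsilon>\<^sup>2"
        using d e eps by (simp add: power_divide power_mult_distrib)
      also have "(\<bar>C\<bar> / real d) / (\<delta> / 2)\<^sup>2 = \<bar>C\<bar> / (\<delta> / 2)\<^sup>2 / real d" by simp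
      finally have "prob {\<omega> \<in> space M. \<epsilon> < \<bar>?R d \<omega>\<bar>} < \<eta>" using elim(3) small by linarith
      then show ?case by simp
    qed
  qed
qed

end

section \<open>The normal distribution function\<close>

lemma std_normal_singleton: "measure std_normal_distribution {x} = 0"
proof -
  have "emeasure std_normal_distribution {x} = 0"
    by (subst emeasure_density) (auto intro!: nn_integral_null_set[OF null_setsI])
  then show ?thesis by (simp add: measure_def)
qed

lemma isCont_Phi: "isCont Phi x"
proof -
  interpret real_distribution std_normal_distribution by (rule real_dist_normal_dist)
  show ?thesis unfolding Phi_def by (simp add: isCont_cdf std_normal_singleton)
qed

text \<open>The reflected law has the same characteristic function, an even one, so uniqueness
  identifies the two laws; that points carry no mass turns \<open>{..<x}\<close> into
  \<open>{..x}\<close>.\<close>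

lemma Phi_minus: "Phi (- x) = 1 - Phi x"
proof -
  let ?N = "std_normal_distribution"
  interpret real_distribution ?N by (rule real_dist_normal_dist)
  interpret U: real_distribution "distr ?N borel uminus"
    by (rule real_distribution_distr) simp
  have "char (distr ?N borel uminus) t = char ?N t" for t
  proof -
    have "char (distr ?N borel uminus) t = char ?N (- t)"
      unfolding char_def by (subst integral_distr) simp_all
    then show ?thesis by (simp add: char_std_normal_distribution)
  qed
  then have eq: "distr ?N borel uminus = ?N"
    by (intro Levy_uniqueness U.real_distribution_axioms real_distribution_axioms) auto
  have "Phi (- x) = measure (distr ?N borel uminus) {..- x}" unfolding eq by (simp add: Phi_def cdf_def)
  also have "\<dots> = measure ?N {x..}"
    by (subst measure_distr) (auto intro!: arg_cong[of _ _ "measure ?N"])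
  also have "\<dots> = measure ?N (space ?N) - measure ?N {..<x}"
    by (subst finite_measure_Diff[symmetric]) (auto intro!: arg_cong[of _ _ "measure ?N"])
  also have "measure ?N {..<x} = measure ?N {..x}"
  proof -
    have "{..x} = {..<x} \<union> {x}" by auto
    then show ?thesis using finite_measure_Union[of "{..<x}" "{x}"] by (simp add: std_normal_singleton)
  qed
  finally show ?thesis using prob_space by (simp add: Phi_def cdf_def)
qed

text \<open>The threshold \<open>y d\<close> moves and is merely bounded, so pointwise convergence
  of distribution functions is not enough. It is used at finitely many grid points of a mesh fine
  for the uniform continuity of \<open>Phi\<close>; monotonicity in the threshold covers the rest,
  and neighbouring grid points absorb the perturbation \<open>R\<close>.\<close>

lemma (in prob_space) normal_tail_limit:
  assumes Z: "\<And>d. Z d \<in> borel_measurable M"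
    and ch: "\<And>t. (\<lambda>d. expectation (\<lambda>x. iexp (t * Z d x))) \<longlonglongrightarrow> complex_of_real (exp (- (t\<^sup>2) / 2))"
    and R: "oP M R" and y: "\<And>d. \<bar>y d\<bar> \<le> B"
  shows "(\<lambda>d. prob {x \<in> space M. y d < Z d x + R d x} - Phi (- y d)) \<longlonglongrightarrow> 0"
proof (rule tendstoI)
  fix \<eta> :: real assume eta: "0 < \<eta>"
  have [measurable]: "Z d \<in> borel_measurable M" "R d \<in> borel_measurable M" for d
    using Z oP_measurable[OF R] by auto
  have "weak_conv_m (\<lambda>d. distr M borel (Z d)) std_normal_distribution"
  proof (rule levy_continuity)
    show "real_distribution (distr M borel (Z d))" for d by (rule real_distribution_distr) (rule Z)
    show "(\<lambda>d. char (distr M borel (Z d)) t) \<longlonglongrightarrow> char std_normal_distribution t" for t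
      using ch[of t] by (simp add: char_std_normal_distribution char_def integral_distr)
  qed (rule real_dist_normal_dist)
  then have lim: "(\<lambda>d. prob {x \<in> space M. Z d x \<le> u}) \<longlonglongrightarrow> Phi u" for u
  proof -
    have "cdf (distr M borel (Z d)) u = prob {x \<in> space M. Z d x \<le> u}" for d
      by (subst cdf_def, subst measure_distr) (auto intro!: arg_cong[of _ _ prob])
    moreover have "(\<lambda>d. cdf (distr M borel (Z d)) u) \<longlonglongrightarrow> Phi u"
      using \<open>weak_conv_m _ _\<close> isCont_Phi[of u] unfolding weak_conv_m_def weak_conv_def Phi_def by blast
    ultimately show ?thesis by simp
  qed
  have "uniformly_continuous_on {- B - 1..B + 1} Phi"
    by (intro compact_uniformly_continuous continuous_at_imp_continuous_on) (auto intro: isCont_Phi)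
  then obtain \<delta>0 where d0: "0 < \<delta>0" "\<And>u v. u \<in> {- B - 1..B + 1} \<Longrightarrow> v \<in> {- B - 1..B + 1} \<Longrightarrow> \<bar>u - v\<bar> < \<delta>0 \<Longrightarrow> \<bar>Phi u - Phi v\<bar> < \<eta> / 3"
    using eta unfolding uniformly_continuous_on_def dist_real_def
    by (metis divide_pos_pos zero_less_numeral)
  define \<delta> where "\<delta> = min \<delta>0 1 / 4"
  have \<delta>: "0 < \<delta>" "4 * \<delta> \<le> \<delta>0" "4 * \<delta> \<le> 1" using d0 by (auto simp: \<delta>_def)
  \<comment> \<open>The range is widened by one step below and two above, so that it contains the
    grid points on both sides of any admissible \<open>y d\<close>.\<close>
  define G where "G = (\<lambda>j::int. \<delta> * real_of_int j) ` {\<lfloor>- B / \<delta>\<rfloor> - 1..\<lfloor>B / \<delta>\<rfloor> + 2}"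
  have "\<forall>\<^sub>F d in sequentially. \<forall>g\<in>G. \<bar>prob {x \<in> space M. Z d x \<le> g} - Phi g\<bar> < \<eta> / 3"
  proof (rule eventually_ball_finite)
    show "\<forall>g\<in>G. \<forall>\<^sub>F d in sequentially. \<bar>prob {x \<in> space M. Z d x \<le> g} - Phi g\<bar> < \<eta> / 3"
      using tendstoD[OF lim, of "\<eta> / 3"] eta by (simp add: dist_real_def)
  qed (simp add: G_def)
  moreover have "\<forall>\<^sub>F d in sequentially. prob {x \<in> space M. \<delta> < \<bar>R d x\<bar>} < \<eta> / 3"
    using R \<delta> eta unfolding oP_def by (intro order_tendstoD(2)) auto
  ultimately show "\<forall>\<^sub>F d in sequentially. dist (prob {x \<in> space M. y d < Z d x + R d x} - Phi (- y d)) 0 < \<eta>"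
  proof eventually_elim
    case (elim d)
    define j where "j = \<lfloor>y d / \<delta>\<rfloor>"
    \<comment> \<open>These lie at distance between \<delta> and \<open>2 * \<delta>\<close> from
      \<open>y d\<close>: far enough to absorb \<open>\<bar>R d x\<bar> \<le> \<delta>\<close>, near
      enough for uniform continuity.\<close>
    define a b where "a = \<delta> * real_of_int (j - 1)" and "b = \<delta> * real_of_int (j + 2)"
    have "real_of_int j \<le> y d / \<delta>" "y d / \<delta> < real_of_int j + 1" unfolding j_def by linarith+
    then have j: "\<delta> * real_of_int j \<le> y d" "y d < \<delta> * real_of_int j + \<delta>"
      using \<delta>(1) by (simp_all add: field_simps)
    have ab: "y d - 2 * \<delta> \<le> a" "a \<le> y d - \<delta>" "y d + \<delta> \<le> b" "b \<le> y d + 2 * \<delta>"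
      using j by (simp_all add: a_def b_def algebra_simps)
    have "- B / \<delta> \<le> y d / \<delta>" "y d / \<delta> \<le> B / \<delta>"
      using y[of d] \<delta>(1) by (intro divide_right_mono; simp add: abs_le_iff)+
    then have "\<lfloor>- B / \<delta>\<rfloor> \<le> j" "j \<le> \<lfloor>B / \<delta>\<rfloor>" unfolding j_def by (auto intro: floor_mono)
    then have G: "a \<in> G" "b \<in> G" unfolding a_def b_def G_def by (intro imageI; simp)+
    have rng: "a \<in> {- B - 1..B + 1}" "b \<in> {- B - 1..B + 1}" "y d \<in> {- B - 1..B + 1}"
      using y[of d] ab \<delta> by (auto simp: abs_le_iff)
    have Pa: "\<bar>Phi a - Phi (y d)\<bar> < \<eta> / 3" and Pb: "\<bar>Phi b - Phi (y d)\<bar> < \<eta> / 3"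
      using ab \<delta> by (intro d0(2) rng; simp add: abs_less_iff)+
    have Fa: "\<bar>prob {x \<in> space M. Z d x \<le> a} - Phi a\<bar> < \<eta> / 3"
      and Fb: "\<bar>prob {x \<in> space M. Z d x \<le> b} - Phi b\<bar> < \<eta> / 3"
      using elim(1) G by blast+
    have compl: "prob {x \<in> space M. u < Z d x} = 1 - prob {x \<in> space M. Z d x \<le> u}" for u
      by (subst prob_compl[symmetric]) (auto intro!: arg_cong[of _ _ prob])
    have "prob {x \<in> space M. y d < Z d x + R d x} \<le> prob ({x \<in> space M. a < Z d x} \<union> {x \<in> space M. \<delta> < \<bar>R d x\<bar>})"
      using ab by (intro finite_measure_mono) auto
    also have "\<dots> \<le> prob {x \<in> space M. a < Z d x} + prob {x \<in> space M. \<delta> < \<bar>R d x\<bar>}"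
      by (intro measure_Un_le) auto
    finally have up: "prob {x \<in> space M. y d < Z d x + R d x} < (1 - Phi (y d)) + \<eta>"
      using elim(2) Fa Pa unfolding compl by linarith
    have "prob {x \<in> space M. b < Z d x} \<le> prob ({x \<in> space M. y d < Z d x + R d x} \<union> {x \<in> space M. \<delta> < \<bar>R d x\<bar>})"
      using ab by (intro finite_measure_mono) auto
    also have "\<dots> \<le> prob {x \<in> space M. y d < Z d x + R d x} + prob {x \<in> space M. \<delta> < \<bar>R d x\<bar>}"
      by (intro measure_Un_le) auto
    finally have lo: "(1 - Phi (y d)) - \<eta> < prob {x \<in> space M. y d < Z d x + R d x}"
      using elim(2) Fb Pb unfolding compl by linarith
    show ?case using up lo by (simp add: Phi_minus abs_less_iff)
  qed
qed

section \<open>Linearisation of the statistics\<close>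

text \<open>The deviation is measured from the fixed limit \<open>x0\<close> and not from the mean,
  so the bias of \<open>p d\<close> is included.\<close>

definition rate :: "'a measure \<Rightarrow> (nat \<Rightarrow> 'a \<Rightarrow> real) \<Rightarrow> real \<Rightarrow> bool" where
  "rate M p x0 \<longleftrightarrow> (\<forall>d. p d \<in> borel_measurable M) \<and>
     (\<exists>C. \<forall>\<^sub>F d in sequentially. square_integrable M (\<lambda>\<omega>. p d \<omega> - x0) \<and>
        (\<integral>\<omega>. (p d \<omega> - x0)\<^sup>2 \<partial>M) \<le> C / real d)"

text \<open>Continuity settles \<open>{-1..1}\<close>. Outside, \<open>arccos\<close> is a
  description that nothing satisfies, hence one fixed value.\<close>

lemma arccos_measurable: "(arccos :: real \<Rightarrow> real) \<in> borel_measurable borel"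
proof -
  have out: "arccos y = (THE x. False)" if "y \<notin> {-1..1}" for y :: real
  proof -
    have "(\<lambda>x. 0 \<le> x \<and> x \<le> pi \<and> cos x = y) = (\<lambda>x. False)"
      using that by (auto simp: fun_eq_iff)
    then show ?thesis unfolding arccos_def by simp
  qed
  have "(\<lambda>x. indicator {-1..1} x *\<^sub>R arccos x) \<in> borel_measurable borel"
    by (rule borel_measurable_continuous_on_indicator) (auto intro: continuous_on_arccos')
  then have "(\<lambda>x. indicator {-1..1} x *\<^sub>R arccos x + indicator (- {-1..1}) x *\<^sub>R (THE x::real. False)) \<in> borel_measurable borel"
    by measurable
  moreover have "indicator {-1..1} x *\<^sub>R arccos x + indicator (- {-1..1}) x *\<^sub>R (THE x::real. False) = arccos x" for x :: real
    using out[of x] by (auto simp: indicator_def)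
  ultimately show ?thesis by simp
qed

context prob_space
begin

lemma rate_measurable: "rate M p x0 \<Longrightarrow> p d \<in> borel_measurable M"
  by (simp add: rate_def)

lemma rate_add:
  assumes "rate M p x0" "rate M q y0"
  shows "rate M (\<lambda>d \<omega>. p d \<omega> + q d \<omega>) (x0 + y0)"
proof -
  obtain C where C: "\<forall>\<^sub>F d in sequentially. square_integrable M (\<lambda>\<omega>. p d \<omega> - x0) \<and> expectation (\<lambda>\<omega>. (p d \<omega> - x0)\<^sup>2) \<le> C / real d"
    using assms(1) by (auto simp: rate_def)
  obtain D where D: "\<forall>\<^sub>F d in sequentially. square_integrable M (\<lambda>\<omega>. q d \<omega> - y0) \<and> expectation (\<lambda>\<omega>. (q d \<omega> - y0)\<^sup>2) \<le> D / real d"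
    using assms(2) by (auto simp: rate_def)
  have "\<forall>\<^sub>F d in sequentially. square_integrable M (\<lambda>\<omega>. p d \<omega> + q d \<omega> - (x0 + y0)) \<and>
      expectation (\<lambda>\<omega>. (p d \<omega> + q d \<omega> - (x0 + y0))\<^sup>2) \<le> (2 * C + 2 * D) / real d"
    using C D
  proof eventually_elim
    case (elim d)
    let ?u = "\<lambda>\<omega>. p d \<omega> - x0" and ?v = "\<lambda>\<omega>. q d \<omega> - y0"
    have eq: "p d \<omega> + q d \<omega> - (x0 + y0) = ?u \<omega> + ?v \<omega>" for \<omega> by simp
    have s: "square_integrable M (\<lambda>\<omega>. ?u \<omega> + ?v \<omega>)" using elim by (intro square_integrable_add) auto
    have "expectation (\<lambda>\<omega>. (?u \<omega> + ?v \<omega>)\<^sup>2) \<le> expectation (\<lambda>\<omega>. 2 * (?u \<omega>)\<^sup>2 + 2 * (?v \<omega>)\<^sup>2)"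
    proof (intro integral_mono)
      show "integrable M (\<lambda>\<omega>. (?u \<omega> + ?v \<omega>)\<^sup>2)" using s by (simp add: square_integrable_def)
      show "integrable M (\<lambda>\<omega>. 2 * (?u \<omega>)\<^sup>2 + 2 * (?v \<omega>)\<^sup>2)" using elim by (simp add: square_integrable_def)
      have "(a + b)\<^sup>2 \<le> 2 * a\<^sup>2 + 2 * b\<^sup>2" for a b :: real
        using zero_le_power2[of "a - b"] by (simp add: power2_eq_square algebra_simps)
      then show "(?u \<omega> + ?v \<omega>)\<^sup>2 \<le> 2 * (?u \<omega>)\<^sup>2 + 2 * (?v \<omega>)\<^sup>2" for \<omega> by blast
    qed
    also have "\<dots> = 2 * expectation (\<lambda>\<omega>. (?u \<omega>)\<^sup>2) + 2 * expectation (\<lambda>\<omega>. (?v \<omega>)\<^sup>2)"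
      using elim by (simp add: square_integrable_def)
    also have "\<dots> \<le> 2 * (C / real d) + 2 * (D / real d)" using elim by (intro add_mono mult_left_mono) auto
    finally show ?case using s unfolding eq by (simp add: add_divide_distrib)
  qed
  moreover have [measurable]: "p d \<in> borel_measurable M" "q d \<in> borel_measurable M" for d
    using assms by (auto intro: rate_measurable)
  have "(\<lambda>\<omega>. p d \<omega> + q d \<omega>) \<in> borel_measurable M" for d by measurable
  ultimately show ?thesis unfolding rate_def by blast
qed

lemma rate_mult_bounded:
  assumes p: "rate M p 0" and c: "\<forall>\<^sub>F d in sequentially. \<bar>c d\<bar> \<le> (K::real)"
  shows "rate M (\<lambda>d \<omega>. c d * p d \<omega>) 0"
proof -
  obtain C where C: "\<forall>\<^sub>F d in sequentially. square_integrable M (\<lambda>\<omega>. p d \<omega> - 0) \<and> expectation (\<lambda>\<omega>. (p d \<omega> - 0)\<^sup>2) \<le> C / real d"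
    using p by (auto simp: rate_def)
  have "\<forall>\<^sub>F d in sequentially. square_integrable M (\<lambda>\<omega>. c d * p d \<omega> - 0) \<and>
      expectation (\<lambda>\<omega>. (c d * p d \<omega> - 0)\<^sup>2) \<le> (K\<^sup>2 * C) / real d"
    using C c
  proof eventually_elim
    case (elim d)
    have K: "(c d)\<^sup>2 \<le> K\<^sup>2" using elim(2) power_mono[of "\<bar>c d\<bar>" K 2] by simp
    have "expectation (\<lambda>\<omega>. (c d * p d \<omega> - 0)\<^sup>2) = (c d)\<^sup>2 * expectation (\<lambda>\<omega>. (p d \<omega>)\<^sup>2)"
      using elim by (simp add: power_mult_distrib)
    also have "\<dots> \<le> K\<^sup>2 * (C / real d)"
      using elim K by (intro mult_mono) auto
    finally show ?case using elim square_integrable_cmult[of M "p d" "c d"] by simp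
  qed
  moreover have [measurable]: "p d \<in> borel_measurable M" for d
    using p by (rule rate_measurable)
  have "(\<lambda>\<omega>. c d * p d \<omega>) \<in> borel_measurable M" for d by measurable
  ultimately show ?thesis unfolding rate_def by blast
qed

lemma rate_shift:
  assumes "rate M p x0" shows "rate M (\<lambda>d \<omega>. p d \<omega> + c) (x0 + c)"
proof -
  have [measurable]: "p d \<in> borel_measurable M" for d using assms by (rule rate_measurable)
  have "(\<lambda>\<omega>. p d \<omega> + c) \<in> borel_measurable M" for d by measurable
  then show ?thesis using assms unfolding rate_def add_diff_cancel_right by blast
qed

lemma rate_centred:
  assumes "rate M p x0" shows "rate M (\<lambda>d \<omega>. p d \<omega> - x0) 0"
  using rate_shift[OF assms, of "- x0"] by simp

lemma delta_method_1:
  assumes p: "rate M p x0" and f: "(f has_real_derivative D) (at x0)" and [measurable]: "f \<in> borel_measurable borel"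
  shows "oP M (\<lambda>d \<omega>. sqrt (real d) * (f (p d \<omega>) - f x0 - D * (p d \<omega> - x0)))"
proof -
  have [measurable]: "p d \<in> borel_measurable M" for d by (rule rate_measurable[OF p])
  obtain C where C: "\<forall>\<^sub>F d in sequentially. square_integrable M (\<lambda>\<omega>. p d \<omega> - x0) \<and> expectation (\<lambda>\<omega>. (p d \<omega> - x0)\<^sup>2) \<le> C / real d"
    using p by (auto simp: rate_def)
  show ?thesis
  proof (rule delta_method[where f' = "(*) D"])
    show "(f has_derivative (*) D) (at x0)" using f by (simp add: has_field_derivative_def)
    show "\<forall>\<^sub>F d in sequentially. square_integrable M (\<lambda>\<omega>. norm (p d \<omega> - x0)) \<and>
       expectation (\<lambda>\<omega>. (norm (p d \<omega> - x0))\<^sup>2) \<le> C / real d"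
      using C by eventually_elim (auto simp: square_integrable_def)
  qed measurable
qed

lemma delta_method_3:
  fixes f :: "real \<times> real \<times> real \<Rightarrow> real"
  assumes p: "rate M p x0" and q: "rate M q y0" and r: "rate M r z0"
    and f: "(f has_derivative f') (at (x0, y0, z0))" and [measurable]: "f \<in> borel_measurable borel"
  shows "oP M (\<lambda>d \<omega>. sqrt (real d) * (f (p d \<omega>, q d \<omega>, r d \<omega>) - f (x0, y0, z0) - f' (p d \<omega> - x0, q d \<omega> - y0, r d \<omega> - z0)))"
proof -
  have [measurable]: "p d \<in> borel_measurable M" "q d \<in> borel_measurable M" "r d \<in> borel_measurable M" for d
    using rate_measurable[OF p] rate_measurable[OF q] rate_measurable[OF r] by auto
  have [measurable]: "f' \<in> borel_measurable borel"
    using has_derivative_bounded_linear[OF f] by (intro borel_measurable_continuous_onI linear_continuous_on)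
  have [measurable]: "(\<lambda>\<omega>. (p d \<omega>, q d \<omega>, r d \<omega>)) \<in> borel_measurable M"
    "(\<lambda>\<omega>. (p d \<omega> - x0, q d \<omega> - y0, r d \<omega> - z0)) \<in> borel_measurable M" for d
    by (intro borel_measurable_Pair; measurable)+
  obtain C where C: "\<forall>\<^sub>F d in sequentially. square_integrable M (\<lambda>\<omega>. p d \<omega> - x0) \<and> expectation (\<lambda>\<omega>. (p d \<omega> - x0)\<^sup>2) \<le> C / real d"
    using p by (auto simp: rate_def)
  obtain C' where C': "\<forall>\<^sub>F d in sequentially. square_integrable M (\<lambda>\<omega>. q d \<omega> - y0) \<and> expectation (\<lambda>\<omega>. (q d \<omega> - y0)\<^sup>2) \<le> C' / real d"
    using q by (auto simp: rate_def)
  obtain C'' where C'': "\<forall>\<^sub>F d in sequentially. square_integrable M (\<lambda>\<omega>. r d \<omega> - z0) \<and> expectation (\<lambda>\<omega>. (r d \<omega> - z0)\<^sup>2) \<le> C'' / real d"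
    using r by (auto simp: rate_def)
  have nrm: "(norm (a, b, c))\<^sup>2 = a\<^sup>2 + b\<^sup>2 + c\<^sup>2" for a b c :: real
    by (simp add: norm_Pair)
  have "oP M (\<lambda>d \<omega>. sqrt (real d) * (f (p d \<omega>, q d \<omega>, r d \<omega>) - f (x0, y0, z0) - f' ((p d \<omega>, q d \<omega>, r d \<omega>) - (x0, y0, z0))))"
  proof (rule delta_method[OF f])
    show "\<forall>\<^sub>F d in sequentially. square_integrable M (\<lambda>\<omega>. norm ((p d \<omega>, q d \<omega>, r d \<omega>) - (x0, y0, z0))) \<and>
       expectation (\<lambda>\<omega>. (norm ((p d \<omega>, q d \<omega>, r d \<omega>) - (x0, y0, z0)))\<^sup>2) \<le> (C + C' + C'') / real d"
      using C C' C''
    proof eventually_elim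
      case (elim d)
      have i: "integrable M (\<lambda>\<omega>. (p d \<omega> - x0)\<^sup>2)" "integrable M (\<lambda>\<omega>. (q d \<omega> - y0)\<^sup>2)" "integrable M (\<lambda>\<omega>. (r d \<omega> - z0)\<^sup>2)"
        using elim by (auto simp: square_integrable_def)
      have "(\<lambda>\<omega>. norm (p d \<omega> - x0, q d \<omega> - y0, r d \<omega> - z0)) \<in> borel_measurable M" by measurable
      then show ?case
        using i elim by (simp add: square_integrable_def nrm add_divide_distrib)
    qed
  qed (simp, measurable)
  then show ?thesis by simp
qed

end

text \<open>The law of cosines: \<open>p\<close> and \<open>q\<close> are the squared sides at the
  vertex and \<open>r\<close> the squared opposite side. At equal sides the cosine is
  \<open>1 / 2\<close>, where \<open>arccos\<close> has slope \<open>- (2 / sqrt 3)\<close>. Hence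
  \<open>- sqrt 3 * s\<close> times the angle has the linear part
  \<open>(h + k) / 4 - l / 2\<close>.\<close>

lemma has_derivative_angle:
  assumes s: "0 < s"
  shows "((\<lambda>(p, q, r). arccos (((p + q - r) / 2) / (sqrt p * sqrt q))) has_derivative
     (\<lambda>(h, k, l). - (2 / sqrt 3) * ((h + k - l) / (4 * s) - (h + k) / (8 * s)))) (at (2 * s, 2 * s, 2 * s))"
proof -
  let ?g = "\<lambda>z::real \<times> real \<times> real. ((fst z + fst (snd z) - snd (snd z)) / 2) / (sqrt (fst z) * sqrt (fst (snd z)))"
  have sq: "sqrt (2 * s) * sqrt (2 * s) = 2 * s" using s by simp
  have g0: "?g (2 * s, 2 * s, 2 * s) = 1 / 2" using s sq by simp
  have g: "(?g has_derivative (\<lambda>(h, k, l). (h + k - l) / (4 * s) - (h + k) / (8 * s))) (at (2 * s, 2 * s, 2 * s))"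
    by (rule has_derivative_eq_rhs, (rule derivative_eq_intros refl | (use s in simp; fail))+)
      (use s sq in \<open>auto simp: fun_eq_iff field_simps\<close>)
  have "(arccos has_real_derivative inverse (- sqrt (1 - (1 / 2)\<^sup>2))) (at (1 / 2))"
    by (rule DERIV_arccos) auto
  moreover have "inverse (- sqrt (1 - (1 / 2 :: real)\<^sup>2)) = - (2 / sqrt 3)"
  proof -
    have "1 - (1 / 2 :: real)\<^sup>2 = 3 / 4" by (simp add: power2_eq_square)
    then show ?thesis by (simp only: real_sqrt_divide) simp
  qed
  ultimately have "(arccos has_derivative (*) (- (2 / sqrt 3))) (at (?g (2 * s, 2 * s, 2 * s)))"
    unfolding g0 by (simp add: has_field_derivative_def)
  from has_derivative_compose[OF g this] show ?thesis
    by (simp add: case_prod_beta')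
qed

text \<open>The numerator vanishes at the base point, so fluctuations of the two norms do not enter
  at first order.\<close>

lemma has_derivative_cosine:
  assumes s: "0 < s"
  shows "((\<lambda>(p, q, r). p / (sqrt q * sqrt r)) has_derivative (\<lambda>(h, k, l). h / (2 * s))) (at (0, 2 * s, 2 * s))"
proof -
  have sq: "sqrt (2 * s) * sqrt (2 * s) = 2 * s" using s by simp
  have "((\<lambda>z::real \<times> real \<times> real. fst z / (sqrt (fst (snd z)) * sqrt (snd (snd z)))) has_derivative (\<lambda>(h, k, l). h / (2 * s))) (at (0, 2 * s, 2 * s))"
    by (rule has_derivative_eq_rhs, (rule derivative_eq_intros refl | (use s in simp; fail))+)
      (use s sq in \<open>auto simp: fun_eq_iff field_simps\<close>)
  then show ?thesis by (simp add: case_prod_beta')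
qed

section \<open>Averages over pairs\<close>

definition sqdist :: "nat \<Rightarrow> (nat \<Rightarrow> real) \<Rightarrow> (nat \<Rightarrow> real) \<Rightarrow> real" where
  "sqdist d u v = (vnorm d (vdiff u v))\<^sup>2"

lemma sqdist_eq: "sqdist d u v = (\<Sum>k\<in>{1..d}. (u k - v k)\<^sup>2)"
  by (simp add: sqdist_def vnorm_def vdiff_def L2_set_def sum_nonneg)

lemma sqdist_commute: "sqdist d u v = sqdist d v u"
  by (simp add: sqdist_eq power2_commute)

lemma vnorm_eq: "vnorm d (vdiff u v) = sqrt (sqdist d u v)"
  by (simp add: sqdist_def vnorm_def)

text \<open>Polarisation. It turns every statistic into a function of squared interpoint
  distances.\<close>

lemma vdot_cross:
  "vdot d (vdiff a b) (vdiff a' b') = (sqdist d a b' + sqdist d a' b - sqdist d a a' - sqdist d b b') / 2"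
  unfolding sqdist_eq vdot_def vdiff_def
  unfolding sum.distrib[symmetric] sum_subtractf[symmetric] sum_divide_distrib
  by (intro sum.cong refl) (simp add: power2_eq_square field_simps)

lemma vdot_corner:
  "vdot d (vdiff a c) (vdiff b c) = (sqdist d a c + sqdist d b c - sqdist d a b) / 2"
  unfolding vdot_cross using sqdist_eq[of d c c] by simp

lemma neq_pairs_Sigma: "neq_pairs n = Sigma {1..n} (\<lambda>i. {1..n} - {i})"
  by (auto simp: neq_pairs_def)

lemma finite_neq_pairs [simp]: "finite (neq_pairs n)"
  by (simp add: neq_pairs_Sigma)

lemma sum_neq_pairs_fst: "(\<Sum>(i, i')\<in>neq_pairs n. f i) = (real n - 1) * (\<Sum>i\<in>{1..n}. f i)"
  unfolding neq_pairs_Sigma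
  by (subst sum.Sigma[symmetric]) (auto simp: sum_distrib_left of_nat_diff intro!: sum.cong)

lemma sum_neq_pairs_swap: "(\<Sum>(i, i')\<in>neq_pairs n. f i i') = (\<Sum>(i, i')\<in>neq_pairs n. f i' i)"
  by (rule sum.reindex_bij_witness[of _ "\<lambda>(i, j). (j, i)" "\<lambda>(i, j). (j, i)"]) (auto simp: neq_pairs_def)

lemma sum_neq_pairs_snd: "(\<Sum>(i, i')\<in>neq_pairs n. f i') = (real n - 1) * (\<Sum>i\<in>{1..n}. f i)"
  using sum_neq_pairs_swap[of "\<lambda>i i'. f i'" n] sum_neq_pairs_fst[of f n] by simp

lemma sum_neq_pairs_const: "(\<Sum>p\<in>neq_pairs n. c) = real n * (real n - 1) * c"
  using sum_neq_pairs_fst[of "\<lambda>_. c" n] by (simp add: case_prod_beta mult_ac)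

definition cross_avg :: "nat \<Rightarrow> nat \<Rightarrow> (nat \<Rightarrow> nat \<Rightarrow> real) \<Rightarrow> real" where
  "cross_avg m n f = 1 / (real m * real n) * (\<Sum>i\<in>{1..m}. \<Sum>j\<in>{1..n}. f i j)"

definition pair_avg :: "nat \<Rightarrow> (nat \<Rightarrow> nat \<Rightarrow> real) \<Rightarrow> real" where
  "pair_avg n f = 1 / (real n * (real n - 1)) * (\<Sum>(i, i')\<in>neq_pairs n. f i i')"

definition quad_avg :: "nat \<Rightarrow> nat \<Rightarrow> (nat \<Rightarrow> nat \<Rightarrow> nat \<Rightarrow> nat \<Rightarrow> real) \<Rightarrow> real" where
  "quad_avg m n f = c_mn m n * (\<Sum>(i1, i2)\<in>neq_pairs m. \<Sum>(j1, j2)\<in>neq_pairs n. f i1 i2 j1 j2)"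

lemma quad_avg_add: "quad_avg m n (\<lambda>i i' j j'. f i i' j j' + g i i' j j') = quad_avg m n f + quad_avg m n g"
  by (simp add: quad_avg_def case_prod_beta sum.distrib distrib_left)

lemma quad_avg_diff: "quad_avg m n (\<lambda>i i' j j'. f i i' j j' - g i i' j j') = quad_avg m n f - quad_avg m n g"
  by (simp add: quad_avg_def case_prod_beta sum_subtractf right_diff_distrib)

lemma quad_avg_cmult: "quad_avg m n (\<lambda>i i' j j'. c * f i i' j j') = c * quad_avg m n f"
  by (simp add: quad_avg_def case_prod_beta flip: sum_distrib_left)

lemma cross_avg_add: "cross_avg m n (\<lambda>i j. f i j + g i j) = cross_avg m n f + cross_avg m n g"
  by (simp add: cross_avg_def sum.distrib distrib_left)

lemma cross_avg_cmult: "cross_avg m n (\<lambda>i j. c * f i j) = c * cross_avg m n f"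
  by (simp add: cross_avg_def flip: sum_distrib_left)

lemma pair_avg_add: "pair_avg n (\<lambda>i j. f i j + g i j) = pair_avg n f + pair_avg n g"
  by (simp add: pair_avg_def case_prod_beta sum.distrib distrib_left)

lemma pair_avg_cmult: "pair_avg n (\<lambda>i j. c * f i j) = c * pair_avg n f"
  by (simp add: pair_avg_def case_prod_beta flip: sum_distrib_left)

context
  fixes m n :: nat assumes mn: "m \<ge> 2" "n \<ge> 2"
begin

lemma cross_avg_const: "cross_avg m n (\<lambda>_ _. c) = c"
  using mn by (simp add: cross_avg_def)

lemma pair_avg_const: "pair_avg m (\<lambda>_ _. c) = c"
  using mn by (simp add: pair_avg_def case_prod_beta sum_neq_pairs_const del: sum_constant)

lemma quad_avg_cross:
  "quad_avg m n (\<lambda>i i' j j'. f i j) = cross_avg m n f"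
  "quad_avg m n (\<lambda>i i' j j'. f i j') = cross_avg m n f"
  "quad_avg m n (\<lambda>i i' j j'. f i' j) = cross_avg m n f"
  "quad_avg m n (\<lambda>i i' j j'. f i' j') = cross_avg m n f"
proof -
  have c: "c_mn m n * ((real m - 1) * ((real n - 1) * S)) = 1 / (real m * real n) * S" for S
    using mn by (simp add: c_mn_def)
  show "quad_avg m n (\<lambda>i i' j j'. f i j) = cross_avg m n f"
    "quad_avg m n (\<lambda>i i' j j'. f i j') = cross_avg m n f"
    "quad_avg m n (\<lambda>i i' j j'. f i' j) = cross_avg m n f"
    "quad_avg m n (\<lambda>i i' j j'. f i' j') = cross_avg m n f"
    unfolding quad_avg_def cross_avg_def sum_neq_pairs_fst sum_neq_pairs_snd
      sum_neq_pairs_fst[of "\<lambda>i. (real n - 1) * (\<Sum>j\<in>{1..n}. f i j)"]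
      sum_neq_pairs_snd[of "\<lambda>i. (real n - 1) * (\<Sum>j\<in>{1..n}. f i j)"]
      sum_distrib_left[symmetric] by (rule c)+
qed

lemma quad_avg_pairs:
  "quad_avg m n (\<lambda>i i' j j'. f i i') = pair_avg m f"
  "quad_avg m n (\<lambda>i i' j j'. g j j') = pair_avg n g"
proof -
  have "c_mn m n * (real n * (real n - 1) * S) = 1 / (real m * (real m - 1)) * S"
    "c_mn m n * (real m * (real m - 1) * S) = 1 / (real n * (real n - 1)) * S" for S
    using mn by (simp_all add: c_mn_def)
  then show "quad_avg m n (\<lambda>i i' j j'. f i i') = pair_avg m f"
    "quad_avg m n (\<lambda>i i' j j'. g j j') = pair_avg n g"
    by (simp_all add: quad_avg_def pair_avg_def case_prod_beta sum_neq_pairs_const del: sum_constant flip: sum_distrib_left)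
qed

end

section \<open>First-order remainders of the five statistics\<close>

context prob_space
begin

lemma oP_cross_avg:
  assumes "\<And>i j. i \<in> {1..m} \<Longrightarrow> j \<in> {1..n} \<Longrightarrow> oP M (R i j)"
  shows "oP M (\<lambda>d \<omega>. cross_avg m n (\<lambda>i j. R i j d \<omega>))"
  unfolding cross_avg_def by (intro oP_cmult oP_sum assms)

lemma oP_pair_avg:
  assumes "\<And>i j. i \<in> {1..n} \<Longrightarrow> j \<in> {1..n} \<Longrightarrow> i \<noteq> j \<Longrightarrow> oP M (R i j)"
  shows "oP M (\<lambda>d \<omega>. pair_avg n (\<lambda>i j. R i j d \<omega>))"
  unfolding pair_avg_def case_prod_beta
  by (intro oP_cmult oP_sum assms) (auto simp: neq_pairs_def)

lemma oP_quad_avg: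
  assumes "\<And>i i' j j'. i \<in> {1..m} \<Longrightarrow> i' \<in> {1..m} \<Longrightarrow> i \<noteq> i' \<Longrightarrow> j \<in> {1..n} \<Longrightarrow> j' \<in> {1..n} \<Longrightarrow> j \<noteq> j' \<Longrightarrow>
      oP M (R i i' j j')"
  shows "oP M (\<lambda>d \<omega>. quad_avg m n (\<lambda>i i' j j'. R i i' j j' d \<omega>))"
  unfolding quad_avg_def case_prod_beta
  by (intro oP_cmult oP_sum assms) (auto simp: neq_pairs_def)

text \<open>The tangent of the square root at \<open>2 * s\<close>, with the normalisation of the
  energy statistic making the slope in the squared distance exactly \<open>1 / 2\<close>. The
  constant \<open>real d * s\<close> is the same for all pairs.\<close>

lemma distance_remainder:
  assumes p: "rate M p (2 * s)" and s: "0 < s"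
  shows "oP M (\<lambda>d \<omega>. (sqrt (2 * real d) * sqrt s * sqrt (real d * p d \<omega>) - real d * p d \<omega> / 2 - real d * s) / sqrt (real d))"
proof (rule oP_cong)
  have [measurable]: "p d \<in> borel_measurable M" for d by (rule rate_measurable[OF p])
  have "(sqrt has_real_derivative inverse (sqrt (2 * s)) / 2) (at (2 * s))"
    by (rule DERIV_real_sqrt) (use s in simp)
  from oP_cmult[OF delta_method_1[OF p this], of "sqrt (2 * s)"]
  show "oP M (\<lambda>d \<omega>. sqrt (2 * s) * (sqrt (real d) * (sqrt (p d \<omega>) - sqrt (2 * s) - inverse (sqrt (2 * s)) / 2 * (p d \<omega> - 2 * s))))"
    by simp
  show "(\<lambda>\<omega>. (sqrt (2 * real d) * sqrt s * sqrt (real d * p d \<omega>) - real d * p d \<omega> / 2 - real d * s) / sqrt (real d)) \<in> borel_measurable M" for d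
    by measurable
  show "\<forall>\<^sub>F d in sequentially. \<forall>\<omega>\<in>space M.
      (sqrt (2 * real d) * sqrt s * sqrt (real d * p d \<omega>) - real d * p d \<omega> / 2 - real d * s) / sqrt (real d) =
      sqrt (2 * s) * (sqrt (real d) * (sqrt (p d \<omega>) - sqrt (2 * s) - inverse (sqrt (2 * s)) / 2 * (p d \<omega> - 2 * s)))"
    using eventually_gt_at_top[of 0]
  proof eventually_elim
    case (elim d)
    define r t where "r = sqrt (real d)" and "t = sqrt (2 * s)"
    have r: "0 < r" "real d = r * r" and t: "0 < t" "2 * s = t * t" using elim s by (auto simp: r_def t_def)
    have e: "sqrt (2 * real d) * sqrt s = r * t" by (simp add: r_def t_def real_sqrt_mult)
    have e': "sqrt (real d * u) = r * sqrt u" for u by (simp add: r_def real_sqrt_mult)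
    have s': "s = t * t / 2" using t by simp
    have key: "(r * t * (r * u) - r * r * v / 2 - r * r * s) / r = t * (r * (u - t - inverse t / 2 * (v - 2 * s)))" for u v
      unfolding s' using r t(1) by (simp add: field_simps)
    show ?case
    proof
      fix \<omega>
      show "(sqrt (2 * real d) * sqrt s * sqrt (real d * p d \<omega>) - real d * p d \<omega> / 2 - real d * s) / sqrt (real d) =
        sqrt (2 * s) * (sqrt (real d) * (sqrt (p d \<omega>) - sqrt (2 * s) - inverse (sqrt (2 * s)) / 2 * (p d \<omega> - 2 * s)))"
        unfolding e e' r_def[symmetric] t_def[symmetric] by (simp only: r(2) key)
    qed
  qed
qed

text \<open>The factor \<open>exp (d * s / bw\<^sup>2)\<close> moves the exponent to
  \<open>- v\<close> with \<open>v\<close> centred at 0, where \<open>exp (- v)\<close> has tangent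
  \<open>1 - v\<close>. Both halves of the order condition on \<open>bw\<^sup>2\<close> enter: the
  lower bound keeps \<open>d / bw\<^sup>2\<close> bounded, so that \<open>v\<close> has a rate; the
  upper bound controls the factor \<open>bw\<^sup>2 / d\<close> in front of the remainder.\<close>

lemma kernel_remainder:
  assumes p: "rate M p (2 * s)" and sd: "\<forall>\<^sub>F d in sequentially. sd d = s"
    and bw: "(\<lambda>d. (bw d)\<^sup>2) \<in> \<Theta>(\<lambda>d. real d)"
  shows "oP M (\<lambda>d \<omega>. ((bw d)\<^sup>2 * exp (real d * sd d / (bw d)\<^sup>2) * exp (- (real d * p d \<omega>) / (2 * (bw d)\<^sup>2))
      - ((bw d)\<^sup>2 + real d * s - real d * p d \<omega> / 2)) / sqrt (real d))"
proof (rule oP_cong)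
  have [measurable]: "p d \<in> borel_measurable M" for d by (rule rate_measurable[OF p])
  obtain c1 where c1: "c1 > 0" "\<forall>\<^sub>F d in sequentially. norm ((bw d)\<^sup>2) \<le> c1 * norm (real d)"
    by (rule landau_o.bigE[OF bigthetaD1[OF bw]])
  obtain c2 where c2: "c2 > 0" "\<forall>\<^sub>F d in sequentially. norm ((bw d)\<^sup>2) \<ge> c2 * norm (real d)"
    by (rule landau_omega.bigE[OF bigthetaD2[OF bw]])
  have b1: "\<forall>\<^sub>F d in sequentially. \<bar>(bw d)\<^sup>2 / real d\<bar> \<le> c1"
    using c1(2) eventually_gt_at_top[of 0] by eventually_elim (simp add: divide_le_eq)
  have b2: "\<forall>\<^sub>F d in sequentially. \<bar>real d / (2 * (bw d)\<^sup>2)\<bar> \<le> 1 / (2 * c2)"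
    using c2(2) eventually_gt_at_top[of 0]
  proof eventually_elim
    case (elim d)
    then have "0 < c2 * real d" "c2 * real d \<le> (bw d)\<^sup>2" using c2(1) by auto
    then have "0 < (bw d)\<^sup>2" by linarith
    then show ?case using \<open>c2 * real d \<le> (bw d)\<^sup>2\<close> c2(1) by (simp add: field_simps)
  qed
  let ?v = "\<lambda>d \<omega>. real d / (2 * (bw d)\<^sup>2) * (p d \<omega> - 2 * s)"
  have v: "rate M ?v 0" by (rule rate_mult_bounded[OF rate_centred[OF p] b2])
  have "((\<lambda>x::real. exp (- x)) has_real_derivative - 1) (at 0)"
    by (auto intro!: derivative_eq_intros)
  from oP_mult_bounded[OF delta_method_1[OF v this] b1]
  show "oP M (\<lambda>d \<omega>. (bw d)\<^sup>2 / real d * (sqrt (real d) * (exp (- ?v d \<omega>) - 1 + ?v d \<omega>)))"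
    by simp
  show "(\<lambda>\<omega>. ((bw d)\<^sup>2 * exp (real d * sd d / (bw d)\<^sup>2) * exp (- (real d * p d \<omega>) / (2 * (bw d)\<^sup>2))
      - ((bw d)\<^sup>2 + real d * s - real d * p d \<omega> / 2)) / sqrt (real d)) \<in> borel_measurable M" for d
    by measurable
  show "\<forall>\<^sub>F d in sequentially. \<forall>\<omega>\<in>space M.
      ((bw d)\<^sup>2 * exp (real d * sd d / (bw d)\<^sup>2) * exp (- (real d * p d \<omega>) / (2 * (bw d)\<^sup>2))
      - ((bw d)\<^sup>2 + real d * s - real d * p d \<omega> / 2)) / sqrt (real d) =
      (bw d)\<^sup>2 / real d * (sqrt (real d) * (exp (- ?v d \<omega>) - 1 + ?v d \<omega>))"
    using sd c2(2) eventually_gt_at_top[of 0]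
  proof eventually_elim
    case (elim d)
    show ?case
    proof
      fix \<omega>
      define b r where "b = (bw d)\<^sup>2" and "r = sqrt (real d)"
      have "0 < c2 * real d" using elim c2(1) by simp
      moreover have "c2 * real d \<le> (bw d)\<^sup>2" using elim(2) by simp
      ultimately have b: "0 < b" unfolding b_def by linarith
      have r: "0 < r" "real d = r * r" using elim by (auto simp: r_def)
      have "exp (real d * s / b) * exp (- (real d * p d \<omega>) / (2 * b)) = exp (- (real d / (2 * b) * (p d \<omega> - 2 * s)))"
        using b by (simp add: field_simps flip: exp_add)
      then have e: "b * exp (real d * s / b) * exp (- (real d * p d \<omega>) / (2 * b)) = b * exp (- (real d / (2 * b) * (p d \<omega> - 2 * s)))"
        by (simp add: mult.assoc)
      have "(b * E - (b + r * r * s - r * r * q / 2)) / r = b / (r * r) * (r * (E - 1 + r * r / (2 * b) * (q - 2 * s)))" for E q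
        using b r by (simp add: field_simps)
      then show "((bw d)\<^sup>2 * exp (real d * sd d / (bw d)\<^sup>2) * exp (- (real d * p d \<omega>) / (2 * (bw d)\<^sup>2))
      - ((bw d)\<^sup>2 + real d * s - real d * p d \<omega> / 2)) / sqrt (real d) =
      (bw d)\<^sup>2 / real d * (sqrt (real d) * (exp (- ?v d \<omega>) - 1 + ?v d \<omega>))"
        unfolding elim(1) b_def[symmetric] r_def[symmetric] e by (simp only: r(2))
    qed
  qed
qed

text \<open>\<open>sqrt 3 * real d * s\<close> inverts the slope of the angle at an equilateral
  triangle, so that the linear part becomes a combination of squared distances with weights
  \<open>1 / 4\<close>, \<open>1 / 4\<close> and \<open>- 1 / 2\<close>.\<close>

lemma angle_remainder:
  assumes p: "rate M p (2 * s)" and q: "rate M q (2 * s)" and r: "rate M r (2 * s)" and s: "0 < s"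
  shows "oP M (\<lambda>d \<omega>. (sqrt 3 * real d * s *
      (pi / 3 - arccos (((real d * p d \<omega> + real d * q d \<omega> - real d * r d \<omega>) / 2) / (sqrt (real d * p d \<omega>) * sqrt (real d * q d \<omega>))))
      - ((real d * p d \<omega> + real d * q d \<omega>) / 4 - real d * r d \<omega> / 2)) / sqrt (real d))"
proof (rule oP_cong)
  have [measurable]: "p d \<in> borel_measurable M" "q d \<in> borel_measurable M" "r d \<in> borel_measurable M" for d
    using rate_measurable[OF p] rate_measurable[OF q] rate_measurable[OF r] by auto
  note [measurable] = arccos_measurable
  let ?f = "\<lambda>(p, q, r). arccos (((p + q - r) / 2) / (sqrt p * sqrt q)) :: real"
  have f: "?f \<in> borel_measurable borel"
    unfolding borel_prod[symmetric] by measurable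
  have f0: "?f (2 * s, 2 * s, 2 * s) = pi / 3"
    using s by (simp flip: arccos_cos add: cos_60) 
  let ?R = "\<lambda>d \<omega>. sqrt (real d) * (?f (p d \<omega>, q d \<omega>, r d \<omega>) - ?f (2 * s, 2 * s, 2 * s) -
     (\<lambda>(h, k, l). - (2 / sqrt 3) * ((h + k - l) / (4 * s) - (h + k) / (8 * s))) (p d \<omega> - 2 * s, q d \<omega> - 2 * s, r d \<omega> - 2 * s))"
  show "oP M (\<lambda>d \<omega>. - (sqrt 3 * s) * ?R d \<omega>)"
    by (intro oP_cmult delta_method_3 p q r has_derivative_angle s f)
  show "(\<lambda>\<omega>. (sqrt 3 * real d * s *
      (pi / 3 - arccos (((real d * p d \<omega> + real d * q d \<omega> - real d * r d \<omega>) / 2) / (sqrt (real d * p d \<omega>) * sqrt (real d * q d \<omega>))))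
      - ((real d * p d \<omega> + real d * q d \<omega>) / 4 - real d * r d \<omega> / 2)) / sqrt (real d)) \<in> borel_measurable M" for d
    by measurable
  show "\<forall>\<^sub>F d in sequentially. \<forall>\<omega>\<in>space M. (sqrt 3 * real d * s *
      (pi / 3 - arccos (((real d * p d \<omega> + real d * q d \<omega> - real d * r d \<omega>) / 2) / (sqrt (real d * p d \<omega>) * sqrt (real d * q d \<omega>))))
      - ((real d * p d \<omega> + real d * q d \<omega>) / 4 - real d * r d \<omega> / 2)) / sqrt (real d) = - (sqrt 3 * s) * ?R d \<omega>"
    using eventually_gt_at_top[of 0]
  proof eventually_elim
    case (elim d)
    define t where "t = sqrt (real d)"
    have t: "0 < t" "real d = t * t" using elim by (auto simp: t_def)
    have sq: "sqrt (t * t * u) = t * sqrt u" for u using t by (simp add: real_sqrt_mult)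
    have arg: "((t * t * u + t * t * v - t * t * w) / 2) / ((t * sqrt u) * (t * sqrt v)) = ((u + v - w) / 2) / (sqrt u * sqrt v)" for u v w
    proof -
      have "(t * t * u + t * t * v - t * t * w) / 2 = (t * t) * ((u + v - w) / 2)" by (simp add: algebra_simps)
      moreover have "(t * sqrt u) * (t * sqrt v) = (t * t) * (sqrt u * sqrt v)" by simp
      ultimately show ?thesis using t(1) by (simp only: mult_divide_mult_cancel_left) simp
    qed
    \<comment> \<open>An arbitrary nonzero \<open>k\<close> stands for \<open>sqrt 3\<close>, and
      \<open>t * t\<close> for \<open>real d\<close>, which leaves a plain identity of rational
      functions.\<close>
    have fin: "(k * (t * t) * s * (c - A) - ((t * t * u + t * t * v) / 4 - t * t * w / 2)) / t
       = - (k * s) * (t * (A - c - (- (2 / k) * (((u - 2 * s) + (v - 2 * s) - (w - 2 * s)) / (4 * s) - ((u - 2 * s) + (v - 2 * s)) / (8 * s)))))"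
      if "k \<noteq> 0" for k c A u v w
      using t(1) s that by (simp add: field_simps)
    have s3: "sqrt 3 \<noteq> (0::real)" by simp
    show ?case
      unfolding f0 unfolding case_prod_conv t_def[symmetric]
      by (simp only: t(2) sq arg fin[OF s3]) simp
  qed
qed

text \<open>Both distances are near \<open>sqrt (2 * d * s)\<close>, so
  \<open>2 * real d * s\<close> restores the inner product that the normalisation removed.\<close>

lemma cosine_remainder:
  assumes h: "rate M h 0" and q: "rate M q (2 * s)" and r: "rate M r (2 * s)" and s: "0 < s"
  shows "oP M (\<lambda>d \<omega>. (2 * real d * s * (real d * h d \<omega> / (sqrt (real d * q d \<omega>) * sqrt (real d * r d \<omega>))) - real d * h d \<omega>) / sqrt (real d))"
proof (rule oP_cong)
  have [measurable]: "h d \<in> borel_measurable M" "q d \<in> borel_measurable M" "r d \<in> borel_measurable M" for d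
    using rate_measurable[OF h] rate_measurable[OF q] rate_measurable[OF r] by auto
  let ?f = "\<lambda>(p, q, r). p / (sqrt q * sqrt r) :: real"
  have f: "?f \<in> borel_measurable borel"
    unfolding borel_prod[symmetric] by measurable
  let ?R = "\<lambda>d \<omega>. sqrt (real d) * (?f (h d \<omega>, q d \<omega>, r d \<omega>) - ?f (0, 2 * s, 2 * s) -
     (\<lambda>(h, k, l). h / (2 * s)) (h d \<omega> - 0, q d \<omega> - 2 * s, r d \<omega> - 2 * s))"
  show "oP M (\<lambda>d \<omega>. 2 * s * ?R d \<omega>)"
    by (intro oP_cmult delta_method_3 h q r has_derivative_cosine s f)
  show "(\<lambda>\<omega>. (2 * real d * s * (real d * h d \<omega> / (sqrt (real d * q d \<omega>) * sqrt (real d * r d \<omega>))) - real d * h d \<omega>) / sqrt (real d)) \<in> borel_measurable M" for d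
    by measurable
  show "\<forall>\<^sub>F d in sequentially. \<forall>\<omega>\<in>space M.
      (2 * real d * s * (real d * h d \<omega> / (sqrt (real d * q d \<omega>) * sqrt (real d * r d \<omega>))) - real d * h d \<omega>) / sqrt (real d) = 2 * s * ?R d \<omega>"
    using eventually_gt_at_top[of 0]
  proof eventually_elim
    case (elim d)
    define t where "t = sqrt (real d)"
    have t: "0 < t" "real d = t * t" using elim by (auto simp: t_def)
    have sq: "sqrt (t * t * u) = t * sqrt u" for u using t by (simp add: real_sqrt_mult)
    have arg: "t * t * u / ((t * v) * (t * w)) = u / (v * w)" for u v w
      using t(1) mult_divide_mult_cancel_left[of "t * t" u "v * w"] by (simp add: mult_ac)
    have fin: "(2 * (t * t) * s * c - t * t * u) / t = 2 * s * (t * (c - 0 - (u - 0) / (2 * s)))" for c u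
      using t(1) s by (simp add: field_simps)
    show ?case
      unfolding case_prod_conv t_def[symmetric] by (simp only: t(2) sq arg fin div_0 mult_zero_left) simp
  qed
qed

end

lemma U_CQ_quad: "U_CQ d m n x y = quad_avg m n (\<lambda>i i' j j'. vdot d (vdiff (x i) (y j)) (vdiff (x i') (y j')))"
  by (simp add: U_CQ_def quad_avg_def)

text \<open>Polarisation averaged over the four indices, each term depending on only two of them. So
  \<open>2 * U_CQ\<close> is the contrast of cross and within-sample averages that also underlies
  the energy and kernel statistics.\<close>

lemma U_CQ_distances:
  assumes mn: "m \<ge> 2" "n \<ge> 2"
  shows "U_CQ d m n x y = cross_avg m n (\<lambda>i j. sqdist d (x i) (y j))
     - pair_avg m (\<lambda>i i'. sqdist d (x i) (x i')) / 2 - pair_avg n (\<lambda>j j'. sqdist d (y j) (y j')) / 2"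
proof -
  let ?D = "\<lambda>i j. sqdist d (x i) (y j)"
  have "U_CQ d m n x y = quad_avg m n (\<lambda>i i' j j'. (1 / 2) * ?D i j' + (1 / 2) * ?D i' j
      + ((- 1 / 2) * sqdist d (x i) (x i') + (- 1 / 2) * sqdist d (y j) (y j')))"
    unfolding U_CQ_quad vdot_cross by (intro arg_cong[of _ _ "quad_avg m n"] ext) (simp add: field_simps)
  also have "\<dots> = (1 / 2) * quad_avg m n (\<lambda>i i' j j'. ?D i j') + (1 / 2) * quad_avg m n (\<lambda>i i' j j'. ?D i' j)
      + ((- 1 / 2) * quad_avg m n (\<lambda>i i' j j'. sqdist d (x i) (x i')) + (- 1 / 2) * quad_avg m n (\<lambda>i i' j j'. sqdist d (y j) (y j')))"
    by (simp only: quad_avg_add quad_avg_cmult)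
  also have "\<dots> = (1 / 2) * cross_avg m n ?D + (1 / 2) * cross_avg m n ?D
      + ((- 1 / 2) * pair_avg m (\<lambda>i i'. sqdist d (x i) (x i')) + (- 1 / 2) * pair_avg n (\<lambda>j j'. sqdist d (y j) (y j')))"
    by (simp only: quad_avg_cross[OF mn] quad_avg_pairs[OF mn])
  finally show ?thesis by simp
qed

lemma scaled_stat_measurable:
  assumes x: "\<And>i k. i \<in> {1..m} \<Longrightarrow> k \<in> {1..d} \<Longrightarrow> (\<lambda>\<omega>. x i \<omega> k) \<in> borel_measurable M"
    and y: "\<And>j k. j \<in> {1..n} \<Longrightarrow> k \<in> {1..d} \<Longrightarrow> (\<lambda>\<omega>. y j \<omega> k) \<in> borel_measurable M"
  shows "(\<lambda>\<omega>. scaled_stat T d m n a s b (\<lambda>i. x i \<omega>) (\<lambda>j. y j \<omega>)) \<in> borel_measurable M"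
proof -
  have D: "(\<lambda>\<omega>. sqdist d (u \<omega>) (v \<omega>)) \<in> borel_measurable M"
    if "\<And>k. k \<in> {1..d} \<Longrightarrow> (\<lambda>\<omega>. u \<omega> k) \<in> borel_measurable M" "\<And>k. k \<in> {1..d} \<Longrightarrow> (\<lambda>\<omega>. v \<omega> k) \<in> borel_measurable M" for u v
    unfolding sqdist_eq using that by (intro borel_measurable_sum borel_measurable_power borel_measurable_diff)
  have Dxx: "(\<lambda>\<omega>. sqdist d (x i \<omega>) (x i' \<omega>)) \<in> borel_measurable M" if "i \<in> {1..m}" "i' \<in> {1..m}" for i i'
    using that by (intro D x)
  have Dyy: "(\<lambda>\<omega>. sqdist d (y i \<omega>) (y i' \<omega>)) \<in> borel_measurable M" if "i \<in> {1..n}" "i' \<in> {1..n}" for i i'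
    using that by (intro D y)
  have Dxy: "(\<lambda>\<omega>. sqdist d (x i \<omega>) (y j \<omega>)) \<in> borel_measurable M" if "i \<in> {1..m}" "j \<in> {1..n}" for i j
    using that by (intro D x y)
  have Dyx: "(\<lambda>\<omega>. sqdist d (y j \<omega>) (x i \<omega>)) \<in> borel_measurable M" if "i \<in> {1..m}" "j \<in> {1..n}" for i j
    using that by (intro D x y)
  have mem: "fst p \<in> {1..k}" "snd p \<in> {1..k}" if "p \<in> neq_pairs k" for p k
    using that by (auto simp: neq_pairs_def)
  have sqrt: "(\<lambda>\<omega>. sqrt (f \<omega>)) \<in> borel_measurable M" if "f \<in> borel_measurable M" for f :: "_ \<Rightarrow> real"
    using that by measurable
  have exp: "(\<lambda>\<omega>. exp (f \<omega>)) \<in> borel_measurable M" if "f \<in> borel_measurable M" for f :: "_ \<Rightarrow> real"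
    using that by measurable
  note rules = borel_measurable_times borel_measurable_const borel_measurable_sum borel_measurable_diff
        borel_measurable_add borel_measurable_divide borel_measurable_power sqrt
        measurable_compose[OF _ arccos_measurable] exp borel_measurable_uminus
        Dxx Dyy Dxy Dyx mem
  note defs = scaled_stat.simps U_CvM_def U_Energy_def U_MMD_def U_CQ_def U_WMW_def
        gauss_kernel_def Ang_def vdot_cross vnorm_eq case_prod_beta
  show ?thesis
  proof (cases T)
    case CvM
    show ?thesis unfolding CvM defs by (intro rules)
  next
    case Energy
    show ?thesis unfolding Energy defs by (intro rules)
  next
    case MMD
    show ?thesis unfolding MMD defs by (intro rules)
  next
    case CQ
    show ?thesis unfolding CQ defs by (intro rules)
  next
    case WMW
    show ?thesis unfolding WMW defs by (intro rules)
  qed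
qed

context
  fixes m n :: nat assumes mn: "m \<ge> 2" "n \<ge> 2"
begin

text \<open>The weights 2, - 1, - 1 add up to 0, so the constant \<open>c\<close> of a tangent drops
  out, however large it is.\<close>

lemma contrast_linear:
  "2 * cross_avg m n (\<lambda>i j. a * f i j + (b * f' i j + c)) - pair_avg m (\<lambda>i j. a * g i j + (b * g' i j + c))
      - pair_avg n (\<lambda>i j. a * h i j + (b * h' i j + c)) =
   a * (2 * cross_avg m n f - pair_avg m g - pair_avg n h) + b * (2 * cross_avg m n f' - pair_avg m g' - pair_avg n h')"
  unfolding cross_avg_add pair_avg_add cross_avg_cmult pair_avg_cmult
    cross_avg_const[OF mn] pair_avg_const[OF mn] pair_avg_const[OF mn(2) mn(1)]
  by (simp add: algebra_simps)

end

context prob_space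
begin

text \<open>\<open>Energy\<close> and \<open>MMD\<close> are contrasts of one function of the
  squared distance; \<open>WMW\<close> and \<open>CvM\<close> are averages over index quadruples,
  linearised term by term. In each case the linear parts recombine to \<open>U_CQ\<close>.\<close>

lemma scaled_stat_remainder:
  fixes x y :: "nat \<Rightarrow> nat \<Rightarrow> 'a \<Rightarrow> nat \<Rightarrow> real"
  assumes mn: "m \<ge> 2" "n \<ge> 2" and s: "0 < s"
    and xm: "\<And>d i k. i \<in> {1..m} \<Longrightarrow> k \<in> {1..d} \<Longrightarrow> (\<lambda>\<omega>. x d i \<omega> k) \<in> borel_measurable M"
    and ym: "\<And>d j k. j \<in> {1..n} \<Longrightarrow> k \<in> {1..d} \<Longrightarrow> (\<lambda>\<omega>. y d j \<omega> k) \<in> borel_measurable M"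
    and xx: "\<And>i i'. i \<in> {1..m} \<Longrightarrow> i' \<in> {1..m} \<Longrightarrow> i \<noteq> i' \<Longrightarrow>
       rate M (\<lambda>d \<omega>. sqdist d (x d i \<omega>) (x d i' \<omega>) / real d) (2 * s)"
    and yy: "\<And>j j'. j \<in> {1..n} \<Longrightarrow> j' \<in> {1..n} \<Longrightarrow> j \<noteq> j' \<Longrightarrow>
       rate M (\<lambda>d \<omega>. sqdist d (y d j \<omega>) (y d j' \<omega>) / real d) (2 * s)"
    and xy: "\<And>i j. i \<in> {1..m} \<Longrightarrow> j \<in> {1..n} \<Longrightarrow>
       rate M (\<lambda>d \<omega>. sqdist d (x d i \<omega>) (y d j \<omega>) / real d) (2 * s)"
    and sd: "\<forall>\<^sub>F d in sequentially. sd d = s"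
    and bw: "(\<lambda>d. (bw d)\<^sup>2) \<in> \<Theta>(\<lambda>d. real d)"
  shows "oP M (\<lambda>d \<omega>. (scaled_stat T d m n (sd d) s (bw d) (\<lambda>i. x d i \<omega>) (\<lambda>j. y d j \<omega>)
     - U_CQ d m n (\<lambda>i. x d i \<omega>) (\<lambda>j. y d j \<omega>)) / sqrt (real d))"
proof -
  let ?XX = "\<lambda>i i' d \<omega>. sqdist d (x d i \<omega>) (x d i' \<omega>)" and ?YY = "\<lambda>j j' d \<omega>. sqdist d (y d j \<omega>) (y d j' \<omega>)"
    and ?XY = "\<lambda>i j d \<omega>. sqdist d (x d i \<omega>) (y d j \<omega>)"
  let ?U = "\<lambda>d \<omega>. U_CQ d m n (\<lambda>i. x d i \<omega>) (\<lambda>j. y d j \<omega>)"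
  have U2: "2 * cross_avg m n (\<lambda>i j. ?XY i j d \<omega>) - pair_avg m (\<lambda>i j. ?XX i j d \<omega>) - pair_avg n (\<lambda>i j. ?YY i j d \<omega>) = 2 * ?U d \<omega>"
    for d \<omega> by (simp add: U_CQ_distances[OF mn])
  have meas: "(\<lambda>\<omega>. (scaled_stat T d m n (sd d) s (bw d) (\<lambda>i. x d i \<omega>) (\<lambda>j. y d j \<omega>) - ?U d \<omega>) / sqrt (real d)) \<in> borel_measurable M" for d
    using scaled_stat_measurable[of m d "x d" M n "y d" T "sd d" s "bw d"]
      scaled_stat_measurable[of m d "x d" M n "y d" CQ "sd d" s "bw d"] xm ym
    by (intro borel_measurable_divide borel_measurable_diff borel_measurable_const) auto
  \<comment> \<open>\<kappa> is the sign of the contrast: 1 for the distance, which grows with the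
    squared distance, and \<open>- 1\<close> for the kernel, which decays. The slope
    \<open>1 / (2 * \<kappa>)\<close> makes the linear part exactly \<open>U_CQ\<close>.\<close>
  have contrast: ?thesis
    if R: "\<And>S. rate M (\<lambda>d \<omega>. S d \<omega> / real d) (2 * s) \<Longrightarrow> oP M (\<lambda>d \<omega>. R d (S d \<omega> / real d))"
      and eq: "\<forall>\<^sub>F d in sequentially. \<forall>\<omega>\<in>space M. 
         scaled_stat T d m n (sd d) s (bw d) (\<lambda>i. x d i \<omega>) (\<lambda>j. y d j \<omega>) =
         \<kappa> * (2 * cross_avg m n (\<lambda>i j. F d (?XY i j d \<omega>)) - pair_avg m (\<lambda>i j. F d (?XX i j d \<omega>)) - pair_avg n (\<lambda>i j. F d (?YY i j d \<omega>)))"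
      and F: "\<forall>\<^sub>F d in sequentially. \<forall>u. F d u = sqrt (real d) * R d (u / real d) + (1 / (2 * \<kappa>) * u + c d)" and k: "\<kappa> \<noteq> 0"
    for R F c \<kappa>
  proof (rule oP_cong[OF _ meas])
    show "oP M (\<lambda>d \<omega>. \<kappa> * (2 * cross_avg m n (\<lambda>i j. R d (?XY i j d \<omega> / real d)) +
      ((- 1) * pair_avg m (\<lambda>i j. R d (?XX i j d \<omega> / real d)) + (- 1) * pair_avg n (\<lambda>i j. R d (?YY i j d \<omega> / real d)))))"
      by (intro oP_cmult oP_add oP_cross_avg oP_pair_avg R xx yy xy)
    show "\<forall>\<^sub>F d in sequentially. \<forall>\<omega>\<in>space M.
      (scaled_stat T d m n (sd d) s (bw d) (\<lambda>i. x d i \<omega>) (\<lambda>j. y d j \<omega>) - ?U d \<omega>) / sqrt (real d) =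
      \<kappa> * (2 * cross_avg m n (\<lambda>i j. R d (?XY i j d \<omega> / real d)) +
      ((- 1) * pair_avg m (\<lambda>i j. R d (?XX i j d \<omega> / real d)) + (- 1) * pair_avg n (\<lambda>i j. R d (?YY i j d \<omega> / real d))))"
      using eq F eventually_gt_at_top[of 0]
    proof eventually_elim
      case (elim d)
      show ?case
      proof
        fix \<omega> assume w: "\<omega> \<in> space M"
        have "scaled_stat T d m n (sd d) s (bw d) (\<lambda>i. x d i \<omega>) (\<lambda>j. y d j \<omega>) =
          \<kappa> * (sqrt (real d) * (2 * cross_avg m n (\<lambda>i j. R d (?XY i j d \<omega> / real d)) - pair_avg m (\<lambda>i j. R d (?XX i j d \<omega> / real d)) -
            pair_avg n (\<lambda>i j. R d (?YY i j d \<omega> / real d))) + 1 / (2 * \<kappa>) * (2 * ?U d \<omega>))"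
          unfolding elim(1)[rule_format, OF w] elim(2)[rule_format] contrast_linear[OF mn] U2 ..
        then show "(scaled_stat T d m n (sd d) s (bw d) (\<lambda>i. x d i \<omega>) (\<lambda>j. y d j \<omega>) - ?U d \<omega>) / sqrt (real d) =
      \<kappa> * (2 * cross_avg m n (\<lambda>i j. R d (?XY i j d \<omega> / real d)) +
      ((- 1) * pair_avg m (\<lambda>i j. R d (?XX i j d \<omega> / real d)) + (- 1) * pair_avg n (\<lambda>i j. R d (?YY i j d \<omega> / real d))))"
          using elim(3) k by (simp add: distrib_left) (simp add: algebra_simps)
      qed
    qed
  qed
  show ?thesis
  proof (cases T)
    case CQ
    then show ?thesis using oP_zero by simp
  next
    case Energy
    show ?thesis
    proof (rule contrast[of _ 1])
      show "oP M (\<lambda>d \<omega>. (\<lambda>d u. (sqrt (2 * real d) * sqrt s * sqrt (real d * u) - real d * u / 2 - real d * s) / sqrt (real d)) d (S d \<omega> / real d))"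
        if "rate M (\<lambda>d \<omega>. S d \<omega> / real d) (2 * s)" for S
        using distance_remainder[OF that s] .
      show "\<forall>\<^sub>F d in sequentially. \<forall>\<omega>\<in>space M. 
         scaled_stat T d m n (sd d) s (bw d) (\<lambda>i. x d i \<omega>) (\<lambda>j. y d j \<omega>) =
         1 * (2 * cross_avg m n (\<lambda>i j. (\<lambda>d u. sqrt (2 * real d) * sqrt s * sqrt u) d (?XY i j d \<omega>))
           - pair_avg m (\<lambda>i j. (\<lambda>d u. sqrt (2 * real d) * sqrt s * sqrt u) d (?XX i j d \<omega>))
           - pair_avg n (\<lambda>i j. (\<lambda>d u. sqrt (2 * real d) * sqrt s * sqrt u) d (?YY i j d \<omega>)))"
        unfolding Energy cross_avg_cmult pair_avg_cmult
        by (simp add: U_Energy_def vnorm_eq cross_avg_def pair_avg_def algebra_simps)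
      show "\<forall>\<^sub>F d in sequentially. \<forall>u. (\<lambda>d u. sqrt (2 * real d) * sqrt s * sqrt u) d u =
        sqrt (real d) * (\<lambda>d u. (sqrt (2 * real d) * sqrt s * sqrt (real d * u) - real d * u / 2 - real d * s) / sqrt (real d)) d (u / real d)
          + (1 / (2 * 1) * u + (\<lambda>d. real d * s) d)"
        using eventually_gt_at_top[of 0] by eventually_elim simp
    qed simp
  next
    case MMD
    let ?e = "\<lambda>d. (bw d)\<^sup>2 * exp (real d * sd d / (bw d)\<^sup>2)"
    show ?thesis
    proof (rule contrast[of _ "- 1"])
      show "oP M (\<lambda>d \<omega>. (\<lambda>d u. (?e d * exp (- (real d * u) / (2 * (bw d)\<^sup>2)) - ((bw d)\<^sup>2 + real d * s - real d * u / 2)) / sqrt (real d)) d (S d \<omega> / real d))"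
        if "rate M (\<lambda>d \<omega>. S d \<omega> / real d) (2 * s)" for S
        using kernel_remainder[OF that sd bw] .
      show "\<forall>\<^sub>F d in sequentially. \<forall>\<omega>\<in>space M. 
         scaled_stat T d m n (sd d) s (bw d) (\<lambda>i. x d i \<omega>) (\<lambda>j. y d j \<omega>) =
         - 1 * (2 * cross_avg m n (\<lambda>i j. (\<lambda>d u. ?e d * exp (- u / (2 * (bw d)\<^sup>2))) d (?XY i j d \<omega>))
           - pair_avg m (\<lambda>i j. (\<lambda>d u. ?e d * exp (- u / (2 * (bw d)\<^sup>2))) d (?XX i j d \<omega>))
           - pair_avg n (\<lambda>i j. (\<lambda>d u. ?e d * exp (- u / (2 * (bw d)\<^sup>2))) d (?YY i j d \<omega>)))"
        unfolding MMD cross_avg_cmult pair_avg_cmult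
        by (simp add: U_MMD_def gauss_kernel_def sqdist_def[symmetric] cross_avg_def pair_avg_def algebra_simps)
      show "\<forall>\<^sub>F d in sequentially. \<forall>u. (\<lambda>d u. ?e d * exp (- u / (2 * (bw d)\<^sup>2))) d u =
        sqrt (real d) * (\<lambda>d u. (?e d * exp (- (real d * u) / (2 * (bw d)\<^sup>2)) - ((bw d)\<^sup>2 + real d * s - real d * u / 2)) / sqrt (real d)) d (u / real d)
          + (1 / (2 * - 1) * u + (\<lambda>d. (bw d)\<^sup>2 + real d * s) d)"
        using eventually_gt_at_top[of 0] by eventually_elim simp
    qed simp
  next
    case WMW
    let ?H = "\<lambda>i i' j j' d \<omega>. ((?XY i j' d \<omega> + ?XY i' j d \<omega>) - (?XX i i' d \<omega> + ?YY j j' d \<omega>)) / 2"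
    let ?R = "\<lambda>i i' j j' d \<omega>. (2 * real d * s * (real d * (?H i i' j j' d \<omega> / real d) /
       (sqrt (real d * (?XY i j d \<omega> / real d)) * sqrt (real d * (?XY i' j' d \<omega> / real d)))) - real d * (?H i i' j j' d \<omega> / real d)) / sqrt (real d)"
    show ?thesis
    proof (rule oP_cong[OF _ meas])
      show "oP M (\<lambda>d \<omega>. quad_avg m n (\<lambda>i i' j j'. ?R i i' j j' d \<omega>))"
      proof (intro oP_quad_avg cosine_remainder s xy)
        fix i i' j j' assume ij: "i \<in> {1..m}" "i' \<in> {1..m}" "i \<noteq> i'" "j \<in> {1..n}" "j' \<in> {1..n}" "j \<noteq> j'"
        have neg: "rate M (\<lambda>d \<omega>. (- 1) * (S d \<omega> - 2 * s)) 0" if "rate M S (2 * s)" for S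
          by (rule rate_mult_bounded[OF rate_centred[OF that], where K = 1]) simp
        \<comment> \<open>All four squared distances have the same limit \<open>2 * s\<close>, and
          their signs cancel it; hence the inner product is centred at 0.\<close>
        have "rate M (\<lambda>d \<omega>. (1 / 2) * (((?XY i j' d \<omega> / real d - 2 * s) + (?XY i' j d \<omega> / real d - 2 * s)) +
            ((- 1) * (?XX i i' d \<omega> / real d - 2 * s) + (- 1) * (?YY j j' d \<omega> / real d - 2 * s)))) 0"
          using rate_add[OF rate_add[OF rate_centred[OF xy] rate_centred[OF xy]] rate_add[OF neg[OF xx] neg[OF yy]]] ij
          by (intro rate_mult_bounded[where K = 1]) simp_all
        moreover have "(1 / 2) * (((?XY i j' d \<omega> / real d - 2 * s) + (?XY i' j d \<omega> / real d - 2 * s)) +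
            ((- 1) * (?XX i i' d \<omega> / real d - 2 * s) + (- 1) * (?YY j j' d \<omega> / real d - 2 * s))) = ?H i i' j j' d \<omega> / real d" for d \<omega>
          by (simp add: add_divide_distrib diff_divide_distrib algebra_simps)
        ultimately show "rate M (\<lambda>d \<omega>. ?H i i' j j' d \<omega> / real d) 0" by (simp only:)
      qed
      show "\<forall>\<^sub>F d in sequentially. \<forall>\<omega>\<in>space M.
        (scaled_stat T d m n (sd d) s (bw d) (\<lambda>i. x d i \<omega>) (\<lambda>j. y d j \<omega>) - ?U d \<omega>) / sqrt (real d) =
        quad_avg m n (\<lambda>i i' j j'. ?R i i' j j' d \<omega>)"
        using eventually_gt_at_top[of 0]
      proof eventually_elim
        case (elim d)
        have H: "?H i i' j j' d \<omega> = vdot d (vdiff (x d i \<omega>) (y d j \<omega>)) (vdiff (x d i' \<omega>) (y d j' \<omega>))" for i i' j j' \<omega>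
          by (simp add: vdot_cross)
        have "quad_avg m n (\<lambda>i i' j j'. ?R i i' j j' d \<omega>) =
          1 / sqrt (real d) * (2 * real d * s * U_WMW d m n (\<lambda>i. x d i \<omega>) (\<lambda>j. y d j \<omega>) - ?U d \<omega>)" for \<omega>
        proof -
          have "quad_avg m n (\<lambda>i i' j j'. ?R i i' j j' d \<omega>) = quad_avg m n (\<lambda>i i' j j'. 1 / sqrt (real d) *
             (2 * real d * s * (?H i i' j j' d \<omega> / (vnorm d (vdiff (x d i \<omega>) (y d j \<omega>)) * vnorm d (vdiff (x d i' \<omega>) (y d j' \<omega>)))) - ?H i i' j j' d \<omega>))"
            using elim by (simp add: vnorm_eq)
          also have "\<dots> = 1 / sqrt (real d) * (2 * real d * s * U_WMW d m n (\<lambda>i. x d i \<omega>) (\<lambda>j. y d j \<omega>) - ?U d \<omega>)"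
            unfolding quad_avg_cmult quad_avg_diff H U_CQ_quad by (simp add: quad_avg_def U_WMW_def)
          finally show ?thesis .
        qed
        then show ?case unfolding WMW by simp
      qed
    qed
  next
    case CvM
    let ?A = "\<lambda>P Q R d \<omega>. sqrt 3 * real d * s * (pi / 3 - arccos (((P d \<omega> + Q d \<omega> - R d \<omega>) / 2) / (sqrt (P d \<omega>) * sqrt (Q d \<omega>))))"
    let ?l = "\<lambda>P Q R d \<omega>. (1 / 4) * P d \<omega> + ((1 / 4) * Q d \<omega> + (- 1 / 2) * R d \<omega>)"
    let ?R = "\<lambda>P Q R d \<omega>. (sqrt 3 * real d * s *
      (pi / 3 - arccos (((real d * (P d \<omega> / real d) + real d * (Q d \<omega> / real d) - real d * (R d \<omega> / real d)) / 2) /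
          (sqrt (real d * (P d \<omega> / real d)) * sqrt (real d * (Q d \<omega> / real d)))))
      - ((real d * (P d \<omega> / real d) + real d * (Q d \<omega> / real d)) / 4 - real d * (R d \<omega> / real d) / 2)) / sqrt (real d)"
    show ?thesis
    proof (rule oP_cong[OF _ meas])
      show "oP M (\<lambda>d \<omega>. quad_avg m n (\<lambda>i i' j j'. ?R (?XY i j) (?XY i' j) (?XX i i') d \<omega> + ?R (?XY i j) (?XY i j') (?YY j j') d \<omega>))"
        by (intro oP_quad_avg oP_add angle_remainder s xx yy xy)
      show "\<forall>\<^sub>F d in sequentially. \<forall>\<omega>\<in>space M.
        (scaled_stat T d m n (sd d) s (bw d) (\<lambda>i. x d i \<omega>) (\<lambda>j. y d j \<omega>) - ?U d \<omega>) / sqrt (real d) =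
        quad_avg m n (\<lambda>i i' j j'. ?R (?XY i j) (?XY i' j) (?XX i i') d \<omega> + ?R (?XY i j) (?XY i j') (?YY j j') d \<omega>)"
        using eventually_gt_at_top[of 0]
      proof eventually_elim
        case (elim d)
        have rd: "real d * (u / real d) = u" for u using elim by simp
        have comb: "(a - ((p + q) / 4 - r / 2)) / t + (b - ((p' + q') / 4 - r' / 2)) / t =
           1 / t * ((a + b) - (((1 / 4) * p + ((1 / 4) * q + (- 1 / 2) * r)) + ((1 / 4) * p' + ((1 / 4) * q' + (- 1 / 2) * r'))))"
          for a b p q r p' q' r' t :: real
          by (cases "t = 0") (simp_all add: field_simps)
        show ?case
        proof
          fix \<omega>
          let ?q = "quad_avg m n"
          \<comment> \<open>The two angles supply four cross terms of weight \<open>1 / 4\<close>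
            and one within-sample term of weight \<open>- 1 / 2\<close> for each sample.\<close>
          have lin: "?q (\<lambda>i i' j j'. ?l (?XY i j) (?XY i' j) (?XX i i') d \<omega> + ?l (?XY i j) (?XY i j') (?YY j j') d \<omega>) = ?U d \<omega>"
            unfolding quad_avg_add quad_avg_cmult quad_avg_cross[OF mn] quad_avg_pairs[OF mn] U_CQ_distances[OF mn] by simp
          have ang: "?q (\<lambda>i i' j j'. ?A (?XY i j) (?XY i' j) (?XX i i') d \<omega> + ?A (?XY i j) (?XY i j') (?YY j j') d \<omega>) =
             2 * pi * sqrt 3 * real d * s * U_CvM d m n (\<lambda>i. x d i \<omega>) (\<lambda>j. y d j \<omega>)"
          proof -
            have K: "K * (pi / 3 - a) + K * (pi / 3 - b) = (2 * pi * K) * (1 / 3 - 1 / (2 * pi) * a - 1 / (2 * pi) * b)" for K a b :: real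
              by (simp add: field_simps)
            have "?q (\<lambda>i i' j j'. ?A (?XY i j) (?XY i' j) (?XX i i') d \<omega> + ?A (?XY i j) (?XY i j') (?YY j j') d \<omega>) =
              ?q (\<lambda>i i' j j'. (2 * pi * (sqrt 3 * real d * s)) * (1 / 3 - 1 / (2 * pi) * Ang d (vdiff (x d i \<omega>) (y d j \<omega>)) (vdiff (x d i' \<omega>) (y d j \<omega>))
              - 1 / (2 * pi) * Ang d (vdiff (y d j \<omega>) (x d i \<omega>)) (vdiff (y d j' \<omega>) (x d i \<omega>))))"
              unfolding K Ang_def vdot_corner vnorm_eq
              by (simp only: sqdist_commute[of d "y d _ \<omega>" "x d _ \<omega>"])
            also have "\<dots> = 2 * pi * (sqrt 3 * real d * s) * U_CvM d m n (\<lambda>i. x d i \<omega>) (\<lambda>j. y d j \<omega>)"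
              unfolding quad_avg_cmult by (simp add: U_CvM_def quad_avg_def)
            finally show ?thesis by (simp add: mult.assoc)
          qed
          have "?q (\<lambda>i i' j j'. ?R (?XY i j) (?XY i' j) (?XX i i') d \<omega> + ?R (?XY i j) (?XY i j') (?YY j j') d \<omega>) =
             ?q (\<lambda>i i' j j'. 1 / sqrt (real d) * ((?A (?XY i j) (?XY i' j) (?XX i i') d \<omega> + ?A (?XY i j) (?XY i j') (?YY j j') d \<omega>)
               - (?l (?XY i j) (?XY i' j) (?XX i i') d \<omega> + ?l (?XY i j) (?XY i j') (?YY j j') d \<omega>)))"
            unfolding rd comb ..
          also have "\<dots> = 1 / sqrt (real d) * (2 * pi * sqrt 3 * real d * s * U_CvM d m n (\<lambda>i. x d i \<omega>) (\<lambda>j. y d j \<omega>) - ?U d \<omega>)"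
            unfolding quad_avg_cmult quad_avg_diff lin ang ..
          finally show "(scaled_stat T d m n (sd d) s (bw d) (\<lambda>i. x d i \<omega>) (\<lambda>j. y d j \<omega>) - ?U d \<omega>) / sqrt (real d) =
             ?q (\<lambda>i i' j j'. ?R (?XY i j) (?XY i' j) (?XX i i') d \<omega> + ?R (?XY i j) (?XY i j') (?YY j j') d \<omega>)"
            unfolding CvM by simp
        qed
      qed
    qed
  qed
qed

end

section \<open>The sample space\<close>

lemma strictly_stationary_integral:
  assumes st: "strictly_stationary N V" and V: "\<And>k. 1 \<le> k \<Longrightarrow> V k \<in> borel_measurable N"
    and f: "f \<in> borel_measurable (Rd r)"
  shows "(\<integral>\<omega>. f (\<lambda>i\<in>{1..r}. V (i + h) \<omega>) \<partial>N) = (\<integral>\<omega>. f (\<lambda>i\<in>{1..r}. V i \<omega>) \<partial>N :: real)"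
proof -
  have m: "(\<lambda>\<omega>. \<lambda>i\<in>{1..r}. V (i + h) \<omega>) \<in> measurable N (Rd r)" for h
    by (intro measurable_restrict V) auto
  have "(\<integral>\<omega>. f (\<lambda>i\<in>{1..r}. V (i + h) \<omega>) \<partial>N) = (\<integral>x. f x \<partial>distr N (Rd r) (\<lambda>\<omega>. \<lambda>i\<in>{1..r}. V (i + h) \<omega>))"
    by (rule integral_distr[OF m f, symmetric])
  also have "distr N (Rd r) (\<lambda>\<omega>. \<lambda>i\<in>{1..r}. V (i + h) \<omega>) = distr N (Rd r) (\<lambda>\<omega>. \<lambda>i\<in>{1..r}. V i \<omega>)"
    using st unfolding strictly_stationary_def by blast
  also have "(\<integral>x. f x \<partial>distr N (Rd r) (\<lambda>\<omega>. \<lambda>i\<in>{1..r}. V i \<omega>)) = (\<integral>\<omega>. f (\<lambda>i\<in>{1..r}. V i \<omega>) \<partial>N)"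
    using integral_distr[OF m[of 0] f] by simp
  finally show ?thesis .
qed

lemma strictly_stationary_product:
  assumes st: "strictly_stationary N V" and V: "\<And>k. 1 \<le> k \<Longrightarrow> V k \<in> borel_measurable N"
    and ij: "1 \<le> i" "1 \<le> j"
  shows "(\<integral>\<omega>. V (i + h) \<omega> * V (j + h) \<omega> \<partial>N) = (\<integral>\<omega>. V i \<omega> * V j \<omega> \<partial>N)"
proof -
  have [measurable]: "i \<in> {1..max i j}" "j \<in> {1..max i j}" using ij by auto
  have "(\<lambda>x. x i * x j) \<in> borel_measurable (Rd (max i j))" by measurable
  from strictly_stationary_integral[OF st V this, of h] show ?thesis using ij by simp
qed

lemma strictly_stationary_marginal:
  assumes st: "strictly_stationary N V" and V: "\<And>k. 1 \<le> k \<Longrightarrow> V k \<in> borel_measurable N"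
    and f: "f \<in> borel_measurable borel" and k: "1 \<le> k"
  shows "(\<integral>\<omega>. f (V k \<omega>) \<partial>N) = (\<integral>\<omega>. f (V 1 \<omega>) \<partial>N :: real)"
proof -
  have [measurable]: "1 \<in> {1..1::nat}" by simp
  note [measurable] = f
  have "(\<lambda>x. f (x 1)) \<in> borel_measurable (Rd 1)" by measurable
  from strictly_stationary_integral[OF st V this, of "k - 1"] show ?thesis using k by simp
qed

lemma cov_mixing_mono:
  assumes "prob_space M" "cov_mixing M F G a" "a \<le> b" shows "cov_mixing M F G b"
  unfolding cov_mixing_def
proof (intro allI impI)
  interpret prob_space M by fact
  fix f g assume "f \<in> borel_measurable F" "square_integrable M f" "g \<in> borel_measurable G" "square_integrable M g"
  then have "\<bar>cov M f g\<bar> \<le> a * (cov M f f + cov M g g) / 2" using assms(2) unfolding cov_mixing_def by blast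
  also have "\<dots> \<le> b * (cov M f f + cov M g g) / 2"
    using assms(3) cov_self_nonneg[of f] cov_self_nonneg[of g] by (intro divide_right_mono mult_right_mono) auto
  finally show "\<bar>cov M f g\<bar> \<le> b * (cov M f f + cov M g g) / 2" .
qed

locale two_sample =
  fixes N :: "'b measure" and VX VY :: "nat \<Rightarrow> 'b \<Rightarrow> real" and m n :: nat
  assumes N: "prob_space N" and m2: "m \<ge> 2" and n2: "n \<ge> 2"
    and VX: "centred_L2_seq N VX" and VY: "centred_L2_seq N VY"
    and stX: "strictly_stationary N VX" and stY: "strictly_stationary N VY"
    and sumX: "summable (\<lambda>k. rho_mix N VX (2 ^ Suc k))" and sumY: "summable (\<lambda>k. rho_mix N VY (2 ^ Suc k))"
    and autocov_eq: "\<And>i j. 1 \<le> i \<Longrightarrow> 1 \<le> j \<Longrightarrow> (\<integral>\<omega>. VX i \<omega> * VX j \<omega> \<partial>N) = (\<integral>\<omega>. VY i \<omega> * VY j \<omega> \<partial>N)"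
begin

sublocale N: prob_space N by (rule N)

definition I :: "(nat + nat) set" where "I = {1..m} <+> {1..n}"

definition V :: "nat + nat \<Rightarrow> nat \<Rightarrow> 'b \<Rightarrow> real" where
  "V a = (case a of Inl _ \<Rightarrow> VX | Inr _ \<Rightarrow> VY)"

text \<open>One copy of \<open>N\<close> for each observation, carrying a whole noise sequence. On a
  coordinate \<open>Inl i\<close> only \<open>VX\<close> is read, on \<open>Inr j\<close> only
  \<open>VY\<close>, so the observations are independent by construction.\<close>

definition Om :: "(nat + nat \<Rightarrow> 'b) measure" where "Om = PiM I (\<lambda>_. N)"

definition past_alg :: "nat \<Rightarrow> (nat + nat \<Rightarrow> 'b) measure" where
  "past_alg l = PiM I (\<lambda>a. sigma_gen N (V a) {1..l})"

text \<open>\<open>adapted\<close> also speaks of the future from time 0, but sequences are indexed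
  from 1 and \<open>V a 0\<close> need not be measurable; so 0 is treated like 1.\<close>

definition future_alg :: "nat \<Rightarrow> (nat + nat \<Rightarrow> 'b) measure" where
  "future_alg l = PiM I (\<lambda>a. sigma_gen N (V a) (if l = 0 then {1..} else {l..}))"

text \<open>The sum dominates both coefficients, and its dyadic summability is immediate.\<close>

definition rho :: "nat \<Rightarrow> real" where "rho q = rho_mix N VX q + rho_mix N VY q"

lemma finite_I [simp]: "finite I" by (simp add: I_def)

lemma Inl_I: "Inl i \<in> I \<longleftrightarrow> i \<in> {1..m}" and Inr_I: "Inr j \<in> I \<longleftrightarrow> j \<in> {1..n}"
  by (auto simp: I_def)

lemma V_Inl [simp]: "V (Inl i) = VX" and V_Inr [simp]: "V (Inr j) = VY"
  by (simp_all add: V_def)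

lemma V_square_integrable: "1 \<le> k \<Longrightarrow> square_integrable N (V a k)"
  using VX VY by (cases a) (auto simp: centred_L2_seq_def)

lemma V_measurable: "1 \<le> k \<Longrightarrow> V a k \<in> borel_measurable N"
  using V_square_integrable square_integrable_measurable by blast

lemma V_mean: "1 \<le> k \<Longrightarrow> (\<integral>\<omega>. V a k \<omega> \<partial>N) = 0"
  using VX VY by (cases a) (auto simp: centred_L2_seq_def)

lemma V_stationary: "strictly_stationary N (V a)"
  using stX stY by (cases a) auto

lemma Om_component: "a \<in> I \<Longrightarrow> f \<in> borel_measurable N \<Longrightarrow> (\<lambda>\<omega>. f (\<omega> a)) \<in> borel_measurable Om"
  unfolding Om_def by (rule measurable_compose[OF measurable_component_singleton])

lemma rho_nonneg: "0 \<le> rho q"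
proof -
  have "0 \<le> rho_mix N VX q" "0 \<le> rho_mix N VY q"
    using cov_mixing_rho_mix(2)[OF N, of VX 1 q] cov_mixing_rho_mix(2)[OF N, of VY 1 q]
      V_measurable[of _ "Inl 0"] V_measurable[of _ "Inr 0"] by simp_all
  then show ?thesis by (simp add: rho_def)
qed

lemma V_cov_mixing:
  assumes "1 \<le> l"
  shows "cov_mixing N (sigma_gen N (V a) {1..l}) (sigma_gen N (V a) {l + q..}) (rho q)"
proof (rule cov_mixing_mono[OF N])
  show "cov_mixing N (sigma_gen N (V a) {1..l}) (sigma_gen N (V a) {l + q..}) (rho_mix N (V a) q)"
    by (rule cov_mixing_rho_mix(1)[OF N V_measurable assms])
  have "0 \<le> rho_mix N VX q" "0 \<le> rho_mix N VY q"
    using cov_mixing_rho_mix(2)[OF N, of VX 1 q] cov_mixing_rho_mix(2)[OF N, of VY 1 q]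
      V_measurable[of _ "Inl 0"] V_measurable[of _ "Inr 0"] by simp_all
  then show "rho_mix N (V a) q \<le> rho q" by (cases a) (simp_all add: rho_def)
qed

lemma past_subalgebra: "subalgebra Om (past_alg l)"
  unfolding Om_def past_alg_def
  by (intro subalgebra_PiM sigma_gen_subalgebra V_measurable) simp

lemma future_subalgebra: "subalgebra Om (future_alg l)"
  unfolding Om_def future_alg_def
  by (intro subalgebra_PiM sigma_gen_subalgebra V_measurable) (simp split: if_splits)

sublocale Om: prob_space Om
  unfolding Om_def by (rule prob_space_PiM) (rule N)

sublocale Om: rho_mixing Om past_alg future_alg rho
proof
  show "f \<in> borel_measurable Om" if "f \<in> borel_measurable (past_alg l)" for l and f :: "_ \<Rightarrow> real"
    by (rule measurable_from_subalg[OF past_subalgebra that])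
  show "f \<in> borel_measurable Om" if "f \<in> borel_measurable (future_alg l)" for l and f :: "_ \<Rightarrow> real"
    by (rule measurable_from_subalg[OF future_subalgebra that])
  show "0 \<le> rho q" for q by (rule rho_nonneg)
  show "summable (\<lambda>k. rho (2 ^ Suc k))" unfolding rho_def by (intro summable_add sumX sumY)
  fix l q and f g :: "(nat + nat \<Rightarrow> 'b) \<Rightarrow> real"
  assume l: "1 \<le> l" and f: "f \<in> borel_measurable (past_alg l)" "square_integrable Om f"
    and g: "g \<in> borel_measurable (future_alg (l + q))" "square_integrable Om g"
  have "future_alg (l + q) = PiM I (\<lambda>a. sigma_gen N (V a) {l + q..})" using l by (simp add: future_alg_def)
  then have "cov_mixing Om (past_alg l) (future_alg (l + q)) (rho q)"
    unfolding Om_def past_alg_def using l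
    by (simp only:) (intro cov_mixing_PiM finite_I rho_nonneg N V_cov_mixing sigma_gen_subalgebra V_measurable; simp)
  then have "\<bar>cov Om f g\<bar> \<le> rho q * (cov Om f f + cov Om g g) / 2"
    using f g unfolding cov_mixing_def by blast
  also have "\<dots> \<le> rho q * (Om.expectation (\<lambda>x. (f x)\<^sup>2) + Om.expectation (\<lambda>x. (g x)\<^sup>2)) / 2"
    using rho_nonneg[of q] f g
    by (intro divide_right_mono mult_left_mono add_mono) (simp_all add: Om.cov_eq power2_eq_square)
  finally show "\<bar>Om.expectation (\<lambda>x. f x * g x) - Om.expectation f * Om.expectation g\<bar>
     \<le> rho q * (Om.expectation (\<lambda>x. (f x)\<^sup>2) + Om.expectation (\<lambda>x. (g x)\<^sup>2)) / 2"
    using f g by (simp add: Om.cov_eq)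
qed

subsection \<open>Moments\<close>

lemma Om_prod:
  assumes "\<And>a. a \<in> I \<Longrightarrow> integrable N (f a)"
  shows "integrable Om (\<lambda>\<omega>. \<Prod>a\<in>I. f a (\<omega> a) :: real)"
    and "Om.expectation (\<lambda>\<omega>. \<Prod>a\<in>I. f a (\<omega> a)) = (\<Prod>a\<in>I. \<integral>x. f a x \<partial>N)"
proof -
  interpret product_sigma_finite "\<lambda>_. N" ..
  show "integrable Om (\<lambda>\<omega>. \<Prod>a\<in>I. f a (\<omega> a))" "Om.expectation (\<lambda>\<omega>. \<Prod>a\<in>I. f a (\<omega> a)) = (\<Prod>a\<in>I. \<integral>x. f a x \<partial>N)"
    unfolding Om_def using assms by (auto intro!: product_integrable_prod product_integral_prod)
qed

lemma Om_two:
  assumes ab: "a \<in> I" "b \<in> I" "a \<noteq> b" and fg: "integrable N f" "integrable N g"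
  shows "integrable Om (\<lambda>\<omega>. f (\<omega> a) * g (\<omega> b) :: real)"
    and "Om.expectation (\<lambda>\<omega>. f (\<omega> a) * g (\<omega> b)) = (\<integral>x. f x \<partial>N) * (\<integral>x. g x \<partial>N)"
proof -
  let ?f = "\<lambda>c x. (if c = a then f x else 1) * (if c = b then g x else 1)"
  have i: "integrable N (?f c)" for c using ab(3) fg by (cases "c = a"; cases "c = b") simp_all
  have pr: "(\<Prod>c\<in>I. ?f c (\<omega> c)) = f (\<omega> a) * g (\<omega> b)" for \<omega>
    using ab by (simp add: prod.distrib)
  have "(\<integral>x. ?f c x \<partial>N) = (if c = a then \<integral>x. f x \<partial>N else 1) * (if c = b then \<integral>x. g x \<partial>N else 1)" for c
    using ab(3) by (auto simp: N.prob_space)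
  then have "(\<Prod>c\<in>I. \<integral>x. ?f c x \<partial>N) = (\<integral>x. f x \<partial>N) * (\<integral>x. g x \<partial>N)"
    using ab by (simp add: prod.distrib)
  with Om_prod[of ?f] i pr show "integrable Om (\<lambda>\<omega>. f (\<omega> a) * g (\<omega> b))"
    "Om.expectation (\<lambda>\<omega>. f (\<omega> a) * g (\<omega> b)) = (\<integral>x. f x \<partial>N) * (\<integral>x. g x \<partial>N)" by simp_all
qed

lemma Om_one:
  assumes a: "a \<in> I" and f: "integrable N f"
  shows "integrable Om (\<lambda>\<omega>. f (\<omega> a) :: real)" and "Om.expectation (\<lambda>\<omega>. f (\<omega> a)) = (\<integral>x. f x \<partial>N)"
proof -
  define b :: "nat + nat" where "b = (case a of Inl _ \<Rightarrow> Inr 1 | Inr _ \<Rightarrow> Inl 1)"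
  have b: "b \<in> I" "a \<noteq> b"
    using m2 n2 by (cases a; simp add: b_def Inl_I Inr_I)+
  from Om_two[OF a b f, of "\<lambda>_. 1"] show "integrable Om (\<lambda>\<omega>. f (\<omega> a) :: real)" "Om.expectation (\<lambda>\<omega>. f (\<omega> a)) = (\<integral>x. f x \<partial>N)"
    by (simp_all add: N.prob_space)
qed

lemma Om_square_one:
  assumes "a \<in> I" "square_integrable N f"
  shows "square_integrable Om (\<lambda>\<omega>. f (\<omega> a))"
  using assms Om_one(1)[of a "\<lambda>x. (f x)\<^sup>2"] Om_component by (auto simp: square_integrable_def)

lemma Om_square_two:
  assumes "a \<in> I" "b \<in> I" "a \<noteq> b" "square_integrable N f" "square_integrable N g"
  shows "square_integrable Om (\<lambda>\<omega>. f (\<omega> a) * g (\<omega> b))"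
    and "Om.expectation (\<lambda>\<omega>. (f (\<omega> a) * g (\<omega> b))\<^sup>2) = (\<integral>x. (f x)\<^sup>2 \<partial>N) * (\<integral>x. (g x)\<^sup>2 \<partial>N)"
proof -
  have [measurable]: "(\<lambda>\<omega>. f (\<omega> a)) \<in> borel_measurable Om" "(\<lambda>\<omega>. g (\<omega> b)) \<in> borel_measurable Om"
    using assms by (auto intro!: Om_component simp: square_integrable_def)
  have "integrable N (\<lambda>x. (f x)\<^sup>2)" "integrable N (\<lambda>x. (g x)\<^sup>2)" using assms by (auto simp: square_integrable_def)
  from Om_two[OF assms(1-3) this]
  show "square_integrable Om (\<lambda>\<omega>. f (\<omega> a) * g (\<omega> b))"
    "Om.expectation (\<lambda>\<omega>. (f (\<omega> a) * g (\<omega> b))\<^sup>2) = (\<integral>x. (f x)\<^sup>2 \<partial>N) * (\<integral>x. (g x)\<^sup>2 \<partial>N)"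
    by (simp_all add: square_integrable_def power_mult_distrib)
qed

definition autocov :: "nat \<Rightarrow> nat \<Rightarrow> real" where
  "autocov i j = (\<integral>\<omega>. VX i \<omega> * VX j \<omega> \<partial>N)"

lemma V_autocov: "1 \<le> i \<Longrightarrow> 1 \<le> j \<Longrightarrow> (\<integral>\<omega>. V a i \<omega> * V a j \<omega> \<partial>N) = autocov i j"
  using autocov_eq by (cases a) (simp_all add: autocov_def)

lemma autocov_commute: "autocov i j = autocov j i"
  by (simp add: autocov_def mult.commute)

lemma autocov_shift: "1 \<le> i \<Longrightarrow> 1 \<le> j \<Longrightarrow> autocov (i + h) (j + h) = autocov i j"
  unfolding autocov_def
  by (rule strictly_stationary_product[OF stX]) (use V_measurable[of _ "Inl 0"] in auto)

lemma V_second_moment: "1 \<le> k \<Longrightarrow> (\<integral>\<omega>. (V a k \<omega>)\<^sup>2 \<partial>N) = autocov 1 1"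
  using V_autocov[of k k a] autocov_shift[of 1 1 "k - 1"] by (simp add: power2_eq_square)

text \<open>By independence and zero means, the expectation vanishes unless every coordinate that
  occurs does so at both times, which forces \<open>{c, e} = {a, b}\<close>. The two summands are
  the two orders of the pair; they exclude each other since \<open>a \<noteq> b\<close>.\<close>

lemma Om_four:
  assumes ab: "a \<in> I" "b \<in> I" "a \<noteq> b" and ce: "c \<in> I" "e \<in> I" "c \<noteq> e" and kl: "1 \<le> k" "1 \<le> l"
  shows "Om.expectation (\<lambda>\<omega>. (V a k (\<omega> a) * V b k (\<omega> b)) * (V c l (\<omega> c) * V e l (\<omega> e))) =
    (if (c, e) = (a, b) then (autocov k l)\<^sup>2 else 0) + (if (c, e) = (b, a) then (autocov k l)\<^sup>2 else 0)"
proof -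
  let ?u = "\<lambda>i x. (if i = a \<or> i = b then V i k x else 1)"
  let ?v = "\<lambda>i x. (if i = c \<or> i = e then V i l x else 1)"
  have su: "square_integrable N (?u i)" and sv: "square_integrable N (?v i)" for i
    using V_square_integrable[OF kl(1)] V_square_integrable[OF kl(2)] N.square_integrable_const[of 1]
    by (cases "i = a \<or> i = b"; cases "i = c \<or> i = e"; simp)+
  have i: "integrable N (\<lambda>x. ?u i x * ?v i x)" for i
    by (rule square_integrable_mult[OF su sv])
  have two: "(\<Prod>i\<in>I. if i = a \<or> i = b then w i else 1) = w a * w b"
    if "a \<in> I" "b \<in> I" "a \<noteq> b" for a b :: "nat + nat" and w :: "nat + nat \<Rightarrow> real"
  proof -
    have "(\<Prod>i\<in>I. if i = a \<or> i = b then w i else 1) = (\<Prod>i\<in>{a, b}. if i = a \<or> i = b then w i else 1)"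
      using that by (intro prod.mono_neutral_right) auto
    then show ?thesis using that by simp
  qed
  have pr: "(\<Prod>i\<in>I. ?u i (\<omega> i) * ?v i (\<omega> i)) = (V a k (\<omega> a) * V b k (\<omega> b)) * (V c l (\<omega> c) * V e l (\<omega> e))" for \<omega>
    unfolding prod.distrib two[OF ab] two[OF ce] ..
  have "Om.expectation (\<lambda>\<omega>. (V a k (\<omega> a) * V b k (\<omega> b)) * (V c l (\<omega> c) * V e l (\<omega> e))) = (\<Prod>i\<in>I. \<integral>x. ?u i x * ?v i x \<partial>N)"
    using Om_prod(2)[of "\<lambda>i x. ?u i x * ?v i x"] i unfolding pr by blast
  also have "\<dots> = (if (c, e) = (a, b) then (autocov k l)\<^sup>2 else 0) + (if (c, e) = (b, a) then (autocov k l)\<^sup>2 else 0)"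
  proof (cases "c \<in> {a, b} \<and> e \<in> {a, b}")
    case True
    then have "(\<integral>x. ?u i x * ?v i x \<partial>N) = (if i = a \<or> i = b then autocov k l else 1)" for i
      using V_autocov[OF kl] ce(3) by (auto simp: N.prob_space)
    then have "(\<Prod>i\<in>I. \<integral>x. ?u i x * ?v i x \<partial>N) = autocov k l * autocov k l"
      using two[OF ab, of "\<lambda>_. autocov k l"] by simp
    then show ?thesis using True ce(3) ab(3) by (auto simp: power2_eq_square)
  next
    case False
    then obtain i where i: "i \<in> {c, e}" "i \<notin> {a, b}" by blast
    have "(\<integral>x. ?u i x * ?v i x \<partial>N) = 0" using i V_mean[OF kl(2)] by auto
    moreover have "i \<in> I" using i ce by auto
    ultimately have "(\<Prod>i\<in>I. \<integral>x. ?u i x * ?v i x \<partial>N) = 0" by (intro prod_zero bexI finite_I)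
    moreover have "(c, e) \<noteq> (a, b)" "(c, e) \<noteq> (b, a)" using False by auto
    ultimately show ?thesis by (simp only: if_False add_0_left)
  qed
  finally show ?thesis .
qed

end

context two_sample
begin

subsection \<open>The quadratic form of the noise\<close>

definition P :: "((nat + nat) \<times> (nat + nat)) set" where
  "P = {(a, b). a \<in> I \<and> b \<in> I \<and> a \<noteq> b}"

text \<open>The coefficients of the CQ statistic as a quadratic form in the pooled sample: \<open>Inl i\<close> stands for
  the \<open>i\<close>-th observation of \<open>X\<close> and \<open>Inr j\<close> for the \<open>j\<close>-th one of \<open>Y\<close>.\<close>

definition wt :: "nat + nat \<Rightarrow> nat + nat \<Rightarrow> real" where
  "wt a b = (case a of
     Inl _ \<Rightarrow> (case b of Inl _ \<Rightarrow> 1 / (real m * (real m - 1)) | Inr _ \<Rightarrow> - 1 / (real m * real n))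
   | Inr _ \<Rightarrow> (case b of Inl _ \<Rightarrow> - 1 / (real m * real n) | Inr _ \<Rightarrow> 1 / (real n * (real n - 1))))"

lemma wt_simps [simp]:
  "wt (Inl i) (Inl i') = 1 / (real m * (real m - 1))" "wt (Inr j) (Inr j') = 1 / (real n * (real n - 1))"
  "wt (Inl i) (Inr j) = - 1 / (real m * real n)" "wt (Inr j) (Inl i) = - 1 / (real m * real n)"
  by (simp_all add: wt_def)

lemma wt_commute: "wt a b = wt b a"
  by (cases a; cases b) simp_all

lemma wt_le_1: "\<bar>wt a b\<bar> \<le> 1"
proof -
  have "1 \<le> real m * (real m - 1)" "1 \<le> real n * (real n - 1)" "1 \<le> real m * real n"
    using m2 n2 mult_mono[of 1 "real m" 1 "real m - 1"] mult_mono[of 1 "real n" 1 "real n - 1"] mult_mono[of 1 "real m" 1 "real n"] by auto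
  then show ?thesis by (cases a; cases b) (auto simp: divide_le_eq abs_divide)
qed

lemma finite_P [simp]: "finite P"
  by (rule finite_subset[of _ "I \<times> I"]) (auto simp: P_def)

lemma sum_P:
  "(\<Sum>(a, b)\<in>P. wt a b * F a b) = pair_avg m (\<lambda>i i'. F (Inl i) (Inl i')) + pair_avg n (\<lambda>j j'. F (Inr j) (Inr j'))
     - cross_avg m n (\<lambda>i j. F (Inl i) (Inr j)) - cross_avg m n (\<lambda>i j. F (Inr j) (Inl i))"
proof -
  let ?G = "\<lambda>p. wt (fst p) (snd p) * F (fst p) (snd p)"
  let ?ll = "\<lambda>(i, i'). (Inl i, Inl i') :: (nat + nat) \<times> (nat + nat)" and ?rr = "\<lambda>(i, i'). (Inr i, Inr i') :: (nat + nat) \<times> (nat + nat)"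
    and ?lr = "\<lambda>(i, i'). (Inl i, Inr i') :: (nat + nat) \<times> (nat + nat)" and ?rl = "\<lambda>(i, i'). (Inr i', Inl i) :: (nat + nat) \<times> (nat + nat)"
  let ?X = "{1..m} \<times> {1..n}"
  have P: "P = (?ll ` neq_pairs m \<union> ?rr ` neq_pairs n) \<union> (?lr ` ?X \<union> ?rl ` ?X)"
    by (auto simp: P_def I_def neq_pairs_def image_iff)
  have inj: "inj_on ?ll A" "inj_on ?rr A" "inj_on ?lr A" "inj_on ?rl A" for A
    by (auto simp: inj_on_def)
  have "(\<Sum>p\<in>P. ?G p) = ((\<Sum>p\<in>?ll ` neq_pairs m. ?G p) + (\<Sum>p\<in>?rr ` neq_pairs n. ?G p)) + ((\<Sum>p\<in>?lr ` ?X. ?G p) + (\<Sum>p\<in>?rl ` ?X. ?G p))"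
    unfolding P
    by (rule trans[OF sum.union_disjoint arg_cong2[of _ _ _ _ "(+)", OF sum.union_disjoint sum.union_disjoint]])
      (auto simp: neq_pairs_Sigma)
  also have "\<dots> = pair_avg m (\<lambda>i i'. F (Inl i) (Inl i')) + pair_avg n (\<lambda>j j'. F (Inr j) (Inr j'))
     - cross_avg m n (\<lambda>i j. F (Inl i) (Inr j)) - cross_avg m n (\<lambda>i j. F (Inr j) (Inl i))"
    unfolding sum.reindex[OF inj(1)] sum.reindex[OF inj(2)] sum.reindex[OF inj(3)] sum.reindex[OF inj(4)] comp_def
    by (simp add: pair_avg_def cross_avg_def case_prod_beta sum.cartesian_product sum_distrib_left sum_negf)
  finally show ?thesis by (simp add: case_prod_beta)
qed

text \<open>The transform \<phi> of the single coordinates is a parameter, so that the noise itself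
  and its truncation share one construction.\<close>

definition Q :: "(nat + nat \<Rightarrow> nat \<Rightarrow> real \<Rightarrow> real) \<Rightarrow> nat \<Rightarrow> (nat + nat \<Rightarrow> 'b) \<Rightarrow> real" where
  "Q \<phi> k \<omega> = (\<Sum>(a, b)\<in>P. wt a b * (\<phi> a k (V a k (\<omega> a)) * \<phi> b k (V b k (\<omega> b))))"

definition W :: "nat \<Rightarrow> (nat + nat \<Rightarrow> 'b) \<Rightarrow> real" where
  "W = Q (\<lambda>_ _ x. x)"

text \<open>Because \<open>i \<noteq> i'\<close> and \<open>j \<noteq> j'\<close>, only products of
  different observations arise; this is why the form has no diagonal and mean 0.\<close>

lemma W_quad_avg:
  "quad_avg m n (\<lambda>i i' j j'. (V (Inl i) k (\<omega> (Inl i)) - V (Inr j) k (\<omega> (Inr j))) * (V (Inl i') k (\<omega> (Inl i')) - V (Inr j') k (\<omega> (Inr j')))) = W k \<omega>"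
proof -
  let ?x = "\<lambda>i. V (Inl i) k (\<omega> (Inl i))" and ?y = "\<lambda>j. V (Inr j) k (\<omega> (Inr j))"
  have "quad_avg m n (\<lambda>i i' j j'. (?x i - ?y j) * (?x i' - ?y j')) =
     quad_avg m n (\<lambda>i i' j j'. ((?x i * ?x i' + ?y j * ?y j') - ?x i * ?y j') - ?x i' * ?y j)"
    by (intro arg_cong[of _ _ "quad_avg m n"] ext) (simp add: algebra_simps)
  also have "\<dots> = pair_avg m (\<lambda>i i'. ?x i * ?x i') + pair_avg n (\<lambda>j j'. ?y j * ?y j')
     - cross_avg m n (\<lambda>i j. ?x i * ?y j) - cross_avg m n (\<lambda>i j. ?x i * ?y j)"
    unfolding quad_avg_add quad_avg_diff
    using quad_avg_pairs(1)[OF m2 n2, of "\<lambda>i i'. ?x i * ?x i'"] quad_avg_pairs(2)[OF m2 n2, of "\<lambda>j j'. ?y j * ?y j'"]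
      quad_avg_cross[OF m2 n2, of "\<lambda>i j. ?x i * ?y j"] by simp
  also have "\<dots> = W k \<omega>"
    unfolding W_def Q_def sum_P by (simp add: mult.commute)
  finally show ?thesis .
qed

lemma Q_adapted:
  assumes [measurable]: "\<And>a k. \<phi> a k \<in> borel_measurable borel"
  shows "Om.adapted (Q \<phi>)"
proof -
  have "Q \<phi> k \<in> borel_measurable (PiM I (\<lambda>a. sigma_gen N (V a) K))" if k: "k \<in> K" for k K
    unfolding Q_def case_prod_beta
  proof (intro borel_measurable_sum borel_measurable_times borel_measurable_const)
    fix p assume p: "p \<in> P"
    have *: "(\<lambda>\<omega>. \<phi> a k (V a k (\<omega> a))) \<in> borel_measurable (PiM I (\<lambda>a. sigma_gen N (V a) K))" if "a \<in> I" for a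
      using that by (intro measurable_compose[OF measurable_component_singleton[OF that]]
          measurable_compose[OF sigma_gen_measurable[OF k]] assms)
    show "(\<lambda>\<omega>. \<phi> (fst p) k (V (fst p) k (\<omega> (fst p)))) \<in> borel_measurable (PiM I (\<lambda>a. sigma_gen N (V a) K))"
      "(\<lambda>\<omega>. \<phi> (snd p) k (V (snd p) k (\<omega> (snd p)))) \<in> borel_measurable (PiM I (\<lambda>a. sigma_gen N (V a) K))"
      using p by (auto simp: P_def intro!: *)
  qed
  then show ?thesis unfolding Om.adapted_def past_alg_def future_alg_def by auto
qed

lemma expectation_weighted_P:
  assumes sq: "\<And>a b. (a, b) \<in> P \<Longrightarrow> square_integrable Om (f a b)"
    and mean: "\<And>a b. (a, b) \<in> P \<Longrightarrow> Om.expectation (f a b) = 0"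
    and bnd: "\<And>a b. (a, b) \<in> P \<Longrightarrow> Om.expectation (\<lambda>\<omega>. (f a b \<omega>)\<^sup>2) \<le> c"
  shows "square_integrable Om (\<lambda>\<omega>. \<Sum>(a, b)\<in>P. wt a b * f a b \<omega>)"
    and "Om.expectation (\<lambda>\<omega>. \<Sum>(a, b)\<in>P. wt a b * f a b \<omega>) = 0"
    and "Om.expectation (\<lambda>\<omega>. (\<Sum>(a, b)\<in>P. wt a b * f a b \<omega>)\<^sup>2) \<le> (real (card P))\<^sup>2 * c"
proof -
  have s: "square_integrable Om (\<lambda>\<omega>. wt (fst p) (snd p) * f (fst p) (snd p) \<omega>)" if "p \<in> P" for p
    using that by (intro square_integrable_cmult sq) simp
  show "square_integrable Om (\<lambda>\<omega>. \<Sum>(a, b)\<in>P. wt a b * f a b \<omega>)"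
    unfolding case_prod_beta by (intro square_integrable_sum s)
  have "Om.expectation (\<lambda>\<omega>. \<Sum>p\<in>P. wt (fst p) (snd p) * f (fst p) (snd p) \<omega>) =
     (\<Sum>p\<in>P. Om.expectation (\<lambda>\<omega>. wt (fst p) (snd p) * f (fst p) (snd p) \<omega>))"
    by (intro Bochner_Integration.integral_sum Om.square_integrable_integrable s)
  also have "\<dots> = 0" by (intro sum.neutral) (auto simp: mean)
  finally show "Om.expectation (\<lambda>\<omega>. \<Sum>(a, b)\<in>P. wt a b * f a b \<omega>) = 0" by (simp add: case_prod_beta)
  show "Om.expectation (\<lambda>\<omega>. (\<Sum>(a, b)\<in>P. wt a b * f a b \<omega>)\<^sup>2) \<le> (real (card P))\<^sup>2 * c"
    unfolding case_prod_beta
  proof (intro Om.expectation_sum_square_le finite_P s)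
    fix p assume p: "p \<in> P"
    obtain a b where ab: "p = (a, b)" by (cases p)
    have "(wt a b)\<^sup>2 * Om.expectation (\<lambda>\<omega>. (f a b \<omega>)\<^sup>2) \<le> 1 * c"
      using wt_le_1[of a b] bnd[of a b] p ab by (intro mult_mono) (auto simp: abs_square_le_1)
    then show "Om.expectation (\<lambda>\<omega>. (wt (fst p) (snd p) * f (fst p) (snd p) \<omega>)\<^sup>2) \<le> c"
      by (simp add: ab power_mult_distrib)
  qed
qed

definition g0 :: real where "g0 = autocov 1 1"

lemma g0_nonneg: "0 \<le> g0"
proof -
  have "0 \<le> (\<integral>\<omega>. (V (Inl 0) 1 \<omega>)\<^sup>2 \<partial>N)" by simp
  also have "\<dots> = g0" unfolding g0_def by (rule V_second_moment) simp
  finally show ?thesis .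
qed

text \<open>For independent coordinates the second moment of a product is the product of second
  moments, so two moments of the noise give two moments of the quadratic form.\<close>

lemma Q_centred_L2:
  assumes m: "\<And>a k. \<phi> a k \<in> borel_measurable borel"
    and sq: "\<And>a k. 1 \<le> k \<Longrightarrow> square_integrable N (\<lambda>x. \<phi> a k (V a k x))"
    and mean: "\<And>a k. 1 \<le> k \<Longrightarrow> (\<integral>x. \<phi> a k (V a k x) \<partial>N) = 0"
    and bnd: "\<And>a k. 1 \<le> k \<Longrightarrow> (\<integral>x. (\<phi> a k (V a k x))\<^sup>2 \<partial>N) \<le> g0"
  shows "Om.centred_L2 (Q \<phi>) ((real (card P))\<^sup>2 * (g0 * g0))"
  unfolding Om.centred_L2_def
proof (intro conjI allI impI)
  show "Om.adapted (Q \<phi>)" by (rule Q_adapted[OF m])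
  fix k :: nat assume k: "1 \<le> k"
  let ?f = "\<lambda>a b \<omega>. \<phi> a k (V a k (\<omega> a)) * \<phi> b k (V b k (\<omega> b))"
  have 1: "square_integrable Om (?f a b)" if "(a, b) \<in> P" for a b
    using that Om_square_two(1)[of a b, OF _ _ _ sq[OF k] sq[OF k]] by (auto simp: P_def)
  have 2: "Om.expectation (?f a b) = 0" if "(a, b) \<in> P" for a b
    using that Om_two(2)[of a b, OF _ _ _ N.square_integrable_integrable[OF sq[OF k]] N.square_integrable_integrable[OF sq[OF k]]] mean[OF k]
    by (auto simp: P_def)
  have 3: "Om.expectation (\<lambda>\<omega>. (?f a b \<omega>)\<^sup>2) \<le> g0 * g0" if "(a, b) \<in> P" for a b
    using that Om_square_two(2)[of a b, OF _ _ _ sq[OF k] sq[OF k]] mult_mono[OF bnd[OF k] bnd[OF k] g0_nonneg]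
    by (auto simp: P_def)
  show "square_integrable Om (Q \<phi> k)" "Om.expectation (Q \<phi> k) = 0"
    "Om.expectation (\<lambda>\<omega>. (Q \<phi> k \<omega>)\<^sup>2) \<le> (real (card P))\<^sup>2 * (g0 * g0)"
    using expectation_weighted_P[of ?f, OF 1 2 3] by (simp_all add: Q_def[abs_def])
qed

text \<open>The difference of two products telescopes into \<open>(x - z) * y + z * (y - w)\<close>.
  In each part one factor is small and independent of the other, and \<open>4 = 2 + 2\<close> comes
  from squaring a sum of two.\<close>

lemma Q_diff_centred_L2:
  assumes m: "\<And>a k. \<phi> a k \<in> borel_measurable borel" "\<And>a k. \<psi> a k \<in> borel_measurable borel"
    and sq: "\<And>a k. 1 \<le> k \<Longrightarrow> square_integrable N (\<lambda>x. \<phi> a k (V a k x))" "\<And>a k. 1 \<le> k \<Longrightarrow> square_integrable N (\<lambda>x. \<psi> a k (V a k x))"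
    and mean: "\<And>a k. 1 \<le> k \<Longrightarrow> (\<integral>x. \<phi> a k (V a k x) \<partial>N) = 0" "\<And>a k. 1 \<le> k \<Longrightarrow> (\<integral>x. \<psi> a k (V a k x) \<partial>N) = 0"
    and bnd: "\<And>a k. 1 \<le> k \<Longrightarrow> (\<integral>x. (\<phi> a k (V a k x))\<^sup>2 \<partial>N) \<le> g0" "\<And>a k. 1 \<le> k \<Longrightarrow> (\<integral>x. (\<psi> a k (V a k x))\<^sup>2 \<partial>N) \<le> g0"
    and dif: "\<And>a k. 1 \<le> k \<Longrightarrow> (\<integral>x. (\<phi> a k (V a k x) - \<psi> a k (V a k x))\<^sup>2 \<partial>N) \<le> \<eta>" and \<eta>: "0 \<le> \<eta>"
  shows "Om.centred_L2 (\<lambda>k \<omega>. Q \<phi> k \<omega> - Q \<psi> k \<omega>) ((real (card P))\<^sup>2 * (4 * (\<eta> * g0)))"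
  unfolding Om.centred_L2_def
proof (intro conjI allI impI)
  show "Om.adapted (\<lambda>k \<omega>. Q \<phi> k \<omega> - Q \<psi> k \<omega>)"
    using Q_adapted[of \<phi>, OF m(1)] Q_adapted[of \<psi>, OF m(2)] unfolding Om.adapted_def by (auto intro!: borel_measurable_diff)
  fix k :: nat assume k: "1 \<le> k"
  let ?p = "\<lambda>a x. \<phi> a k (V a k x)" and ?q = "\<lambda>a x. \<psi> a k (V a k x)"
  note sq = sq(1)[OF k] sq(2)[OF k] and mean = mean(1)[OF k] mean(2)[OF k] and bnd = bnd(1)[OF k] bnd(2)[OF k] and dif = dif[OF k]
  have sd: "square_integrable N (\<lambda>x. ?p a x - ?q a x)" for a by (intro square_integrable_diff sq)
  let ?f = "\<lambda>a b \<omega>. ?p a (\<omega> a) * ?p b (\<omega> b) - ?q a (\<omega> a) * ?q b (\<omega> b)"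
  have 1: "square_integrable Om (?f a b)" if "(a, b) \<in> P" for a b
    using that by (intro square_integrable_diff Om_square_two(1) sq) (auto simp: P_def)
  have 2: "Om.expectation (?f a b) = 0" if "(a, b) \<in> P" for a b
  proof -
    have ab: "a \<in> I" "b \<in> I" "a \<noteq> b" using that by (auto simp: P_def)
    note i = N.square_integrable_integrable[OF sq(1)] N.square_integrable_integrable[OF sq(2)]
    show ?thesis using Om_two[OF ab i(1) i(1)] Om_two[OF ab i(2) i(2)] mean by simp
  qed
  have 3: "Om.expectation (\<lambda>\<omega>. (?f a b \<omega>)\<^sup>2) \<le> 4 * (\<eta> * g0)" if "(a, b) \<in> P" for a b
  proof -
    have ab: "a \<in> I" "b \<in> I" "a \<noteq> b" using that by (auto simp: P_def)
    note u = Om_square_two[OF ab sd sq(1)] and v = Om_square_two[OF ab sq(2) sd]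
    have "Om.expectation (\<lambda>\<omega>. (?f a b \<omega>)\<^sup>2) \<le>
      Om.expectation (\<lambda>\<omega>. 2 * ((?p a (\<omega> a) - ?q a (\<omega> a)) * ?p b (\<omega> b))\<^sup>2 + 2 * (?q a (\<omega> a) * (?p b (\<omega> b) - ?q b (\<omega> b)))\<^sup>2)"
    proof (intro integral_mono)
      show "integrable Om (\<lambda>\<omega>. (?f a b \<omega>)\<^sup>2)" using 1[OF that] by (simp add: square_integrable_def)
      show "integrable Om (\<lambda>\<omega>. 2 * ((?p a (\<omega> a) - ?q a (\<omega> a)) * ?p b (\<omega> b))\<^sup>2 + 2 * (?q a (\<omega> a) * (?p b (\<omega> b) - ?q b (\<omega> b)))\<^sup>2)"
        using u(1) v(1) unfolding square_integrable_def by (intro Bochner_Integration.integrable_add integrable_mult_right) auto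
      have "(x * y - z * w)\<^sup>2 \<le> 2 * ((x - z) * y)\<^sup>2 + 2 * (z * (y - w))\<^sup>2" for x y z w :: real
        using zero_le_power2[of "(x - z) * y - z * (y - w)"] by (simp add: power2_eq_square algebra_simps)
      then show "(?f a b \<omega>)\<^sup>2 \<le> 2 * ((?p a (\<omega> a) - ?q a (\<omega> a)) * ?p b (\<omega> b))\<^sup>2 + 2 * (?q a (\<omega> a) * (?p b (\<omega> b) - ?q b (\<omega> b)))\<^sup>2" for \<omega>
        by blast
    qed
    also have "\<dots> = 2 * Om.expectation (\<lambda>\<omega>. ((?p a (\<omega> a) - ?q a (\<omega> a)) * ?p b (\<omega> b))\<^sup>2) + 2 * Om.expectation (\<lambda>\<omega>. (?q a (\<omega> a) * (?p b (\<omega> b) - ?q b (\<omega> b)))\<^sup>2)"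
      using u(1) v(1) unfolding square_integrable_def
      by (subst Bochner_Integration.integral_add) (auto simp only: integral_mult_right_zero intro!: integrable_mult_right)
    also have "\<dots> \<le> 2 * (\<eta> * g0) + 2 * (g0 * \<eta>)"
      unfolding u(2) v(2) using \<eta> g0_nonneg by (intro add_mono mult_left_mono mult_mono dif bnd) auto
    finally show ?thesis by simp
  qed
  have eq: "Q \<phi> k \<omega> - Q \<psi> k \<omega> = (\<Sum>(a, b)\<in>P. wt a b * ?f a b \<omega>)" for \<omega>
    by (simp add: Q_def case_prod_beta right_diff_distrib sum_subtractf)
  show "square_integrable Om (\<lambda>\<omega>. Q \<phi> k \<omega> - Q \<psi> k \<omega>)" "Om.expectation (\<lambda>\<omega>. Q \<phi> k \<omega> - Q \<psi> k \<omega>) = 0"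
    "Om.expectation (\<lambda>\<omega>. (Q \<phi> k \<omega> - Q \<psi> k \<omega>)\<^sup>2) \<le> (real (card P))\<^sup>2 * (4 * (\<eta> * g0))"
    unfolding eq using expectation_weighted_P[of ?f, OF 1 2 3] by simp_all
qed

end

section \<open>Variance and central limit theorem of the quadratic form\<close>

context two_sample
begin

definition kap :: real where
  "kap = 2 / (real m * (real m - 1)) + 2 / (real n * (real n - 1)) + 4 / (real m * real n)"

lemma kap_pos: "0 < kap"
  unfolding kap_def using m2 n2 by (intro add_pos_pos divide_pos_pos mult_pos_pos) auto

lemma sum_wt_square: "(\<Sum>(a, b)\<in>P. wt a b * wt a b) = kap / 2"
  unfolding sum_P wt_simps cross_avg_const[OF m2 n2] pair_avg_const[OF m2 n2] pair_avg_const[OF n2 m2]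
  by (simp add: kap_def)

lemma W_centred_L2: "Om.centred_L2 W ((real (card P))\<^sup>2 * (g0 * g0))"
  unfolding W_def
proof (rule Q_centred_L2)
  show "(\<integral>x. (V a k x)\<^sup>2 \<partial>N) \<le> g0" if "1 \<le> k" for a k
    using V_second_moment[OF that] by (simp add: g0_def)
qed (simp_all add: V_square_integrable V_mean)

text \<open>A pair correlates exactly with itself and with its reversal, and the weights are
  symmetric; twice the sum of the squared weights over ordered pairs is \<open>kap\<close>.\<close>

lemma W_cov:
  assumes kl: "1 \<le> k" "1 \<le> l"
  shows "Om.expectation (\<lambda>\<omega>. W k \<omega> * W l \<omega>) = kap * (autocov k l)\<^sup>2"
proof -
  let ?f = "\<lambda>k p \<omega>. V (fst p) k (\<omega> (fst p)) * V (snd p) k (\<omega> (snd p))"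
  have if_distr: "x * ((if A then y else 0) + (if B then y else 0)) = (if A then x * y else 0) + (if B then x * y else 0)"
    for x y :: real and A B by simp
  have mem: "fst p \<in> I" "snd p \<in> I" "fst p \<noteq> snd p" if "p \<in> P" for p using that by (auto simp: P_def)
  have sq: "square_integrable Om (?f k p)" if "p \<in> P" "1 \<le> k" for p k
    using that by (intro Om_square_two(1) mem V_square_integrable)
  have int: "integrable Om (\<lambda>\<omega>. ?f k p \<omega> * ?f l p' \<omega>)" if "p \<in> P" "p' \<in> P" for p p'
    using that kl by (intro square_integrable_mult sq)
  let ?w = "\<lambda>p. wt (fst p) (snd p)" and ?s = "\<lambda>p. (snd p, fst p)"
  have "W k \<omega> * W l \<omega> = (\<Sum>p\<in>P. \<Sum>p'\<in>P. (?w p * ?w p') * (?f k p \<omega> * ?f l p' \<omega>))" for \<omega>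
    unfolding W_def Q_def case_prod_beta sum_product by (intro sum.cong refl) simp
  then have "Om.expectation (\<lambda>\<omega>. W k \<omega> * W l \<omega>) = (\<Sum>p\<in>P. \<Sum>p'\<in>P. (?w p * ?w p') * Om.expectation (\<lambda>\<omega>. ?f k p \<omega> * ?f l p' \<omega>))"
    using int by (simp add: Bochner_Integration.integral_sum)
  also have "\<dots> = (\<Sum>p\<in>P. \<Sum>p'\<in>P. (?w p * ?w p') * ((if p' = p then (autocov k l)\<^sup>2 else 0) + (if p' = ?s p then (autocov k l)\<^sup>2 else 0)))"
  proof (intro sum.cong refl arg_cong2[of _ _ _ _ "(*)"])
    fix p p' assume "p \<in> P" "p' \<in> P"
    from Om_four[OF mem[OF this(1)] mem[OF this(2)] kl]
    show "Om.expectation (\<lambda>\<omega>. ?f k p \<omega> * ?f l p' \<omega>) = (if p' = p then (autocov k l)\<^sup>2 else 0) + (if p' = ?s p then (autocov k l)\<^sup>2 else 0)"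
      by (simp add: prod_eq_iff)
  qed
  also have "\<dots> = (\<Sum>p\<in>P. 2 * (?w p * ?w p) * (autocov k l)\<^sup>2)"
  proof (intro sum.cong refl)
    fix p assume p: "p \<in> P"
    then have "?s p \<in> P" by (auto simp: P_def)
    have "(\<Sum>p'\<in>P. (?w p * ?w p') * ((if p' = p then (autocov k l)\<^sup>2 else 0) + (if p' = ?s p then (autocov k l)\<^sup>2 else 0))) =
      (\<Sum>p'\<in>P. if p' = p then ?w p * ?w p' * (autocov k l)\<^sup>2 else 0) + (\<Sum>p'\<in>P. if p' = ?s p then ?w p * ?w p' * (autocov k l)\<^sup>2 else 0)"
      unfolding sum.distrib[symmetric] if_distr ..
    also have "\<dots> = ?w p * ?w p * (autocov k l)\<^sup>2 + ?w p * ?w (?s p) * (autocov k l)\<^sup>2"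
      using p \<open>?s p \<in> P\<close> by (simp only: sum.delta finite_P if_True)
    finally show "(\<Sum>p'\<in>P. (?w p * ?w p') * ((if p' = p then (autocov k l)\<^sup>2 else 0) + (if p' = ?s p then (autocov k l)\<^sup>2 else 0)))
      = 2 * (?w p * ?w p) * (autocov k l)\<^sup>2"
      by (simp add: wt_commute[of "snd p" "fst p"])
  qed
  also have "\<dots> = 2 * (\<Sum>(a, b)\<in>P. wt a b * wt a b) * (autocov k l)\<^sup>2"
    by (simp add: sum_distrib_left sum_distrib_right case_prod_beta)
  finally show ?thesis by (simp add: sum_wt_square)
qed

definition T :: "nat \<Rightarrow> real" where
  "T p = (\<Sum>k\<in>{1..p}. \<Sum>l\<in>{1..p}. (autocov k l)\<^sup>2)"

lemma W_blk_variance: "Om.expectation (\<lambda>\<omega>. (Om.blk W h p \<omega>)\<^sup>2) = kap * T p"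
proof -
  have sq: "square_integrable Om (W k)" if "1 \<le> k" for k
    using W_centred_L2 that unfolding Om.centred_L2_def by blast
  have "Om.expectation (\<lambda>\<omega>. (Om.blk W h p \<omega>)\<^sup>2) = Om.expectation (\<lambda>\<omega>. \<Sum>k\<in>{h<..h + p}. \<Sum>l\<in>{h<..h + p}. W k \<omega> * W l \<omega>)"
    by (simp add: Om.blk_def power2_eq_square sum_product)
  also have "\<dots> = (\<Sum>k\<in>{h<..h + p}. \<Sum>l\<in>{h<..h + p}. Om.expectation (\<lambda>\<omega>. W k \<omega> * W l \<omega>))"
    by (subst Bochner_Integration.integral_sum; (intro Bochner_Integration.integrable_sum square_integrable_mult sq; auto)?)
      (intro sum.cong refl Bochner_Integration.integral_sum square_integrable_mult sq; auto)
  also have "\<dots> = (\<Sum>k\<in>{h<..h + p}. \<Sum>l\<in>{h<..h + p}. kap * (autocov k l)\<^sup>2)"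
    by (intro sum.cong refl W_cov) auto
  also have "\<dots> = (\<Sum>k\<in>{1..p}. \<Sum>l\<in>{1..p}. kap * (autocov k l)\<^sup>2)"
  proof -
    have re: "(\<Sum>k\<in>{h<..h + p}. F k) = (\<Sum>k\<in>{1..p}. F (k + h))" for F :: "nat \<Rightarrow> real"
      by (rule sum.reindex_bij_witness[of _ "\<lambda>k. k + h" "\<lambda>k. k - h"]) auto
    show ?thesis unfolding re by (intro sum.cong refl) (simp add: autocov_shift)
  qed
  finally show ?thesis by (simp add: T_def sum_distrib_left)
qed

lemma autocov_lag: "1 \<le> i \<Longrightarrow> i \<le> j \<Longrightarrow> autocov i j = autocov 1 (1 + (j - i))"
  using autocov_shift[of 1 "1 + (j - i)" "i - 1"] by simp

definition tail :: "nat \<Rightarrow> real" where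
  "tail p = (\<Sum>h\<in>{1..p}. (autocov 1 (1 + h))\<^sup>2)"

text \<open>Bordering a symmetric Toeplitz matrix: the new row and the new column each carry the
  lags 1 to \<open>p\<close>, the corner carries lag 0. The increments thus grow with
  \<open>p\<close>, so \<open>T\<close> is convex, which the lemmas on \<open>T\<close> below
  exploit.\<close>

lemma T_Suc: "T (Suc p) = T p + (g0\<^sup>2 + 2 * tail p)"
proof -
  have row: "(\<Sum>k\<in>{1..p}. (autocov k (Suc p))\<^sup>2) = tail p"
  proof -
    have "(\<Sum>k\<in>{1..p}. (autocov k (Suc p))\<^sup>2) = (\<Sum>k\<in>{1..p}. (autocov 1 (1 + (Suc p - k)))\<^sup>2)"
    proof (intro sum.cong refl)
      fix k assume "k \<in> {1..p}"
      then have "autocov k (Suc p) = autocov 1 (1 + (Suc p - k))" by (intro autocov_lag) auto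
      then show "(autocov k (Suc p))\<^sup>2 = (autocov 1 (1 + (Suc p - k)))\<^sup>2" by (rule arg_cong)
    qed
    also have "\<dots> = tail p"
      unfolding tail_def
      by (rule sum.reindex_bij_witness[of _ "\<lambda>h. Suc p - h" "\<lambda>k. Suc p - k"]) auto
    finally show ?thesis .
  qed
  have sw: "(\<Sum>l\<in>{1..p}. (autocov (Suc p) l)\<^sup>2) = (\<Sum>l\<in>{1..p}. (autocov l (Suc p))\<^sup>2)"
    by (intro sum.cong refl arg_cong[of _ _ "\<lambda>x. x\<^sup>2"] autocov_commute)
  have "T (Suc p) = (\<Sum>k\<in>{1..p}. \<Sum>l\<in>{1..Suc p}. (autocov k l)\<^sup>2) + (\<Sum>l\<in>{1..Suc p}. (autocov (Suc p) l)\<^sup>2)"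
    by (simp add: T_def)
  also have "\<dots> = (T p + (\<Sum>k\<in>{1..p}. (autocov k (Suc p))\<^sup>2)) + ((\<Sum>l\<in>{1..p}. (autocov l (Suc p))\<^sup>2) + (autocov (Suc p) (Suc p))\<^sup>2)"
    using sw by (simp add: T_def sum.distrib)
  also have "autocov (Suc p) (Suc p) = g0"
    using autocov_lag[of "Suc p" "Suc p"] by (simp add: g0_def)
  finally show ?thesis unfolding row by simp
qed

lemma T_0 [simp]: "T 0 = 0" by (simp add: T_def)

text \<open>\<open>T p\<close> is \<open>tr (\<Sigma>\<^sup>2)\<close> in dimension \<open>p\<close>. The linear bound on \<open>T\<close>, inherited from the variance bound
  for \<open>W\<close>, is what makes the autocovariances square summable.\<close>

lemma tail_mono: "p \<le> q \<Longrightarrow> tail p \<le> tail q"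
  unfolding tail_def by (intro sum_mono2) auto

lemma T_le: "T p \<le> real p * (g0\<^sup>2 + 2 * tail p)"
proof (induction p)
  case (Suc p)
  have "real p * (g0\<^sup>2 + 2 * tail p) \<le> real p * (g0\<^sup>2 + 2 * tail (Suc p))"
    using tail_mono[of p "Suc p"] by (intro mult_left_mono) auto
  moreover have "g0\<^sup>2 + 2 * tail p \<le> g0\<^sup>2 + 2 * tail (Suc p)" using tail_mono[of p "Suc p"] by simp
  ultimately show ?case using Suc unfolding T_Suc by (simp add: algebra_simps)
qed simp

lemma T_bounded: "\<exists>C. \<forall>p. T p \<le> C * real p"
proof -
  obtain C where C: "\<And>W w h p. Om.centred_L2 W w \<Longrightarrow> Om.expectation (\<lambda>x. (Om.blk W h p x)\<^sup>2) \<le> C * w * real p"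
    using Om.variance_bound by blast
  have "T p \<le> (C * ((real (card P))\<^sup>2 * (g0 * g0)) / kap) * real p" for p
    using C[OF W_centred_L2, of 0 p] kap_pos unfolding W_blk_variance by (simp add: field_simps)
  then show ?thesis by blast
qed

lemma T_add: "T p + real q * (g0\<^sup>2 + 2 * tail p) \<le> T (p + q)"
proof (induction q)
  case (Suc q)
  have "tail p \<le> tail (p + q)" by (rule tail_mono) simp
  then show ?case using Suc by (simp add: T_Suc algebra_simps)
qed simp

text \<open>Convexity: from \<open>p\<close> to \<open>2 * p\<close> every increment is at least the
  one at \<open>p\<close>, while \<open>T (2 * p)\<close> is at most \<open>2 * C * p\<close>. So
  the increment at \<open>p\<close>, and with it \<open>tail p\<close>, is bounded.\<close>

lemma tail_bounded: "\<exists>C. \<forall>p. tail p \<le> C"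
proof -
  obtain C where C: "\<And>p. T p \<le> C * real p" using T_bounded by blast
  have "tail p \<le> \<bar>C\<bar>" for p
  proof (cases "p = 0")
    case False
    have "0 \<le> T p" unfolding T_def by (intro sum_nonneg) auto
    then have "real p * (g0\<^sup>2 + 2 * tail p) \<le> C * real (p + p)"
      using T_add[of p p] C[of "p + p"] by linarith
    then have "real p * (g0\<^sup>2 + 2 * tail p) \<le> real p * (2 * C)" by (simp add: mult_ac)
    then have "g0\<^sup>2 + 2 * tail p \<le> 2 * C" using False by (simp only: mult_le_cancel_left_pos of_nat_0_less_iff)
    then show ?thesis using zero_le_power2[of g0] by linarith
  qed (simp add: tail_def)
  then show ?thesis by blast
qed

text \<open>Convexity with \<open>T 0 = 0\<close> makes \<open>T p / p\<close> increasing, and the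
  linear bound makes it convergent. Its value at \<open>p = 1\<close> is the lower bound
  \<open>g0\<^sup>2\<close>, which keeps the limiting variance away from 0.\<close>

lemma T_limit: "\<exists>\<tau>. (\<lambda>p. T p / real p) \<longlonglongrightarrow> \<tau> \<and> g0\<^sup>2 \<le> \<tau>"
proof -
  let ?t = "\<lambda>p. T (Suc p) / real (Suc p)"
  have "?t p \<le> ?t (Suc p)" for p
  proof -
    have "T (Suc p) \<le> real (Suc p) * (g0\<^sup>2 + 2 * tail (Suc p))" by (rule T_le)
    then show ?thesis unfolding T_Suc[of "Suc p"] by (simp add: field_simps)
  qed
  then have inc: "incseq ?t" by (rule incseq_SucI)
  obtain C where C: "\<And>p. T p \<le> C * real p" using T_bounded by blast
  have "?t p \<le> C" for p using C[of "Suc p"] by (simp add: divide_le_eq del: of_nat_Suc)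
  then obtain \<tau> where \<tau>: "?t \<longlonglongrightarrow> \<tau>" "\<And>p. ?t p \<le> \<tau>" using incseq_convergent[OF inc] by blast
  have "g0\<^sup>2 \<le> \<tau>" using \<tau>(2)[of 0] T_Suc[of 0] by (simp add: tail_def)
  then show ?thesis using \<tau>(1) filterlim_sequentially_Suc[of "\<lambda>p. T p / real p"] by blast
qed

section \<open>Truncation of the noise\<close>

definition clip :: "real \<Rightarrow> real \<Rightarrow> real" where "clip K x = max (- K) (min K x)"

definition clip_err :: "nat \<Rightarrow> nat + nat \<Rightarrow> real" where
  "clip_err K a = (\<integral>x. (V a 1 x - clip (real K) (V a 1 x))\<^sup>2 \<partial>N)"

lemma clip_measurable [measurable]: "clip K \<in> borel_measurable borel"
  unfolding clip_def by measurable

lemma clip_bound: "0 \<le> K \<Longrightarrow> \<bar>clip K x\<bar> \<le> K" "0 \<le> K \<Longrightarrow> \<bar>clip K x\<bar> \<le> \<bar>x\<bar>" "0 \<le> K \<Longrightarrow> \<bar>x - clip K x\<bar> \<le> \<bar>x\<bar>"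
  by (auto simp: clip_def max_def min_def abs_if)

lemma clip_err_limit: "(\<lambda>K. clip_err K a) \<longlonglongrightarrow> 0"
proof -
  have [measurable]: "V a 1 \<in> borel_measurable N" by (rule V_measurable) simp
  have "(\<lambda>K. \<integral>x. (V a 1 x - clip (real K) (V a 1 x))\<^sup>2 \<partial>N) \<longlonglongrightarrow> (\<integral>x. 0 \<partial>N)"
  proof (rule integral_dominated_convergence[where w = "\<lambda>x. (V a 1 x)\<^sup>2"])
    show "integrable N (\<lambda>x. (V a 1 x)\<^sup>2)" using V_square_integrable[of 1 a] by (simp add: square_integrable_def)
    show "AE x in N. (\<lambda>K. (V a 1 x - clip (real K) (V a 1 x))\<^sup>2) \<longlonglongrightarrow> 0"
    proof (rule AE_I2)
      fix x
      obtain K0 where "\<bar>V a 1 x\<bar> \<le> real K0" using real_arch_simple by blast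
      then have "\<forall>\<^sub>F K in sequentially. (V a 1 x - clip (real K) (V a 1 x))\<^sup>2 = 0"
        unfolding eventually_sequentially by (intro exI[of _ K0]) (auto simp: clip_def max_def min_def abs_le_iff)
      then show "(\<lambda>K. (V a 1 x - clip (real K) (V a 1 x))\<^sup>2) \<longlonglongrightarrow> 0" by (rule tendsto_eventually)
    qed
    show "AE x in N. norm ((V a 1 x - clip (real K) (V a 1 x))\<^sup>2) \<le> (V a 1 x)\<^sup>2" for K
      using clip_bound(3)[of "real K"] by (intro AE_I2) (simp add: abs_le_square_iff)
  qed measurable
  then show ?thesis by (simp add: clip_err_def)
qed

text \<open>The observations are clipped, not \<open>W\<close> itself, so that the truncation is
  again a quadratic form of the same shape. Clipping destroys the zero mean, so the clipped noise is
  recentred; this only lowers second moments, and the bounds \<open>g0\<close> and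
  \<open>clip_err\<close> survive. By stationarity the clipping error is the same at every index,
  and one level \<open>K\<close> serves the whole sequence.\<close>

lemma W_truncation:
  assumes "0 < \<epsilon>"
  shows "\<exists>U K. Om.centred_L2 U ((real (card P))\<^sup>2 * (g0 * g0)) \<and>
     Om.centred_L2 (\<lambda>k \<omega>. W k \<omega> - U k \<omega>) \<epsilon> \<and> (\<forall>k\<ge>1. \<forall>\<omega>\<in>space Om. \<bar>U k \<omega>\<bar> \<le> K)"
proof -
  have "(\<lambda>K. (real (card P))\<^sup>2 * (4 * ((clip_err K (Inl 0) + clip_err K (Inr 0)) * g0))) \<longlonglongrightarrow> (real (card P))\<^sup>2 * (4 * ((0 + 0) * g0))"
    by (intro tendsto_intros clip_err_limit)
  then have "\<forall>\<^sub>F K in sequentially. (real (card P))\<^sup>2 * (4 * ((clip_err K (Inl 0) + clip_err K (Inr 0)) * g0)) < \<epsilon>"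
    using assms by (intro order_tendstoD(2)) auto
  then obtain K where K: "(real (card P))\<^sup>2 * (4 * ((clip_err K (Inl 0) + clip_err K (Inr 0)) * g0)) < \<epsilon>"
    by (auto simp: eventually_sequentially)
  define \<eta> where "\<eta> = clip_err K (Inl 0) + clip_err K (Inr 0)"
  define c where "c a k = (\<integral>x. clip (real K) (V a k x) \<partial>N)" for a k
  define \<psi> where "\<psi> a k x = clip (real K) x - c a k" for a k x
  have \<psi>m: "\<psi> a k \<in> borel_measurable borel" for a k unfolding \<psi>_def by measurable
  have Vm: "V a k \<in> borel_measurable N" if "1 \<le> k" for a k by (rule V_measurable[OF that])
  have clm: "(\<lambda>x. clip (real K) (V a k x)) \<in> borel_measurable N" if "1 \<le> k" for a k
    by (rule measurable_compose[OF Vm[OF that] clip_measurable])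
  have clsq: "square_integrable N (\<lambda>x. clip (real K) (V a k x))" if "1 \<le> k" for a k
    using clip_bound(1)[of "real K"] by (intro N.square_integrable_bounded[where K = "real K"] clm that) simp
  have \<psi>sq: "square_integrable N (\<lambda>x. \<psi> a k (V a k x))" if "1 \<le> k" for a k
    unfolding \<psi>_def by (intro square_integrable_diff clsq that N.square_integrable_const)
  have \<psi>mean: "(\<integral>x. \<psi> a k (V a k x) \<partial>N) = 0" if "1 \<le> k" for a k
    using N.square_integrable_integrable[OF clsq[OF that]] by (simp add: \<psi>_def c_def N.prob_space)
  have var: "(\<integral>x. (f x - (\<integral>x. f x \<partial>N))\<^sup>2 \<partial>N) \<le> (\<integral>x. (f x)\<^sup>2 \<partial>N)" if "square_integrable N f" for f
    using N.variance_eq[of f] N.square_integrable_integrable[OF that] that by (simp add: square_integrable_def)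
  have \<psi>bnd: "(\<integral>x. (\<psi> a k (V a k x))\<^sup>2 \<partial>N) \<le> g0" if k: "1 \<le> k" for a k
  proof -
    have "(\<integral>x. (\<psi> a k (V a k x))\<^sup>2 \<partial>N) \<le> (\<integral>x. (clip (real K) (V a k x))\<^sup>2 \<partial>N)"
      unfolding \<psi>_def c_def by (rule var[OF clsq[OF k]])
    also have "\<dots> \<le> (\<integral>x. (V a k x)\<^sup>2 \<partial>N)"
      using clsq[OF k] V_square_integrable[OF k] clip_bound(2)[of "real K"]
      by (intro integral_mono) (auto simp: square_integrable_def abs_le_square_iff)
    finally show ?thesis using V_second_moment[OF k] by (simp add: g0_def)
  qed
  have err: "0 \<le> clip_err K a" for a by (simp add: clip_err_def)
  have \<psi>dif: "(\<integral>x. (V a k x - \<psi> a k (V a k x))\<^sup>2 \<partial>N) \<le> \<eta>" if k: "1 \<le> k" for a k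
  proof -
    let ?d = "\<lambda>x. V a k x - clip (real K) (V a k x)"
    have d: "square_integrable N ?d" by (intro square_integrable_diff V_square_integrable clsq k)
    have "(\<integral>x. ?d x \<partial>N) = - c a k"
      using N.square_integrable_integrable[OF clsq[OF k]] N.square_integrable_integrable[OF V_square_integrable[OF k]] V_mean[OF k]
      by (simp add: c_def)
    then have "(\<integral>x. (V a k x - \<psi> a k (V a k x))\<^sup>2 \<partial>N) = (\<integral>x. (?d x - (\<integral>x. ?d x \<partial>N))\<^sup>2 \<partial>N)"
      by (simp add: \<psi>_def algebra_simps)
    also have "\<dots> \<le> (\<integral>x. (?d x)\<^sup>2 \<partial>N)" by (rule var[OF d])
    also have "\<dots> = clip_err K a"
      unfolding clip_err_def
      by (rule strictly_stationary_marginal[OF V_stationary V_measurable _ k]) (auto intro!: borel_measurable_power borel_measurable_diff clip_measurable)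
    also have "\<dots> \<le> \<eta>"
    proof (cases a)
      case (Inl i)
      then have "clip_err K a = clip_err K (Inl 0)" by (simp add: clip_err_def)
      then show ?thesis using err[of "Inr 0"] by (simp add: \<eta>_def)
    next
      case (Inr j)
      then have "clip_err K a = clip_err K (Inr 0)" by (simp add: clip_err_def)
      then show ?thesis using err[of "Inl 0"] by (simp add: \<eta>_def)
    qed
    finally show ?thesis .
  qed
  have 1: "Om.centred_L2 (Q \<psi>) ((real (card P))\<^sup>2 * (g0 * g0))"
    by (rule Q_centred_L2[OF \<psi>m \<psi>sq \<psi>mean \<psi>bnd])
  have Vb: "(\<integral>x. (V a k x)\<^sup>2 \<partial>N) \<le> g0" if "1 \<le> k" for a k
    using V_second_moment[OF that] by (simp add: g0_def)
  have "Om.centred_L2 (\<lambda>k \<omega>. Q (\<lambda>_ _ x. x) k \<omega> - Q \<psi> k \<omega>) ((real (card P))\<^sup>2 * (4 * (\<eta> * g0)))"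
    by (rule Q_diff_centred_L2) (use \<psi>m \<psi>sq \<psi>mean \<psi>bnd \<psi>dif V_square_integrable V_mean Vb err in \<open>auto simp: \<eta>_def\<close>)
  then have 2: "Om.centred_L2 (\<lambda>k \<omega>. W k \<omega> - Q \<psi> k \<omega>) \<epsilon>"
    using K unfolding Om.centred_L2_def W_def \<eta>_def by force
  have 3: "\<bar>Q \<psi> k \<omega>\<bar> \<le> (\<Sum>p\<in>P. (2 * real K) * (2 * real K))" if k: "1 \<le> k" for k \<omega>
  proof -
    have cb: "\<bar>c a k\<bar> \<le> real K" for a
    proof -
      have "\<bar>c a k\<bar> \<le> (\<integral>x. \<bar>clip (real K) (V a k x)\<bar> \<partial>N)" unfolding c_def by (rule integral_abs_bound)
      also have "\<dots> \<le> real K"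
        using N.square_integrable_integrable[OF clsq[OF k]] clip_bound(1)[of "real K"] by (intro N.integral_le_const AE_I2) auto
      finally show ?thesis .
    qed
    have \<psi>b: "\<bar>\<psi> a k x\<bar> \<le> 2 * real K" for a x
      using cb[of a] clip_bound(1)[of "real K" x] unfolding \<psi>_def by simp
    have "\<bar>Q \<psi> k \<omega>\<bar> \<le> (\<Sum>p\<in>P. \<bar>wt (fst p) (snd p) * (\<psi> (fst p) k (V (fst p) k (\<omega> (fst p))) * \<psi> (snd p) k (V (snd p) k (\<omega> (snd p))))\<bar>)"
      unfolding Q_def case_prod_beta by (rule sum_abs)
    also have "\<dots> \<le> (\<Sum>p\<in>P. 1 * ((2 * real K) * (2 * real K)))"
      unfolding abs_mult by (intro sum_mono mult_mono wt_le_1 \<psi>b) auto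
    finally show ?thesis by simp
  qed
  show ?thesis using 1 2 3 by blast
qed

lemma W_clt:
  "\<exists>\<tau>. (\<lambda>p. T p / real p) \<longlonglongrightarrow> \<tau> \<and> g0\<^sup>2 \<le> \<tau> \<and>
     (\<forall>t. (\<lambda>d. Om.expectation (\<lambda>\<omega>. iexp (t / sqrt (real d) * Om.blk W 0 d \<omega>))) \<longlonglongrightarrow> complex_of_real (exp (- (kap * \<tau>) * t\<^sup>2 / 2)))"
proof -
  obtain \<tau> where \<tau>: "(\<lambda>p. T p / real p) \<longlonglongrightarrow> \<tau>" "g0\<^sup>2 \<le> \<tau>" using T_limit by blast
  have "0 \<le> \<tau>" using \<tau>(2) zero_le_power2[of g0] by linarith
  have lim: "(\<lambda>p. kap * T p / real p) \<longlonglongrightarrow> kap * \<tau>"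
    using tendsto_mult_left[OF \<tau>(1), of kap] by simp
  have "(\<lambda>d. Om.expectation (\<lambda>\<omega>. iexp (t / sqrt (real d) * Om.blk W 0 d \<omega>))) \<longlonglongrightarrow> complex_of_real (exp (- (kap * \<tau>) * t\<^sup>2 / 2))" for t
    by (rule Om.central_limit[OF W_centred_L2 W_truncation W_blk_variance lim]) (use kap_pos \<open>0 \<le> \<tau>\<close> in auto)
  then show ?thesis using \<tau> by blast
qed

text \<open>Square summability alone suffices. Beyond a fixed lag \<open>K\<close>, Cauchy-Schwarz
  bounds the sum by \<open>sqrt d\<close> times the root of a small tail; the first \<open>K\<close>
  lags form a constant, negligible against \<open>sqrt d\<close>.\<close>

lemma autocov_sum_small: "(\<lambda>d. (\<Sum>h\<in>{1..d}. \<bar>autocov 1 (1 + h)\<bar>) / sqrt (real d)) \<longlonglongrightarrow> 0"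
proof (rule tendstoI)
  fix e :: real assume e: "0 < e"
  let ?g = "\<lambda>h. autocov 1 (1 + h)"
  obtain C where C: "\<And>p. tail p \<le> C" using tail_bounded by blast
  have inc: "incseq tail" by (simp add: incseq_def tail_mono)
  obtain t where t: "tail \<longlonglongrightarrow> t" using incseq_convergent[OF inc] C by blast
  have tl: "tail p \<le> t" for p by (rule incseq_le[OF _ t]) (auto simp: incseq_def tail_mono)
  have "\<forall>\<^sub>F p in sequentially. t - tail p < (e / 2)\<^sup>2"
    using order_tendstoD(1)[OF t, of "t - (e / 2)\<^sup>2"] e by (auto elim: eventually_mono)
  then obtain K where K: "t - tail K < (e / 2)\<^sup>2" by (auto simp: eventually_sequentially)
  have "(\<lambda>d. (\<Sum>h\<in>{1..K}. \<bar>?g h\<bar>) / sqrt (real d)) \<longlonglongrightarrow> 0"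
    by (rule real_tendsto_divide_at_top[OF tendsto_const filterlim_compose[OF sqrt_at_top filterlim_real_sequentially]])
  then have "\<forall>\<^sub>F d in sequentially. (\<Sum>h\<in>{1..K}. \<bar>?g h\<bar>) / sqrt (real d) < e / 2"
    using e by (intro order_tendstoD(2)) auto
  then show "\<forall>\<^sub>F d in sequentially. dist ((\<Sum>h\<in>{1..d}. \<bar>?g h\<bar>) / sqrt (real d)) 0 < e"
    using eventually_ge_at_top[of "Suc K"]
  proof eventually_elim
    case (elim d)
    have split: "(\<Sum>h\<in>{1..d}. F h) = (\<Sum>h\<in>{1..K}. F h) + (\<Sum>h\<in>{K<..d}. F h)" for F :: "nat \<Rightarrow> real"
    proof -
      have eq: "{1..d} = {1..K} \<union> {K<..d}" using elim(2) by auto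
      show ?thesis unfolding eq by (intro sum.union_disjoint) auto
    qed
    have "(\<Sum>h\<in>{K<..d}. (?g h)\<^sup>2) = tail d - tail K" unfolding tail_def using split[of "\<lambda>h. (?g h)\<^sup>2"] by simp
    also have "\<dots> < (e / 2)\<^sup>2" using K tl[of d] by linarith
    finally have s2: "(\<Sum>h\<in>{K<..d}. (?g h)\<^sup>2) < (e / 2)\<^sup>2" .
    have "(\<Sum>h\<in>{K<..d}. \<bar>?g h\<bar>)\<^sup>2 \<le> real (card {K<..d}) * (\<Sum>h\<in>{K<..d}. (?g h)\<^sup>2)"
      using Cauchy_Schwarz_ineq_sum[of "\<lambda>_. 1" "\<lambda>h. \<bar>?g h\<bar>" "{K<..d}"] by simp
    also have "\<dots> \<le> real d * (e / 2)\<^sup>2"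
      using s2 by (intro mult_mono) (auto intro: sum_nonneg)
    finally have "(\<Sum>h\<in>{K<..d}. \<bar>?g h\<bar>) \<le> sqrt (real d * (e / 2)\<^sup>2)" by (rule real_le_rsqrt)
    also have "\<dots> = sqrt (real d) * (e / 2)" using e by (simp add: real_sqrt_mult)
    finally have "(\<Sum>h\<in>{K<..d}. \<bar>?g h\<bar>) / sqrt (real d) \<le> e / 2"
      using elim(2) by (simp add: divide_le_eq mult.commute)
    then have "(\<Sum>h\<in>{1..d}. \<bar>?g h\<bar>) / sqrt (real d) < e"
      using elim(1) unfolding split add_divide_distrib by linarith
    moreover have "0 \<le> (\<Sum>h\<in>{1..d}. \<bar>?g h\<bar>) / sqrt (real d)" by (intro divide_nonneg_nonneg sum_nonneg) auto
    ultimately show ?case by simp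
  qed
qed

end

section \<open>The linear term and the interpoint distances\<close>

lemma distr_PiM_pair:
  assumes J: "finite J" and M: "\<And>i. prob_space (M i)" and ab: "a \<in> J" "b \<in> J" "a \<noteq> b"
  shows "distr (PiM J M) (M a \<Otimes>\<^sub>M M b) (\<lambda>\<omega>. (\<omega> a, \<omega> b)) = M a \<Otimes>\<^sub>M M b"
proof (rule pair_measure_eqI[symmetric])
  interpret prob_space "M i" for i by (rule M)
  show "sigma_finite_measure (M a)" "sigma_finite_measure (M b)" ..
  show "sets (M a \<Otimes>\<^sub>M M b) = sets (distr (PiM J M) (M a \<Otimes>\<^sub>M M b) (\<lambda>\<omega>. (\<omega> a, \<omega> b)))" by simp
  have m: "(\<lambda>\<omega>. (\<omega> a, \<omega> b)) \<in> measurable (PiM J M) (M a \<Otimes>\<^sub>M M b)"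
    by (intro measurable_Pair measurable_component_singleton ab)
  fix A B assume AB: "A \<in> sets (M a)" "B \<in> sets (M b)"
  let ?X = "\<lambda>i. if i = a then A else B"
  have "emeasure (distr (PiM J M) (M a \<Otimes>\<^sub>M M b) (\<lambda>\<omega>. (\<omega> a, \<omega> b))) (A \<times> B) =
     emeasure (PiM J M) ((\<lambda>\<omega>. (\<omega> a, \<omega> b)) -` (A \<times> B) \<inter> space (PiM J M))"
    using AB by (intro emeasure_distr m) auto
  also have "(\<lambda>\<omega>. (\<omega> a, \<omega> b)) -` (A \<times> B) \<inter> space (PiM J M) = prod_emb J M {a, b} (Pi\<^sub>E {a, b} ?X)"
    using ab by (auto simp: prod_emb_def space_PiM restrict_def PiE_def extensional_def Pi_def split: if_splits)
  also have "emeasure (PiM J M) \<dots> = (\<Prod>i\<in>{a, b}. emeasure (M i) (?X i))"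
    using ab AB by (intro emeasure_PiM_emb M) auto
  finally show "emeasure (M a) A * emeasure (M b) B = emeasure (distr (PiM J M) (M a \<Otimes>\<^sub>M M b) (\<lambda>\<omega>. (\<omega> a, \<omega> b))) (A \<times> B)"
    using ab by simp
qed

lemma quad_avg_sum:
  "quad_avg m n (\<lambda>i i' j j'. \<Sum>k\<in>K. f k i i' j j') = (\<Sum>k\<in>K. quad_avg m n (f k))"
proof -
  have 0: "quad_avg m n (\<lambda>i i' j j'. 0) = 0" by (simp add: quad_avg_def)
  show ?thesis
    by (induction K rule: infinite_finite_induct) (simp_all add: 0 quad_avg_add)
qed

context two_sample
begin

text \<open>On each side of the diagonal the lags are distinct and at most \<open>d\<close>, so
  either side is bounded by the sum over all lags.\<close>

lemma autocov_row:
  assumes k: "k \<in> {1..d}"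
  shows "(\<Sum>l\<in>{1..d}. \<bar>autocov k l\<bar>) \<le> g0 + 2 * (\<Sum>h\<in>{1..d}. \<bar>autocov 1 (1 + h)\<bar>)"
proof -
  let ?S = "\<Sum>h\<in>{1..d}. \<bar>autocov 1 (1 + h)\<bar>"
  have eq: "{1..d} = insert k ({k<..d} \<union> {1..<k})" using k by auto
  have "(\<Sum>l\<in>{k<..d}. \<bar>autocov k l\<bar>) = (\<Sum>l\<in>{k<..d}. \<bar>autocov 1 (1 + (l - k))\<bar>)"
    by (intro sum.cong refl arg_cong[of _ _ abs] autocov_lag) (use k in auto)
  also have "\<dots> = (\<Sum>h\<in>{1..d - k}. \<bar>autocov 1 (1 + h)\<bar>)"
    by (rule sum.reindex_bij_witness[of _ "\<lambda>h. h + k" "\<lambda>l. l - k"]) auto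
  also have "\<dots> \<le> ?S" by (intro sum_mono2) auto
  finally have 1: "(\<Sum>l\<in>{k<..d}. \<bar>autocov k l\<bar>) \<le> ?S" .
  have "(\<Sum>l\<in>{1..<k}. \<bar>autocov k l\<bar>) = (\<Sum>l\<in>{1..<k}. \<bar>autocov 1 (1 + (k - l))\<bar>)"
  proof (intro sum.cong refl arg_cong[of _ _ abs])
    fix l assume "l \<in> {1..<k}"
    then show "autocov k l = autocov 1 (1 + (k - l))" unfolding autocov_commute[of k l] by (intro autocov_lag) auto
  qed
  also have "\<dots> = (\<Sum>h\<in>{1..<k}. \<bar>autocov 1 (1 + h)\<bar>)"
    by (rule sum.reindex_bij_witness[of _ "\<lambda>h. k - h" "\<lambda>l. k - l"]) auto
  also have "\<dots> \<le> ?S" using k by (intro sum_mono2) auto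
  finally have 2: "(\<Sum>l\<in>{1..<k}. \<bar>autocov k l\<bar>) \<le> ?S" .
  have "autocov k k = g0" using autocov_lag[of k k] k by (simp add: g0_def)
  then have 3: "\<bar>autocov k k\<bar> = g0" using g0_nonneg by simp
  have "(\<Sum>l\<in>{1..d}. \<bar>autocov k l\<bar>) = \<bar>autocov k k\<bar> + ((\<Sum>l\<in>{k<..d}. \<bar>autocov k l\<bar>) + (\<Sum>l\<in>{1..<k}. \<bar>autocov k l\<bar>))"
    unfolding eq by (subst sum.insert; (subst sum.union_disjoint)?) auto
  then show ?thesis using 1 2 3 by linarith
qed

definition lin :: "(nat \<Rightarrow> real) \<Rightarrow> nat \<Rightarrow> nat + nat \<Rightarrow> (nat + nat \<Rightarrow> 'b) \<Rightarrow> real" where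
  "lin \<delta> d a \<omega> = (\<Sum>k\<in>{1..d}. \<delta> k * V a k (\<omega> a))"

text \<open>The Schur test: splitting \<open>\<delta> k * \<delta> l\<close> into half squares and
  using symmetry, the covariance matrix acts as a quadratic form bounded by its largest absolute row
  sum.\<close>

lemma lin_second_moment:
  assumes a: "a \<in> I"
  shows "square_integrable Om (lin \<delta> d a)"
    and "Om.expectation (\<lambda>\<omega>. (lin \<delta> d a \<omega>)\<^sup>2) \<le> (\<Sum>k\<in>{1..d}. (\<delta> k)\<^sup>2) * (g0 + 2 * (\<Sum>h\<in>{1..d}. \<bar>autocov 1 (1 + h)\<bar>))"
proof -
  let ?f = "\<lambda>x. \<Sum>k\<in>{1..d}. \<delta> k * V a k x" and ?B = "g0 + 2 * (\<Sum>h\<in>{1..d}. \<bar>autocov 1 (1 + h)\<bar>)"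
  have sq: "square_integrable N ?f"
    by (intro square_integrable_sum square_integrable_cmult V_square_integrable) simp
  show "square_integrable Om (lin \<delta> d a)"
    using Om_square_one[OF a sq] by (simp add: lin_def[abs_def])
  have int: "integrable N (\<lambda>x. V a k x * V a l x)" if "k \<in> {1..d}" "l \<in> {1..d}" for k l
    using that by (intro square_integrable_mult V_square_integrable) auto
  have "Om.expectation (\<lambda>\<omega>. (lin \<delta> d a \<omega>)\<^sup>2) = (\<integral>x. (?f x)\<^sup>2 \<partial>N)"
    unfolding lin_def using sq by (intro Om_one(2)[OF a, of "\<lambda>x. (?f x)\<^sup>2"]) (simp add: square_integrable_def)
  also have "\<dots> = (\<integral>x. (\<Sum>k\<in>{1..d}. \<Sum>l\<in>{1..d}. (\<delta> k * \<delta> l) * (V a k x * V a l x)) \<partial>N)"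
    unfolding power2_eq_square sum_product by (intro Bochner_Integration.integral_cong refl sum.cong) simp
  also have "\<dots> = (\<Sum>k\<in>{1..d}. (\<integral>x. (\<Sum>l\<in>{1..d}. (\<delta> k * \<delta> l) * (V a k x * V a l x)) \<partial>N))"
    by (intro Bochner_Integration.integral_sum Bochner_Integration.integrable_sum integrable_mult_right int)
  also have "\<dots> = (\<Sum>k\<in>{1..d}. \<Sum>l\<in>{1..d}. (\<integral>x. (\<delta> k * \<delta> l) * (V a k x * V a l x) \<partial>N))"
    by (intro sum.cong refl Bochner_Integration.integral_sum integrable_mult_right int)
  also have "\<dots> = (\<Sum>k\<in>{1..d}. \<Sum>l\<in>{1..d}. (\<delta> k * \<delta> l) * (\<integral>x. V a k x * V a l x \<partial>N))"
    by simp
  also have "\<dots> = (\<Sum>k\<in>{1..d}. \<Sum>l\<in>{1..d}. (\<delta> k * \<delta> l) * autocov k l)"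
    by (intro sum.cong refl) (simp add: V_autocov)
  also have "\<dots> \<le> (\<Sum>k\<in>{1..d}. \<Sum>l\<in>{1..d}. ((\<delta> k)\<^sup>2 / 2) * \<bar>autocov k l\<bar> + ((\<delta> l)\<^sup>2 / 2) * \<bar>autocov l k\<bar>)"
  proof (intro sum_mono)
    fix k l
    have "(\<delta> k * \<delta> l) * autocov k l \<le> \<bar>\<delta> k * \<delta> l\<bar> * \<bar>autocov k l\<bar>" by (metis abs_ge_self abs_mult)
    also have "\<dots> \<le> ((\<delta> k)\<^sup>2 / 2 + (\<delta> l)\<^sup>2 / 2) * \<bar>autocov k l\<bar>"
    proof (rule mult_right_mono)
      show "\<bar>\<delta> k * \<delta> l\<bar> \<le> (\<delta> k)\<^sup>2 / 2 + (\<delta> l)\<^sup>2 / 2"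
        using sum_squares_bound[of "\<delta> k" "\<delta> l"] sum_squares_bound[of "\<delta> k" "- \<delta> l"] by (simp add: abs_le_iff)
    qed simp
    finally show "(\<delta> k * \<delta> l) * autocov k l \<le> ((\<delta> k)\<^sup>2 / 2) * \<bar>autocov k l\<bar> + ((\<delta> l)\<^sup>2 / 2) * \<bar>autocov l k\<bar>"
      unfolding autocov_commute[of l k] distrib_right .
  qed
  also have "\<dots> = (\<Sum>k\<in>{1..d}. \<Sum>l\<in>{1..d}. (\<delta> k)\<^sup>2 * \<bar>autocov k l\<bar>)"
  proof -
    have "(\<Sum>k\<in>{1..d}. \<Sum>l\<in>{1..d}. ((\<delta> l)\<^sup>2 / 2) * \<bar>autocov l k\<bar>) = (\<Sum>k\<in>{1..d}. \<Sum>l\<in>{1..d}. ((\<delta> k)\<^sup>2 / 2) * \<bar>autocov k l\<bar>)"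
      by (rule sum.swap)
    then show ?thesis
      by (simp only: sum.distrib) (simp only: sum.distrib[symmetric], intro sum.cong refl, simp)
  qed
  also have "\<dots> = (\<Sum>k\<in>{1..d}. (\<delta> k)\<^sup>2 * (\<Sum>l\<in>{1..d}. \<bar>autocov k l\<bar>))"
    by (simp add: sum_distrib_left)
  also have "\<dots> \<le> (\<Sum>k\<in>{1..d}. (\<delta> k)\<^sup>2 * ?B)"
    by (intro sum_mono mult_left_mono autocov_row) auto
  finally show "Om.expectation (\<lambda>\<omega>. (lin \<delta> d a \<omega>)\<^sup>2) \<le> (\<Sum>k\<in>{1..d}. (\<delta> k)\<^sup>2) * ?B"
    by (simp add: sum_distrib_right)
qed

text \<open>The second moment is at most \<open>c * sqrt d\<close> times a row sum of order
  \<open>o(sqrt d)\<close>, divided by \<open>d\<close>. The rate of the mean difference and the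
  decay of the row sums are both used in full.\<close>

lemma lin_oP:
  assumes a: "a \<in> I" and \<delta>: "\<forall>\<^sub>F d in sequentially. (\<Sum>k\<in>{1..d}. (\<delta> d k)\<^sup>2) \<le> c * sqrt (real d)"
  shows "oP Om (\<lambda>d \<omega>. lin (\<delta> d) d a \<omega> / sqrt (real d))"
proof (rule Om.oP_L2)
  let ?S = "\<lambda>d. \<Sum>h\<in>{1..d}. \<bar>autocov 1 (1 + h)\<bar>"
  have sq: "square_integrable Om (\<lambda>\<omega>. lin (\<delta> d) d a \<omega> / sqrt (real d))" for d
    using square_integrable_cmult[OF lin_second_moment(1)[OF a], of "1 / sqrt (real d)"] by simp
  then show "(\<lambda>\<omega>. lin (\<delta> d) d a \<omega> / sqrt (real d)) \<in> borel_measurable Om" for d by (rule square_integrable_measurable)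
  show "\<forall>\<^sub>F d in sequentially. square_integrable Om (\<lambda>\<omega>. lin (\<delta> d) d a \<omega> / sqrt (real d)) \<and>
     Om.expectation (\<lambda>\<omega>. (lin (\<delta> d) d a \<omega> / sqrt (real d))\<^sup>2) \<le> c * (g0 / sqrt (real d) + 2 * (?S d / sqrt (real d)))"
    using \<delta> eventually_gt_at_top[of 0]
  proof eventually_elim
    case (elim d)
    have S0: "0 \<le> ?S d" by (intro sum_nonneg) auto
    have "Om.expectation (\<lambda>\<omega>. (lin (\<delta> d) d a \<omega> / sqrt (real d))\<^sup>2) = Om.expectation (\<lambda>\<omega>. (lin (\<delta> d) d a \<omega>)\<^sup>2) / real d"
      by (simp add: power_divide)
    also have "\<dots> \<le> (\<Sum>k\<in>{1..d}. (\<delta> d k)\<^sup>2) * (g0 + 2 * ?S d) / real d"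
      by (intro divide_right_mono lin_second_moment(2)[OF a]) simp
    also have "\<dots> \<le> (c * sqrt (real d)) * (g0 + 2 * ?S d) / real d"
      using g0_nonneg S0 elim(1) by (intro divide_right_mono mult_right_mono) auto
    also have "\<dots> = c * (g0 / sqrt (real d) + 2 * (?S d / sqrt (real d)))"
    proof -
      define r where "r = sqrt (real d)"
      have "0 < r" "real d = r * r" using elim(2) by (auto simp: r_def)
      then show ?thesis unfolding r_def[symmetric] by (simp add: field_simps)
    qed
    finally show ?case using sq by simp
  qed
  have "(\<lambda>d. g0 / sqrt (real d)) \<longlonglongrightarrow> 0"
    by (rule real_tendsto_divide_at_top[OF tendsto_const filterlim_compose[OF sqrt_at_top filterlim_real_sequentially]])
  then have "(\<lambda>d. c * (g0 / sqrt (real d) + 2 * (?S d / sqrt (real d)))) \<longlonglongrightarrow> c * (0 + 2 * 0)"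
    by (intro tendsto_intros autocov_sum_small)
  then show "(\<lambda>d. c * (g0 / sqrt (real d) + 2 * (?S d / sqrt (real d)))) \<longlonglongrightarrow> 0" by simp
qed

definition shift :: "(nat \<Rightarrow> real) \<Rightarrow> nat + nat \<Rightarrow> nat \<Rightarrow> 'b \<Rightarrow> nat \<Rightarrow> real" where
  "shift \<mu> a d x = (\<lambda>k\<in>{1..d}. \<mu> k + V a k x)"

lemma shift_measurable: "shift \<mu> a d \<in> measurable N (Rd d)"
  unfolding shift_def by (intro measurable_restrict borel_measurable_add borel_measurable_const V_measurable) simp

lemma shift_coord_measurable: "a \<in> I \<Longrightarrow> k \<in> {1..d} \<Longrightarrow> (\<lambda>\<omega>. shift \<mu> a d (\<omega> a) k) \<in> borel_measurable Om"
  unfolding shift_def by (simp add: Om_component V_measurable borel_measurable_add)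

lemma sqdist_measurable: "(\<lambda>z. sqdist d (fst z) (snd z)) \<in> borel_measurable (Rd d \<Otimes>\<^sub>M Rd d)"
  unfolding sqdist_eq by measurable

text \<open>Each of the two factors of the inner product contributes the linear part once, and both
  copies have the same average, whence the factor 2.\<close>

lemma U_CQ_expansion:
  fixes \<mu>X \<mu>Y :: "nat \<Rightarrow> real"
  defines "\<delta> \<equiv> \<lambda>k. \<mu>X k - \<mu>Y k"
  shows "U_CQ d m n (\<lambda>i. shift \<mu>X (Inl i) d (\<omega> (Inl i))) (\<lambda>j. shift \<mu>Y (Inr j) d (\<omega> (Inr j))) =
    (\<Sum>k\<in>{1..d}. (\<delta> k)\<^sup>2) + 2 * cross_avg m n (\<lambda>i j. lin \<delta> d (Inl i) \<omega> + - 1 * lin \<delta> d (Inr j) \<omega>) + Om.blk W 0 d \<omega>"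
proof -
  let ?u = "\<lambda>i j k. V (Inl i) k (\<omega> (Inl i)) - V (Inr j) k (\<omega> (Inr j))"
  define L where "L i j = lin \<delta> d (Inl i) \<omega> + - 1 * lin \<delta> d (Inr j) \<omega>" for i j
  define S where "S = (\<Sum>k\<in>{1..d}. (\<delta> k)\<^sup>2)"
  have L: "L i j = (\<Sum>k\<in>{1..d}. \<delta> k * ?u i j k)" for i j
    by (simp add: L_def lin_def right_diff_distrib sum_subtractf)
  have "vdot d (vdiff (shift \<mu>X (Inl i) d (\<omega> (Inl i))) (shift \<mu>Y (Inr j) d (\<omega> (Inr j))))
      (vdiff (shift \<mu>X (Inl i') d (\<omega> (Inl i'))) (shift \<mu>Y (Inr j') d (\<omega> (Inr j')))) =
     (S + (L i j + L i' j')) + (\<Sum>k\<in>{1..d}. ?u i j k * ?u i' j' k)" for i i' j j'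
    unfolding L S_def vdot_def vdiff_def shift_def sum.distrib[symmetric]
    by (intro sum.cong refl) (simp add: \<delta>_def power2_eq_square algebra_simps)
  then have "U_CQ d m n (\<lambda>i. shift \<mu>X (Inl i) d (\<omega> (Inl i))) (\<lambda>j. shift \<mu>Y (Inr j) d (\<omega> (Inr j))) =
    quad_avg m n (\<lambda>i i' j j'. (S + (L i j + L i' j')) + (\<Sum>k\<in>{1..d}. ?u i j k * ?u i' j' k))"
    unfolding U_CQ_quad by simp
  also have "\<dots> = (cross_avg m n (\<lambda>_ _. S) + (cross_avg m n L + cross_avg m n L)) + (\<Sum>k\<in>{1..d}. W k \<omega>)"
    unfolding quad_avg_add quad_avg_sum W_quad_avg quad_avg_cross(1)[OF m2 n2, of L] quad_avg_cross(4)[OF m2 n2, of L]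
      quad_avg_cross(1)[OF m2 n2, of "\<lambda>_ _. S"] ..
  also have "(\<Sum>k\<in>{1..d}. W k \<omega>) = Om.blk W 0 d \<omega>"
    unfolding Om.blk_def by (intro sum.cong) auto
  finally show ?thesis by (simp add: cross_avg_const[OF m2 n2] S_def L_def[abs_def])
qed

lemma sqdist_mean:
  assumes ab: "a \<in> I" "b \<in> I" "a \<noteq> b"
  shows "Om.expectation (\<lambda>\<omega>. sqdist d (shift \<mu> a d (\<omega> a)) (shift \<nu> b d (\<omega> b))) = 2 * real d * g0 + (\<Sum>k\<in>{1..d}. (\<mu> k - \<nu> k)\<^sup>2)"
proof -
  have E: "integrable Om (\<lambda>\<omega>. (\<mu> k + V a k (\<omega> a) - (\<nu> k + V b k (\<omega> b)))\<^sup>2)"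
    "Om.expectation (\<lambda>\<omega>. (\<mu> k + V a k (\<omega> a) - (\<nu> k + V b k (\<omega> b)))\<^sup>2) = 2 * g0 + (\<mu> k - \<nu> k)\<^sup>2" if "k \<in> {1..d}" for k
  proof -
    have k: "1 \<le> k" using that by simp
    let ?x = "\<lambda>\<omega>. V a k (\<omega> a)" and ?y = "\<lambda>\<omega>. V b k (\<omega> b)" and ?c = "\<mu> k - \<nu> k"
    have i1: "integrable N (V a k)" for a by (rule N.square_integrable_integrable[OF V_square_integrable[OF k]])
    have i2: "integrable N (\<lambda>x. (V a k x)\<^sup>2)" for a using V_square_integrable[OF k] by (simp add: square_integrable_def)
    note x = Om_one[OF ab(1) i1] and y = Om_one[OF ab(2) i1] and x2 = Om_one[OF ab(1) i2] and y2 = Om_one[OF ab(2) i2]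
      and xy = Om_two[OF ab i1 i1]
    have eq: "(\<mu> k + ?x \<omega> - (\<nu> k + ?y \<omega>))\<^sup>2 = (?x \<omega>)\<^sup>2 + (?y \<omega>)\<^sup>2 + ?c\<^sup>2 + 2 * ?c * ?x \<omega> - 2 * ?c * ?y \<omega> - 2 * (?x \<omega> * ?y \<omega>)" for \<omega>
      by (simp add: power2_eq_square algebra_simps)
    show "integrable Om (\<lambda>\<omega>. (\<mu> k + ?x \<omega> - (\<nu> k + ?y \<omega>))\<^sup>2)"
      unfolding eq using x(1) y(1) x2(1) y2(1) xy(1)
      by (intro Bochner_Integration.integrable_add Bochner_Integration.integrable_diff integrable_mult_right Om.integrable_const) auto
    have "Om.expectation (\<lambda>\<omega>. (\<mu> k + ?x \<omega> - (\<nu> k + ?y \<omega>))\<^sup>2) = Om.expectation (\<lambda>\<omega>. (?x \<omega>)\<^sup>2) + Om.expectation (\<lambda>\<omega>. (?y \<omega>)\<^sup>2) + ?c\<^sup>2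
       + 2 * ?c * Om.expectation ?x - 2 * ?c * Om.expectation ?y - 2 * Om.expectation (\<lambda>\<omega>. ?x \<omega> * ?y \<omega>)"
      unfolding eq using x(1) y(1) x2(1) y2(1) xy(1) by (simp add: Om.prob_space)
    then show "Om.expectation (\<lambda>\<omega>. (\<mu> k + ?x \<omega> - (\<nu> k + ?y \<omega>))\<^sup>2) = 2 * g0 + ?c\<^sup>2"
      unfolding x(2) y(2) x2(2) y2(2) xy(2) V_mean[OF k] V_second_moment[OF k] by (simp add: g0_def)
  qed
  have "Om.expectation (\<lambda>\<omega>. sqdist d (shift \<mu> a d (\<omega> a)) (shift \<nu> b d (\<omega> b))) =
     Om.expectation (\<lambda>\<omega>. \<Sum>k\<in>{1..d}. (\<mu> k + V a k (\<omega> a) - (\<nu> k + V b k (\<omega> b)))\<^sup>2)"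
    unfolding sqdist_eq shift_def by (intro Bochner_Integration.integral_cong refl sum.cong) simp
  also have "\<dots> = (\<Sum>k\<in>{1..d}. 2 * g0 + (\<mu> k - \<nu> k)\<^sup>2)"
    by (subst Bochner_Integration.integral_sum[OF E(1)]) (auto intro!: sum.cong simp: E(2))
  finally show ?thesis by (simp add: sum.distrib)
qed

lemma Om_pair_distr:
  assumes ab: "a \<in> I" "b \<in> I" "a \<noteq> b"
  shows "distr Om (Rd d \<Otimes>\<^sub>M Rd d) (\<lambda>\<omega>. (shift \<mu> a d (\<omega> a), shift \<nu> b d (\<omega> b))) =
    distr N (Rd d) (shift \<mu> a d) \<Otimes>\<^sub>M distr N (Rd d) (shift \<nu> b d)"
proof -
  have p: "(\<lambda>\<omega>. (\<omega> a, \<omega> b)) \<in> measurable Om (N \<Otimes>\<^sub>M N)"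
    unfolding Om_def by (intro measurable_Pair measurable_component_singleton ab)
  have s: "(\<lambda>(x, y). (shift \<mu> a d x, shift \<nu> b d y)) \<in> measurable (N \<Otimes>\<^sub>M N) (Rd d \<Otimes>\<^sub>M Rd d)"
    unfolding case_prod_beta
    by (intro measurable_Pair measurable_compose[OF measurable_fst shift_measurable] measurable_compose[OF measurable_snd shift_measurable])
  interpret S: prob_space "distr N (Rd d) (shift \<nu> b d)" by (rule N.prob_space_distr[OF shift_measurable])
  have "distr N (Rd d) (shift \<mu> a d) \<Otimes>\<^sub>M distr N (Rd d) (shift \<nu> b d) = distr (N \<Otimes>\<^sub>M N) (Rd d \<Otimes>\<^sub>M Rd d) (\<lambda>(x, y). (shift \<mu> a d x, shift \<nu> b d y))"
    by (rule pair_measure_distr[OF shift_measurable shift_measurable]) (rule S.sigma_finite_measure_axioms)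
  also have "N \<Otimes>\<^sub>M N = distr Om (N \<Otimes>\<^sub>M N) (\<lambda>\<omega>. (\<omega> a, \<omega> b))"
    unfolding Om_def by (rule distr_PiM_pair[OF finite_I N ab, symmetric])
  also have "distr \<dots> (Rd d \<Otimes>\<^sub>M Rd d) (\<lambda>(x, y). (shift \<mu> a d x, shift \<nu> b d y)) =
     distr Om (Rd d \<Otimes>\<^sub>M Rd d) (\<lambda>\<omega>. (shift \<mu> a d (\<omega> a), shift \<nu> b d (\<omega> b)))"
    by (subst distr_distr[OF s p]) (simp add: comp_def)
  finally show ?thesis ..
qed

text \<open>The mean square deviation is variance plus squared bias. The variance is of order
  \<open>d\<close> by assumption; the bias is the squared mean difference, of order
  \<open>sqrt d\<close>, so its square is of order \<open>d\<close> as well. Dividing by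
  \<open>d\<^sup>2\<close> leaves \<open>1 / d\<close>. The variance is given on a product of four
  laws and is carried over to \<open>Om\<close> through the joint law of the first two
  coordinates.\<close>

lemma sqdist_rate:
  fixes \<mu> \<nu> :: "nat \<Rightarrow> nat \<Rightarrow> real" and R :: "nat \<Rightarrow> nat \<Rightarrow> (nat \<Rightarrow> real) measure"
  assumes ab: "a \<in> I" "b \<in> I" "a \<noteq> b"
    and R: "R 1 = (\<lambda>d. distr N (Rd d) (shift (\<mu> d) a d))" "R 2 = (\<lambda>d. distr N (Rd d) (shift (\<nu> d) b d))"
      "\<And>i d. prob_space (R i d)"
    and var: "var_O_d (\<lambda>d. \<Pi>\<^sub>M i\<in>{1..4}. R i d) (\<lambda>d z. (vnorm d (vdiff (z 1) (z 2)))\<^sup>2)"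
    and mean: "\<forall>\<^sub>F d in sequentially. (\<Sum>k\<in>{1..d}. (\<mu> d k - \<nu> d k)\<^sup>2) \<le> c * sqrt (real d)"
  shows "rate Om (\<lambda>d \<omega>. sqdist d (shift (\<mu> d) a d (\<omega> a)) (shift (\<nu> d) b d (\<omega> b)) / real d) (2 * g0)"
proof -
  let ?D = "\<lambda>d \<omega>. sqdist d (shift (\<mu> d) a d (\<omega> a)) (shift (\<nu> d) b d (\<omega> b))"
  let ?S = "\<lambda>d. \<Sum>k\<in>{1..d}. (\<mu> d k - \<nu> d k)\<^sup>2"
  have pm: "(\<lambda>\<omega>. (shift (\<mu> d) a d (\<omega> a), shift (\<nu> d) b d (\<omega> b))) \<in> measurable Om (Rd d \<Otimes>\<^sub>M Rd d)" for d
    unfolding Om_def by (intro measurable_Pair measurable_compose[OF measurable_component_singleton[OF ab(1)] shift_measurable]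
        measurable_compose[OF measurable_component_singleton[OF ab(2)] shift_measurable])
  have Dm: "?D d \<in> borel_measurable Om" for d
    using measurable_compose[OF pm sqdist_measurable] by simp
  have pz: "(\<lambda>z. (z 1, z 2)) \<in> measurable (\<Pi>\<^sub>M i\<in>{1..4}. R i d) (Rd d \<Otimes>\<^sub>M Rd d)" for d
  proof (intro measurable_Pair)
    have comp: "(\<lambda>z. z i) \<in> measurable (\<Pi>\<^sub>M i\<in>{1..4}. R i d) (Rd d)" if "i \<in> {1..4}" "sets (R i d) = sets (Rd d)" for i
      using measurable_component_singleton[OF that(1), of "\<lambda>i. R i d"] measurable_cong_sets[OF refl that(2)] by blast
    have s: "sets (R 1 d) = sets (Rd d)" "sets (R 2 d) = sets (Rd d)" unfolding R(1,2) by simp_all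
    show "(\<lambda>z. z 1) \<in> measurable (\<Pi>\<^sub>M i\<in>{1..4}. R i d) (Rd d)" by (rule comp[OF _ s(1)]) simp
    show "(\<lambda>z. z 2) \<in> measurable (\<Pi>\<^sub>M i\<in>{1..4}. R i d) (Rd d)" by (rule comp[OF _ s(2)]) simp
  qed
  have dist: "distr (\<Pi>\<^sub>M i\<in>{1..4}. R i d) (Rd d \<Otimes>\<^sub>M Rd d) (\<lambda>z. (z 1, z 2)) =
    distr Om (Rd d \<Otimes>\<^sub>M Rd d) (\<lambda>\<omega>. (shift (\<mu> d) a d (\<omega> a), shift (\<nu> d) b d (\<omega> b)))" for d
  proof -
    have s: "sets (Rd d) = sets (R 1 d)" "sets (Rd d) = sets (R 2 d)" unfolding R(1,2) by simp_all
    have "distr (\<Pi>\<^sub>M i\<in>{1..4}. R i d) (Rd d \<Otimes>\<^sub>M Rd d) (\<lambda>z. (z 1, z 2)) =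
       distr (\<Pi>\<^sub>M i\<in>{1..4}. R i d) (R 1 d \<Otimes>\<^sub>M R 2 d) (\<lambda>z. (z 1, z 2))"
      by (intro distr_cong refl sets_pair_measure_cong s)
    also have "\<dots> = R 1 d \<Otimes>\<^sub>M R 2 d" by (rule distr_PiM_pair) (use R(3) in auto)
    also have "\<dots> = distr Om (Rd d \<Otimes>\<^sub>M Rd d) (\<lambda>\<omega>. (shift (\<mu> d) a d (\<omega> a), shift (\<nu> d) b d (\<omega> b)))"
      unfolding R(1,2) by (rule Om_pair_distr[OF ab, symmetric])
    finally show ?thesis .
  qed
  have sq_iff: "square_integrable (\<Pi>\<^sub>M i\<in>{1..4}. R i d) (\<lambda>z. (vnorm d (vdiff (z 1) (z 2)))\<^sup>2) \<longleftrightarrow> square_integrable Om (?D d)" for d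
    using square_integrable_distr[OF pz[of d] sqdist_measurable] square_integrable_distr[OF pm[of d] sqdist_measurable]
    unfolding dist by (simp add: sqdist_def)
  have cov_eq: "cov (\<Pi>\<^sub>M i\<in>{1..4}. R i d) (\<lambda>z. (vnorm d (vdiff (z 1) (z 2)))\<^sup>2) (\<lambda>z. (vnorm d (vdiff (z 1) (z 2)))\<^sup>2) = cov Om (?D d) (?D d)" for d
    using cov_distr[OF pz[of d] sqdist_measurable sqdist_measurable] cov_distr[OF pm[of d] sqdist_measurable sqdist_measurable]
    unfolding dist by (simp add: sqdist_def)
  have "(\<lambda>d. cov Om (?D d) (?D d)) \<in> O(\<lambda>d. real d)"
    using var unfolding var_O_d_def cov_eq by blast
  then obtain C where C: "\<forall>\<^sub>F d in sequentially. norm (cov Om (?D d) (?D d)) \<le> C * norm (real d)"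
    by (rule landau_o.bigE)
  have sqev: "\<forall>\<^sub>F d in sequentially. square_integrable Om (?D d)"
    using var unfolding var_O_d_def sq_iff by blast
  have "\<forall>\<^sub>F d in sequentially. square_integrable Om (\<lambda>\<omega>. ?D d \<omega> / real d - 2 * g0) \<and>
      Om.expectation (\<lambda>\<omega>. (?D d \<omega> / real d - 2 * g0)\<^sup>2) \<le> (C + c\<^sup>2) / real d"
    using C sqev mean eventually_gt_at_top[of 0]
  proof eventually_elim
    case (elim d)
    have s1: "square_integrable Om (\<lambda>\<omega>. ?D d \<omega> / real d - 2 * g0)"
      using square_integrable_diff[OF square_integrable_cmult[OF elim(2), of "1 / real d"] Om.square_integrable_const[of "2 * g0"]] by simp
    have i: "integrable Om (?D d)" "integrable Om (\<lambda>\<omega>. (?D d \<omega>)\<^sup>2)"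
      using Om.square_integrable_integrable[OF elim(2)] elim(2) by (auto simp: square_integrable_def)
    let ?e = "2 * real d * g0"
    have "(?D d \<omega> / real d - 2 * g0)\<^sup>2 = (1 / (real d)\<^sup>2) * ((?D d \<omega>)\<^sup>2 - 2 * ?e * ?D d \<omega> + ?e\<^sup>2)" for \<omega>
      using elim(4) by (simp add: power2_eq_square field_simps)
    then have "Om.expectation (\<lambda>\<omega>. (?D d \<omega> / real d - 2 * g0)\<^sup>2) =
       (1 / (real d)\<^sup>2) * (Om.expectation (\<lambda>\<omega>. (?D d \<omega>)\<^sup>2) - 2 * ?e * Om.expectation (?D d) + ?e\<^sup>2)"
      using i by (simp add: Om.prob_space)
    also have "\<dots> = (1 / (real d)\<^sup>2) * (cov Om (?D d) (?D d) + (?S d)\<^sup>2)"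
      unfolding Om.cov_eq[OF elim(2) elim(2)] sqdist_mean[OF ab] by (simp add: power2_eq_square algebra_simps)
    also have "\<dots> \<le> (1 / (real d)\<^sup>2) * (C * real d + (c * sqrt (real d))\<^sup>2)"
      using elim(1,3) by (intro mult_left_mono add_mono power_mono) (auto intro: sum_nonneg)
    also have "\<dots> = (C + c\<^sup>2) / real d"
      using elim(4) by (simp add: power_mult_distrib power2_eq_square field_simps)
    finally show ?case using s1 by simp
  qed
  moreover have "(\<lambda>\<omega>. ?D d \<omega> / real d) \<in> borel_measurable Om" for d
    using Dm by (intro borel_measurable_divide borel_measurable_const)
  ultimately show ?thesis unfolding rate_def by blast
qed

end

section \<open>Limiting power\<close>

lemma (in prob_space) oP_const: "c \<longlonglongrightarrow> 0 \<Longrightarrow> oP M (\<lambda>d _. c d)"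
  by (rule oP_L2[where b = "\<lambda>d. (c d)\<^sup>2"])
    (auto simp: square_integrable_def prob_space intro!: tendsto_eq_intros)

text \<open>Samples restricted to \<open>I\<close> are \<open>undefined\<close> elsewhere; the
  statistics read only indices up to \<open>m\<close> and \<open>n\<close>, so they are functions of
  the restricted sample.\<close>

lemma scaled_stat_cong:
  assumes x: "\<And>i. i \<in> {1..m} \<Longrightarrow> x i = x' i" and y: "\<And>j. j \<in> {1..n} \<Longrightarrow> y j = y' j"
  shows "scaled_stat T d m n a s b x y = scaled_stat T d m n a s b x' y'"
proof -
  have mem: "fst p \<in> {1..k}" "snd p \<in> {1..k}" if "p \<in> neq_pairs k" for p k
    using that by (auto simp: neq_pairs_def)
  have xx: "x (fst p) = x' (fst p)" "x (snd p) = x' (snd p)" if "p \<in> neq_pairs m" for p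
    using x mem[OF that] by blast+
  have yy: "y (fst p) = y' (fst p)" "y (snd p) = y' (snd p)" if "p \<in> neq_pairs n" for p
    using y mem[OF that] by blast+
  have xy: "(\<Sum>i\<in>{1..m}. \<Sum>j\<in>{1..n}. F (x i) (y j)) = (\<Sum>i\<in>{1..m}. \<Sum>j\<in>{1..n}. F (x' i) (y' j))" for F :: "_ \<Rightarrow> _ \<Rightarrow> real"
    by (intro sum.cong refl) (simp only: x y)
  show ?thesis
    using xy[of "\<lambda>u v. vnorm d (vdiff u v)"] xy[of "gauss_kernel d b"]
    by (cases T) (simp_all add: U_CvM_def U_Energy_def U_MMD_def U_CQ_def U_WMW_def case_prod_beta xx yy cong: sum.cong)
qed

context two_sample
begin

text \<open>Divided by \<open>s * sqrt d\<close>, the statistic is an asymptotically standard normal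
  term plus the scaled mean difference and a negligible rest. Moving the mean difference to the
  other side leaves the threshold \<open>y0\<close>, whose normal tail is the claimed power.\<close>

lemma power_limit:
  fixes \<mu>X \<mu>Y :: "nat \<Rightarrow> nat \<Rightarrow> real" and z c :: real
  defines "x \<equiv> \<lambda>d i \<omega>. shift (\<mu>X d) (Inl i) d (\<omega> (Inl i))" and "y \<equiv> \<lambda>d j \<omega>. shift (\<mu>Y d) (Inr j) d (\<omega> (Inr j))"
    and "S \<equiv> \<lambda>d. \<Sum>k\<in>{1..d}. (\<mu>X d k - \<mu>Y d k)\<^sup>2"
  assumes g0: "0 < g0" and S: "\<forall>\<^sub>F d in sequentially. S d \<le> c * sqrt (real d)"
    and xx: "\<And>i i'. i \<in> {1..m} \<Longrightarrow> i' \<in> {1..m} \<Longrightarrow> i \<noteq> i' \<Longrightarrow>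
       rate Om (\<lambda>d \<omega>. sqdist d (x d i \<omega>) (x d i' \<omega>) / real d) (2 * g0)"
    and yy: "\<And>j j'. j \<in> {1..n} \<Longrightarrow> j' \<in> {1..n} \<Longrightarrow> j \<noteq> j' \<Longrightarrow>
       rate Om (\<lambda>d \<omega>. sqdist d (y d j \<omega>) (y d j' \<omega>) / real d) (2 * g0)"
    and xy: "\<And>i j. i \<in> {1..m} \<Longrightarrow> j \<in> {1..n} \<Longrightarrow>
       rate Om (\<lambda>d \<omega>. sqdist d (x d i \<omega>) (y d j \<omega>) / real d) (2 * g0)"
    and sd: "\<forall>\<^sub>F d in sequentially. sd d = g0"
    and bw: "(\<lambda>d. (bw d)\<^sup>2) \<in> \<Theta>(\<lambda>d. real d)"
  shows "(\<lambda>d. Om.prob {\<omega> \<in> space Om. z * sqrt (kap * T d) < scaled_stat U d m n (sd d) g0 (bw d) (\<lambda>i. x d i \<omega>) (\<lambda>j. y d j \<omega>)}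
     - Phi (- z + S d / sqrt (kap * T d))) \<longlonglongrightarrow> 0"
proof -
  let ?stat = "\<lambda>d \<omega>. scaled_stat U d m n (sd d) g0 (bw d) (\<lambda>i. x d i \<omega>) (\<lambda>j. y d j \<omega>)"
  let ?U = "\<lambda>d \<omega>. U_CQ d m n (\<lambda>i. x d i \<omega>) (\<lambda>j. y d j \<omega>)"
  let ?\<delta> = "\<lambda>d k. \<mu>X d k - \<mu>Y d k"
  let ?L = "\<lambda>d \<omega>. 2 * cross_avg m n (\<lambda>i j. lin (?\<delta> d) d (Inl i) \<omega> + - 1 * lin (?\<delta> d) d (Inr j) \<omega>)"
  have xm: "(\<lambda>\<omega>. x d i \<omega> k) \<in> borel_measurable Om" if "i \<in> {1..m}" "k \<in> {1..d}" for d i k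
    unfolding x_def using that by (intro shift_coord_measurable) (simp_all add: Inl_I)
  have ym: "(\<lambda>\<omega>. y d j \<omega> k) \<in> borel_measurable Om" if "j \<in> {1..n}" "k \<in> {1..d}" for d j k
    unfolding y_def using that by (intro shift_coord_measurable) (simp_all add: Inr_I)
  have rem: "oP Om (\<lambda>d \<omega>. (?stat d \<omega> - ?U d \<omega>) / sqrt (real d))"
    by (rule Om.scaled_stat_remainder[OF m2 n2 g0 xm ym xx yy xy sd bw])
  have "oP Om (\<lambda>d \<omega>. 2 * cross_avg m n (\<lambda>i j. lin (?\<delta> d) d (Inl i) \<omega> / sqrt (real d) + - 1 * (lin (?\<delta> d) d (Inr j) \<omega> / sqrt (real d))))"
    by (intro Om.oP_cmult Om.oP_cross_avg Om.oP_add lin_oP[where c = c])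
      (use S in \<open>simp_all add: S_def Inl_I Inr_I\<close>)
  moreover have "2 * cross_avg m n (\<lambda>i j. lin (?\<delta> d) d (Inl i) \<omega> / sqrt (real d) + - 1 * (lin (?\<delta> d) d (Inr j) \<omega> / sqrt (real d))) = ?L d \<omega> / sqrt (real d)" for d \<omega>
  proof -
    have "2 * cross_avg m n (\<lambda>i j. (1 / sqrt (real d)) * (lin (?\<delta> d) d (Inl i) \<omega> + - 1 * lin (?\<delta> d) d (Inr j) \<omega>)) = ?L d \<omega> / sqrt (real d)"
      unfolding cross_avg_cmult by simp
    then show ?thesis by (simp add: diff_divide_distrib)
  qed
  ultimately have lino: "oP Om (\<lambda>d \<omega>. ?L d \<omega> / sqrt (real d))" by simp
  obtain \<tau> where \<tau>: "(\<lambda>p. T p / real p) \<longlonglongrightarrow> \<tau>" "g0\<^sup>2 \<le> \<tau>"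
    and clt: "\<And>t. (\<lambda>d. Om.expectation (\<lambda>\<omega>. iexp (t / sqrt (real d) * Om.blk W 0 d \<omega>))) \<longlonglongrightarrow> complex_of_real (exp (- (kap * \<tau>) * t\<^sup>2 / 2))"
    using W_clt by blast
  have \<tau>0: "0 < \<tau>" using \<tau>(2) g0 by (meson less_le_trans zero_less_power)
  define s where "s = sqrt (kap * \<tau>)"
  have s: "0 < s" "s\<^sup>2 = kap * \<tau>" using kap_pos \<tau>0 by (simp_all add: s_def)
  let ?Z = "\<lambda>d \<omega>. (1 / s) / sqrt (real d) * Om.blk W 0 d \<omega>"
  have Zm: "?Z d \<in> borel_measurable Om" for d
    using square_integrable_measurable[OF Om.blk_square_integrable[OF W_centred_L2], of 0 d] by measurable
  have ch: "(\<lambda>d. Om.expectation (\<lambda>\<omega>. iexp (t * ?Z d \<omega>))) \<longlonglongrightarrow> complex_of_real (exp (- (t\<^sup>2) / 2))" for t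
  proof -
    have "- (kap * \<tau>) * (t / s)\<^sup>2 / 2 = - (t\<^sup>2) / 2" using s by (simp add: power_divide flip: s(2))
    moreover have "(t / s) / sqrt (real d) * b = t * ((1 / s) / sqrt (real d) * b)" for d b by simp
    ultimately show ?thesis using clt[of "t / s"] by simp
  qed
  define y0 where "y0 d = z - S d / sqrt (kap * T d)" for d
  \<comment> \<open>Bounds \<open>y0 d\<close> for large \<open>d\<close>: \<open>S d\<close> is at
    most \<open>c * sqrt d\<close>, and \<open>sqrt (kap * T d)\<close> at least
    \<open>sqrt kap * g0 * sqrt d\<close>. Clipping at \<open>B\<close> supplies a bound for every
    \<open>d\<close>, as the normal approximation requires, and changes nothing for large
    \<open>d\<close>.\<close>
  define B where "B = \<bar>z\<bar> + \<bar>c\<bar> / (sqrt kap * g0)"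
  have B: "0 \<le> B" unfolding B_def using kap_pos g0 by (intro add_nonneg_nonneg divide_nonneg_nonneg mult_nonneg_nonneg) auto
  define y1 where "y1 d = clip B (y0 d)" for d
  define q where "q d = sqrt (kap * (T d / real d)) / s" for d
  have Tlow: "real d * g0\<^sup>2 \<le> T d" for d
    using T_add[of 0 d] by (simp add: tail_def)
  have y01: "\<forall>\<^sub>F d in sequentially. y1 d = y0 d"
    using S eventually_gt_at_top[of 0]
  proof eventually_elim
    case (elim d)
    have S0: "0 \<le> S d" unfolding S_def by (intro sum_nonneg) auto
    have r: "0 < sqrt kap * g0 * sqrt (real d)" using kap_pos g0 elim by simp
    have "sqrt kap * g0 * sqrt (real d) = sqrt (kap * (real d * g0\<^sup>2))" using g0 by (simp add: real_sqrt_mult)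
    also have "\<dots> \<le> sqrt (kap * T d)" using Tlow[of d] kap_pos by (intro real_sqrt_le_mono mult_left_mono) auto
    finally have "S d / sqrt (kap * T d) \<le> (\<bar>c\<bar> * sqrt (real d)) / (sqrt kap * g0 * sqrt (real d))"
      using S0 r order_trans[OF elim(1) mult_right_mono[OF abs_ge_self, of "sqrt (real d)" c]] by (intro frac_le) auto
    also have "\<dots> = \<bar>c\<bar> / (sqrt kap * g0)" using elim(2) by simp
    finally have "S d / sqrt (kap * T d) \<le> \<bar>c\<bar> / (sqrt kap * g0)" .
    moreover have "0 \<le> S d / sqrt (kap * T d)" using S0 kap_pos Tlow[of d] order_trans[OF _ Tlow[of d]] by (intro divide_nonneg_nonneg) auto
    ultimately have "\<bar>y0 d\<bar> \<le> B" unfolding y0_def B_def by linarith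
    then show ?case by (auto simp: y1_def clip_def max_def min_def abs_le_iff)
  qed
  have y1b: "\<bar>y1 d\<bar> \<le> B" for d unfolding y1_def by (rule clip_bound(1)[OF B])
  have "q \<longlonglongrightarrow> sqrt (kap * \<tau>) / s" unfolding q_def using s(1) by (intro tendsto_intros \<tau>(1)) auto
  moreover have "sqrt (kap * \<tau>) / s = 1"
  proof -
    have "sqrt (kap * \<tau>) = s" by (simp only: s_def)
    then show ?thesis using s(1) by simp
  qed
  ultimately have "q \<longlonglongrightarrow> 1" by simp
  from tendsto_diff[OF tendsto_const[of "1::real"] this] have q1: "(\<lambda>d. 1 - q d) \<longlonglongrightarrow> 0" by simp
  have yq: "(\<lambda>d. y1 d - y1 d * q d) \<longlonglongrightarrow> 0"
  proof (rule Lim_null_comparison)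
    show "\<forall>\<^sub>F d in sequentially. norm (y1 d - y1 d * q d) \<le> B * \<bar>1 - q d\<bar>"
    proof (intro always_eventually allI)
      fix d
      have "norm (y1 d - y1 d * q d) = \<bar>y1 d\<bar> * \<bar>1 - q d\<bar>" by (simp add: right_diff_distrib flip: abs_mult)
      also have "\<dots> \<le> B * \<bar>1 - q d\<bar>" by (intro mult_right_mono y1b) simp
      finally show "norm (y1 d - y1 d * q d) \<le> B * \<bar>1 - q d\<bar>" .
    qed
    show "(\<lambda>d. B * \<bar>1 - q d\<bar>) \<longlonglongrightarrow> 0" using tendsto_mult_left[OF tendsto_rabs[OF q1], of B] by simp
  qed
  \<comment> \<open>The last summand corrects the scale: the threshold is normalised by the exact
    \<open>sqrt (kap * T d)\<close>, the sum by its limit \<open>s * sqrt d\<close>, and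
    \<open>q\<close> is their ratio, which tends to 1.\<close>
  let ?R = "\<lambda>d \<omega>. (1 / s) * ((?stat d \<omega> - ?U d \<omega>) / sqrt (real d) + ?L d \<omega> / sqrt (real d)) + (y1 d - y1 d * q d)"
  have Ro: "oP Om ?R" by (intro Om.oP_add Om.oP_cmult rem lino Om.oP_const yq)
  have lim: "(\<lambda>d. Om.prob {\<omega> \<in> space Om. y1 d < ?Z d \<omega> + ?R d \<omega>} - Phi (- y1 d)) \<longlonglongrightarrow> 0"
    by (rule Om.normal_tail_limit[OF Zm ch Ro y1b])
  have "\<forall>\<^sub>F d in sequentially. Om.prob {\<omega> \<in> space Om. y1 d < ?Z d \<omega> + ?R d \<omega>} - Phi (- y1 d) =
     Om.prob {\<omega> \<in> space Om. z * sqrt (kap * T d) < ?stat d \<omega>} - Phi (- z + S d / sqrt (kap * T d))"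
    using y01 eventually_gt_at_top[of 0]
  proof eventually_elim
    case (elim d)
    define r where "r = sqrt (real d)"
    have r: "0 < r" using elim(2) by (simp add: r_def)
    define p where "p = sqrt (kap * T d)"
    have "0 < T d" using Tlow[of d] g0 elim(2) by (meson less_le_trans mult_pos_pos of_nat_0_less_iff zero_less_power)
    then have p: "0 < p" using kap_pos by (simp add: p_def)
    have qd: "q d = p / r / s" by (simp add: q_def p_def r_def real_sqrt_divide)
    have "(y1 d < ?Z d \<omega> + ?R d \<omega>) = (z * p < ?stat d \<omega>)" for \<omega>
    proof -
      have U: "?U d \<omega> = S d + ?L d \<omega> + Om.blk W 0 d \<omega>"
        unfolding x_def y_def S_def by (rule U_CQ_expansion)
      have alg: "(1 / s) / r * b + ((1 / s) * ((st - (S d + l + b)) / r + l / r) + (y1 d - y1 d * q d)) = y1 d + ((st - z * p) / (s * r))" for b st l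
        unfolding elim(1) y0_def qd p_def[symmetric] using s(1) r p by (simp add: field_simps)
      have "(y1 d < ?Z d \<omega> + ?R d \<omega>) = (0 < (?stat d \<omega> - z * p) / (s * r))"
        unfolding U r_def[symmetric] alg by simp
      also have "\<dots> = (z * p < ?stat d \<omega>)" using mult_pos_pos[OF s(1) r] by (auto simp: zero_less_divide_iff)
      finally show ?thesis .
    qed
    then show ?case by (simp add: p_def elim(1) y0_def)
  qed
  then show ?thesis by (rule Lim_transform_eventually[OF lim])
qed

lemma shift_component: "a \<in> I \<Longrightarrow> (\<lambda>\<omega>. shift \<mu> a d (\<omega> a)) \<in> measurable Om (Rd d)"
  unfolding Om_def by (rule measurable_compose[OF _ shift_measurable]) (rule measurable_component_singleton)

lemma sample_distr:
  "distr Om (PiM I (\<lambda>_. Rd d)) (\<lambda>\<omega>. \<lambda>a\<in>I. shift (\<mu> a) a d (\<omega> a)) = PiM I (\<lambda>a. distr N (Rd d) (shift (\<mu> a) a d))"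
proof -
  have pr: "prob_space (distr N (Rd d) (shift (\<mu> a) a d))" for a by (rule N.prob_space_distr[OF shift_measurable])
  interpret product_sigma_finite "\<lambda>a. distr N (Rd d) (shift (\<mu> a) a d)"
    using pr by (intro product_sigma_finite.intro prob_space_imp_sigma_finite)
  interpret NN: product_sigma_finite "\<lambda>_. N" ..
  have m: "(\<lambda>\<omega>. \<lambda>a\<in>I. shift (\<mu> a) a d (\<omega> a)) \<in> measurable Om (PiM I (\<lambda>_. Rd d))"
    by (intro measurable_restrict shift_component)
  show ?thesis
  proof (rule PiM_eqI[OF finite_I])
    show "sets (distr Om (PiM I (\<lambda>_. Rd d)) (\<lambda>\<omega>. \<lambda>a\<in>I. shift (\<mu> a) a d (\<omega> a))) = sets (PiM I (\<lambda>a. distr N (Rd d) (shift (\<mu> a) a d)))"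
      by (simp cong: sets_PiM_cong)
    fix A assume A: "\<And>a. a \<in> I \<Longrightarrow> A a \<in> sets (distr N (Rd d) (shift (\<mu> a) a d))"
    have "emeasure (distr Om (PiM I (\<lambda>_. Rd d)) (\<lambda>\<omega>. \<lambda>a\<in>I. shift (\<mu> a) a d (\<omega> a))) (Pi\<^sub>E I A) =
      emeasure Om ((\<lambda>\<omega>. \<lambda>a\<in>I. shift (\<mu> a) a d (\<omega> a)) -` Pi\<^sub>E I A \<inter> space Om)"
      using A by (intro emeasure_distr m sets_PiM_I_finite finite_I) simp
    also have "(\<lambda>\<omega>. \<lambda>a\<in>I. shift (\<mu> a) a d (\<omega> a)) -` Pi\<^sub>E I A \<inter> space Om = Pi\<^sub>E I (\<lambda>a. shift (\<mu> a) a d -` A a \<inter> space N)"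
      unfolding Om_def space_PiM by (auto simp: PiE_iff)
    also have "emeasure Om \<dots> = (\<Prod>a\<in>I. emeasure N (shift (\<mu> a) a d -` A a \<inter> space N))"
      unfolding Om_def using A by (intro NN.emeasure_PiM finite_I measurable_sets[OF shift_measurable]) simp
    also have "\<dots> = (\<Prod>a\<in>I. emeasure (distr N (Rd d) (shift (\<mu> a) a d)) (A a))"
      using A by (intro prod.cong refl emeasure_distr[symmetric] shift_measurable) simp
    finally show "emeasure (distr Om (PiM I (\<lambda>_. Rd d)) (\<lambda>\<omega>. \<lambda>a\<in>I. shift (\<mu> a) a d (\<omega> a))) (Pi\<^sub>E I A) =
      (\<Prod>a\<in>I. emeasure (distr N (Rd d) (shift (\<mu> a) a d)) (A a))" .
  qed
qed

text \<open>For each \<open>d\<close> the given sample may live on a different space \<open>M d\<close>; only its law matters, and it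
  is replaced by independent copies of the whole noise sequences, which serve all \<open>d\<close> at once.\<close>

lemma power_transfer:
  fixes Xs Ys :: "nat \<Rightarrow> 'c \<Rightarrow> nat \<Rightarrow> real" and M :: "'c measure"
  assumes M: "prob_space M"
    and ind: "prob_space.indep_vars M (\<lambda>_. Rd d) (case_sum Xs Ys) ({1..m} <+> {1..n})"
    and X: "\<And>i. i \<in> {1..m} \<Longrightarrow> distr M (Rd d) (Xs i) = distr N (Rd d) (shift \<mu>X (Inl i) d)"
    and Y: "\<And>j. j \<in> {1..n} \<Longrightarrow> distr M (Rd d) (Ys j) = distr N (Rd d) (shift \<mu>Y (Inr j) d)"
  shows "(\<integral>\<omega>. of_bool (t < scaled_stat U d m n a s b (\<lambda>i. Xs i \<omega>) (\<lambda>j. Ys j \<omega>)) \<partial>M) =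
    Om.prob {\<omega> \<in> space Om. t < scaled_stat U d m n a s b (\<lambda>i. shift \<mu>X (Inl i) d (\<omega> (Inl i))) (\<lambda>j. shift \<mu>Y (Inr j) d (\<omega> (Inr j)))}"
proof -
  interpret M: prob_space M by fact
  let ?P = "PiM I (\<lambda>_. Rd d)"
  let ?stat = "\<lambda>z. scaled_stat U d m n a s b (\<lambda>i. z (Inl i)) (\<lambda>j. z (Inr j))"
  let ?G = "\<lambda>z. of_bool (t < ?stat z) :: real"
  define \<mu> where "\<mu> = case_sum (\<lambda>_::nat. \<mu>X) (\<lambda>_::nat. \<mu>Y)"
  have stat: "?stat \<in> borel_measurable ?P"
  proof (rule scaled_stat_measurable)
    have c: "(\<lambda>z. z a k) \<in> borel_measurable ?P" if "a \<in> I" "k \<in> {1..d}" for a k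
      by (rule measurable_compose[OF measurable_component_singleton[OF that(1)] measurable_component_singleton[OF that(2)]])
    show "(\<lambda>z. z (Inl i) k) \<in> borel_measurable ?P" if "i \<in> {1..m}" "k \<in> {1..d}" for i k using that by (intro c) (simp_all add: Inl_I)
    show "(\<lambda>z. z (Inr i) k) \<in> borel_measurable ?P" if "i \<in> {1..n}" "k \<in> {1..d}" for i k using that by (intro c) (simp_all add: Inr_I)
  qed
  then have G: "?G \<in> borel_measurable ?P" by measurable
  have I: "{1..m} <+> {1..n} = I" by (simp add: I_def)
  have rv: "case_sum Xs Ys a \<in> measurable M (Rd d)" if "a \<in> I" for a
    using ind that unfolding M.indep_vars_def I by blast
  have Mm: "(\<lambda>\<omega>. \<lambda>a\<in>I. case_sum Xs Ys a \<omega>) \<in> measurable M ?P"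
    by (intro measurable_restrict rv)
  have Om_m: "(\<lambda>\<omega>. \<lambda>a\<in>I. shift (\<mu> a) a d (\<omega> a)) \<in> measurable Om ?P"
    by (intro measurable_restrict shift_component)
  have "I \<noteq> {}" using m2 by (auto simp: I_def)
  from M.indep_vars_iff_distr_eq_PiM'[OF this rv, of "\<lambda>a. a"]
  have "distr M ?P (\<lambda>\<omega>. \<lambda>a\<in>I. case_sum Xs Ys a \<omega>) = PiM I (\<lambda>a. distr M (Rd d) (case_sum Xs Ys a))"
    using ind unfolding I by simp
  also have "\<dots> = PiM I (\<lambda>a. distr N (Rd d) (shift (\<mu> a) a d))"
  proof (intro PiM_cong refl)
    fix a assume "a \<in> I"
    then show "distr M (Rd d) (case_sum Xs Ys a) = distr N (Rd d) (shift (\<mu> a) a d)"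
      using X Y by (cases a) (auto simp: Inl_I Inr_I \<mu>_def)
  qed
  finally have D: "distr M ?P (\<lambda>\<omega>. \<lambda>a\<in>I. case_sum Xs Ys a \<omega>) = distr Om ?P (\<lambda>\<omega>. \<lambda>a\<in>I. shift (\<mu> a) a d (\<omega> a))"
    unfolding sample_distr .
  have r1: "?stat (\<lambda>a\<in>I. case_sum Xs Ys a \<omega>) = scaled_stat U d m n a s b (\<lambda>i. Xs i \<omega>) (\<lambda>j. Ys j \<omega>)" for \<omega>
    by (intro scaled_stat_cong) (simp_all add: Inl_I Inr_I)
  have r2: "?stat (\<lambda>a\<in>I. shift (\<mu> a) a d (\<omega> a)) = scaled_stat U d m n a s b (\<lambda>i. shift \<mu>X (Inl i) d (\<omega> (Inl i))) (\<lambda>j. shift \<mu>Y (Inr j) d (\<omega> (Inr j)))" for \<omega>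
    by (intro scaled_stat_cong) (simp_all add: Inl_I Inr_I \<mu>_def)
  have "(\<integral>\<omega>. ?G (\<lambda>a\<in>I. case_sum Xs Ys a \<omega>) \<partial>M) = (\<integral>\<omega>. ?G (\<lambda>a\<in>I. shift (\<mu> a) a d (\<omega> a)) \<partial>Om)"
    using integral_distr[OF Mm G] integral_distr[OF Om_m G] unfolding D by simp
  also have "\<dots> = (\<integral>\<omega>. indicator {\<omega> \<in> space Om. t < ?stat (\<lambda>a\<in>I. shift (\<mu> a) a d (\<omega> a))} \<omega> \<partial>Om)"
    by (intro Bochner_Integration.integral_cong refl) (simp add: indicator_def)
  also have "\<dots> = Om.prob {\<omega> \<in> space Om. t < ?stat (\<lambda>a\<in>I. shift (\<mu> a) a d (\<omega> a))}"
    by (simp add: Int_absorb2)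
  finally show ?thesis unfolding r1 r2 .
qed

end

lemma cov_matrix_shift_law:
  assumes N: "prob_space N" and V: "centred_L2_seq N V" and ij: "i \<in> {1..d}" "j \<in> {1..d}"
  shows "cov_matrix (shift_law N \<mu> V d) i j = (\<integral>\<omega>. V i \<omega> * V j \<omega> \<partial>N)"
proof -
  interpret prob_space N by fact
  have sq: "square_integrable N (V k)" "(\<integral>\<omega>. V k \<omega> \<partial>N) = 0" if "k \<in> {1..d}" for k
    using V that by (auto simp: centred_L2_seq_def)
  have m: "(\<lambda>\<omega>. \<lambda>k\<in>{1..d}. \<mu> d k + V k \<omega>) \<in> measurable N (Rd d)"
    by (intro measurable_restrict borel_measurable_add borel_measurable_const square_integrable_measurable sq)
  have mean: "(\<integral>\<omega>. \<mu> d k + V k \<omega> \<partial>N) = \<mu> d k" if "k \<in> {1..d}" for k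
    using square_integrable_integrable[OF sq(1)[OF that]] sq(2)[OF that] by (simp add: prob_space)
  have "cov_matrix (shift_law N \<mu> V d) i j = cov N (\<lambda>\<omega>. \<mu> d i + V i \<omega>) (\<lambda>\<omega>. \<mu> d j + V j \<omega>)"
    unfolding cov_matrix_def shift_law_def
    using cov_distr[OF m measurable_component_singleton[OF ij(1)] measurable_component_singleton[OF ij(2)]] ij by simp
  also have "\<dots> = (\<integral>\<omega>. V i \<omega> * V j \<omega> \<partial>N)"
    unfolding cov_def mean[OF ij(1)] mean[OF ij(2)] by simp
  finally show ?thesis .
qed

text \<open>The target itself may oscillate with \<open>d\<close>, since the normalised squared mean
  difference is only bounded; so the assertion is that differences tend to 0. Each power is compared
  with the common target, and the comparison between tests follows by subtraction.\<close>

theorem corollary5p2: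
  fixes N :: "'b measure"
    and VX VY :: "nat \<Rightarrow> 'b \<Rightarrow> real"
    and \<mu>X \<mu>Y :: "nat \<Rightarrow> nat \<Rightarrow> real"
    and PX PY :: "nat \<Rightarrow> (nat \<Rightarrow> real) measure"
    and M :: "nat \<Rightarrow> 'a measure"
    and X Y :: "nat \<Rightarrow> nat \<Rightarrow> 'a \<Rightarrow> nat \<Rightarrow> real"
    and m n :: nat
    and bw :: "nat \<Rightarrow> real"
    and \<alpha> s2 :: real
    and \<Sigma> :: "nat \<Rightarrow> nat \<Rightarrow> nat \<Rightarrow> real"
    and pwr :: "two_sample_test \<Rightarrow> nat \<Rightarrow> real"
  assumes "m \<ge> 2" and "n \<ge> 2" and "0 < \<alpha>" and "\<alpha> < 1"
    and "prob_space N"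
    and "centred_L2_seq N VX" and "centred_L2_seq N VY"
    and "prob_space.indep_var N
           (\<Pi>\<^sub>M k\<in>{1..}. borel) (\<lambda>\<omega>. \<lambda>k\<in>{1..}. VX k \<omega>)
           (\<Pi>\<^sub>M k\<in>{1..}. borel) (\<lambda>\<omega>. \<lambda>k\<in>{1..}. VY k \<omega>)"
    and "strictly_stationary N VX" and "summable (\<lambda>k. rho_mix N VX (2 ^ Suc k))"
    and "strictly_stationary N VY" and "summable (\<lambda>k. rho_mix N VY (2 ^ Suc k))"
    and "PX = shift_law N \<mu>X VX" and "PY = shift_law N \<mu>Y VY"
    and "\<And>d. d \<ge> 1 \<Longrightarrow> pos_def d (cov_matrix (PX d))"
    and "\<And>d. d \<ge> 1 \<Longrightarrow> pos_def d (cov_matrix (PY d))"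
    and "\<And>d. d \<ge> 1 \<Longrightarrow> cont_projections d (PX d)"
    and "\<And>d. d \<ge> 1 \<Longrightarrow> cont_projections d (PY d)"
    and "A1 PX PY" and "A2 PX PY \<mu>X \<mu>Y" and "A3 PX PY" and "A4 PX PY \<mu>X \<mu>Y"
    and "(\<lambda>d. (bw d)\<^sup>2) \<in> \<Theta>(\<lambda>d. real d)"
    and "\<And>d. d \<ge> 1 \<Longrightarrow> prob_space (M d)"
    and "\<And>d. d \<ge> 1 \<Longrightarrow>
           prob_space.indep_vars (M d) (\<lambda>_. Rd d) (case_sum (X d) (Y d)) ({1..m} <+> {1..n})"
    and "\<And>d i. d \<ge> 1 \<Longrightarrow> i \<in> {1..m} \<Longrightarrow> distr (M d) (Rd d) (X d i) = PX d"
    and "\<And>d j. d \<ge> 1 \<Longrightarrow> j \<in> {1..n} \<Longrightarrow> distr (M d) (Rd d) (Y d j) = PY d"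
    and "\<Sigma> = (\<lambda>d. cov_matrix (PX d))"
    and "s2 = lim (\<lambda>d. mtrace d (\<Sigma> d) / real d)"
    and "pwr = (\<lambda>T d. \<integral>\<omega>. phi_test T d m n \<alpha> (\<Sigma> d) s2 (bw d)
                              (\<lambda>i. X d i \<omega>) (\<lambda>j. Y d j \<omega>) \<partial>M d)"
  shows "(\<forall>T T'. (\<lambda>d. pwr T d - pwr T' d) \<longlonglongrightarrow> 0) \<and>
         (\<forall>T. (\<lambda>d. pwr T d -
                Phi (- upper_quantile \<alpha> +
                     (vnorm d (vdiff (\<mu>X d) (\<mu>Y d)))\<^sup>2 / sqrt (psi d m n (\<Sigma> d)))) \<longlonglongrightarrow> 0)"
proof -
  have cX: "cov_matrix (PX d) i j = (\<integral>\<omega>. VX i \<omega> * VX j \<omega> \<partial>N)" if "i \<in> {1..d}" "j \<in> {1..d}" for d i j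
    unfolding assms(13) by (rule cov_matrix_shift_law[OF assms(5,6) that])
  have cY: "cov_matrix (PY d) i j = (\<integral>\<omega>. VY i \<omega> * VY j \<omega> \<partial>N)" if "i \<in> {1..d}" "j \<in> {1..d}" for d i j
    unfolding assms(14) by (rule cov_matrix_shift_law[OF assms(5,7) that])
  interpret ts: two_sample N VX VY m n
  proof (rule two_sample.intro[OF assms(5,1,2,6,7,9,11,10,12)])
    fix i j :: nat assume "1 \<le> i" "1 \<le> j"
    \<comment> \<open>The covariance matrices agree in each dimension separately;
      \<open>max i j\<close> is the least dimension that contains both coordinates.\<close>
    then have ij: "i \<in> {1..max i j}" "j \<in> {1..max i j}" by auto
    then have "cov_matrix (PX (max i j)) i j = cov_matrix (PY (max i j)) i j"
      using assms(22) unfolding A4_def by blast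
    then show "(\<integral>\<omega>. VX i \<omega> * VX j \<omega> \<partial>N) = (\<integral>\<omega>. VY i \<omega> * VY j \<omega> \<partial>N)"
      by (simp only: cX[OF ij] cY[OF ij])
  qed
  have PX: "PX d = distr N (Rd d) (ts.shift (\<mu>X d) (Inl i) d)" and PY: "PY d = distr N (Rd d) (ts.shift (\<mu>Y d) (Inr i) d)" for d i
    unfolding assms(13,14) shift_law_def ts.shift_def by simp_all
  have PXe: "PX = (\<lambda>d. distr N (Rd d) (ts.shift (\<mu>X d) (Inl i) d))" and PYe: "PY = (\<lambda>d. distr N (Rd d) (ts.shift (\<mu>Y d) (Inr i) d))" for i
    using PX PY by auto
  have pr: "prob_space (PX d)" "prob_space (PY d)" for d
    unfolding PX[of d 0] PY[of d 0] by (intro ts.N.prob_space_distr ts.shift_measurable)+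
  have Sig: "\<Sigma> d i j = ts.autocov i j" if "i \<in> {1..d}" "j \<in> {1..d}" for d i j
    using cX[OF that] by (simp add: assms(28) ts.autocov_def)
  have "ts.autocov i i = ts.g0" if "1 \<le> i" for i
    using ts.autocov_lag[of i i] that by (simp add: ts.g0_def)
  \<comment> \<open>By stationarity all diagonal entries are equal, so the average variance is
    constant from \<open>d = 1\<close> on and coincides with its limit \<open>s2\<close>.\<close>
  then have "mtrace d (\<Sigma> d) = real d * ts.g0" for d
    unfolding mtrace_def by (simp add: Sig)
  then have sd: "mtrace d (\<Sigma> d) / real d = ts.g0" if "d \<ge> 1" for d
    using that by simp
  then have sdev: "\<forall>\<^sub>F d in sequentially. mtrace d (\<Sigma> d) / real d = ts.g0"
    unfolding eventually_sequentially by blast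
  have s2: "s2 = ts.g0"
    unfolding assms(29) by (rule limI) (rule tendsto_eventually[OF sdev])
  \<comment> \<open>Positive definiteness in dimension 1, tested on the constant vector, is
    positivity of the common marginal variance.\<close>
  have g0: "0 < ts.g0"
  proof -
    have "0 < (\<Sum>i\<in>{1..1::nat}. \<Sum>j\<in>{1..1::nat}. (\<lambda>_. 1) i * cov_matrix (PX 1) i j * (\<lambda>_. 1) j)"
      using assms(15)[of 1] unfolding pos_def_def by fastforce
    then show ?thesis using cX[of 1 1 1] by (simp add: ts.g0_def ts.autocov_def)
  qed
  have psi: "psi d m n (\<Sigma> d) = ts.kap * ts.T d" for d
  proof -
    have "mtrace d (mmult d (\<Sigma> d) (\<Sigma> d)) = ts.T d"
      unfolding mtrace_def mmult_def ts.T_def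
      by (intro sum.cong refl) (simp add: Sig power2_eq_square ts.autocov_commute)
    then show ?thesis by (simp add: psi_def ts.kap_def)
  qed
  let ?S = "\<lambda>d. \<Sum>k\<in>{1..d}. (\<mu>X d k - \<mu>Y d k)\<^sup>2"
  have nrm: "(vnorm d (vdiff (\<mu>X d) (\<mu>Y d)))\<^sup>2 = ?S d" for d
    using sqdist_eq[of d "\<mu>X d" "\<mu>Y d"] by (simp add: sqdist_def)
  obtain c where c: "c > 0" "\<forall>\<^sub>F d in sequentially. norm (?S d) \<le> c * norm (sqrt (real d))"
    using assms(22) unfolding A4_def nrm by (blast elim: landau_o.bigE)
  have S: "\<forall>\<^sub>F d in sequentially. ?S d \<le> c * sqrt (real d)"
    using c(2) by eventually_elim (simp add: abs_le_iff)
  have S0: "\<forall>\<^sub>F d in sequentially. (\<Sum>k\<in>{1..d}. (\<mu> d k - \<mu> d k)\<^sup>2) \<le> c * sqrt (real d)" for \<mu> :: "nat \<Rightarrow> nat \<Rightarrow> real"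
    using c(1) by simp
  \<comment> \<open>The assumption lets each of the four laws be chosen freely; the first is
    \<open>L1\<close> and the others are \<open>L2\<close>, which covers pairs within a sample and
    across the samples.\<close>
  have var: "var_O_d (\<lambda>d. \<Pi>\<^sub>M i\<in>{1..4::nat}. (if i = 1 then L1 else L2) d) (\<lambda>d z. (vnorm d (vdiff (z 1) (z 2)))\<^sup>2)"
    if "L1 \<in> {PX, PY}" "L2 \<in> {PX, PY}" for L1 L2
    using assms(19)[unfolded A1_def, rule_format, of "\<lambda>i. if i = 1 then L1 else L2"] that by simp
  have xx: "rate ts.Om (\<lambda>d \<omega>. sqdist d (ts.shift (\<mu>X d) (Inl i) d (\<omega> (Inl i))) (ts.shift (\<mu>X d) (Inl i') d (\<omega> (Inl i'))) / real d) (2 * ts.g0)"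
    if "i \<in> {1..m}" "i' \<in> {1..m}" "i \<noteq> i'" for i i'
    by (rule ts.sqdist_rate[OF _ _ _ _ _ _ var[of PX PX] S0])
      (use that pr PXe in \<open>simp_all add: ts.Inl_I\<close>)
  have yy: "rate ts.Om (\<lambda>d \<omega>. sqdist d (ts.shift (\<mu>Y d) (Inr j) d (\<omega> (Inr j))) (ts.shift (\<mu>Y d) (Inr j') d (\<omega> (Inr j'))) / real d) (2 * ts.g0)"
    if "j \<in> {1..n}" "j' \<in> {1..n}" "j \<noteq> j'" for j j'
    by (rule ts.sqdist_rate[OF _ _ _ _ _ _ var[of PY PY] S0])
      (use that pr PYe in \<open>simp_all add: ts.Inr_I\<close>)
  have xy: "rate ts.Om (\<lambda>d \<omega>. sqdist d (ts.shift (\<mu>X d) (Inl i) d (\<omega> (Inl i))) (ts.shift (\<mu>Y d) (Inr j) d (\<omega> (Inr j))) / real d) (2 * ts.g0)"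
    if "i \<in> {1..m}" "j \<in> {1..n}" for i j
    by (rule ts.sqdist_rate[OF _ _ _ _ _ _ var[of PX PY] S])
      (use that pr PXe PYe in \<open>simp_all add: ts.Inl_I ts.Inr_I\<close>)
  let ?z = "upper_quantile \<alpha>"
  let ?target = "\<lambda>d. Phi (- ?z + (vnorm d (vdiff (\<mu>X d) (\<mu>Y d)))\<^sup>2 / sqrt (psi d m n (\<Sigma> d)))"
  have lim: "(\<lambda>d. pwr T d - ?target d) \<longlonglongrightarrow> 0" for T
  proof (rule Lim_transform_eventually[OF ts.power_limit[OF g0 S xx yy xy sdev assms(23), of ?z T]])
    show "\<forall>\<^sub>F d in sequentially.
      ts.Om.prob {\<omega> \<in> space ts.Om. ?z * sqrt (ts.kap * ts.T d) <
          scaled_stat T d m n (mtrace d (\<Sigma> d) / real d) ts.g0 (bw d) (\<lambda>i. ts.shift (\<mu>X d) (Inl i) d (\<omega> (Inl i))) (\<lambda>j. ts.shift (\<mu>Y d) (Inr j) d (\<omega> (Inr j)))} -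
        Phi (- ?z + ?S d / sqrt (ts.kap * ts.T d)) = pwr T d - ?target d"
      using eventually_ge_at_top[of 1]
    proof eventually_elim
      case (elim d)
      have "pwr T d = (\<integral>\<omega>. of_bool (?z * sqrt (ts.kap * ts.T d) <
          scaled_stat T d m n (mtrace d (\<Sigma> d) / real d) ts.g0 (bw d) (\<lambda>i. X d i \<omega>) (\<lambda>j. Y d j \<omega>)) \<partial>M d)"
        unfolding assms(30) phi_test_def psi s2 ..
      also have "\<dots> = ts.Om.prob {\<omega> \<in> space ts.Om. ?z * sqrt (ts.kap * ts.T d) <
          scaled_stat T d m n (mtrace d (\<Sigma> d) / real d) ts.g0 (bw d) (\<lambda>i. ts.shift (\<mu>X d) (Inl i) d (\<omega> (Inl i))) (\<lambda>j. ts.shift (\<mu>Y d) (Inr j) d (\<omega> (Inr j)))}"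
      proof (rule ts.power_transfer[OF assms(24)[OF elim] assms(25)[OF elim]])
        show "distr (M d) (Rd d) (X d i) = distr N (Rd d) (ts.shift (\<mu>X d) (Inl i) d)" if "i \<in> {1..m}" for i
          unfolding PX[symmetric] by (rule assms(26)[OF elim that])
        show "distr (M d) (Rd d) (Y d j) = distr N (Rd d) (ts.shift (\<mu>Y d) (Inr j) d)" if "j \<in> {1..n}" for j
          unfolding PY[symmetric] by (rule assms(27)[OF elim that])
      qed
      finally show ?case unfolding nrm psi by simp
    qed
  qed
  have "(\<lambda>d. pwr T d - pwr T' d) \<longlonglongrightarrow> 0" for T T'
    using tendsto_diff[OF lim[of T] lim[of T']] by simp
  then show ?thesis using lim by blast
qed

end
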